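(* Let $d,n\ge 1$ be integers and, for $j\in\{1,\dots,d\}$ and $U\in\mathbb{R}^n$, let $A_j(U)$ be a real symmetric $n\times n$ matrix whose entries are polynomial functions of $U$. Let $s>d/2+1$, $M>0$, and $U^0\in H^s((2\pi\mathbb{T})^d)^n$ with $|U^0|_{H^s}\le M$. Let $U\in\mathcal{C}(I;H^s((2\pi\mathbb{T})^d)^n)$ be the maximal-in-time classical solution to $$\partial_t U+\sum_{j=1}^d A_j(U)\partial_{x_j}U=0,\qquad U|_{t=0}=U^0, \qquad (\mathrm{H})$$ and, for $N\in\mathbb{N}$, let $U_N\in\mathcal{C}(I_N;H^s((2\pi\mathbb{T})^d)^n)$ be the maximal-in-time classical solution to $$\partial_t U_N+\mathsf{P}_N\Big(\sum_{j=1}^d A_j(U_N)\partial_{x_j}U_N\Big)=0,\qquad U_N|_{t=0}=\mathsf{P}_N U^0. \qquad (\mathrm{H}_N)$$ (1) Let $T>0$, depending only on $s$ and $M$, be a uniform existence time for both problems, in the sense that for some $C_1>0$ depending only on $s$ and $M$, for every $V^0\in H^s((2\pi\mathbb{T})^d)^n$ with $|V^0|_{H^s}\le M$ and every $N\in\mathbb{N}$, the maximal-in-time classical solutions $V$ of (H) with initial data $V^0$ and $V_N$ of $(\mathrm{H}_N)$ with initial data $\mathsf{P}_N V^0$ are defined on $[0,T/|V^0|_{H^s}]$ and satisfy there $|V(t,\cdot)|_{H^s}\le |V^0|_{H^s}\exp(C_1|V^0|_{H^s}t)\le 2|V^0|_{H^s}$ and $|V_N(t,\cdot)|_{H^s}\le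 |V^0|_{H^s}\exp(C_1|V^0|_{H^s}t)\le 2|V^0|_{H^s}$. Then there is $C>0$, depending only on $s$ and $M$, such that for all $N\in\mathbb{N}$, all $0\le t\le T/|U^0|_{H^s}$ and all $0\le r\le s$, $$|(U-U_N)(t,\cdot)|_{H^r}\le C\,|U^0|_{H^s}\,N^{r-s}.$$ (2) Moreover, for every compact subset $I^*\subset I$, there are $N_0\in\mathbb{N}$ and $C^*>0$, depending only on $s$, $|I^*|$ and $M^*:=\sup_{t\in I^*}|U(t,\cdot)|_{H^s}$, such that for all $N\ge N_0$ one has $I_N\supset I^*$ and, for any $0\le r\le s$, $$\sup_{t\in I^*}|(U-U_N)(t,\cdot)|_{H^r}\le C^*\,M^*\,N^{r-s}.$$
   Context: $(2\pi\mathbb{T})^d$ is the torus of period $2\pi$ in each of the $d$ variables; functions on it are real-valued. For real $s\ge0$, $H^s((2\pi\mathbb{T})^d)^n$ is the space of $U\in L^2((2\pi\mathbb{T})^d)^n$ with $|U|_{H^s}^2=\sum_{k\in\mathbb{Z}^d}\langle k\rangle^{2s}|\widehat U_k|^2<\infty$, where $\widehat U_k$ is the $k$-th Fourier coefficient and $\langle k\rangle=(1+|k|^2)^{1/2}$. $\mathcal{C}(I;X)$ denotes continuous functions on the interval $I$ with values in the Banach space $X$. $\mathbb{N}$ denotes the positive integers. $|I^*|$ denotes the length (Lebesgue measure) of $I^*\subset\mathbb{R}$. $\mathsf{P}_N$ (sharp low-pass filter) acts componentwise as the Fourier multiplier with symbol $\mathbf{1}_{\{-N,\dots,N\}^d}$,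 i.e. $\widehat{(\mathsf{P}_NU)}_k=\widehat U_k$ if $\max_j|k_j|\le N$ and $0$ otherwise. A maximal-in-time classical solution in $\mathcal{C}(I;H^s)$ is a solution on an open interval $I\ni0$ which cannot be extended to a solution in the same class on a strictly larger interval; for both problems with $s>d/2+1$ it exists and is unique, and a time $T$ as in (1) exists. If the initial datum is $0$, the interval $[0,T/|U^0|_{H^s}]$ is read as $[0,\infty)$. Constants said to depend "only" on certain quantities may also depend on the fixed data $d,n,A_1,\dots,A_d$, but never on $N$.
   Formalization: In (2), N_0 and C* depend only on s, |I*| and M* when I* is a compact interval containing 0; for other compact subsets I* of I they may depend on the solution, since the uniform claim fails there (e.g. Burgers with I* = {t0}). *)

theory Defs
  imports "HOL-Analysis.Analysis"
begin

text \<open>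
  A function on the torus of period \<open>2\<pi>\<close> in each of \<open>d = CARD('d)\<close> variables is a function on
  \<open>real ^ 'd\<close> that is periodic in every coordinate. Elements of \<open>L\<^sup>2\<close> and of \<open>H\<^sup>s\<close> are represented
  by functions; all quantities built from Fourier coefficients depend only on the class modulo
  almost everywhere equality.
\<close>

definition torus_periodic :: "(real ^ 'd \<Rightarrow> 'a) \<Rightarrow> bool" where
  "torus_periodic U \<longleftrightarrow> (\<forall>x j. U (x + axis j (2 * pi)) = U x)"

definition torus_cell :: "(real ^ 'd) set" where
  "torus_cell = cbox 0 (\<chi> j. 2 * pi)"

definition torus_L2 :: "(real ^ 'd \<Rightarrow> real ^ 'n) set" where
  "torus_L2 = {U. torus_periodic U \<and> U \<in> borel_measurable lebesgue \<and>
                  set_integrable lebesgue torus_cell (\<lambda>x. (norm (U x))\<^sup>2)}"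

definition freq_dot :: "int ^ 'd \<Rightarrow> real ^ 'd \<Rightarrow> real" where
  "freq_dot k x = (\<Sum>j\<in>UNIV. real_of_int (k $ j) * x $ j)"

definition japanese_bracket :: "int ^ 'd \<Rightarrow> real" where
  "japanese_bracket k = sqrt (1 + (\<Sum>j\<in>UNIV. (real_of_int (k $ j))\<^sup>2))"

definition fourier_coeff :: "(real ^ 'd \<Rightarrow> real ^ 'n) \<Rightarrow> int ^ 'd \<Rightarrow> complex ^ 'n" where
  "fourier_coeff U k =
     (\<chi> i. (LINT x:torus_cell|lebesgue. complex_of_real (U x $ i) * cis (- freq_dot k x))
            / complex_of_real ((2 * pi) ^ CARD('d)))"

definition sobolev :: "real \<Rightarrow> (real ^ 'd \<Rightarrow> real ^ 'n) set" where
  "sobolev s = {U \<in> torus_L2.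
     (\<lambda>k. japanese_bracket k powr (2 * s) * (norm (fourier_coeff U k))\<^sup>2) summable_on UNIV}"

text \<open>Only meaningful on \<open>sobolev s\<close>, since divergent sums have value \<open>0\<close>.\<close>

definition sobolev_norm :: "real \<Rightarrow> (real ^ 'd \<Rightarrow> real ^ 'n) \<Rightarrow> real" where
  "sobolev_norm s U =
     sqrt (\<Sum>\<^sub>\<infinity>k. japanese_bracket k powr (2 * s) * (norm (fourier_coeff U k))\<^sup>2)"

text \<open>
  The Fourier multiplier with symbol the indicator function of \<open>{-N..N}\<^sup>d\<close>. As the coefficients of
  a real-valued function at \<open>k\<close> and \<open>-k\<close> are conjugate and the symbol is even, the trigonometric
  sum is real; \<open>Re\<close> only changes the type.
\<close>

definition low_pass :: "nat \<Rightarrow> (real ^ 'd \<Rightarrow> real ^ 'n) \<Rightarrow> real ^ 'd \<Rightarrow> real ^ 'n" where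
  "low_pass N U x =
     (\<chi> i. Re (\<Sum>k | \<forall>j. \<bar>k $ j\<bar> \<le> int N. fourier_coeff U k $ i * cis (freq_dot k x)))"

definition partial_x :: "'d::finite \<Rightarrow> (real ^ 'd \<Rightarrow> real ^ 'n) \<Rightarrow> real ^ 'd \<Rightarrow> real ^ 'n" where
  "partial_x j U x = vector_derivative (\<lambda>h. U (x + axis j h)) (at 0)"

definition advection ::
  "('d::finite \<Rightarrow> real ^ 'n \<Rightarrow> real ^ 'n ^ 'n) \<Rightarrow> (real ^ 'd \<Rightarrow> real ^ 'n) \<Rightarrow> real ^ 'd \<Rightarrow> real ^ 'n" where
  "advection A U x = (\<Sum>j\<in>UNIV. A j (U x) *v partial_x j U x)"

definition C1_on :: "'a::real_normed_vector set \<Rightarrow> ('a \<Rightarrow> 'b::real_normed_vector) \<Rightarrow> bool" where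
  "C1_on S f \<longleftrightarrow> (\<exists>D :: 'a \<Rightarrow> 'a \<Rightarrow>\<^sub>L 'b. continuous_on S D \<and>
                  (\<forall>p\<in>S. (f has_derivative blinfun_apply (D p)) (at p)))"

text \<open>
  Classical solution in \<open>C(I; H\<^sup>s)\<close>, on an open interval \<open>I\<close> containing \<open>0\<close>, of
  \<open>\<partial>\<^sub>t u + F(u) = 0\<close> with initial value \<open>U0\<close>, where \<open>F\<close> maps functions of \<open>x\<close> to functions of \<open>x\<close>.
  Values \<open>u t\<close> for \<open>t\<close> outside \<open>I\<close> are irrelevant. The initial value is attained as an element of
  \<open>L\<^sup>2\<close>: \<open>U0\<close> may be any representative of its class, whereas \<open>u 0\<close> is the \<open>C\<^sup>1\<close> one.
\<close>

definition classical_solution ::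
  "real \<Rightarrow> ((real ^ 'd \<Rightarrow> real ^ 'n) \<Rightarrow> real ^ 'd \<Rightarrow> real ^ 'n) \<Rightarrow> (real ^ 'd \<Rightarrow> real ^ 'n) \<Rightarrow>
   real set \<Rightarrow> (real \<Rightarrow> real ^ 'd \<Rightarrow> real ^ 'n) \<Rightarrow> bool" where
  "classical_solution s F U0 I u \<longleftrightarrow>
     open I \<and> is_interval I \<and> 0 \<in> I \<and>
     (\<forall>t\<in>I. u t \<in> sobolev s) \<and>
     (\<forall>t\<in>I. ((\<lambda>\<tau>. sobolev_norm s (\<lambda>x. u \<tau> x - u t x)) \<longlongrightarrow> 0) (at t within I)) \<and>
     C1_on (I \<times> UNIV) (\<lambda>(t, x). u t x) \<and>
     (\<forall>t\<in>I. \<forall>x. vector_derivative (\<lambda>\<tau>. u \<tau> x) (at t) + F (u t) x = 0) \<and>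
     (AE x in lebesgue. u 0 x = U0 x)"

definition maximal_solution ::
  "real \<Rightarrow> ((real ^ 'd \<Rightarrow> real ^ 'n) \<Rightarrow> real ^ 'd \<Rightarrow> real ^ 'n) \<Rightarrow> (real ^ 'd \<Rightarrow> real ^ 'n) \<Rightarrow>
   real set \<Rightarrow> (real \<Rightarrow> real ^ 'd \<Rightarrow> real ^ 'n) \<Rightarrow> bool" where
  "maximal_solution s F U0 I u \<longleftrightarrow>
     classical_solution s F U0 I u \<and>
     \<not> (\<exists>J v. I \<subset> J \<and> classical_solution s F U0 J v \<and> (\<forall>t\<in>I. v t = u t))"

definition maximal_solution_H ::
  "('d::finite \<Rightarrow> real ^ 'n \<Rightarrow> real ^ 'n ^ 'n) \<Rightarrow> real \<Rightarrow> (real ^ 'd \<Rightarrow> real ^ 'n) \<Rightarrow>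
   real set \<Rightarrow> (real \<Rightarrow> real ^ 'd \<Rightarrow> real ^ 'n) \<Rightarrow> bool" where
  "maximal_solution_H A s U0 I u \<longleftrightarrow> maximal_solution s (advection A) U0 I u"

definition maximal_solution_HN ::
  "('d::finite \<Rightarrow> real ^ 'n \<Rightarrow> real ^ 'n ^ 'n) \<Rightarrow> real \<Rightarrow> nat \<Rightarrow> (real ^ 'd \<Rightarrow> real ^ 'n) \<Rightarrow>
   real set \<Rightarrow> (real \<Rightarrow> real ^ 'd \<Rightarrow> real ^ 'n) \<Rightarrow> bool" where
  "maximal_solution_HN A s N U0 I u \<longleftrightarrow>
     maximal_solution s (\<lambda>V. low_pass N (advection A V)) (low_pass N U0) I u"

text \<open>The time interval \<open>[0, T / a]\<close>, read as \<open>[0, \<infinity>)\<close> if \<open>a = 0\<close> (where \<open>T / a = 0\<close> in HOL).\<close>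

definition time_span :: "real \<Rightarrow> real \<Rightarrow> real set" where
  "time_span T a = (if a = 0 then {0..} else {0..T / a})"

definition uniform_existence_time ::
  "('d::finite \<Rightarrow> real ^ 'n \<Rightarrow> real ^ 'n ^ 'n) \<Rightarrow> real \<Rightarrow> real \<Rightarrow> real \<Rightarrow> bool" where
  "uniform_existence_time A s M T \<longleftrightarrow>
     T > 0 \<and>
     (\<exists>C1>0. \<forall>V0\<in>sobolev s. sobolev_norm s V0 \<le> M \<longrightarrow>
        (\<forall>t\<in>time_span T (sobolev_norm s V0).
           sobolev_norm s V0 * exp (C1 * sobolev_norm s V0 * t) \<le> 2 * sobolev_norm s V0) \<and>
        (\<forall>I V. maximal_solution_H A s V0 I V \<longrightarrow>
           time_span T (sobolev_norm s V0) \<subseteq> I \<and>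
           (\<forall>t\<in>time_span T (sobolev_norm s V0).
              sobolev_norm s (V t) \<le> sobolev_norm s V0 * exp (C1 * sobolev_norm s V0 * t))) \<and>
        (\<forall>N\<ge>1. \<forall>I V. maximal_solution_HN A s N V0 I V \<longrightarrow>
           time_span T (sobolev_norm s V0) \<subseteq> I \<and>
           (\<forall>t\<in>time_span T (sobolev_norm s V0).
              sobolev_norm s (V t) \<le> sobolev_norm s V0 * exp (C1 * sobolev_norm s V0 * t))))"

end

theory Submission
  imports Defs
begin

text \<open>
  The difficulty is the derivative in the nonlinear term. Comparing \<open>U\<^sub>N\<close> with \<open>P\<^sub>N U\<close> loses a power
  of \<open>N\<close>: as the symbol of \<open>P\<^sub>N\<close> jumps, the commutator of \<open>P\<^sub>N\<close> with \<open>A\<^sub>j(U) \<partial>\<^sub>j\<close> applied to \<open>U\<close> is in general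
  only of size \<open>N\<^sup>1\<^sup>-\<^sup>s\<close> in \<open>L\<^sup>2\<close>. The comparison is made instead with \<open>\<Pi>U\<close>, where \<open>\<Pi>\<close> is the Fourier
  multiplier with the symbol \<open>\<pi>(k) = 1 - (min(N, \<langle>k\<rangle>) / N)\<^sup>s\<close>. This symbol vanishes beyond \<open>N\<close>, so that
  \<open>\<Pi>U\<close> is band-limited like \<open>U\<^sub>N\<close>, and \<open>U - \<Pi>U\<close> is of size \<open>N\<^sup>r\<^sup>-\<^sup>s\<close> in \<open>H\<^sup>r\<close>. Moreover
  \<open>N\<^sup>s (1 - \<pi>(k)) = min(N, \<langle>k\<rangle>)\<^sup>s\<close> is a truncation of the weight of \<open>H\<^sup>s\<close> and satisfies the Kato--Ponce
  type commutator estimate of that weight uniformly in \<open>N\<close> (\<open>truncated_weight_commutator\<close>). Hence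
  \<open>[\<Pi>, A\<^sub>j(U) \<partial>\<^sub>j] U\<close> is of size \<open>N\<^sup>-\<^sup>s\<close> in \<open>L\<^sup>2\<close> (\<open>commutator_pairing\<close>).

  The difference \<open>D = \<Pi>U - U\<^sub>N\<close> satisfies \<open>P\<^sub>N D = D\<close>, so that the sharp filter disappears when the
  equation for \<open>D\<close> is paired with \<open>D\<close>. What remains is the commutator, the source
  \<open>(A\<^sub>j(U) - A\<^sub>j(U\<^sub>N)) \<partial>\<^sub>j \<Pi>U\<close>, which is bounded by \<open>|U - U\<^sub>N|\<close> in \<open>L\<^sup>2\<close>, and the transport term
  \<open>A\<^sub>j(U\<^sub>N) \<partial>\<^sub>j D\<close>, whose pairing with \<open>D\<close> loses no derivative since the matrices are real symmetric. If
  \<open>\<sigma>\<close> bounds \<open>U\<close> in \<open>H\<^sup>s\<close> and \<open>\<mu> \<ge> \<sigma>\<close> bounds \<open>U\<^sub>N\<close> in the Wiener algebra of functions with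
  \<open>\<Sum>\<^sub>k \<langle>k\<rangle> |\<hat>u\<^sub>k| < \<infinity>\<close>, then the square \<open>y\<close> of the \<open>L\<^sup>2\<close> norm of \<open>D\<close> obeys
  \<open>|y'| \<le> C \<mu> (y + (\<sigma> N\<^sup>-\<^sup>s)\<^sup>2)\<close> (\<open>energy_rate\<close>). The rate is proportional to the size of the solutions
  because only \<open>A\<^sub>j(u) - A\<^sub>j(0)\<close> contributes to the commutator and to the transport term, and the source
  contains \<open>\<partial>\<^sub>j \<Pi>U\<close>; this makes the resulting bound \<open>|D| = O(\<sigma> N\<^sup>-\<^sup>s)\<close> uniform
  on time intervals of length \<open>T / |U\<^sup>0|\<close>. As \<open>D\<close> contains no frequencies beyond \<open>N\<close>, its \<open>H\<^sup>r\<close> norm is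
  at most a multiple of \<open>N\<^sup>r\<close> times its \<open>L\<^sup>2\<close> norm (\<open>sobolev_norm_difference_le\<close>); no energy
  estimate in a higher norm enters.

  On the uniform existence time the Wiener bound for \<open>U\<^sub>N\<close> follows from the bound in \<open>H\<^sup>s\<close> that is
  part of the hypothesis (\<open>convergence_on_existence_time\<close>). On a compact interval \<open>K\<close> no bound for \<open>U\<^sub>N\<close> is
  known beforehand. For \<open>d/2 + 1 < s' < s\<close>, the Wiener norm of \<open>D\<close> is at most a multiple of \<open>N\<^sup>s\<^sup>'\<close> times its
  \<open>L\<^sup>2\<close> norm, so \<open>U\<^sub>N\<close> is controlled while \<open>|D|\<close> stays below a multiple of \<open>N\<^sup>-\<^sup>s\<^sup>'\<close>; for large \<open>N\<close> the
  estimate \<open>|D| = O(N\<^sup>-\<^sup>s)\<close> prevents \<open>|D|\<close> from ever reaching this threshold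
  (\<open>wiener_bound_of_small_defect\<close>, \<open>gronwall_bootstrap\<close>). The truncated equation is an ordinary
  differential equation with locally Lipschitz right-hand side, whose bounded solutions extend by
  time steps of a fixed length (\<open>galerkin_continuation\<close>); therefore \<open>U\<^sub>N\<close> exists on all of \<open>K\<close>
  (\<open>convergence_on_compact_interval\<close>). An arbitrary compact \<open>K\<close> is replaced by the interval spanned by
  \<open>K\<close> and \<open>0\<close>. The supremum of the norm over that interval is at most a multiple of the one over \<open>K\<close>, unless
  the latter is \<open>0\<close>, in which case the solution vanishes on the whole interval (\<open>solution_vanishes\<close>).

  All estimates are made on Fourier coefficients, for which products become convolutions and
  derivatives become multiplications; the dictionary rests on the uniqueness of the Fourier
  coefficients of continuous functions (\<open>fourier_uniqueness\<close>), a consequence of the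
  Stone--Weierstrass theorem.
\<close>


section \<open>Weighted sequences on the lattice of frequencies\<close>

text \<open>Weighted \<open>\<ell>\<^sup>1\<close> and \<open>\<ell>\<^sup>2\<close> bounds are expressed by finite partial sums: summability and the bound are then
  one statement, whereas a divergent infinite sum has the value \<open>0\<close> and satisfies every nonnegative bound.\<close>

definition l1_bound :: "('k \<Rightarrow> real) \<Rightarrow> ('k \<Rightarrow> complex) \<Rightarrow> real \<Rightarrow> bool" where
  "l1_bound w a C \<longleftrightarrow> (\<forall>F. finite F \<longrightarrow> (\<Sum>k\<in>F. w k * cmod (a k)) \<le> C)"

definition l2_bound :: "('k \<Rightarrow> real) \<Rightarrow> ('k \<Rightarrow> complex) \<Rightarrow> real \<Rightarrow> bool" where
  "l2_bound w a C \<longleftrightarrow> C \<ge> 0 \<and> (\<forall>F. finite F \<longrightarrow> (\<Sum>k\<in>F. (w k * cmod (a k))\<^sup>2) \<le> C\<^sup>2)"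

lemma l1_boundD: "l1_bound w a C \<Longrightarrow> finite F \<Longrightarrow> (\<Sum>k\<in>F. w k * cmod (a k)) \<le> C"
  by (simp add: l1_bound_def)

lemma l1_bound_nonneg: "l1_bound w a C \<Longrightarrow> 0 \<le> C"
  using l1_boundD[of w a C "{}"] by simp

lemma l2_boundD: "l2_bound w a C \<Longrightarrow> finite F \<Longrightarrow> (\<Sum>k\<in>F. (w k * cmod (a k))\<^sup>2) \<le> C\<^sup>2"
  by (simp add: l2_bound_def)

lemma l2_bound_nonneg: "l2_bound w a C \<Longrightarrow> 0 \<le> C"
  by (simp add: l2_bound_def)

lemma l2_bound_L2_set: "l2_bound w a C \<Longrightarrow> finite F \<Longrightarrow> L2_set (\<lambda>k. w k * cmod (a k)) F \<le> C"
  using l2_boundD[of w a C F] l2_bound_nonneg[of w a C]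
  by (simp add: L2_set_def real_le_lsqrt sum_nonneg)

lemma l2_boundI_L2_set:
  assumes "C \<ge> 0" "\<And>F. finite F \<Longrightarrow> L2_set (\<lambda>k. w k * cmod (a k)) F \<le> C"
  shows "l2_bound w a C"
  unfolding l2_bound_def
proof (intro conjI allI impI)
  fix F :: "'a set" assume "finite F"
  then have "sqrt (\<Sum>k\<in>F. (w k * cmod (a k))\<^sup>2) \<le> C" using assms(2) by (simp add: L2_set_def)
  then show "(\<Sum>k\<in>F. (w k * cmod (a k))\<^sup>2) \<le> C\<^sup>2" by (rule sqrt_le_D)
qed (use assms in simp)

lemma l1_bound_mono:
  assumes "l1_bound w a C" "C \<le> C'" "\<And>k. 0 \<le> w' k \<and> w' k \<le> w k"
  shows "l1_bound w' a C'"
  unfolding l1_bound_def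
proof (intro allI impI)
  fix F :: "'a set" assume F: "finite F"
  have "(\<Sum>k\<in>F. w' k * cmod (a k)) \<le> (\<Sum>k\<in>F. w k * cmod (a k))"
    using assms(3) by (intro sum_mono mult_right_mono) auto
  then show "(\<Sum>k\<in>F. w' k * cmod (a k)) \<le> C'" using l1_boundD[OF assms(1) F] assms(2) by linarith
qed

lemma l2_bound_mono:
  assumes "l2_bound w a C" "C \<le> C'"
  shows "l2_bound w a C'"
  unfolding l2_bound_def
proof (intro conjI allI impI)
  show "0 \<le> C'" using assms l2_bound_nonneg by fastforce
  fix F :: "'a set" assume F: "finite F"
  have "C\<^sup>2 \<le> C'\<^sup>2" using assms l2_bound_nonneg[OF assms(1)] by (intro power_mono) auto
  then show "(\<Sum>k\<in>F. (w k * cmod (a k))\<^sup>2) \<le> C'\<^sup>2" using l2_boundD[OF assms(1) F] by linarith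
qed

lemma l1_bound_add:
  assumes "l1_bound w a A" "l1_bound w b B" "\<And>k. 0 \<le> w k"
  shows "l1_bound w (\<lambda>k. a k + b k) (A + B)"
  unfolding l1_bound_def
proof (intro allI impI)
  fix F :: "'a set" assume F: "finite F"
  have "(\<Sum>k\<in>F. w k * cmod (a k + b k)) \<le> (\<Sum>k\<in>F. w k * cmod (a k) + w k * cmod (b k))"
    using assms(3) by (intro sum_mono) (metis distrib_left mult_left_mono norm_triangle_ineq)
  then show "(\<Sum>k\<in>F. w k * cmod (a k + b k)) \<le> A + B"
    using l1_boundD[OF assms(1) F] l1_boundD[OF assms(2) F] by (simp add: sum.distrib)
qed

lemma l2_bound_add:
  assumes "l2_bound w a A" "l2_bound w b B" "\<And>k. 0 \<le> w k"
  shows "l2_bound w (\<lambda>k. a k + b k) (A + B)"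
proof (rule l2_boundI_L2_set)
  show "0 \<le> A + B" using l2_bound_nonneg[OF assms(1)] l2_bound_nonneg[OF assms(2)] by simp
  fix F :: "'a set" assume F: "finite F"
  have "L2_set (\<lambda>k. w k * cmod (a k + b k)) F \<le> L2_set (\<lambda>k. w k * cmod (a k) + w k * cmod (b k)) F"
    using assms(3) by (intro L2_set_mono) (auto simp: norm_triangle_ineq mult_left_mono simp flip: distrib_left)
  also have "\<dots> \<le> L2_set (\<lambda>k. w k * cmod (a k)) F + L2_set (\<lambda>k. w k * cmod (b k)) F"
    by (rule L2_set_triangle_ineq)
  finally show "L2_set (\<lambda>k. w k * cmod (a k + b k)) F \<le> A + B"
    using l2_bound_L2_set[OF assms(1) F] l2_bound_L2_set[OF assms(2) F] by linarith
qed

lemma l1_bound_cmult: "l1_bound w a A \<Longrightarrow> l1_bound w (\<lambda>k. c * a k) (cmod c * A)"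
  unfolding l1_bound_def
  by (auto simp: norm_mult mult.left_commute[of _ "cmod c"] simp flip: sum_distrib_left intro!: mult_left_mono)

lemma l2_bound_cmult: "l2_bound w a A \<Longrightarrow> l2_bound w (\<lambda>k. c * a k) (cmod c * A)"
  unfolding l2_bound_def
  by (auto simp: norm_mult power_mult_distrib mult.left_commute[of _ "(cmod c)\<^sup>2"]
      simp flip: sum_distrib_left intro!: mult_left_mono)

lemma l1_bound_abs_summable:
  assumes "l1_bound (\<lambda>_. 1) a A" shows "(\<lambda>k. norm (a k)) summable_on UNIV"
  using assms by (intro nonneg_bounded_partial_sums_imp_summable_on[where C = A])
    (auto simp: l1_bound_def)

text \<open>Passage from finite sums over \<open>l\<close> to infinite ones: each row sum \<open>\<gamma> k\<close> is a limit of finite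
  sums, so that a bound for all finite double sums is inherited.\<close>

lemma row_sums_bound:
  fixes g :: "'k \<Rightarrow> 'l \<Rightarrow> complex"
  assumes "finite F" "\<And>k. k \<in> F \<Longrightarrow> (g k has_sum \<gamma> k) UNIV" "\<And>k. 0 \<le> c k"
    and "\<And>F'. finite F' \<Longrightarrow> (\<Sum>k\<in>F. \<Sum>l\<in>F'. c k * cmod (g k l)) \<le> B"
  shows "(\<Sum>k\<in>F. c k * cmod (\<gamma> k)) \<le> B"
proof -
  have "((\<lambda>F'. \<Sum>k\<in>F. c k * cmod (\<Sum>l\<in>F'. g k l)) \<longlongrightarrow> (\<Sum>k\<in>F. c k * cmod (\<gamma> k)))
      (finite_subsets_at_top UNIV)"
    using assms(2) by (intro tendsto_sum tendsto_mult tendsto_const tendsto_norm) (simp add: has_sum_def)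
  moreover have "\<forall>\<^sub>F F' in finite_subsets_at_top UNIV. (\<Sum>k\<in>F. c k * cmod (\<Sum>l\<in>F'. g k l)) \<le> B"
  proof (rule eventually_finite_subsets_at_top_weakI)
    fix F' :: "'l set" assume "finite F'"
    then have B: "(\<Sum>k\<in>F. \<Sum>l\<in>F'. c k * cmod (g k l)) \<le> B" by (rule assms(4))
    have "c k * cmod (\<Sum>l\<in>F'. g k l) \<le> (\<Sum>l\<in>F'. c k * cmod (g k l))" for k
      unfolding sum_distrib_left[symmetric] by (intro mult_left_mono norm_sum assms(3))
    then have "(\<Sum>k\<in>F. c k * cmod (\<Sum>l\<in>F'. g k l)) \<le> (\<Sum>k\<in>F. \<Sum>l\<in>F'. c k * cmod (g k l))"
      by (rule sum_mono)
    then show "(\<Sum>k\<in>F. c k * cmod (\<Sum>l\<in>F'. g k l)) \<le> B" using B by linarith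
  qed
  ultimately show ?thesis by (rule tendsto_upperbound) simp
qed

lemma sum_shift_CS:
  fixes c f :: "'g::ab_group_add \<Rightarrow> real"
  assumes "finite F" "\<And>k. 0 \<le> f k" "\<And>k. 0 \<le> c k" "0 \<le> C" "(\<Sum>k\<in>F. (c k)\<^sup>2) \<le> C\<^sup>2"
    "\<And>F. finite F \<Longrightarrow> (\<Sum>k\<in>F. (f k)\<^sup>2) \<le> A\<^sup>2" "0 \<le> A"
  shows "(\<Sum>k\<in>F. c k * f (k - l)) \<le> C * A"
proof -
  have "(\<Sum>k\<in>F. c k * f (k - l)) \<le> (\<Sum>k\<in>F. \<bar>c k\<bar> * \<bar>f (k - l)\<bar>)"
    by (intro sum_mono) (simp add: assms)
  also have "\<dots> \<le> L2_set c F * L2_set (\<lambda>k. f (k - l)) F" by (rule L2_set_mult_ineq)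
  also have "\<dots> \<le> C * A"
  proof (rule mult_mono)
    show "L2_set c F \<le> C" unfolding L2_set_def using assms by (intro real_le_lsqrt) (auto intro: sum_nonneg)
    have "(\<Sum>k\<in>F. (f (k - l))\<^sup>2) = (\<Sum>k\<in>(\<lambda>k. k - l) ` F. (f k)\<^sup>2)"
      by (subst sum.reindex) (auto intro: inj_onI)
    then show "L2_set (\<lambda>k. f (k - l)) F \<le> A"
      unfolding L2_set_def using assms by (intro real_le_lsqrt) (auto intro: sum_nonneg)
  qed (use assms in \<open>auto simp: L2_set_nonneg\<close>)
  finally show ?thesis .
qed

text \<open>Young's inequality for convolutions, in dual form: the convolution is paired with a
  square-summable \<open>c\<close>, so that Cauchy--Schwarz bounds the sum over \<open>k\<close> uniformly in \<open>l\<close>.\<close>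

lemma young_l2_l1:
  fixes c f g :: "'g::ab_group_add \<Rightarrow> real"
  assumes "finite F" "finite F'" "\<And>k. 0 \<le> f k" "\<And>k. 0 \<le> g k" "\<And>k. 0 \<le> c k"
    "0 \<le> C" "(\<Sum>k\<in>F. (c k)\<^sup>2) \<le> C\<^sup>2"
    "\<And>F. finite F \<Longrightarrow> (\<Sum>k\<in>F. (f k)\<^sup>2) \<le> A\<^sup>2" "0 \<le> A"
    "\<And>F. finite F \<Longrightarrow> (\<Sum>k\<in>F. g k) \<le> B"
  shows "(\<Sum>k\<in>F. \<Sum>l\<in>F'. c k * (f (k - l) * g l)) \<le> C * A * B"
proof -
  have "(\<Sum>k\<in>F. \<Sum>l\<in>F'. c k * (f (k - l) * g l)) = (\<Sum>l\<in>F'. g l * (\<Sum>k\<in>F. c k * f (k - l)))"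
    by (subst sum.swap) (simp add: sum_distrib_left mult_ac)
  also have "\<dots> \<le> (\<Sum>l\<in>F'. g l * (C * A))"
    using assms by (intro sum_mono mult_left_mono sum_shift_CS) auto
  also have "\<dots> = (\<Sum>l\<in>F'. g l) * (C * A)" by (simp add: sum_distrib_right)
  also have "\<dots> \<le> B * (C * A)" using assms by (intro mult_right_mono) auto
  finally show ?thesis by (simp add: mult_ac)
qed

lemma young_l1_l2:
  fixes c f g :: "'g::ab_group_add \<Rightarrow> real"
  assumes "finite F" "finite F'" "\<And>k. 0 \<le> f k" "\<And>k. 0 \<le> g k" "\<And>k. 0 \<le> c k"
    "0 \<le> C" "(\<Sum>k\<in>F. (c k)\<^sup>2) \<le> C\<^sup>2"
    "\<And>F. finite F \<Longrightarrow> (\<Sum>k\<in>F. f k) \<le> A"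
    "\<And>F. finite F \<Longrightarrow> (\<Sum>k\<in>F. (g k)\<^sup>2) \<le> B\<^sup>2" "0 \<le> B"
  shows "(\<Sum>k\<in>F. \<Sum>l\<in>F'. c k * (f (k - l) * g l)) \<le> C * A * B"
proof -
  define M where "M = (\<lambda>(k, l). k - l) ` (F \<times> F')"
  have M: "finite M" unfolding M_def using assms by simp
  have "(\<Sum>l\<in>F'. c k * (f (k - l) * g l)) \<le> (\<Sum>m\<in>M. c k * (g (k - m) * f m))" if "k \<in> F" for k
  proof -
    have "(\<Sum>l\<in>F'. c k * (f (k - l) * g l)) = (\<Sum>m\<in>(\<lambda>l. k - l) ` F'. c k * (g (k - m) * f m))"
      by (subst sum.reindex) (auto intro: inj_onI simp: mult_ac)
    also have "\<dots> \<le> (\<Sum>m\<in>M. c k * (g (k - m) * f m))"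
      using M assms that by (intro sum_mono2) (auto simp: M_def)
    finally show ?thesis .
  qed
  then have "(\<Sum>k\<in>F. \<Sum>l\<in>F'. c k * (f (k - l) * g l)) \<le> (\<Sum>k\<in>F. \<Sum>m\<in>M. c k * (g (k - m) * f m))"
    by (rule sum_mono)
  also have "\<dots> \<le> C * B * A" using assms M by (intro young_l2_l1) auto
  finally show ?thesis by (simp add: mult_ac)
qed

lemma young_l1_l1:
  fixes f g :: "'g::ab_group_add \<Rightarrow> real"
  assumes "finite F" "finite F'" "\<And>k. 0 \<le> f k" "\<And>k. 0 \<le> g k"
    "\<And>F. finite F \<Longrightarrow> (\<Sum>k\<in>F. f k) \<le> A"
    "\<And>F. finite F \<Longrightarrow> (\<Sum>k\<in>F. g k) \<le> B"
  shows "(\<Sum>k\<in>F. \<Sum>l\<in>F'. f (k - l) * g l) \<le> A * B"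
proof -
  have A: "0 \<le> A" using assms(5)[of "{}"] by simp
  have "(\<Sum>k\<in>F. f (k - l)) \<le> A" for l
  proof -
    have "(\<Sum>k\<in>F. f (k - l)) = (\<Sum>k\<in>(\<lambda>k. k - l) ` F. f k)"
      by (subst sum.reindex) (auto intro: inj_onI)
    then show ?thesis using assms by auto
  qed
  then have "(\<Sum>l\<in>F'. g l * (\<Sum>k\<in>F. f (k - l))) \<le> (\<Sum>l\<in>F'. g l * A)"
    using assms by (intro sum_mono mult_left_mono) auto
  also have "\<dots> = (\<Sum>l\<in>F'. g l) * A" by (simp add: sum_distrib_right)
  also have "\<dots> \<le> B * A" using assms A by (intro mult_right_mono) auto
  also have "(\<Sum>l\<in>F'. g l * (\<Sum>k\<in>F. f (k - l))) = (\<Sum>k\<in>F. \<Sum>l\<in>F'. f (k - l) * g l)"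
    by (subst sum.swap[of _ F' F]) (simp add: sum_distrib_left mult_ac)
  finally show ?thesis by (simp add: mult_ac)
qed

text \<open>The converse of Cauchy--Schwarz, by pairing the weighted sequence with itself.\<close>

lemma l2_bound_dual:
  assumes "C \<ge> 0" "\<And>k. 0 \<le> w k"
    and "\<And>F c. finite F \<Longrightarrow> (\<And>k. 0 \<le> c k) \<Longrightarrow>
      (\<Sum>k\<in>F. c k * (w k * cmod (a k))) \<le> sqrt (\<Sum>k\<in>F. (c k)\<^sup>2) * C"
  shows "l2_bound w a C"
proof (rule l2_boundI_L2_set[OF assms(1)])
  fix F :: "'a set" assume F: "finite F"
  let ?f = "\<lambda>k. w k * cmod (a k)"
  have "(\<Sum>k\<in>F. ?f k * ?f k) \<le> sqrt (\<Sum>k\<in>F. (?f k)\<^sup>2) * C"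
    using assms(2) F by (intro assms(3)) auto
  then have "L2_set ?f F * L2_set ?f F \<le> L2_set ?f F * C"
    by (simp add: L2_set_def power2_eq_square sum_nonneg)
  moreover have "L2_set ?f F \<ge> 0" by (rule L2_set_nonneg)
  ultimately show "L2_set ?f F \<le> C" using assms(1)
    by (metis mult_le_cancel_left_pos order_le_less)
qed

section \<open>The Japanese bracket\<close>

lemma jb_ge_1: "1 \<le> japanese_bracket k"
  by (simp add: japanese_bracket_def sum_nonneg)

lemma jb_pos [simp]: "0 < japanese_bracket k" "0 \<le> japanese_bracket k" "japanese_bracket k \<noteq> 0"
  using jb_ge_1[of k] by linarith+

lemma jb_0 [simp]: "japanese_bracket 0 = 1" by (simp add: japanese_bracket_def)

lemma jb_minus_commute: "japanese_bracket (k - l) = japanese_bracket (l - k)"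
  by (simp add: japanese_bracket_def power2_commute)

lemma abs_component_le_jb: "\<bar>real_of_int (k $ j)\<bar> \<le> japanese_bracket k"
proof -
  have "(real_of_int (k $ j))\<^sup>2 \<le> (\<Sum>j\<in>UNIV. (real_of_int (k $ j))\<^sup>2)"
    by (rule member_le_sum) auto
  then have "sqrt ((real_of_int (k $ j))\<^sup>2) \<le> japanese_bracket k"
    unfolding japanese_bracket_def by (intro real_sqrt_le_mono) simp
  then show ?thesis by simp
qed

text \<open>The Japanese bracket is the Euclidean norm of this vector, hence 1-Lipschitz.\<close>

definition freq_vec :: "int ^ 'd \<Rightarrow> real \<times> (real ^ 'd)" where
  "freq_vec k = (1, \<chi> j. real_of_int (k $ j))"

lemma jb_eq_norm: "japanese_bracket k = norm (freq_vec k)"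
  by (simp add: japanese_bracket_def freq_vec_def norm_prod_def norm_vec_def L2_set_def sum_nonneg)

lemma jb_lipschitz: "\<bar>japanese_bracket k - japanese_bracket l\<bar> \<le> japanese_bracket (k - l)"
proof -
  have "\<bar>japanese_bracket k - japanese_bracket l\<bar> \<le> norm (freq_vec k - freq_vec l)"
    unfolding jb_eq_norm by (rule norm_triangle_ineq3)
  also have "\<dots> \<le> japanese_bracket (k - l)"
    by (simp add: japanese_bracket_def freq_vec_def norm_prod_def norm_vec_def L2_set_def sum_nonneg)
  finally show ?thesis .
qed

lemma jb_le_add: "japanese_bracket k \<le> japanese_bracket (k - l) + japanese_bracket l"
  using jb_lipschitz[of k l] by linarith

lemma jb_le_mult: "japanese_bracket k \<le> 2 * (japanese_bracket (k - l) * japanese_bracket l)"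
proof -
  have "0 \<le> (japanese_bracket (k - l) - 1) * (japanese_bracket l - 1)"
    using jb_ge_1[of "k - l"] jb_ge_1[of l] by simp
  then show ?thesis using jb_le_add[of k l] jb_ge_1[of l] jb_ge_1[of "k-l"]
    by (simp add: algebra_simps)
qed

lemma powr_add_le:
  fixes a b p :: real
  assumes "0 \<le> a" "0 \<le> b" "0 \<le> p"
  shows "(a + b) powr p \<le> 2 powr p * (a powr p + b powr p)"
proof -
  have "(a + b) powr p \<le> (2 * max a b) powr p" using assms by (intro powr_mono2) auto
  also have "\<dots> = 2 powr p * (max a b) powr p" using assms by (simp add: powr_mult)
  also have "\<dots> \<le> 2 powr p * (a powr p + b powr p)" by (intro mult_left_mono) (auto simp: max_def)
  finally show ?thesis .
qed

lemma jb_powr_le_add: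
  assumes "0 \<le> p"
  shows "japanese_bracket k powr p
    \<le> 2 powr p * (japanese_bracket (k - l) powr p + japanese_bracket l powr p)"
proof -
  have "japanese_bracket k powr p \<le> (japanese_bracket (k - l) + japanese_bracket l) powr p"
    using assms jb_le_add[of k l] by (intro powr_mono2) auto
  also have "\<dots> \<le> 2 powr p * (japanese_bracket (k - l) powr p + japanese_bracket l powr p)"
    using assms by (intro powr_add_le) auto
  finally show ?thesis .
qed

lemma powr_diff_le:
  fixes x y p :: real
  assumes "0 < x" "0 < y" "1 \<le> p"
  shows "\<bar>x powr p - y powr p\<bar> \<le> p * max x y powr (p - 1) * \<bar>x - y\<bar>"
proof -
  have *: "y powr p - x powr p \<le> p * y powr (p - 1) * (y - x)" if "0 < x" "x \<le> y" for x y :: real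
  proof (cases "x = y")
    case False
    with that have "\<exists>z. x < z \<and> z < y \<and> y powr p - x powr p = (y - x) * (p * z powr (p - 1))"
      by (intro MVT2) (auto intro!: derivative_eq_intros)
    then obtain z where z: "x < z" "z < y" "y powr p - x powr p = (y - x) * (p * z powr (p - 1))" by blast
    have "z powr (p - 1) \<le> y powr (p - 1)" using z that assms by (intro powr_mono2) auto
    then show ?thesis using z assms by (simp add: mult_left_mono mult_ac)
  qed simp
  show ?thesis
  proof (cases "x \<le> y")
    case True
    then have "x powr p \<le> y powr p" using assms by (intro powr_mono2) auto
    then show ?thesis using *[of x y] True assms by (auto simp: max_def)
  next
    case False
    then have "y powr p \<le> x powr p" using assms by (intro powr_mono2) auto
    then show ?thesis using *[of y x] False assms by (auto simp: max_def)
  qed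
qed

text \<open>The truncated weight \<open>min(N, \<langle>k\<rangle>)\<^sup>s\<close> obeys the Kato--Ponce type bound of \<open>\<langle>k\<rangle>\<^sup>s\<close>, uniformly in \<open>N\<close>:
  truncation is 1-Lipschitz, so it does not increase differences.\<close>

lemma truncated_weight_commutator:
  fixes k l :: "int ^ 'd"
  assumes "1 \<le> s" "0 < N"
  shows "\<bar>min N (japanese_bracket k) powr s - min N (japanese_bracket l) powr s\<bar>
    \<le> s * 2 powr (s - 1) *
        (japanese_bracket (k - l) powr s + japanese_bracket (k - l) * japanese_bracket l powr (s - 1))"
proof -
  let ?x = "min N (japanese_bracket k)" and ?y = "min N (japanese_bracket l)"
    and ?m = "japanese_bracket (k - l)"
  have "\<bar>?x powr s - ?y powr s\<bar> \<le> s * max ?x ?y powr (s - 1) * \<bar>?x - ?y\<bar>"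
    using assms by (intro powr_diff_le) auto
  also have "\<dots> \<le> s * (?m + japanese_bracket l) powr (s - 1) * ?m"
  proof (intro mult_mono mult_left_mono powr_mono2)
    show "max ?x ?y \<le> ?m + japanese_bracket l"
      using jb_le_add[of k l] jb_pos(2)[of "k - l"] by linarith
    show "\<bar>?x - ?y\<bar> \<le> ?m" using jb_lipschitz[of k l] by linarith
  qed (use assms jb_pos(2)[of k] jb_pos(2)[of l] in \<open>auto simp: le_max_iff_disj\<close>)
  also have "\<dots> \<le> s * (2 powr (s - 1) * (?m powr (s - 1) + japanese_bracket l powr (s - 1))) * ?m"
    using assms by (intro mult_right_mono mult_left_mono powr_add_le) auto
  also have "\<dots> = s * 2 powr (s - 1) *
      (?m powr (s - 1) * ?m + ?m * japanese_bracket l powr (s - 1))"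
    by (simp add: algebra_simps)
  also have "?m powr (s - 1) * ?m = ?m powr s" by (simp add: powr_diff)
  finally show ?thesis .
qed

text \<open>\<open>\<langle>k\<rangle>\<^sup>-\<^sup>2\<^sup>p\<close> is summable over the lattice for \<open>p > d/2\<close>: it is dominated by the product over the
  coordinates of the one-dimensional weights \<open>(1 + k\<^sub>j\<^sup>2)\<^sup>-\<^sup>p\<^sup>/\<^sup>d\<close>.\<close>

lemma sum_weight_1d_bounded:
  fixes q :: real
  assumes "q > 1 / 2"
  shows "\<exists>B\<ge>0. \<forall>R::int. (\<Sum>m\<in>{-R..R}. (1 + (real_of_int m)\<^sup>2) powr (- q)) \<le> B"
proof -
  have sm: "summable (\<lambda>n::nat. real n powr (- 2 * q))" using assms by (simp add: summable_real_powr_iff)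
  define S where "S = (\<Sum>n. real n powr (- 2 * q))"
  have S0: "0 \<le> S" unfolding S_def by (intro suminf_nonneg sm) auto
  have "(\<Sum>m\<in>{-R..R}. (1 + (real_of_int m)\<^sup>2) powr (- q)) \<le> 1 + 2 * S" for R
  proof -
    define f where "f m = (1 + (real_of_int m)\<^sup>2) powr (- q)" for m
    have pos: "sum f {1..R} \<le> S"
    proof -
      have "sum f {1..R} = (\<Sum>n\<in>{1..nat R}. f (int n))"
        by (rule sum.reindex_bij_witness[of _ int nat]) auto
      also have "\<dots> \<le> (\<Sum>n\<in>{1..nat R}. real n powr (- 2 * q))"
      proof (intro sum_mono)
        fix n assume n: "n \<in> {1..nat R}"
        have "f (int n) \<le> (real n ^ 2) powr (- q)" unfolding f_def using n assms
          by (intro powr_mono2') auto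
        also have "\<dots> = real n powr (- 2 * q)" using n by (simp add: powr_powr flip: powr_numeral)
        finally show "f (int n) \<le> real n powr (- 2 * q)" .
      qed
      also have "\<dots> \<le> S" unfolding S_def by (rule sum_le_suminf[OF sm]) auto
      finally show ?thesis .
    qed
    have neg: "sum f {-R..-1} = sum f {1..R}"
      by (rule sum.reindex_bij_witness[of _ uminus uminus]) (auto simp: f_def)
    have "sum f {-R..R} \<le> sum f ({-R..-1} \<union> {0} \<union> {1..R})"
      by (rule sum_mono2) (auto simp: f_def)
    also have "\<dots> = sum f {-R..-1} + f 0 + sum f {1..R}"
      by (subst sum.union_disjoint; simp add: sum.union_disjoint)
    also have "\<dots> \<le> 1 + 2 * S" using neg pos by (simp add: f_def)
    finally show ?thesis by (simp add: f_def)
  qed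
  then show ?thesis using S0 by (intro exI[of _ "1 + 2 * S"]) auto
qed

lemma lattice_sum_bounded:
  fixes p :: real
  assumes "p > real CARD('d) / 2"
  shows "\<exists>B\<ge>0. \<forall>F::(int ^ 'd) set. finite F \<longrightarrow> (\<Sum>k\<in>F. japanese_bracket k powr (- 2 * p)) \<le> B"
proof -
  define q where "q = p / real CARD('d)"
  have d0: "real CARD('d) > 0" by simp
  have q: "q > 1 / 2" unfolding q_def using assms d0 by (simp add: field_simps)
  obtain B where B: "B \<ge> 0" "\<And>R::int. (\<Sum>m\<in>{-R..R}. (1 + (real_of_int m)\<^sup>2) powr (- q)) \<le> B"
    using sum_weight_1d_bounded[OF q] by blast
  define f where "f m = (1 + (real_of_int m)\<^sup>2) powr (- q)" for m
  have weight: "japanese_bracket k powr (- 2 * p) \<le> (\<Prod>j\<in>UNIV. f (k $ j))" for k :: "int ^ 'd"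
  proof -
    have "japanese_bracket k powr (- 2 * p) = (\<Prod>j\<in>(UNIV::'d set). japanese_bracket k powr (- 2 * q))"
      by (simp add: powr_powr q_def flip: powr_realpow)
    also have "\<dots> \<le> (\<Prod>j\<in>UNIV. f (k $ j))"
    proof (intro prod_mono conjI)
      fix j :: 'd
      have "(real_of_int (k $ j))\<^sup>2 \<le> (\<Sum>j\<in>UNIV. (real_of_int (k $ j))\<^sup>2)" by (rule member_le_sum) auto
      then have "((japanese_bracket k)\<^sup>2) powr (- q) \<le> f (k $ j)"
        unfolding f_def using q
        by (intro powr_mono2') (auto simp: japanese_bracket_def sum_nonneg add_pos_nonneg)
      then show "japanese_bracket k powr (- 2 * q) \<le> f (k $ j)"
        by (simp add: powr_powr flip: powr_numeral)
    qed auto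
    finally show ?thesis .
  qed
  have "(\<Sum>k\<in>F. japanese_bracket k powr (- 2 * p)) \<le> B ^ CARD('d)" if F: "finite F" for F :: "(int ^ 'd) set"
  proof -
    define R where "R = Max (insert 0 ((\<lambda>(k, j). \<bar>k $ j\<bar>) ` (F \<times> UNIV)))"
    have R: "\<bar>k $ j\<bar> \<le> R" if "k \<in> F" for k j
      unfolding R_def using F that by (intro Max_ge) (auto intro!: image_eqI[of _ _ "(k, j)"])
    define E where "E = PiE (UNIV :: 'd set) (\<lambda>_. {-R..R})"
    have "(\<Sum>k\<in>F. japanese_bracket k powr (- 2 * p)) \<le> (\<Sum>k\<in>F. \<Prod>j\<in>UNIV. f (k $ j))"
      by (intro sum_mono weight)
    also have "\<dots> = (\<Sum>g\<in>vec_nth ` F. \<Prod>j\<in>UNIV. f (g j))"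
      by (subst sum.reindex) (auto simp: inj_on_def vec_nth_inject)
    also have "\<dots> \<le> (\<Sum>g\<in>E. \<Prod>j\<in>UNIV. f (g j))"
    proof (rule sum_mono2)
      show "finite E" unfolding E_def by (intro finite_PiE) auto
      show "vec_nth ` F \<subseteq> E" unfolding E_def 
      proof (clarsimp simp: PiE_def Pi_def)
        fix k j assume "k \<in> F"
        from R[OF this, of j] show "- R \<le> k $ j \<and> k $ j \<le> R" by linarith
      qed
    qed (auto intro!: prod_nonneg simp: f_def)
    also have "\<dots> = (\<Prod>j\<in>(UNIV::'d set). \<Sum>m\<in>{-R..R}. f m)"
      unfolding E_def by (subst prod_sum_PiE) auto
    also have "\<dots> \<le> (\<Prod>j\<in>(UNIV::'d set). B)"
      using B(2)[of R] by (intro prod_mono) (auto simp: f_def intro!: sum_nonneg)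
    finally show ?thesis by simp
  qed
  then show ?thesis using B(1) by (intro exI[of _ "B ^ CARD('d)"]) auto
qed

text \<open>The Sobolev embedding of \<open>H\<^sup>s\<close> into the Wiener algebra with weight \<open>\<langle>k\<rangle>\<close>: by Cauchy--Schwarz,
  since \<open>\<langle>k\<rangle>\<^sup>1\<^sup>-\<^sup>s\<close> is square-summable exactly when \<open>s - 1 > d/2\<close>.\<close>

lemma l2_imp_l1_bound:
  fixes s :: real
  assumes "s > real CARD('d) / 2 + 1"
  shows "\<exists>c>0. \<forall>(a :: int ^ 'd \<Rightarrow> complex) C. l2_bound (\<lambda>k. japanese_bracket k powr s) a C \<longrightarrow>
    l1_bound japanese_bracket a (c * C)"
proof -
  have "s - 1 > real CARD('d) / 2" using assms by linarith
  from lattice_sum_bounded[OF this] obtain B where B: "B \<ge> 0"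
    "\<And>F::(int ^ 'd) set. finite F \<Longrightarrow> (\<Sum>k\<in>F. japanese_bracket k powr (- 2 * (s - 1))) \<le> B" by blast
  have "l1_bound japanese_bracket a (sqrt (B + 1) * C)"
    if a: "l2_bound (\<lambda>k. japanese_bracket k powr s) a C" for a :: "int ^ 'd \<Rightarrow> complex" and C
    unfolding l1_bound_def
  proof (intro allI impI)
    fix F :: "(int ^ 'd) set" assume F: "finite F"
    have C: "0 \<le> C" using a by (rule l2_bound_nonneg)
    have "japanese_bracket k powr (1 - s) * japanese_bracket k powr s = japanese_bracket k" for k :: "int ^ 'd"
      by (simp flip: powr_add)
    then have "(\<Sum>k\<in>F. japanese_bracket k * cmod (a k))
      = (\<Sum>k\<in>F. japanese_bracket k powr (1 - s) * (japanese_bracket k powr s * cmod (a k)))"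
      by (simp flip: mult.assoc)
    also have "\<dots> \<le> (\<Sum>k\<in>F. \<bar>japanese_bracket k powr (1 - s)\<bar> * \<bar>japanese_bracket k powr s * cmod (a k)\<bar>)"
      by (intro sum_mono) auto
    also have "\<dots> \<le> L2_set (\<lambda>k. japanese_bracket k powr (1 - s)) F * L2_set (\<lambda>k. japanese_bracket k powr s * cmod (a k)) F"
      by (rule L2_set_mult_ineq)
    also have "\<dots> \<le> sqrt (B + 1) * C"
    proof (intro mult_mono l2_bound_L2_set[OF a F])
      have "(\<Sum>k\<in>F. (japanese_bracket k powr (1 - s))\<^sup>2) = (\<Sum>k\<in>F. japanese_bracket k powr (- 2 * (s - 1)))"
        by (intro sum.cong) (auto simp: powr_powr algebra_simps simp flip: powr_numeral)
      then show "L2_set (\<lambda>k. japanese_bracket k powr (1 - s)) F \<le> sqrt (B + 1)"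
        unfolding L2_set_def using B(2)[OF F] by (intro real_sqrt_le_mono) linarith
    qed (use B C in \<open>auto simp: L2_set_nonneg\<close>)
    finally show "(\<Sum>k\<in>F. japanese_bracket k * cmod (a k)) \<le> sqrt (B + 1) * C" .
  qed
  then show ?thesis using B(1) by (intro exI[of _ "sqrt (B + 1)"]) auto
qed

section \<open>Fourier series on the torus\<close>

definition continuous_periodic :: "(real ^ 'd \<Rightarrow> 'a::topological_space) \<Rightarrow> bool" where
  "continuous_periodic f \<longleftrightarrow> continuous_on UNIV f \<and> torus_periodic f"

definition coef :: "(real ^ 'd \<Rightarrow> complex) \<Rightarrow> int ^ 'd \<Rightarrow> complex" where
  "coef f k = (LINT x:torus_cell|lebesgue. f x * cis (- freq_dot k x))
     / complex_of_real ((2 * pi) ^ CARD('d))"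

lemma fourier_coeff_component:
  "fourier_coeff U k $ i = coef (\<lambda>x. complex_of_real (U x $ i)) k"
  by (simp add: fourier_coeff_def coef_def)

lemma continuous_periodicD:
  "continuous_periodic f \<Longrightarrow> continuous_on S f"
  "continuous_periodic f \<Longrightarrow> f (x + axis j (2 * pi)) = f x"
  by (auto simp: continuous_periodic_def torus_periodic_def intro: continuous_on_subset)

lemma continuous_periodic_compose:
  "continuous_periodic f \<Longrightarrow> continuous_on UNIV g \<Longrightarrow> continuous_periodic (\<lambda>x. g (f x))"
  by (auto simp: continuous_periodic_def torus_periodic_def intro: continuous_on_compose2)

lemma continuous_periodic_const [simp]: "continuous_periodic (\<lambda>x. c)"
  by (simp add: continuous_periodic_def torus_periodic_def)

lemma continuous_periodic_add:
  fixes f g :: "real ^ 'd \<Rightarrow> 'a::real_normed_vector"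
  shows "continuous_periodic f \<Longrightarrow> continuous_periodic g \<Longrightarrow> continuous_periodic (\<lambda>x. f x + g x)"
  by (auto simp: continuous_periodic_def torus_periodic_def intro: continuous_intros)

lemma continuous_periodic_diff:
  fixes f g :: "real ^ 'd \<Rightarrow> 'a::real_normed_vector"
  shows "continuous_periodic f \<Longrightarrow> continuous_periodic g \<Longrightarrow> continuous_periodic (\<lambda>x. f x - g x)"
  by (auto simp: continuous_periodic_def torus_periodic_def intro: continuous_intros)

lemma continuous_periodic_mult:
  fixes f g :: "real ^ 'd \<Rightarrow> 'a::real_normed_algebra"
  shows "continuous_periodic f \<Longrightarrow> continuous_periodic g \<Longrightarrow> continuous_periodic (\<lambda>x. f x * g x)"
  by (auto simp: continuous_periodic_def torus_periodic_def intro: continuous_intros)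

lemma continuous_periodic_sum:
  fixes f :: "'i \<Rightarrow> real ^ 'd \<Rightarrow> 'a::real_normed_vector"
  shows "(\<And>i. i \<in> I \<Longrightarrow> continuous_periodic (f i)) \<Longrightarrow> continuous_periodic (\<lambda>x. \<Sum>i\<in>I. f i x)"
  by (auto simp: continuous_periodic_def torus_periodic_def intro!: continuous_intros)

lemma continuous_periodic_shift:
  fixes f :: "real ^ 'd \<Rightarrow> 'a::topological_space"
  assumes "continuous_periodic f" shows "continuous_periodic (\<lambda>x. f (x + v))"
proof -
  have "continuous_on UNIV (\<lambda>x. f (x + v))"
    using assms by (auto simp: continuous_periodic_def intro!: continuous_on_compose2[of UNIV f] continuous_intros)
  then show ?thesis using continuous_periodicD(2)[OF assms, of "_ + v"]
    by (auto simp: continuous_periodic_def torus_periodic_def add_ac)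
qed

lemma freq_dot_simps:
  "freq_dot k (x + y) = freq_dot k x + freq_dot k y"
  "freq_dot (k + l) x = freq_dot k x + freq_dot l x"
  "freq_dot (k - l) x = freq_dot k x - freq_dot l x"
  "freq_dot (- k) x = - freq_dot k x"
  "freq_dot 0 x = 0" "freq_dot k 0 = 0"
  by (simp_all add: freq_dot_def algebra_simps sum.distrib sum_subtractf sum_negf)

lemma freq_dot_axis: "freq_dot k (axis j h) = real_of_int (k $ j) * h"
proof -
  have "freq_dot k (axis j h) = (\<Sum>i\<in>UNIV. if i = j then real_of_int (k $ j) * h else 0)"
    unfolding freq_dot_def by (intro sum.cong) (auto simp: axis_def)
  then show ?thesis by simp
qed

lemma continuous_on_freq_dot [continuous_intros]: "continuous_on S (freq_dot k)"
  unfolding freq_dot_def by (intro continuous_intros)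

lemma cis_of_int_period: "cis (a + real_of_int m * (2 * pi)) = cis a"
proof -
  have "cis (real_of_int m * (2 * pi)) = 1"
    using cis_multiple_2pi[of "real_of_int m"] by (simp add: mult_ac)
  then show ?thesis by (simp flip: cis_mult)
qed

lemma continuous_periodic_cis [simp]: "continuous_periodic (\<lambda>x. cis (freq_dot k x))"
  by (auto simp: continuous_periodic_def torus_periodic_def freq_dot_simps freq_dot_axis cis_of_int_period
      intro!: continuous_intros)

lemma continuous_periodic_cis_minus [simp]: "continuous_periodic (\<lambda>x. cis (- freq_dot k x))"
  using continuous_periodic_cis[of "- k"] by (simp add: freq_dot_simps)

lemma continuous_periodic_mult_int:
  assumes "continuous_periodic f"
  shows "f (x + axis j (2 * pi * real_of_int m)) = f x"
proof -
  have *: "f (x + axis j (2 * pi * real n)) = f x" for n :: nat and x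
  proof (induction n)
    case 0 show ?case by (simp add: axis_def zero_vec_def[symmetric])
  next
    case (Suc n)
    have "x + axis j (2 * pi * real (Suc n)) = (x + axis j (2 * pi * real n)) + axis j (2 * pi)"
      by (simp add: vec_eq_iff axis_def algebra_simps)
    then show ?case using Suc continuous_periodicD(2)[OF assms] by metis
  qed
  show ?thesis
  proof (cases "m \<ge> 0")
    case True
    then show ?thesis using *[of x "nat m"] by simp
  next
    case False
    have "(x + axis j (2 * pi * real_of_int m)) + axis j (2 * pi * real (nat (- m))) = x"
      using False by (simp add: vec_eq_iff axis_def algebra_simps)
    then show ?thesis using *[of "x + axis j (2 * pi * real_of_int m)" "nat (- m)"] by metis
  qed
qed

lemma continuous_periodic_lattice:
  assumes "continuous_periodic f"
  shows "f (x + (\<chi> j. 2 * pi * real_of_int (m j))) = f x"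
proof -
  have "f (x + (\<chi> j. if j \<in> S then 2 * pi * real_of_int (m j) else 0)) = f x" if "finite S" for S
    using that
  proof (induction S)
    case empty then show ?case by (simp add: zero_vec_def[symmetric])
  next
    case (insert i S)
    have "x + (\<chi> j. if j \<in> insert i S then 2 * pi * real_of_int (m j) else 0)
      = (x + (\<chi> j. if j \<in> S then 2 * pi * real_of_int (m j) else 0)) + axis i (2 * pi * real_of_int (m i))"
      using insert by (auto simp: vec_eq_iff axis_def)
    then have "f (x + (\<chi> j. if j \<in> insert i S then 2 * pi * real_of_int (m j) else 0))
      = f (x + (\<chi> j. if j \<in> S then 2 * pi * real_of_int (m j) else 0))"
      by (simp only: continuous_periodic_mult_int[OF assms])
    then show ?case using insert by simp
  qed
  from this[of UNIV] show ?thesis by simp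
qed

lemma torus_cell_representative:
  fixes x :: "real ^ 'd"
  obtains y m where "y \<in> torus_cell" "x = y + (\<chi> j. 2 * pi * real_of_int (m j))"
proof -
  define m where "m j = \<lfloor>x $ j / (2 * pi)\<rfloor>" for j
  define y where "y = (\<chi> j. x $ j - 2 * pi * real_of_int (m j))"
  have "0 \<le> y $ j \<and> y $ j \<le> 2 * pi" for j
  proof -
    have "real_of_int (m j) \<le> x $ j / (2 * pi)" "x $ j / (2 * pi) \<le> real_of_int (m j) + 1"
      unfolding m_def by linarith+
    then show ?thesis by (simp add: y_def field_simps)
  qed
  then have "y \<in> torus_cell" by (simp add: torus_cell_def mem_box_cart)
  moreover have "x = y + (\<chi> j. 2 * pi * real_of_int (m j))" by (simp add: y_def vec_eq_iff)
  ultimately show ?thesis by (rule that)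
qed

lemma continuous_periodic_bounded:
  fixes f :: "real ^ 'd \<Rightarrow> 'a::real_normed_vector"
  assumes "continuous_periodic f"
  shows "\<exists>B\<ge>0. \<forall>x. norm (f x) \<le> B"
proof -
  have "compact (f ` torus_cell)"
    using assms by (intro compact_continuous_image continuous_periodicD) (auto simp: torus_cell_def)
  then obtain B where B: "\<And>x. x \<in> torus_cell \<Longrightarrow> norm (f x) \<le> B"
    by (meson compact_imp_bounded bounded_iff image_eqI)
  have "norm (f x) \<le> max B 0" for x
  proof -
    obtain y m where y: "y \<in> torus_cell" "x = y + (\<chi> j. 2 * pi * real_of_int (m j))"
      by (rule torus_cell_representative)
    have "f x = f y" unfolding y(2) by (rule continuous_periodic_lattice[OF assms])
    with B[OF y(1)] show ?thesis by simp
  qed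
  then show ?thesis by (intro exI[of _ "max B 0"]) auto
qed

lemma torus_cell_props:
  "(torus_cell :: (real ^ 'd) set) \<noteq> {}" "compact (torus_cell :: (real ^ 'd) set)"
  "measure lborel (torus_cell :: (real ^ 'd) set) = (2 * pi) ^ CARD('d)"
proof -
  have "(0::real ^ 'd) \<in> torus_cell" by (simp add: torus_cell_def mem_box_cart)
  then show "(torus_cell :: (real ^ 'd) set) \<noteq> {}" by blast
  then show "measure lborel (torus_cell :: (real ^ 'd) set) = (2 * pi) ^ CARD('d)"
    unfolding torus_cell_def by (subst content_cbox_cart) auto
  show "compact (torus_cell :: (real ^ 'd) set)" by (simp add: torus_cell_def)
qed

lemma continuous_integrable_torus:
  fixes f :: "real ^ 'd \<Rightarrow> 'b::euclidean_space"
  assumes "continuous_on UNIV f"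
  shows "f integrable_on torus_cell" "(LINT x:torus_cell|lebesgue. f x) = integral torus_cell f"
proof -
  have "f absolutely_integrable_on torus_cell"
    unfolding torus_cell_def using assms
    by (intro absolutely_integrable_continuous) (auto intro: continuous_on_subset)
  then show "f integrable_on torus_cell" "(LINT x:torus_cell|lebesgue. f x) = integral torus_cell f"
    by (simp_all add: set_lebesgue_integral_eq_integral)
qed

text \<open>The slab of the cell that a translation moves out at one face is the translate by a period of
  the slab that it leaves uncovered at the opposite face.\<close>

lemma integral_torus_shift_small:
  fixes g :: "real ^ 'd \<Rightarrow> complex"
  assumes g: "continuous_periodic g" and h: "0 \<le> h" "h \<le> 2 * pi"
  shows "integral torus_cell (\<lambda>x. g (x + axis j h)) = integral torus_cell g"
proof -
  define b :: "real ^ 'd" where "b = (\<chi> i. 2 * pi)"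
  let ?e = "\<lambda>t::real. (axis j t :: real ^ 'd)"
  have int: "g integrable_on cbox a c" for a c
    using g by (intro integrable_continuous continuous_periodicD)
  have ax: "(axis j 1 :: real ^ 'd) \<in> Basis" by simp
  have e: "?e t $ i = (if i = j then t else 0)" for t i by (simp add: axis_def)
  have "integral torus_cell (\<lambda>x. g (x + ?e h)) = integral (cbox (?e h) (b + ?e h)) g"
    using integral_shift_cbox[of "?e h" "?e h" "b + ?e h" g] by (simp add: torus_cell_def b_def)
  also have "\<dots> = integral (cbox (?e h) (b + ?e h) \<inter> {x. x \<bullet> axis j 1 \<le> 2 * pi}) g
      + integral (cbox (?e h) (b + ?e h) \<inter> {x. x \<bullet> axis j 1 \<ge> 2 * pi}) g"
    by (rule integral_split[OF int ax])
  also have "cbox (?e h) (b + ?e h) \<inter> {x. x \<bullet> axis j 1 \<le> 2 * pi} = cbox (?e h) b"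
    using h by (auto simp: mem_box_cart inner_axis e b_def split: if_splits)
      (smt (verit, best))+
  also have "cbox (?e h) (b + ?e h) \<inter> {x. x \<bullet> axis j 1 \<ge> 2 * pi} = cbox (?e (2 * pi)) (b + ?e h)"
    using h by (auto simp: mem_box_cart inner_axis e b_def split: if_splits)
      (smt (verit, best))+
  also have "integral (cbox (?e (2 * pi)) (b + ?e h)) g
      = integral (cbox 0 (b + ?e h - ?e (2 * pi))) (\<lambda>x. g (x + ?e (2 * pi)))"
    using integral_shift_cbox[of "?e (2 * pi)" "?e (2 * pi)" "b + ?e h" g] by simp
  also have "\<dots> = integral (cbox 0 (b + ?e h - ?e (2 * pi))) g"
    by (simp add: continuous_periodicD(2)[OF g])
  also have "cbox 0 (b + ?e h - ?e (2 * pi)) = cbox 0 b \<inter> {x. x \<bullet> axis j 1 \<le> h}"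
    using h by (auto simp: mem_box_cart inner_axis e b_def split: if_splits)
      (smt (verit, best))+
  also have "cbox (?e h) b = cbox 0 b \<inter> {x. x \<bullet> axis j 1 \<ge> h}"
    using h by (auto simp: mem_box_cart inner_axis e b_def split: if_splits)
      (smt (verit, best))+
  also have "integral (cbox 0 b \<inter> {x. x \<bullet> axis j 1 \<ge> h}) g + integral (cbox 0 b \<inter> {x. x \<bullet> axis j 1 \<le> h}) g
      = integral (cbox 0 b) g"
    using integral_split[OF int[of 0 b] ax, of h] by simp
  finally show ?thesis by (simp add: torus_cell_def b_def)
qed

lemma integral_torus_shift:
  fixes g :: "real ^ 'd \<Rightarrow> complex"
  assumes g: "continuous_periodic g"
  shows "integral torus_cell (\<lambda>x. g (x + axis j h)) = integral torus_cell g"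
proof -
  define m where "m = \<lfloor>h / (2 * pi)\<rfloor>"
  define h' where "h' = h - 2 * pi * real_of_int m"
  have "real_of_int m \<le> h / (2 * pi)" "h / (2 * pi) \<le> real_of_int m + 1"
    unfolding m_def by linarith+
  then have h': "0 \<le> h'" "h' \<le> 2 * pi" by (simp_all add: h'_def field_simps)
  have "g (x + axis j h) = g (x + axis j h')" for x
  proof -
    have "x + axis j h = (x + axis j h') + axis j (2 * pi * real_of_int m)"
      by (simp add: vec_eq_iff axis_def h'_def)
    then show ?thesis using continuous_periodic_mult_int[OF g] by metis
  qed
  then show ?thesis using integral_torus_shift_small[OF g h'] by simp
qed

lemma coef_eq_integral:
  fixes f :: "real ^ 'd \<Rightarrow> complex"
  assumes "continuous_periodic f"
  shows "coef f k = integral torus_cell (\<lambda>x. f x * cis (- freq_dot k x)) / complex_of_real ((2 * pi) ^ CARD('d))"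
  unfolding coef_def using assms
  by (subst continuous_integrable_torus)
    (auto intro!: continuous_periodicD continuous_periodic_mult)

lemma coef_integrable:
  fixes f :: "real ^ 'd \<Rightarrow> complex"
  assumes "continuous_periodic f"
  shows "(\<lambda>x. f x * cis (- freq_dot k x)) integrable_on torus_cell"
  using assms by (intro continuous_integrable_torus(1) continuous_periodicD continuous_periodic_mult) auto

lemma coef_add:
  assumes "continuous_periodic f" "continuous_periodic g"
  shows "coef (\<lambda>x. f x + g x) k = coef f k + coef g k"
  using assms by (simp add: coef_eq_integral continuous_periodic_add distrib_right
      integral_add coef_integrable add_divide_distrib)

lemma coef_diff:
  assumes "continuous_periodic f" "continuous_periodic g"
  shows "coef (\<lambda>x. f x - g x) k = coef f k - coef g k"
  using assms by (simp add: coef_eq_integral continuous_periodic_diff left_diff_distrib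
      integral_diff coef_integrable diff_divide_distrib)

lemma coef_cmult:
  assumes "continuous_periodic f"
  shows "coef (\<lambda>x. c * f x) k = c * coef f k"
  using assms by (simp add: coef_eq_integral continuous_periodic_mult mult.assoc)

lemma coef_sum:
  assumes "finite I" "\<And>i. i \<in> I \<Longrightarrow> continuous_periodic (f i)"
  shows "coef (\<lambda>x. \<Sum>i\<in>I. f i x) k = (\<Sum>i\<in>I. coef (f i) k)"
  using assms
proof (induction I)
  case empty show ?case by (simp add: coef_def)
next
  case (insert i I)
  then show ?case by (simp add: coef_add continuous_periodic_sum)
qed

lemma coef_norm_le:
  fixes f :: "real ^ 'd \<Rightarrow> complex"
  assumes "continuous_periodic f" "\<And>x. cmod (f x) \<le> B"
  shows "cmod (coef f k) \<le> B"
proof -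
  have "cmod (integral torus_cell (\<lambda>x. f x * cis (- freq_dot k x))) \<le> integral (torus_cell :: (real ^ 'd) set) (\<lambda>_. B)"
    using assms by (intro integral_norm_bound_integral coef_integrable)
      (auto simp: norm_mult torus_cell_def)
  also have "\<dots> = B * (2 * pi) ^ CARD('d)"
    using torus_cell_props(3)[where 'd='d] by (simp add: torus_cell_def)
  finally show ?thesis using assms(1)
    by (simp add: coef_eq_integral norm_divide divide_le_eq norm_power norm_mult)
qed

lemma coef_modulate: "coef (\<lambda>x. f x * cis (freq_dot l x)) k = coef f (k - l)"
  unfolding coef_def by (simp add: mult.assoc cis_mult freq_dot_simps)

lemma coef_shift:
  assumes "continuous_periodic f"
  shows "coef (\<lambda>x. f (x + axis j h)) k = cis (real_of_int (k $ j) * h) * coef f k"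
proof -
  let ?g = "\<lambda>x. f x * cis (- freq_dot k x)"
  have g: "continuous_periodic ?g" using assms by (intro continuous_periodic_mult) auto
  have "f (x + axis j h) * cis (- freq_dot k x) = cis (real_of_int (k $ j) * h) * ?g (x + axis j h)" for x
    by (simp add: freq_dot_simps freq_dot_axis mult.left_commute[of _ "f _"] cis_mult)
  then have "integral torus_cell (\<lambda>x. f (x + axis j h) * cis (- freq_dot k x))
      = cis (real_of_int (k $ j) * h) * integral torus_cell (\<lambda>x. ?g (x + axis j h))"
    by (simp only: integral_mult_right)
  also have "integral torus_cell (\<lambda>x. ?g (x + axis j h)) = integral torus_cell ?g"
    by (rule integral_torus_shift[OF g])
  finally have "integral torus_cell (\<lambda>x. f (x + axis j h) * cis (- freq_dot k x))
      = cis (real_of_int (k $ j) * h) * integral torus_cell ?g" .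
  then show ?thesis using assms by (simp add: coef_eq_integral continuous_periodic_shift)
qed

text \<open>A suitable translation multiplies the coefficient at \<open>k \<noteq> 0\<close> by \<open>-1\<close>, yet leaves constants invariant.
  Modulation turns this into the orthogonality of the characters.\<close>

lemma coef_const: "coef (\<lambda>x::real ^ 'd. c) k = (if k = 0 then c else 0)"
proof (cases "k = 0")
  case True
  have "integral (torus_cell :: (real ^ 'd) set) (\<lambda>x. c) = (2 * pi) ^ CARD('d) *\<^sub>R c"
    using torus_cell_props(3)[where 'd='d] by (simp add: torus_cell_def)
  then show ?thesis using True
    by (simp add: coef_eq_integral freq_dot_simps scaleR_conv_of_real)
next
  case False
  then obtain j where j: "k $ j \<noteq> 0" by (auto simp: vec_eq_iff)
  have "coef (\<lambda>x::real ^ 'd. c) k = cis (real_of_int (k $ j) * (pi / real_of_int (k $ j))) * coef (\<lambda>x. c) k"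
    using coef_shift[of "\<lambda>x. c" j "pi / real_of_int (k $ j)" k] by simp
  also have "\<dots> = - coef (\<lambda>x. c) k" using j by simp
  finally show ?thesis using False by simp
qed

lemma coef_character: "coef (\<lambda>x. cis (freq_dot l x)) k = (if k = l then 1 else 0)"
  using coef_modulate[of "\<lambda>x. 1" l k] by (simp add: coef_const)

lemma coef_character': "coef (\<lambda>x. a * cis (freq_dot l x)) k = (if k = l then a else 0)"
  by (simp add: coef_cmult coef_character)

lemma coef_uniform_limit:
  assumes ul: "uniform_limit UNIV f g \<F>" and nt: "\<F> \<noteq> bot"
    and f: "\<And>n. continuous_periodic (f n)" and g: "continuous_periodic g"
  shows "((\<lambda>n. coef (f n) k) \<longlongrightarrow> coef g k) \<F>"
proof (rule tendstoI)
  fix e :: real assume e: "e > 0"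
  have "\<forall>\<^sub>F n in \<F>. \<forall>x\<in>UNIV. dist (f n x) (g x) < e / 2"
    using ul e unfolding uniform_limit_iff by (meson half_gt_zero)
  then show "\<forall>\<^sub>F n in \<F>. dist (coef (f n) k) (coef g k) < e"
  proof (eventually_elim)
    case (elim n)
    have "cmod (coef (\<lambda>x. f n x - g x) k) \<le> e / 2"
      using elim f g by (intro coef_norm_le continuous_periodic_diff) (auto simp: dist_norm less_imp_le)
    then show ?case using e f g by (simp add: coef_diff dist_norm)
  qed
qed

section \<open>Uniqueness of Fourier coefficients, inversion and convolution\<close>

text \<open>Multiplication by such a function preserves the vanishing of all coefficients. Unlike the
  vanishing of a single coefficient of the product, this property is stable under products, so that
  it extends from the characters to all polynomials in them.\<close>

definition annihilates_null :: "(real ^ 'd \<Rightarrow> complex) \<Rightarrow> bool" where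
  "annihilates_null g \<longleftrightarrow> continuous_periodic g \<and>
     (\<forall>f. continuous_periodic f \<longrightarrow> (\<forall>k. coef f k = 0) \<longrightarrow> (\<forall>k. coef (\<lambda>x. f x * g x) k = 0))"

lemma annihilates_null_cis: "annihilates_null (\<lambda>x. cis (freq_dot l x))"
  by (simp add: annihilates_null_def coef_modulate)

lemma annihilates_null_const: "annihilates_null (\<lambda>x. c)"
  by (auto simp: annihilates_null_def mult.commute[of _ c] coef_cmult)

lemma annihilates_null_add:
  "annihilates_null f \<Longrightarrow> annihilates_null g \<Longrightarrow> annihilates_null (\<lambda>x. f x + g x)"
  by (simp add: annihilates_null_def continuous_periodic_add distrib_left coef_add continuous_periodic_mult)

lemma annihilates_null_mult:
  assumes "annihilates_null f" "annihilates_null g" shows "annihilates_null (\<lambda>x. f x * g x)"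
  unfolding annihilates_null_def
proof (intro conjI allI impI)
  show "continuous_periodic (\<lambda>x. f x * g x)"
    using assms by (auto simp: annihilates_null_def intro: continuous_periodic_mult)
  fix h :: "real ^ 'a \<Rightarrow> complex" and k assume h: "continuous_periodic h" "\<forall>k. coef h k = 0"
  have "continuous_periodic (\<lambda>x. h x * f x)" "\<forall>k. coef (\<lambda>x. h x * f x) k = 0"
    using h assms(1) by (auto simp: annihilates_null_def intro: continuous_periodic_mult)
  then have "coef (\<lambda>x. h x * f x * g x) k = 0"
    using assms(2) unfolding annihilates_null_def by blast
  then show "coef (\<lambda>x. h x * (f x * g x)) k = 0" by (simp only: mult.assoc)
qed

lemma annihilates_null_sum:
  "finite I \<Longrightarrow> (\<And>i. i \<in> I \<Longrightarrow> annihilates_null (f i)) \<Longrightarrow> annihilates_null (\<lambda>x. \<Sum>i\<in>I. f i x)"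
proof (induction I rule: finite_induct)
  case empty show ?case using annihilates_null_const[of 0] by simp
next
  case (insert i I) then show ?case by (simp add: annihilates_null_add)
qed

definition torus_embedding :: "real ^ 'd \<Rightarrow> complex ^ 'd" where
  "torus_embedding x = (\<chi> j. cis (x $ j))"

lemma annihilates_null_polynomial:
  assumes "real_polynomial_function p"
  shows "annihilates_null (\<lambda>x. complex_of_real (p (torus_embedding x)))"
  using assms
proof (induction p)
  case (linear p)
  then interpret bounded_linear p .
  have eq: "complex_of_real (p (torus_embedding x)) =
    (\<Sum>j\<in>UNIV. complex_of_real (p (axis j 1)) / 2 * (cis (freq_dot (axis j 1) x) + cis (freq_dot (- axis j 1) x))
      + complex_of_real (p (axis j \<i>)) / (2 * \<i>) * (cis (freq_dot (axis j 1) x) + (- 1) * cis (freq_dot (- axis j 1) x)))" for x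
  proof -
    have fd: "freq_dot (axis j 1) x = x $ j" for j
    proof -
      have "freq_dot (axis j 1) x = (\<Sum>i\<in>UNIV. if i = j then x $ j else 0)"
        unfolding freq_dot_def by (intro sum.cong) (auto simp: axis_def)
      then show ?thesis by simp
    qed
    have "torus_embedding x = (\<Sum>j\<in>UNIV. cos (x $ j) *\<^sub>R axis j 1 + sin (x $ j) *\<^sub>R axis j \<i>)"
    proof -
      have "(\<Sum>j\<in>UNIV. cos (x $ j) *\<^sub>R axis j (1::complex) + sin (x $ j) *\<^sub>R axis j \<i>) $ i
        = (\<Sum>j\<in>UNIV. if j = i then cis (x $ i) else 0)" for i
        unfolding sum_component by (intro sum.cong) (auto simp: axis_def complex_eq_iff)
      then show ?thesis by (simp add: vec_eq_iff torus_embedding_def)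
    qed
    then have "p (torus_embedding x) = (\<Sum>j\<in>UNIV. cos (x $ j) * p (axis j 1) + sin (x $ j) * p (axis j \<i>))"
      by (simp add: sum add scaleR)
    then have "complex_of_real (p (torus_embedding x)) = (\<Sum>j\<in>UNIV.
      complex_of_real (p (axis j 1)) * complex_of_real (cos (x $ j))
      + complex_of_real (p (axis j \<i>)) * complex_of_real (sin (x $ j)))"
      by (simp add: mult.commute)
    also have "\<dots> = (\<Sum>j\<in>UNIV. complex_of_real (p (axis j 1)) / 2 * (cis (freq_dot (axis j 1) x) + cis (freq_dot (- axis j 1) x))
      + complex_of_real (p (axis j \<i>)) / (2 * \<i>) * (cis (freq_dot (axis j 1) x) + (- 1) * cis (freq_dot (- axis j 1) x)))"
    proof (intro sum.cong refl)
      fix j :: 'a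
      have "complex_of_real (cos (x $ j)) = (cis (x $ j) + cis (- (x $ j))) / 2"
        "complex_of_real (sin (x $ j)) = (cis (x $ j) + (- 1) * cis (- (x $ j))) / (2 * \<i>)"
        by (simp_all add: complex_eq_iff Re_divide Im_divide)
      then show "complex_of_real (p (axis j 1)) * complex_of_real (cos (x $ j))
        + complex_of_real (p (axis j \<i>)) * complex_of_real (sin (x $ j))
        = complex_of_real (p (axis j 1)) / 2 * (cis (freq_dot (axis j 1) x) + cis (freq_dot (- axis j 1) x))
        + complex_of_real (p (axis j \<i>)) / (2 * \<i>) * (cis (freq_dot (axis j 1) x) + (- 1) * cis (freq_dot (- axis j 1) x))"
        by (simp only: fd freq_dot_simps) simp
    qed
    finally show ?thesis .
  qed
  show ?case unfolding eq
    by (intro annihilates_null_sum annihilates_null_add annihilates_null_mult annihilates_null_const annihilates_null_cis) auto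
next
  case (const c) show ?case by (rule annihilates_null_const)
next
  case (add p q) then show ?case using annihilates_null_add by fastforce
next
  case (mult p q) then show ?case using annihilates_null_mult by fastforce
qed

lemma torus_embedding_eqD:
  assumes "continuous_periodic h" "torus_embedding x = torus_embedding y"
  shows "h x = h y"
proof -
  have "cis (x $ j) = cis (y $ j)" for j using assms(2) by (simp add: torus_embedding_def vec_eq_iff)
  then have "\<exists>n::int. x $ j = y $ j + 2 * pi * n" for j
    using sin_cos_eq_iff[of "x $ j" "y $ j"] by (simp add: complex_eq_iff)
  then obtain m :: "'a \<Rightarrow> int" where "\<And>j. x $ j = y $ j + 2 * pi * m j" by metis
  then have "x = y + (\<chi> j. 2 * pi * real_of_int (m j))" by (simp add: vec_eq_iff)
  then show ?thesis using continuous_periodic_lattice[OF assms(1)] by metis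
qed

text \<open>A continuous periodic function is a continuous function of the point \<open>(e\<^sup>i\<^sup>x\<^sub>j)\<^sub>j\<close> of a compact
  set, hence by Stone--Weierstrass a uniform limit of trigonometric polynomials.\<close>

lemma trigonometric_approximation:
  fixes h :: "real ^ 'd \<Rightarrow> real"
  assumes h: "continuous_periodic h" and e: "0 < e"
  shows "\<exists>p. real_polynomial_function p \<and> (\<forall>x. \<bar>h x - p (torus_embedding x)\<bar> < e)"
proof -
  let ?C = "torus_cell :: (real ^ 'd) set"
  let ?S = "torus_embedding ` ?C"
  define H where "H z = h (SOME x. x \<in> ?C \<and> torus_embedding x = z)" for z
  have H: "H (torus_embedding x) = h x" for x
  proof -
    obtain y m where y: "y \<in> ?C" "x = y + (\<chi> j. 2 * pi * real_of_int (m j))"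
      by (rule torus_cell_representative)
    have "torus_embedding y = torus_embedding x"
      by (simp add: y(2) torus_embedding_def vec_eq_iff cis_of_int_period mult.commute[of "2 * pi"])
    then have "\<exists>z. z \<in> ?C \<and> torus_embedding z = torus_embedding x" using y by blast
    from someI_ex[OF this] show ?thesis unfolding H_def by (intro torus_embedding_eqD[OF h]) auto
  qed
  have contE: "continuous_on A (torus_embedding :: real ^ 'd \<Rightarrow> _)" for A
    unfolding torus_embedding_def by (intro continuous_intros)
  have S: "compact ?S" by (intro compact_continuous_image contE torus_cell_props)
  have "continuous_on ?S H"
    unfolding continuous_on_closed_vimage[OF compact_imp_closed[OF S]]
  proof (intro allI impI)
    fix B :: "real set" assume B: "closed B"
    have "H -` B \<inter> ?S = torus_embedding ` (?C \<inter> h -` B)" using H by auto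
    moreover have "closed (h -` B)"
      using B h by (intro closed_vimage continuous_periodicD)
    then have "compact (torus_embedding ` (?C \<inter> h -` B))"
      by (intro compact_continuous_image contE compact_Int_closed torus_cell_props)
    ultimately show "closed (H -` B \<inter> ?S)" by (simp add: compact_imp_closed)
  qed
  from Stone_Weierstrass_real_polynomial_function[OF S this e]
  obtain p where p: "real_polynomial_function p" "\<And>z. z \<in> ?S \<Longrightarrow> \<bar>H z - p z\<bar> < e" by blast
  have "\<bar>h x - p (torus_embedding x)\<bar> < e" for x
  proof -
    obtain y m where y: "y \<in> ?C" "x = y + (\<chi> j. 2 * pi * real_of_int (m j))"
      by (rule torus_cell_representative)
    have "torus_embedding y = torus_embedding x"
      by (simp add: y(2) torus_embedding_def vec_eq_iff cis_of_int_period mult.commute[of "2 * pi"])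
    moreover have "\<bar>H (torus_embedding y) - p (torus_embedding y)\<bar> < e" using y(1) by (intro p(2)) simp
    ultimately show ?thesis by (simp add: H)
  qed
  with p(1) show ?thesis by blast
qed

lemma coef_null_mult_real:
  fixes f :: "real ^ 'd \<Rightarrow> complex" and h :: "real ^ 'd \<Rightarrow> real"
  assumes f: "continuous_periodic f" "\<And>k. coef f k = 0" and h: "continuous_periodic h"
  shows "coef (\<lambda>x. f x * complex_of_real (h x)) k = 0"
proof -
  obtain B where B: "B \<ge> 0" "\<And>x. cmod (f x) \<le> B" using continuous_periodic_bounded[OF f(1)] by blast
  have h': "continuous_periodic (\<lambda>x. complex_of_real (h x))"
    using h by (rule continuous_periodic_compose) (intro continuous_intros)
  have "cmod (coef (\<lambda>x. f x * complex_of_real (h x)) k) \<le> e" if e: "e > 0" for e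
  proof -
    obtain p where p: "real_polynomial_function p"
      "\<And>x. \<bar>h x - p (torus_embedding x)\<bar> < e / (B + 1)"
      using trigonometric_approximation[OF h, of "e / (B + 1)"] e B(1) by auto
    let ?p = "\<lambda>x. complex_of_real (p (torus_embedding x))"
    have P: "continuous_periodic ?p" "coef (\<lambda>x. f x * ?p x) k = 0"
      using annihilates_null_polynomial[OF p(1)] f by (auto simp: annihilates_null_def)
    have "cmod (coef (\<lambda>x. f x * complex_of_real (h x) - f x * ?p x) k) \<le> e"
    proof (rule coef_norm_le)
      show "continuous_periodic (\<lambda>x. f x * complex_of_real (h x) - f x * ?p x)"
        by (intro continuous_periodic_diff continuous_periodic_mult f h' P)
      fix x
      have "cmod (f x * complex_of_real (h x) - f x * ?p x) = cmod (f x) * \<bar>h x - p (torus_embedding x)\<bar>"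
        by (metis norm_mult norm_of_real of_real_diff right_diff_distrib)
      also have "\<dots> \<le> B * (e / (B + 1))"
        using B p(2)[of x] by (intro mult_mono) (auto intro: less_imp_le)
      also have "\<dots> \<le> e" using B(1) e by (simp add: field_simps)
      finally show "cmod (f x * complex_of_real (h x) - f x * ?p x) \<le> e" .
    qed
    then show ?thesis using P(2) f(1) h' P(1)
      by (simp add: coef_diff continuous_periodic_mult)
  qed
  then have "cmod (coef (\<lambda>x. f x * complex_of_real (h x)) k) \<le> 0" by (rule field_le_epsilon) simp
  then show ?thesis by simp
qed

text \<open>A function without Fourier coefficients is orthogonal to all continuous functions, in particular
  to its own real and imaginary parts.\<close>

theorem fourier_uniqueness:
  fixes f :: "real ^ 'd \<Rightarrow> complex"
  assumes f: "continuous_periodic f" "\<And>k. coef f k = 0"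
  shows "f x = 0"
proof -
  have cRe: "continuous_periodic (\<lambda>x. Re (f x))" and cIm: "continuous_periodic (\<lambda>x. Im (f x))"
    by (rule continuous_periodic_compose[OF f(1)], intro continuous_intros)+
  have c: "continuous_periodic (\<lambda>x. f x * complex_of_real (Re (f x)))"
    "continuous_periodic (\<lambda>x. f x * complex_of_real (Im (f x)))"
    by (intro continuous_periodic_mult f continuous_periodic_compose[of "\<lambda>x. Re (f x)" complex_of_real]
        continuous_periodic_compose[of "\<lambda>x. Im (f x)" complex_of_real] cRe cIm continuous_intros)+
  have eq: "complex_of_real ((cmod (f x))\<^sup>2) = f x * complex_of_real (Re (f x)) - \<i> * (f x * complex_of_real (Im (f x)))" for x
    unfolding cmod_power2 by (simp add: complex_eq_iff power2_eq_square)
  have "coef (\<lambda>x. complex_of_real ((cmod (f x))\<^sup>2)) 0 = 0"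
    unfolding eq using c coef_null_mult_real[OF f cRe] coef_null_mult_real[OF f cIm]
    by (simp add: coef_diff coef_cmult continuous_periodic_mult)
  moreover have "continuous_periodic (\<lambda>x. complex_of_real ((cmod (f x))\<^sup>2))"
    using f(1) by (rule continuous_periodic_compose) (intro continuous_intros)
  ultimately have "integral torus_cell (\<lambda>x. complex_of_real ((cmod (f x))\<^sup>2)) = 0"
    by (simp add: coef_eq_integral freq_dot_simps)
  moreover have cn: "continuous_on UNIV (\<lambda>x. (cmod (f x))\<^sup>2)"
    using f(1) by (intro continuous_intros continuous_periodicD)
  have "integral torus_cell (\<lambda>x. complex_of_real ((cmod (f x))\<^sup>2)) =
      complex_of_real (integral torus_cell (\<lambda>x. (cmod (f x))\<^sup>2))"
    using integral_linear[OF continuous_integrable_torus(1)[OF cn] bounded_linear_of_real]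
    by (simp add: o_def)
  ultimately have "integral torus_cell (\<lambda>x. (cmod (f x))\<^sup>2) = 0" by simp
  moreover have "box (0 :: real ^ 'd) (\<chi> j. 2 * pi) \<noteq> {}"
    by (simp add: interval_ne_empty_cart)
  ultimately have *: "\<forall>x\<in>torus_cell. (cmod (f x))\<^sup>2 = 0"
    unfolding torus_cell_def using cn
    by (subst (asm) integral_cbox_eq_0_iff) (auto intro: continuous_on_subset)
  obtain y m where y: "y \<in> torus_cell" "x = y + (\<chi> j. 2 * pi * real_of_int (m j))"
    by (rule torus_cell_representative)
  then have "f x = f y" using continuous_periodic_lattice[OF f(1)] by metis
  then show ?thesis using * y by simp
qed

lemma trigonometric_series_uniform:
  fixes a :: "int ^ 'd \<Rightarrow> complex"
  assumes "l1_bound (\<lambda>_. 1) a A"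
  shows "uniform_limit UNIV (\<lambda>F x. \<Sum>k\<in>F. a k * cis (freq_dot k x))
    (\<lambda>x. \<Sum>\<^sub>\<infinity>k. a k * cis (freq_dot k x)) (finite_subsets_at_top UNIV)"
    "((\<lambda>k. a k * cis (freq_dot k x)) has_sum (\<Sum>\<^sub>\<infinity>k. a k * cis (freq_dot k x))) UNIV"
proof -
  have sm: "(\<lambda>k. norm (a k)) summable_on UNIV" using assms by (rule l1_bound_abs_summable)
  show "uniform_limit UNIV (\<lambda>F x. \<Sum>k\<in>F. a k * cis (freq_dot k x))
    (\<lambda>x. \<Sum>\<^sub>\<infinity>k. a k * cis (freq_dot k x)) (finite_subsets_at_top UNIV)"
    by (rule Weierstrass_m_test_general[OF _ sm]) (simp add: norm_mult)
  have "(\<lambda>k. norm (a k * cis (freq_dot k x))) summable_on UNIV" using sm by (simp add: norm_mult)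
  then show "((\<lambda>k. a k * cis (freq_dot k x)) has_sum (\<Sum>\<^sub>\<infinity>k. a k * cis (freq_dot k x))) UNIV"
    by (rule has_sum_infsum[OF abs_summable_summable])
qed

lemma continuous_periodic_trig_sum: "continuous_periodic (\<lambda>x. \<Sum>k\<in>F. a k * cis (freq_dot k x))"
  by (intro continuous_periodic_sum continuous_periodic_mult) auto

lemma coef_trig_sum:
  "finite F \<Longrightarrow> coef (\<lambda>x. \<Sum>l\<in>F. a l * cis (freq_dot l x)) k = (if k \<in> F then a k else 0)"
  by (subst coef_sum) (auto simp: coef_character' intro: continuous_periodic_mult)

text \<open>The series converges uniformly to a continuous function, which has the same coefficients as \<open>f\<close>.\<close>

theorem fourier_inversion:
  fixes f :: "real ^ 'd \<Rightarrow> complex"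
  assumes f: "continuous_periodic f" and b: "l1_bound (\<lambda>_. 1) (coef f) A"
  shows "((\<lambda>k. coef f k * cis (freq_dot k x)) has_sum f x) UNIV"
    "uniform_limit UNIV (\<lambda>F x. \<Sum>k\<in>F. coef f k * cis (freq_dot k x)) f (finite_subsets_at_top UNIV)"
proof -
  define g where "g x = (\<Sum>\<^sub>\<infinity>k. coef f k * cis (freq_dot k x))" for x
  note ul = trigonometric_series_uniform(1)[OF b, folded g_def]
  note hs = trigonometric_series_uniform(2)[OF b, folded g_def]
  have gp: "torus_periodic g"
    unfolding torus_periodic_def g_def
    by (simp only: freq_dot_simps freq_dot_axis cis_of_int_period) simp
  have "continuous_on UNIV g"
    using continuous_periodicD(1)[OF continuous_periodic_trig_sum]
    by (intro uniform_limit_theorem[OF _ ul]) (auto intro!: always_eventually)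
  then have g: "continuous_periodic g" using gp by (simp add: continuous_periodic_def)
  have "coef g k = coef f k" for k
  proof (rule tendsto_unique)
    show "((\<lambda>F. coef (\<lambda>x. \<Sum>k\<in>F. coef f k * cis (freq_dot k x)) k) \<longlongrightarrow> coef g k) (finite_subsets_at_top UNIV)"
      by (intro coef_uniform_limit ul g continuous_periodic_trig_sum) simp
    show "((\<lambda>F. coef (\<lambda>x. \<Sum>k\<in>F. coef f k * cis (freq_dot k x)) k) \<longlongrightarrow> coef f k) (finite_subsets_at_top UNIV)"
    proof (rule tendsto_eventually)
      have "\<forall>\<^sub>F F in finite_subsets_at_top UNIV. finite F \<and> {k} \<subseteq> F \<and> F \<subseteq> UNIV"
        unfolding eventually_finite_subsets_at_top by (rule exI[of _ "{k}"]) auto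
      then show "\<forall>\<^sub>F F in finite_subsets_at_top UNIV. coef (\<lambda>x. \<Sum>k\<in>F. coef f k * cis (freq_dot k x)) k = coef f k"
        by eventually_elim (simp add: coef_trig_sum)
    qed
  qed simp
  then have "coef (\<lambda>x. g x - f x) k = 0" for k using f g by (simp add: coef_diff)
  then have "g x - f x = 0" for x
    using f g by (intro fourier_uniqueness[of "\<lambda>x. g x - f x"] continuous_periodic_diff)
  then have "g = f" by auto
  with ul hs show "((\<lambda>k. coef f k * cis (freq_dot k x)) has_sum f x) UNIV"
    "uniform_limit UNIV (\<lambda>F x. \<Sum>k\<in>F. coef f k * cis (freq_dot k x)) f (finite_subsets_at_top UNIV)"
    by auto
qed

text \<open>Multiplication by a character shifts the coefficients, and \<open>g\<close> is the uniform limit of the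
  partial sums of its Fourier series.\<close>

theorem coef_mult_has_sum:
  fixes f g :: "real ^ 'd \<Rightarrow> complex"
  assumes f: "continuous_periodic f" and g: "continuous_periodic g" "l1_bound (\<lambda>_. 1) (coef g) A"
  shows "((\<lambda>l. coef f (k - l) * coef g l) has_sum coef (\<lambda>x. f x * g x) k) UNIV"
proof -
  obtain B where B: "B \<ge> 0" "\<And>x. cmod (f x) \<le> B" using continuous_periodic_bounded[OF f] by blast
  let ?S = "\<lambda>F x. \<Sum>k\<in>F. coef g k * cis (freq_dot k x)"
  have ul: "uniform_limit UNIV (\<lambda>F x. f x * ?S F x) (\<lambda>x. f x * g x) (finite_subsets_at_top UNIV)"
  proof (rule uniform_limitI)
    fix e :: real assume e: "e > 0"
    have "\<forall>\<^sub>F F in finite_subsets_at_top UNIV. \<forall>x\<in>UNIV. dist (?S F x) (g x) < e / (B + 1)"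
      using fourier_inversion(2)[OF g] e B(1) unfolding uniform_limit_iff
      by (meson add_nonneg_pos divide_pos_pos zero_less_one)
    then show "\<forall>\<^sub>F F in finite_subsets_at_top UNIV. \<forall>x\<in>UNIV. dist (f x * ?S F x) (f x * g x) < e"
    proof eventually_elim
      case (elim F)
      show ?case
      proof
        fix x
        have "dist (f x * ?S F x) (f x * g x) = cmod (f x) * dist (?S F x) (g x)"
          by (simp add: dist_norm norm_mult flip: right_diff_distrib)
        also have "\<dots> \<le> B * (e / (B + 1))"
          using B elim by (intro mult_mono) (auto intro: less_imp_le)
        also have "\<dots> < e" using B(1) e by (simp add: field_simps)
        finally show "dist (f x * ?S F x) (f x * g x) < e" .
      qed
    qed
  qed
  have "coef (\<lambda>x. f x * ?S F x) k = (\<Sum>l\<in>F. coef f (k - l) * coef g l)" if "finite F" for F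
  proof -
    have "coef (\<lambda>x. f x * ?S F x) k = coef (\<lambda>x. \<Sum>l\<in>F. coef g l * (f x * cis (freq_dot l x))) k"
      by (simp add: sum_distrib_left mult_ac)
    also have "\<dots> = (\<Sum>l\<in>F. coef g l * coef f (k - l))"
      using that f by (subst coef_sum) (auto simp: coef_cmult coef_modulate continuous_periodic_mult)
    finally show ?thesis by (simp add: mult.commute)
  qed
  then have "\<forall>\<^sub>F F in finite_subsets_at_top UNIV.
      coef (\<lambda>x. f x * ?S F x) k = (\<Sum>l\<in>F. coef f (k - l) * coef g l)"
    by (intro eventually_finite_subsets_at_top_weakI)
  moreover have "((\<lambda>F. coef (\<lambda>x. f x * ?S F x) k) \<longlongrightarrow> coef (\<lambda>x. f x * g x) k) (finite_subsets_at_top UNIV)"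
    by (intro coef_uniform_limit ul continuous_periodic_mult f g continuous_periodic_trig_sum) simp
  ultimately show ?thesis unfolding has_sum_def by (rule Lim_transform_eventually[rotated])
qed

text \<open>The symbol of \<open>\<partial>\<^sub>j\<close>, obtained by differentiating the effect of translations on coefficients.\<close>

lemma coef_partial:
  fixes f f' :: "real ^ 'd \<Rightarrow> complex"
  assumes f: "continuous_periodic f" and f': "continuous_periodic f'"
    and d: "\<And>x. ((\<lambda>h. f (x + axis j h)) has_vector_derivative f' x) (at 0)"
  shows "coef f' k = \<i> * of_int (k $ j) * coef f k"
proof -
  define c where "c = complex_of_real ((2 * pi) ^ CARD('d))"
  have c: "c \<noteq> 0" unfolding c_def by simp
  have e: "x + axis j (t + h) = (x + axis j t) + axis j h" for x :: "real ^ 'd" and t h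
    by (simp add: vec_eq_iff axis_def)
  have dt: "((\<lambda>h. f (x + axis j h)) has_vector_derivative f' (x + axis j t)) (at t)" for x t
  proof -
    have "((\<lambda>h. h - t) has_vector_derivative 1) (at t)"
      by (auto intro!: derivative_eq_intros)
    from vector_diff_chain_at[OF this, of "\<lambda>h. f ((x + axis j t) + axis j h)" "f' (x + axis j t)"] d
    have "((\<lambda>h. f ((x + axis j t) + axis j (h - t))) has_vector_derivative f' (x + axis j t)) (at t)"
      by (simp add: o_def)
    then show ?thesis by (simp flip: e)
  qed
  have cont: "continuous_on A (\<lambda>(h, x). f' (x + axis j h) * cis (- freq_dot k x))" for A
  proof -
    have 1: "continuous_on A (\<lambda>p. f' (snd p + fst p *\<^sub>R axis j 1))"
      by (rule continuous_on_compose2[OF continuous_periodicD(1)[OF f', of UNIV]])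
        (auto intro!: continuous_intros)
    have 2: "continuous_on A (\<lambda>p. freq_dot k (snd p))"
      by (rule continuous_on_compose2[OF continuous_on_freq_dot[of UNIV]]) (auto intro!: continuous_intros)
    from 1 2 have "continuous_on A (\<lambda>p. f' (snd p + fst p *\<^sub>R axis j 1) * cis (- freq_dot k (snd p)))"
      by (intro continuous_on_mult continuous_on_cis continuous_on_minus)
    moreover have "axis j h = h *\<^sub>R (axis j 1 :: real ^ 'd)" for h by (simp add: vec_eq_iff axis_def)
    then have "(\<lambda>(h, x). f' (x + axis j h) * cis (- freq_dot k x))
        = (\<lambda>p. f' (snd p + fst p *\<^sub>R axis j 1) * cis (- freq_dot k (snd p)))"
      unfolding fun_eq_iff by (metis (no_types, lifting) case_prod_beta)
    ultimately show ?thesis by (simp only:)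
  qed
  have "((\<lambda>h. integral torus_cell (\<lambda>x. f (x + axis j h) * cis (- freq_dot k x))) has_vector_derivative
      integral torus_cell (\<lambda>x. f' (x + axis j 0) * cis (- freq_dot k x))) (at 0 within UNIV)"
    unfolding torus_cell_def
  proof (rule leibniz_rule_vector_derivative)
    fix h :: real and x :: "real ^ 'd"
    show "((\<lambda>h. f (x + axis j h) * cis (- freq_dot k x)) has_vector_derivative f' (x + axis j h) * cis (- freq_dot k x))
        (at h within UNIV)"
      using dt by (intro has_vector_derivative_mult_left) auto
    show "(\<lambda>x. f (x + axis j h) * cis (- freq_dot k x)) integrable_on cbox 0 (\<chi> j. 2 * pi)"
      using coef_integrable[OF continuous_periodic_shift[OF f]] by (simp add: torus_cell_def)
  qed (use cont in auto)
  moreover have "axis j 0 = (0 :: real ^ 'd)" by (simp add: vec_eq_iff axis_def)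
  ultimately have "((\<lambda>h. integral torus_cell (\<lambda>x. f (x + axis j h) * cis (- freq_dot k x)) / c)
      has_vector_derivative coef f' k) (at 0)"
    using f' by (auto simp: coef_eq_integral c_def intro: has_vector_derivative_divide)
  moreover have "integral torus_cell (\<lambda>x. f (x + axis j h) * cis (- freq_dot k x)) / c
      = cis (real_of_int (k $ j) * h) * coef f k" for h
    using coef_shift[OF f, of j h k] coef_eq_integral[OF continuous_periodic_shift[OF f], of "axis j h" k]
    by (simp add: c_def)
  moreover have "((\<lambda>h. cis (real_of_int (k $ j) * h) * coef f k) has_vector_derivative
      (real_of_int (k $ j) *\<^sub>R (\<i> * cis (real_of_int (k $ j) * 0))) * coef f k) (at 0)"
    by (auto intro!: derivative_eq_intros simp: has_vector_derivative_def)
  ultimately show ?thesis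
    by (simp add: scaleR_conv_of_real mult_ac vector_derivative_unique_at)
qed

lemma coef_real_cnj:
  fixes f :: "real ^ 'd \<Rightarrow> real"
  shows "coef (\<lambda>x. complex_of_real (f x)) (- k) = cnj (coef (\<lambda>x. complex_of_real (f x)) k)"
  unfolding coef_def set_lebesgue_integral_def complex_cnj_divide
  by (subst Bochner_Integration.integral_cnj[symmetric]) (simp add: freq_dot_simps cis_cnj scaleR_conv_of_real)

section \<open>Polynomials of functions with decaying coefficients\<close>

abbreviation rcoef :: "(real ^ 'd \<Rightarrow> real) \<Rightarrow> int ^ 'd \<Rightarrow> complex" where
  "rcoef f \<equiv> coef (\<lambda>x. complex_of_real (f x))"

text \<open>The size of \<open>f\<close> in the Wiener algebra of functions whose first derivatives have summable
  coefficients, and its size in the intersection of that algebra with \<open>H\<^sup>s\<close>. The intersection is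
  an algebra for all \<open>s \<ge> 0\<close>, because the weight \<open>\<langle>k\<rangle>\<^sup>s\<close> may be moved on to one factor while the
  other one is measured by the sum of its coefficients.\<close>

definition wiener_bound :: "(real ^ 'd \<Rightarrow> real) \<Rightarrow> real \<Rightarrow> bool" where
  "wiener_bound f C \<longleftrightarrow> continuous_periodic f \<and> l1_bound japanese_bracket (rcoef f) C"

definition sobolev_bound :: "real \<Rightarrow> (real ^ 'd \<Rightarrow> real) \<Rightarrow> real \<Rightarrow> bool" where
  "sobolev_bound s f C \<longleftrightarrow> wiener_bound f C \<and> l2_bound (\<lambda>k. japanese_bracket k powr s) (rcoef f) C"

lemma continuous_periodic_of_real:
  "continuous_periodic f \<Longrightarrow> continuous_periodic (\<lambda>x. complex_of_real (f x))"
  by (rule continuous_periodic_compose) (auto intro!: continuous_intros)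

lemma l1_bound_jb_imp: "l1_bound japanese_bracket a C \<Longrightarrow> l1_bound (\<lambda>_. 1) a C"
  by (rule l1_bound_mono) (auto simp: jb_ge_1)

lemma wiener_bound_continuous: "wiener_bound f C \<Longrightarrow> continuous_periodic f"
  by (simp add: wiener_bound_def)

lemma rcoef_add:
  "continuous_periodic f \<Longrightarrow> continuous_periodic g \<Longrightarrow> rcoef (\<lambda>x. f x + g x) k = rcoef f k + rcoef g k"
  using coef_add[OF continuous_periodic_of_real continuous_periodic_of_real, of f g k] by simp

lemma rcoef_add_fun:
  "continuous_periodic f \<Longrightarrow> continuous_periodic g \<Longrightarrow>
    rcoef (\<lambda>x. f x + g x) = (\<lambda>k. rcoef f k + rcoef g k)"
  by (rule ext) (rule rcoef_add)

lemma rcoef_diff: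
  "continuous_periodic f \<Longrightarrow> continuous_periodic g \<Longrightarrow> rcoef (\<lambda>x. f x - g x) k = rcoef f k - rcoef g k"
  using coef_diff[OF continuous_periodic_of_real continuous_periodic_of_real, of f g k] by simp

lemma rcoef_sum:
  assumes "finite I" "\<And>i. i \<in> I \<Longrightarrow> continuous_periodic (f i)"
  shows "rcoef (\<lambda>x. \<Sum>i\<in>I. f i x) k = (\<Sum>i\<in>I. rcoef (f i) k)"
  using coef_sum[OF assms(1), of "\<lambda>i x. complex_of_real (f i x)" k] assms(2)
  by (simp add: continuous_periodic_of_real)

lemma rcoef_const: "rcoef (\<lambda>x. c) k = (if k = 0 then complex_of_real c else 0)"
  by (simp add: coef_const)

lemma rcoef_mult_has_sum:
  assumes "continuous_periodic f" "continuous_periodic g" "l1_bound (\<lambda>_. 1) (rcoef g) B"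
  shows "((\<lambda>l. rcoef f (k - l) * rcoef g l) has_sum rcoef (\<lambda>x. f x * g x) k) UNIV"
  using coef_mult_has_sum[OF continuous_periodic_of_real continuous_periodic_of_real, of f g B k] assms
  by simp

lemma wiener_bound_const: "wiener_bound (\<lambda>x. c) \<bar>c\<bar>"
proof -
  have "(\<Sum>k\<in>F. japanese_bracket k * cmod (rcoef (\<lambda>x::real ^ 'a. c) k)) \<le> \<bar>c\<bar>" if "finite F" for F
  proof -
    have "(\<Sum>k\<in>F. japanese_bracket k * cmod (rcoef (\<lambda>x::real ^ 'a. c) k)) = (\<Sum>k\<in>F. if k = 0 then \<bar>c\<bar> else 0)"
      by (intro sum.cong) (auto simp: rcoef_const)
    then show ?thesis using that by simp
  qed
  then show ?thesis by (simp add: wiener_bound_def l1_bound_def)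
qed

lemma l2_bound_const: "l2_bound (\<lambda>k. japanese_bracket k powr s) (rcoef (\<lambda>x. c)) \<bar>c\<bar>"
proof -
  have "(\<Sum>k\<in>F. (japanese_bracket k powr s * cmod (rcoef (\<lambda>x::real ^ 'a. c) k))\<^sup>2) \<le> c\<^sup>2" if "finite F" for F
  proof -
    have "(\<Sum>k\<in>F. (japanese_bracket k powr s * cmod (rcoef (\<lambda>x::real ^ 'a. c) k))\<^sup>2) = (\<Sum>k\<in>F. if k = 0 then c\<^sup>2 else 0)"
      by (intro sum.cong) (auto simp: rcoef_const)
    then show ?thesis using that by simp
  qed
  then show ?thesis by (simp add: l2_bound_def)
qed

lemma wiener_bound_add:
  "wiener_bound f A \<Longrightarrow> wiener_bound g B \<Longrightarrow> wiener_bound (\<lambda>x. f x + g x) (A + B)"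
  unfolding wiener_bound_def
  by (auto simp: continuous_periodic_add rcoef_add_fun simp del: of_real_add intro!: l1_bound_add)

lemma wiener_bound_mult:
  assumes f: "wiener_bound f A" and g: "wiener_bound g B"
  shows "wiener_bound (\<lambda>x. f x * g x) (2 * A * B)"
  unfolding wiener_bound_def l1_bound_def
proof (intro conjI allI impI)
  note cp = wiener_bound_continuous[OF f] wiener_bound_continuous[OF g]
  have l1: "l1_bound japanese_bracket (rcoef f) A" "l1_bound japanese_bracket (rcoef g) B"
    using f g by (auto simp: wiener_bound_def)
  show "continuous_periodic (\<lambda>x. f x * g x)" using cp by (rule continuous_periodic_mult)
  fix F :: "(int ^ 'a) set" assume F: "finite F"
  show "(\<Sum>k\<in>F. japanese_bracket k * cmod (rcoef (\<lambda>x. f x * g x) k)) \<le> 2 * A * B"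
  proof (rule row_sums_bound[OF F rcoef_mult_has_sum[OF cp l1_bound_jb_imp[OF l1(2)]]])
    fix F' :: "(int ^ 'a) set" assume F': "finite F'"
    have "(\<Sum>k\<in>F. \<Sum>l\<in>F'. japanese_bracket k * cmod (rcoef f (k - l) * rcoef g l))
      \<le> (\<Sum>k\<in>F. \<Sum>l\<in>F'. 2 * ((japanese_bracket (k - l) * cmod (rcoef f (k - l))) * (japanese_bracket l * cmod (rcoef g l))))"
    proof (intro sum_mono)
      fix k l :: "int ^ 'a"
      have "japanese_bracket k * (cmod (rcoef f (k - l)) * cmod (rcoef g l))
        \<le> (2 * (japanese_bracket (k - l) * japanese_bracket l)) * (cmod (rcoef f (k - l)) * cmod (rcoef g l))"
        by (intro mult_right_mono jb_le_mult) auto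
      then show "japanese_bracket k * cmod (rcoef f (k - l) * rcoef g l)
        \<le> 2 * ((japanese_bracket (k - l) * cmod (rcoef f (k - l))) * (japanese_bracket l * cmod (rcoef g l)))"
        by (simp add: norm_mult mult_ac)
    qed
    also have "\<dots> = 2 * (\<Sum>k\<in>F. \<Sum>l\<in>F'. (japanese_bracket (k - l) * cmod (rcoef f (k - l))) * (japanese_bracket l * cmod (rcoef g l)))"
      by (simp add: sum_distrib_left)
    also have "\<dots> \<le> 2 * (A * B)"
      using F F' l1 by (intro mult_left_mono young_l1_l1[where f="\<lambda>m. japanese_bracket m * cmod (rcoef f m)"])
        (auto simp: l1_boundD)
    finally show "(\<Sum>k\<in>F. \<Sum>l\<in>F'. japanese_bracket k * cmod (rcoef f (k - l) * rcoef g l)) \<le> 2 * A * B" by simp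
  qed auto
qed

lemma sobolev_bound_mult:
  assumes s: "0 \<le> s" and f: "sobolev_bound s f A" and g: "sobolev_bound s g B"
  shows "sobolev_bound s (\<lambda>x. f x * g x) (2 * 2 powr s * A * B)"
proof -
  have w: "wiener_bound f A" "wiener_bound g B" using f g by (auto simp: sobolev_bound_def)
  note cp = wiener_bound_continuous[OF w(1)] wiener_bound_continuous[OF w(2)]
  have l1: "l1_bound (\<lambda>_. 1) (rcoef f) A" "l1_bound (\<lambda>_. 1) (rcoef g) B"
    using w by (auto simp: wiener_bound_def intro: l1_bound_jb_imp)
  have l2: "l2_bound (\<lambda>k. japanese_bracket k powr s) (rcoef f) A" "l2_bound (\<lambda>k. japanese_bracket k powr s) (rcoef g) B"
    using f g by (auto simp: sobolev_bound_def)
  have AB: "0 \<le> A" "0 \<le> B" using l2 l2_bound_nonneg by blast+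
  let ?w = "\<lambda>k::int ^ 'a. japanese_bracket k powr s"
  have "l2_bound ?w (rcoef (\<lambda>x. f x * g x)) (2 * 2 powr s * A * B)"
  proof (rule l2_bound_dual)
    fix F :: "(int ^ 'a) set" and c :: "int ^ 'a \<Rightarrow> real"
    assume F: "finite F" and c: "\<And>k. 0 \<le> c k"
    let ?c = "sqrt (\<Sum>k\<in>F. (c k)\<^sup>2)"
    have c0: "0 \<le> ?c" "(\<Sum>k\<in>F. (c k)\<^sup>2) \<le> ?c\<^sup>2" by (auto simp: sum_nonneg)
    have "(\<Sum>k\<in>F. (c k * ?w k) * cmod (rcoef (\<lambda>x. f x * g x) k)) \<le> ?c * (2 * 2 powr s * A * B)"
    proof (rule row_sums_bound[OF F rcoef_mult_has_sum[OF cp l1(2)]])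
      fix F' :: "(int ^ 'a) set" assume F': "finite F'"
      have "(\<Sum>k\<in>F. \<Sum>l\<in>F'. (c k * ?w k) * cmod (rcoef f (k - l) * rcoef g l))
        \<le> (\<Sum>k\<in>F. \<Sum>l\<in>F'. 2 powr s * (c k * ((?w (k - l) * cmod (rcoef f (k - l))) * cmod (rcoef g l))
             + c k * (cmod (rcoef f (k - l)) * (?w l * cmod (rcoef g l)))))"
      proof (intro sum_mono)
        fix k l :: "int ^ 'a"
        have "?w k * (c k * (cmod (rcoef f (k - l)) * cmod (rcoef g l)))
          \<le> (2 powr s * (?w (k - l) + ?w l)) * (c k * (cmod (rcoef f (k - l)) * cmod (rcoef g l)))"
          using c s by (intro mult_right_mono jb_powr_le_add) auto
        then show "(c k * ?w k) * cmod (rcoef f (k - l) * rcoef g l)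
          \<le> 2 powr s * (c k * ((?w (k - l) * cmod (rcoef f (k - l))) * cmod (rcoef g l))
             + c k * (cmod (rcoef f (k - l)) * (?w l * cmod (rcoef g l))))"
          by (simp add: norm_mult algebra_simps)
      qed
      also have "\<dots> = 2 powr s * ((\<Sum>k\<in>F. \<Sum>l\<in>F'. c k * ((?w (k - l) * cmod (rcoef f (k - l))) * cmod (rcoef g l)))
          + (\<Sum>k\<in>F. \<Sum>l\<in>F'. c k * (cmod (rcoef f (k - l)) * (?w l * cmod (rcoef g l)))))"
        by (simp only: sum_distrib_left sum.distrib distrib_left)
      also have "\<dots> \<le> 2 powr s * (?c * A * B + ?c * A * B)"
      proof (intro mult_left_mono add_mono)
        show "(\<Sum>k\<in>F. \<Sum>l\<in>F'. c k * ((?w (k - l) * cmod (rcoef f (k - l))) * cmod (rcoef g l))) \<le> ?c * A * B"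
          using F F' c c0 l2_boundD[OF l2(1)] l1_boundD[OF l1(2)] AB
          by (intro young_l2_l1[where f="\<lambda>m. ?w m * cmod (rcoef f m)"]) auto
        show "(\<Sum>k\<in>F. \<Sum>l\<in>F'. c k * (cmod (rcoef f (k - l)) * (?w l * cmod (rcoef g l)))) \<le> ?c * A * B"
          using F F' c c0 l2_boundD[OF l2(2)] l1_boundD[OF l1(1)] AB
          by (intro young_l1_l2[where f="\<lambda>m. cmod (rcoef f m)"]) auto
      qed auto
      finally show "(\<Sum>k\<in>F. \<Sum>l\<in>F'. (c k * ?w k) * cmod (rcoef f (k - l) * rcoef g l)) \<le> ?c * (2 * 2 powr s * A * B)"
        by (simp add: algebra_simps)
    qed (use c in auto)
    then show "(\<Sum>k\<in>F. c k * (?w k * cmod (rcoef (\<lambda>x. f x * g x) k))) \<le> ?c * (2 * 2 powr s * A * B)"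
      by (simp only: mult.assoc)
  qed (use AB in auto)
  moreover have "wiener_bound (\<lambda>x. f x * g x) (2 * 2 powr s * A * B)"
  proof -
    have "(1::real) \<le> 2 powr s" using s by (simp add: ge_one_powr_ge_zero)
    then have "1 * (2 * A * B) \<le> 2 powr s * (2 * A * B)" using AB by (intro mult_right_mono) auto
    then have le: "2 * A * B \<le> 2 * 2 powr s * A * B" by (simp add: mult_ac)
    show ?thesis using wiener_bound_mult[OF w] le
      by (auto simp: wiener_bound_def intro: l1_bound_mono)
  qed
  ultimately show ?thesis by (simp add: sobolev_bound_def)
qed

text \<open>In a normed algebra of functions \<open>Q\<close>, a polynomial of \<open>u\<close> differs from its value at \<open>0\<close> by
  something of size linear in that of \<open>u\<close>. The linearity makes the rates below proportional to
  the size of the data, hence uniform on time spans inversely proportional to it.\<close>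

lemma polynomial_algebra_bound:
  fixes Q :: "(real ^ 'd \<Rightarrow> real) \<Rightarrow> real \<Rightarrow> bool" and p :: "real ^ 'n \<Rightarrow> real"
  assumes p: "real_polynomial_function p"
    and const: "\<And>c. Q (\<lambda>_. c) \<bar>c\<bar>"
    and add: "\<And>f g A B. Q f A \<Longrightarrow> Q g B \<Longrightarrow> Q (\<lambda>x. f x + g x) (A + B)"
    and mult: "\<And>f g A B. Q f A \<Longrightarrow> Q g B \<Longrightarrow> Q (\<lambda>x. f x * g x) (\<kappa> * A * B)"
    and mono: "\<And>f A B. Q f A \<Longrightarrow> A \<le> B \<Longrightarrow> Q f B"
    and \<kappa>: "0 \<le> \<kappa>" and M: "0 \<le> M"
  shows "\<exists>C\<ge>0. \<forall>\<mu> u. 0 \<le> \<mu> \<longrightarrow> \<mu> \<le> M \<longrightarrow> (\<forall>i. Q (\<lambda>x. u x $ i) \<mu>) \<longrightarrow> Q (\<lambda>x. p (u x) - p 0) (C * \<mu>)"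
  using p
proof (induction p)
  case (linear p)
  then interpret bounded_linear p .
  define C where "C = (\<Sum>i\<in>UNIV. \<kappa> * \<bar>p (axis i 1)\<bar>)"
  have Qsum: "Q (\<lambda>x. \<Sum>i\<in>I. f i x) (\<Sum>i\<in>I. B i)" if "finite I" "\<And>i. Q (f i) (B i)" for I :: "'n set" and f B
    using that by (induction I rule: finite_induct) (auto intro: assms(3) assms(2)[of 0, simplified])
  have "Q (\<lambda>x. p (u x) - p 0) (C * \<mu>)" if "\<forall>i. Q (\<lambda>x. u x $ i) \<mu>" for \<mu> u
  proof -
    have "p (u x) - p 0 = (\<Sum>i\<in>UNIV. p (axis i 1) * u x $ i)" for x
    proof -
      have "u x = (\<Sum>i\<in>UNIV. u x $ i *\<^sub>R axis i 1)"
        using basis_expansion[of "u x"] by (simp add: scalar_mult_eq_scaleR)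
      then have "p (u x) = p (\<Sum>i\<in>UNIV. u x $ i *\<^sub>R axis i 1)" by simp
      also have "\<dots> = (\<Sum>i\<in>UNIV. u x $ i * p (axis i 1))" unfolding sum by (simp add: scaleR)
      finally have "p (u x) = (\<Sum>i\<in>UNIV. u x $ i * p (axis i 1))" .
      then show ?thesis by (simp add: zero mult.commute)
    qed
    then have eq: "(\<lambda>x. p (u x) - p 0) = (\<lambda>x. \<Sum>i\<in>UNIV. p (axis i 1) * u x $ i)" by auto
    have "C * \<mu> = (\<Sum>i\<in>UNIV. \<kappa> * \<bar>p (axis i 1)\<bar> * \<mu>)" by (simp add: C_def sum_distrib_right)
    then show ?thesis unfolding eq using that by (auto intro!: Qsum assms(4) assms(2))
  qed
  moreover have "0 \<le> C" unfolding C_def using \<kappa> by (intro sum_nonneg) auto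
  ultimately show ?case by blast
next
  case (const c)
  show ?case using assms(2)[of 0] by (intro exI[of _ 0]) auto
next
  case (add p q)
  then obtain C1 C2 where C1: "0 \<le> C1" "\<And>\<mu> u. 0 \<le> \<mu> \<Longrightarrow> \<mu> \<le> M \<Longrightarrow> (\<forall>i. Q (\<lambda>x. u x $ i) \<mu>) \<Longrightarrow> Q (\<lambda>x. p (u x) - p 0) (C1 * \<mu>)"
    and C2: "0 \<le> C2" "\<And>\<mu> u. 0 \<le> \<mu> \<Longrightarrow> \<mu> \<le> M \<Longrightarrow> (\<forall>i. Q (\<lambda>x. u x $ i) \<mu>) \<Longrightarrow> Q (\<lambda>x. q (u x) - q 0) (C2 * \<mu>)"
    by auto
  have "Q (\<lambda>x. p (u x) + q (u x) - (p 0 + q 0)) ((C1 + C2) * \<mu>)"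
    if "0 \<le> \<mu>" "\<mu> \<le> M" "\<forall>i. Q (\<lambda>x. u x $ i) \<mu>" for \<mu> u
    using assms(3)[OF C1(2)[OF that] C2(2)[OF that]] by (simp add: algebra_simps)
  then show ?case using C1(1) C2(1) by (intro exI[of _ "C1 + C2"]) auto
next
  case (mult p q)
  then obtain C1 C2 where C1: "0 \<le> C1" "\<And>\<mu> u. 0 \<le> \<mu> \<Longrightarrow> \<mu> \<le> M \<Longrightarrow> (\<forall>i. Q (\<lambda>x. u x $ i) \<mu>) \<Longrightarrow> Q (\<lambda>x. p (u x) - p 0) (C1 * \<mu>)"
    and C2: "0 \<le> C2" "\<And>\<mu> u. 0 \<le> \<mu> \<Longrightarrow> \<mu> \<le> M \<Longrightarrow> (\<forall>i. Q (\<lambda>x. u x $ i) \<mu>) \<Longrightarrow> Q (\<lambda>x. q (u x) - q 0) (C2 * \<mu>)"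
    by auto
  define C where "C = \<kappa> * C1 * (C2 * M) + \<kappa> * \<bar>p 0\<bar> * C2 + \<kappa> * \<bar>q 0\<bar> * C1"
  have "Q (\<lambda>x. p (u x) * q (u x) - p 0 * q 0) (C * \<mu>)"
    if u: "0 \<le> \<mu>" "\<mu> \<le> M" "\<forall>i. Q (\<lambda>x. u x $ i) \<mu>" for \<mu> u
  proof -
    have "Q (\<lambda>x. (p (u x) - p 0) * (q (u x) - q 0) + p 0 * (q (u x) - q 0) + q 0 * (p (u x) - p 0))
      (\<kappa> * (C1 * \<mu>) * (C2 * \<mu>) + \<kappa> * \<bar>p 0\<bar> * (C2 * \<mu>) + \<kappa> * \<bar>q 0\<bar> * (C1 * \<mu>))"
      by (intro assms(3) assms(4) assms(2) C1(2) C2(2) u)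
    moreover have "\<kappa> * (C1 * \<mu>) * (C2 * \<mu>) \<le> \<kappa> * (C1 * \<mu>) * (C2 * M)"
      using u \<kappa> C1(1) C2(1) by (intro mult_left_mono) auto
    ultimately have "Q (\<lambda>x. (p (u x) - p 0) * (q (u x) - q 0) + p 0 * (q (u x) - q 0) + q 0 * (p (u x) - p 0)) (C * \<mu>)"
      by (elim mono) (simp add: C_def algebra_simps)
    moreover have "(p (u x) - p 0) * (q (u x) - q 0) + p 0 * (q (u x) - q 0) + q 0 * (p (u x) - p 0)
      = p (u x) * q (u x) - p 0 * q 0" for x by (simp add: algebra_simps)
    ultimately show ?thesis by simp
  qed
  moreover have "0 \<le> C" unfolding C_def using C1(1) C2(1) \<kappa> M by auto
  ultimately show ?case by blast
qed

lemma wiener_bound_mono: "wiener_bound f A \<Longrightarrow> A \<le> B \<Longrightarrow> wiener_bound f B"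
  by (auto simp: wiener_bound_def intro: l1_bound_mono)

lemma sobolev_bound_mono: "sobolev_bound s f A \<Longrightarrow> A \<le> B \<Longrightarrow> sobolev_bound s f B"
  by (auto simp: sobolev_bound_def intro: wiener_bound_mono l2_bound_mono)

lemma sobolev_bound_add:
  assumes f: "sobolev_bound s f A" and g: "sobolev_bound s g B"
  shows "sobolev_bound s (\<lambda>x. f x + g x) (A + B)"
proof -
  have cp: "continuous_periodic f" "continuous_periodic g"
    using f g by (auto simp: sobolev_bound_def wiener_bound_def)
  have "l2_bound (\<lambda>k. japanese_bracket k powr s) (\<lambda>k. rcoef f k + rcoef g k) (A + B)"
    using f g by (intro l2_bound_add) (auto simp: sobolev_bound_def)
  then have "l2_bound (\<lambda>k. japanese_bracket k powr s) (rcoef (\<lambda>x. f x + g x)) (A + B)"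
    by (simp only: rcoef_add_fun[OF cp])
  then show ?thesis using f g wiener_bound_add by (auto simp: sobolev_bound_def)
qed

lemma polynomial_wiener_bound:
  fixes p :: "real ^ 'n \<Rightarrow> real"
  assumes "real_polynomial_function p" "0 \<le> M"
  shows "\<exists>C\<ge>0. \<forall>\<mu> (u :: real ^ 'd \<Rightarrow> real ^ 'n). 0 \<le> \<mu> \<longrightarrow> \<mu> \<le> M \<longrightarrow> (\<forall>i. wiener_bound (\<lambda>x. u x $ i) \<mu>) \<longrightarrow>
    wiener_bound (\<lambda>x. p (u x) - p 0) (C * \<mu>)"
  by (rule polynomial_algebra_bound[where Q = wiener_bound and \<kappa> = 2])
    (use assms in \<open>auto intro: wiener_bound_const wiener_bound_add wiener_bound_mult wiener_bound_mono\<close>)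

lemma polynomial_sobolev_bound:
  fixes p :: "real ^ 'n \<Rightarrow> real"
  assumes "real_polynomial_function p" "0 \<le> M" "0 \<le> s"
  shows "\<exists>C\<ge>0. \<forall>\<mu> (u :: real ^ 'd \<Rightarrow> real ^ 'n). 0 \<le> \<mu> \<longrightarrow> \<mu> \<le> M \<longrightarrow> (\<forall>i. sobolev_bound s (\<lambda>x. u x $ i) \<mu>) \<longrightarrow>
    sobolev_bound s (\<lambda>x. p (u x) - p 0) (C * \<mu>)"
  by (rule polynomial_algebra_bound[where Q = "sobolev_bound s" and \<kappa> = "2 * 2 powr s"])
    (use assms in \<open>auto simp: sobolev_bound_def[of s "\<lambda>_. _"] wiener_bound_const l2_bound_const
      intro: sobolev_bound_add sobolev_bound_mult sobolev_bound_mono\<close>)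

lemma l2_bound_mult_wiener:
  assumes f: "wiener_bound f A" and g: "continuous_periodic g" "l2_bound (\<lambda>_. 1) (rcoef g) B"
  shows "l2_bound (\<lambda>_. 1) (rcoef (\<lambda>x. g x * f x)) (B * A)"
proof -
  have l1: "l1_bound (\<lambda>_. 1) (rcoef f) A" using f by (auto simp: wiener_bound_def intro: l1_bound_jb_imp)
  have AB: "0 \<le> A" "0 \<le> B" using l1_bound_nonneg[OF l1] l2_bound_nonneg[OF g(2)] by auto
  show ?thesis
  proof (rule l2_bound_dual)
    fix F :: "(int ^ 'a) set" and c :: "int ^ 'a \<Rightarrow> real"
    assume F: "finite F" and c: "\<And>k. 0 \<le> c k"
    let ?c = "sqrt (\<Sum>k\<in>F. (c k)\<^sup>2)"
    have "(\<Sum>k\<in>F. c k * cmod (rcoef (\<lambda>x. g x * f x) k)) \<le> ?c * B * A"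
    proof (rule row_sums_bound[OF F rcoef_mult_has_sum[OF g(1) wiener_bound_continuous[OF f] l1]])
      fix F' :: "(int ^ 'a) set" assume F': "finite F'"
      show "(\<Sum>k\<in>F. \<Sum>l\<in>F'. c k * cmod (rcoef g (k - l) * rcoef f l)) \<le> ?c * B * A"
        unfolding norm_mult using F F' c l2_boundD[OF g(2)] l1_boundD[OF l1] AB
        by (intro young_l2_l1[where f="\<lambda>m. cmod (rcoef g m)"]) (auto simp: sum_nonneg)
    qed (use c in auto)
    then show "(\<Sum>k\<in>F. c k * (1 * cmod (rcoef (\<lambda>x. g x * f x) k))) \<le> ?c * (B * A)"
      by (simp only: mult.assoc mult_1)
  qed (use AB in auto)
qed

text \<open>By induction on the polynomial, with \<open>p q(u) - p q(v) = (q(u) - q(v)) p(u) + (p(u) - p(v)) q(v)\<close>: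
  the undifferenced factor is bounded in the Wiener algebra, which acts on \<open>L\<^sup>2\<close>.\<close>

lemma polynomial_l2_lipschitz:
  fixes p :: "real ^ 'n \<Rightarrow> real"
  assumes p: "real_polynomial_function p" and M: "0 \<le> M"
  shows "\<exists>C\<ge>0. \<forall>\<epsilon> (u :: real ^ 'd \<Rightarrow> real ^ 'n) v.
    (\<forall>i. wiener_bound (\<lambda>x. u x $ i) M) \<longrightarrow> (\<forall>i. wiener_bound (\<lambda>x. v x $ i) M) \<longrightarrow>
    (\<forall>i. l2_bound (\<lambda>_. 1) (rcoef (\<lambda>x. u x $ i - v x $ i)) \<epsilon>) \<longrightarrow>
    l2_bound (\<lambda>_. 1) (rcoef (\<lambda>x. p (u x) - p (v x))) (C * \<epsilon>)"
proof -
  have poly: "\<exists>B\<ge>0. \<forall>u :: real ^ 'd \<Rightarrow> real ^ 'n. (\<forall>i. wiener_bound (\<lambda>x. u x $ i) M) \<longrightarrow> wiener_bound (\<lambda>x. q (u x)) B"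
    if q: "real_polynomial_function q" for q
  proof -
    obtain C where C: "0 \<le> C" "\<And>u :: real ^ 'd \<Rightarrow> real ^ 'n. (\<forall>i. wiener_bound (\<lambda>x. u x $ i) M) \<Longrightarrow>
      wiener_bound (\<lambda>x. q (u x) - q 0) (C * M)"
      using polynomial_wiener_bound[OF q M] M by (metis order_refl)
    have "wiener_bound (\<lambda>x. q (u x)) (C * M + \<bar>q 0\<bar>)" if "\<forall>i. wiener_bound (\<lambda>x. u x $ i) M" for u :: "real ^ 'd \<Rightarrow> real ^ 'n"
      using wiener_bound_add[OF C(2)[OF that] wiener_bound_const[of "q 0"]] by simp
    then show ?thesis using C(1) M by (intro exI[of _ "C * M + \<bar>q 0\<bar>"]) auto
  qed
  show ?thesis using p
  proof (induction p)
    case (linear p)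
    then interpret bounded_linear p .
    define C where "C = (\<Sum>i\<in>UNIV. \<bar>p (axis i 1)\<bar>)"
    have "l2_bound (\<lambda>_. 1) (rcoef (\<lambda>x. p (u x) - p (v x))) (C * \<epsilon>)"
      if uv: "\<forall>i. wiener_bound (\<lambda>x. u x $ i) M" "\<forall>i. wiener_bound (\<lambda>x. v x $ i) M"
        and d: "\<forall>i. l2_bound (\<lambda>_. 1) (rcoef (\<lambda>x. u x $ i - v x $ i)) \<epsilon>"
      for \<epsilon> and u v :: "real ^ 'd \<Rightarrow> real ^ 'n"
    proof -
      have cp: "continuous_periodic (\<lambda>x. u x $ i - v x $ i)" for i
        using uv by (auto intro!: continuous_periodic_diff simp: wiener_bound_def)
      have "p (u x) - p (v x) = (\<Sum>i\<in>UNIV. p (axis i 1) * (u x $ i - v x $ i))" for x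
      proof -
        have "u x - v x = (\<Sum>i\<in>UNIV. (u x $ i - v x $ i) *\<^sub>R axis i 1)"
          using basis_expansion[of "u x - v x"] by (simp add: scalar_mult_eq_scaleR)
        then have "p (u x - v x) = p (\<Sum>i\<in>UNIV. (u x $ i - v x $ i) *\<^sub>R axis i 1)" by simp
        also have "\<dots> = (\<Sum>i\<in>UNIV. (u x $ i - v x $ i) * p (axis i 1))" unfolding sum by (simp add: scaleR)
        finally have "p (u x - v x) = (\<Sum>i\<in>UNIV. (u x $ i - v x $ i) * p (axis i 1))" .
        then show ?thesis by (simp add: diff mult.commute)
      qed
      then have "rcoef (\<lambda>x. p (u x) - p (v x)) = rcoef (\<lambda>x. \<Sum>i\<in>UNIV. p (axis i 1) * (u x $ i - v x $ i))"
        by presburger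
      also have "\<dots> = (\<lambda>k. \<Sum>i\<in>UNIV. complex_of_real (p (axis i 1)) * rcoef (\<lambda>x. u x $ i - v x $ i) k)"
      proof
        fix k
        have "rcoef (\<lambda>x. \<Sum>i\<in>UNIV. p (axis i 1) * (u x $ i - v x $ i)) k
          = (\<Sum>i\<in>UNIV. rcoef (\<lambda>x. p (axis i 1) * (u x $ i - v x $ i)) k)"
          using cp by (intro rcoef_sum) (auto intro!: continuous_periodic_mult)
        also have "\<dots> = (\<Sum>i\<in>UNIV. complex_of_real (p (axis i 1)) * rcoef (\<lambda>x. u x $ i - v x $ i) k)"
        proof (intro sum.cong refl)
          fix i
          show "rcoef (\<lambda>x. p (axis i 1) * (u x $ i - v x $ i)) k = complex_of_real (p (axis i 1)) * rcoef (\<lambda>x. u x $ i - v x $ i) k"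
            using coef_cmult[OF continuous_periodic_of_real[OF cp], of "complex_of_real (p (axis i 1))" i k]
            by (simp only: of_real_mult)
        qed
        finally show "rcoef (\<lambda>x. \<Sum>i\<in>UNIV. p (axis i 1) * (u x $ i - v x $ i)) k
          = (\<Sum>i\<in>UNIV. complex_of_real (p (axis i 1)) * rcoef (\<lambda>x. u x $ i - v x $ i) k)" .
      qed
      finally have eq: "rcoef (\<lambda>x. p (u x) - p (v x)) = (\<lambda>k. \<Sum>i\<in>UNIV. complex_of_real (p (axis i 1)) * rcoef (\<lambda>x. u x $ i - v x $ i) k)" .
      have l2sum: "l2_bound (\<lambda>_. 1) (\<lambda>k. \<Sum>i\<in>I. a i k) (\<Sum>i\<in>I. B i)" if "finite I" "\<And>i. l2_bound (\<lambda>_. 1) (a i) (B i)"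
        for I :: "'n set" and a :: "'n \<Rightarrow> int ^ 'd \<Rightarrow> complex" and B
        using that
      proof (induction I rule: finite_induct)
        case empty show ?case by (simp add: l2_bound_def)
      next
        case (insert i I) then show ?case using l2_bound_add[of "\<lambda>_. 1" "a i" "B i"] by auto
      qed
      have "C * \<epsilon> = (\<Sum>i\<in>UNIV. cmod (complex_of_real (p (axis i 1))) * \<epsilon>)" by (simp add: C_def sum_distrib_right)
      then show ?thesis unfolding eq using d by (auto intro!: l2sum l2_bound_cmult simp del: norm_of_real)
    qed
    moreover have "0 \<le> C" unfolding C_def by (intro sum_nonneg) auto
    ultimately show ?case by blast
  next
    case (const c)
    show ?case by (intro exI[of _ 0]) (auto simp: l2_bound_def coef_const)
  next
    case (add p q)
    then obtain C1 C2 where C: "0 \<le> C1" "0 \<le> C2"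
      and C1: "\<And>\<epsilon> (u :: real ^ 'd \<Rightarrow> real ^ 'n) v. (\<forall>i. wiener_bound (\<lambda>x. u x $ i) M) \<Longrightarrow> (\<forall>i. wiener_bound (\<lambda>x. v x $ i) M) \<Longrightarrow>
        (\<forall>i. l2_bound (\<lambda>_. 1) (rcoef (\<lambda>x. u x $ i - v x $ i)) \<epsilon>) \<Longrightarrow> l2_bound (\<lambda>_. 1) (rcoef (\<lambda>x. p (u x) - p (v x))) (C1 * \<epsilon>)"
      and C2: "\<And>\<epsilon> (u :: real ^ 'd \<Rightarrow> real ^ 'n) v. (\<forall>i. wiener_bound (\<lambda>x. u x $ i) M) \<Longrightarrow> (\<forall>i. wiener_bound (\<lambda>x. v x $ i) M) \<Longrightarrow>
        (\<forall>i. l2_bound (\<lambda>_. 1) (rcoef (\<lambda>x. u x $ i - v x $ i)) \<epsilon>) \<Longrightarrow> l2_bound (\<lambda>_. 1) (rcoef (\<lambda>x. q (u x) - q (v x))) (C2 * \<epsilon>)"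
      by auto
    have "l2_bound (\<lambda>_. 1) (rcoef (\<lambda>x. p (u x) + q (u x) - (p (v x) + q (v x)))) ((C1 + C2) * \<epsilon>)"
      if uv: "\<forall>i. wiener_bound (\<lambda>x. u x $ i) M" "\<forall>i. wiener_bound (\<lambda>x. v x $ i) M"
        and d: "\<forall>i. l2_bound (\<lambda>_. 1) (rcoef (\<lambda>x. u x $ i - v x $ i)) \<epsilon>"
      for \<epsilon> and u v :: "real ^ 'd \<Rightarrow> real ^ 'n"
    proof -
      have cp: "continuous_periodic (\<lambda>x. p (u x) - p (v x))" "continuous_periodic (\<lambda>x. q (u x) - q (v x))"
        using poly[OF add.hyps(1)] poly[OF add.hyps(2)] uv
        by (auto intro!: continuous_periodic_diff dest: wiener_bound_continuous)
      have eq: "rcoef (\<lambda>x. p (u x) + q (u x) - (p (v x) + q (v x))) = rcoef (\<lambda>x. (p (u x) - p (v x)) + (q (u x) - q (v x)))"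
        by (rule arg_cong[where f = coef]) (auto simp: algebra_simps)
      show ?thesis unfolding eq rcoef_add_fun[OF cp] distrib_right
        by (intro l2_bound_add C1[OF uv d] C2[OF uv d]) simp
    qed
    then show ?case using C by (intro exI[of _ "C1 + C2"]) auto
  next
    case (mult p q)
    then obtain C1 C2 where C: "0 \<le> C1" "0 \<le> C2"
      and C1: "\<And>\<epsilon> (u :: real ^ 'd \<Rightarrow> real ^ 'n) v. (\<forall>i. wiener_bound (\<lambda>x. u x $ i) M) \<Longrightarrow> (\<forall>i. wiener_bound (\<lambda>x. v x $ i) M) \<Longrightarrow>
        (\<forall>i. l2_bound (\<lambda>_. 1) (rcoef (\<lambda>x. u x $ i - v x $ i)) \<epsilon>) \<Longrightarrow> l2_bound (\<lambda>_. 1) (rcoef (\<lambda>x. p (u x) - p (v x))) (C1 * \<epsilon>)"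
      and C2: "\<And>\<epsilon> (u :: real ^ 'd \<Rightarrow> real ^ 'n) v. (\<forall>i. wiener_bound (\<lambda>x. u x $ i) M) \<Longrightarrow> (\<forall>i. wiener_bound (\<lambda>x. v x $ i) M) \<Longrightarrow>
        (\<forall>i. l2_bound (\<lambda>_. 1) (rcoef (\<lambda>x. u x $ i - v x $ i)) \<epsilon>) \<Longrightarrow> l2_bound (\<lambda>_. 1) (rcoef (\<lambda>x. q (u x) - q (v x))) (C2 * \<epsilon>)"
      by auto
    obtain B1 where B1: "0 \<le> B1" "\<And>u :: real ^ 'd \<Rightarrow> real ^ 'n. (\<forall>i. wiener_bound (\<lambda>x. u x $ i) M) \<Longrightarrow> wiener_bound (\<lambda>x. p (u x)) B1"
      using poly[OF mult.hyps(1)] by blast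
    obtain B2 where B2: "0 \<le> B2" "\<And>u :: real ^ 'd \<Rightarrow> real ^ 'n. (\<forall>i. wiener_bound (\<lambda>x. u x $ i) M) \<Longrightarrow> wiener_bound (\<lambda>x. q (u x)) B2"
      using poly[OF mult.hyps(2)] by blast
    have "l2_bound (\<lambda>_. 1) (rcoef (\<lambda>x. p (u x) * q (u x) - p (v x) * q (v x))) ((C2 * B1 + C1 * B2) * \<epsilon>)"
      if uv: "\<forall>i. wiener_bound (\<lambda>x. u x $ i) M" "\<forall>i. wiener_bound (\<lambda>x. v x $ i) M"
        and d: "\<forall>i. l2_bound (\<lambda>_. 1) (rcoef (\<lambda>x. u x $ i - v x $ i)) \<epsilon>"
      for \<epsilon> and u v :: "real ^ 'd \<Rightarrow> real ^ 'n"
    proof -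
      have cp: "continuous_periodic (\<lambda>x. p (u x) - p (v x))" "continuous_periodic (\<lambda>x. q (u x) - q (v x))"
        using B1 B2 uv by (auto intro!: continuous_periodic_diff dest: wiener_bound_continuous)
      have cp': "continuous_periodic (\<lambda>x. (q (u x) - q (v x)) * p (u x))" "continuous_periodic (\<lambda>x. (p (u x) - p (v x)) * q (v x))"
        using cp B1 B2 uv by (auto intro!: continuous_periodic_mult dest: wiener_bound_continuous)
      have "l2_bound (\<lambda>_. 1) (\<lambda>k. rcoef (\<lambda>x. (q (u x) - q (v x)) * p (u x)) k + rcoef (\<lambda>x. (p (u x) - p (v x)) * q (v x)) k)
        (C2 * \<epsilon> * B1 + C1 * \<epsilon> * B2)"
        using uv d by (intro l2_bound_add l2_bound_mult_wiener cp C1 C2 B1 B2) auto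
      moreover have "(\<lambda>k. rcoef (\<lambda>x. (q (u x) - q (v x)) * p (u x)) k + rcoef (\<lambda>x. (p (u x) - p (v x)) * q (v x)) k)
        = rcoef (\<lambda>x. (q (u x) - q (v x)) * p (u x) + (p (u x) - p (v x)) * q (v x))"
        by (rule ext, rule rcoef_add[OF cp', symmetric])
      moreover have "rcoef (\<lambda>x. (q (u x) - q (v x)) * p (u x) + (p (u x) - p (v x)) * q (v x)) = rcoef (\<lambda>x. p (u x) * q (u x) - p (v x) * q (v x))"
        by (rule arg_cong[where f = coef]) (auto simp: algebra_simps)
      moreover have "C2 * \<epsilon> * B1 + C1 * \<epsilon> * B2 = (C2 * B1 + C1 * B2) * \<epsilon>" by (simp add: algebra_simps)
      ultimately show ?thesis by (simp only:)
    qed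
    then show ?case using C B1(1) B2(1) by (intro exI[of _ "C2 * B1 + C1 * B2"]) auto
  qed
qed

section \<open>A band-limiting filter with a regular symbol\<close>

text \<open>The symbol decreases from nearly \<open>1\<close> at \<open>k = 0\<close> to \<open>0\<close> at \<open>\<langle>k\<rangle> = N\<close>. Its distance from \<open>1\<close> is a
  multiple of the truncated weight \<open>min(N, \<langle>k\<rangle>)\<^sup>s\<close>, which is what makes its commutators small.\<close>

definition truncation_symbol :: "real \<Rightarrow> real \<Rightarrow> int ^ 'd \<Rightarrow> real" where
  "truncation_symbol s N k = 1 - (min N (japanese_bracket k) / N) powr s"

definition freqs :: "nat \<Rightarrow> (int ^ 'd) set" where
  "freqs N = {k. \<forall>j. \<bar>k $ j\<bar> \<le> int N}"

lemma finite_freqs [simp]: "finite (freqs N :: (int ^ 'd) set)"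
proof -
  have "freqs N \<subseteq> vec_lambda ` (PiE (UNIV :: 'd set) (\<lambda>_. {- int N..int N}))"
  proof
    fix k :: "int ^ 'd" assume "k \<in> freqs N"
    then have "\<And>j. \<bar>k $ j\<bar> \<le> int N" by (auto simp: freqs_def)
    then have "vec_nth k \<in> PiE UNIV (\<lambda>_. {- int N..int N})" by (simp add: PiE_def Pi_def abs_le_iff) (metis minus_le_iff)
    then show "k \<in> vec_lambda ` (PiE (UNIV :: 'd set) (\<lambda>_. {- int N..int N}))"
      by (intro image_eqI[of _ _ "vec_nth k"]) (auto simp: vec_nth_inverse)
  qed
  then show ?thesis by (rule finite_subset) (intro finite_imageI finite_PiE; simp)
qed

lemma freqs_uminus: "k \<in> freqs N \<Longrightarrow> - k \<in> freqs N"
  by (auto simp: freqs_def)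

lemma not_freqs_jb: "k \<notin> freqs N \<Longrightarrow> real N \<le> japanese_bracket k"
proof -
  assume "k \<notin> freqs N"
  then obtain j where "int N < \<bar>k $ j\<bar>" by (auto simp: freqs_def not_le)
  then have "real N \<le> \<bar>real_of_int (k $ j)\<bar>" by linarith
  then show ?thesis using abs_component_le_jb[of k j] by linarith
qed

lemma freqs_jb_le: "k \<in> freqs N \<Longrightarrow> japanese_bracket (k :: int ^ 'd) \<le> sqrt (1 + real CARD('d) * (real N)\<^sup>2)"
proof -
  assume k: "k \<in> freqs N"
  have "(real_of_int (k $ j))\<^sup>2 \<le> (real N)\<^sup>2" for j
  proof -
    have "\<bar>real_of_int (k $ j)\<bar> \<le> real N" using k by (auto simp: freqs_def) (metis of_int_abs of_int_le_iff of_int_of_nat_eq)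
    then show ?thesis by (metis abs_le_square_iff abs_of_nat)
  qed
  then have "(\<Sum>j\<in>UNIV. (real_of_int (k $ j))\<^sup>2) \<le> (\<Sum>j\<in>(UNIV :: 'd set). (real N)\<^sup>2)" by (intro sum_mono)
  then show ?thesis by (simp add: japanese_bracket_def)
qed

lemma truncation_symbol_bounds:
  assumes "0 < N" "0 \<le> s"
  shows "0 \<le> truncation_symbol s N k" "truncation_symbol s N k \<le> 1"
proof -
  have "(min N (japanese_bracket k) / N) powr s \<le> 1 powr s"
    using assms by (intro powr_mono2) auto
  then show "0 \<le> truncation_symbol s N k" by (simp add: truncation_symbol_def)
qed (simp add: truncation_symbol_def)

lemma truncation_symbol_eq_0: "0 < N \<Longrightarrow> N \<le> japanese_bracket k \<Longrightarrow> truncation_symbol s N k = 0"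
  by (simp add: truncation_symbol_def)

text \<open>With \<open>x = min(N, \<langle>k\<rangle>) / N \<le> 1\<close> one has \<open>x\<^sup>s \<le> x\<^sup>s\<^sup>-\<^sup>r \<le> (\<langle>k\<rangle> / N)\<^sup>s\<^sup>-\<^sup>r\<close>. Thus the filter misses the
  identity by \<open>O(N\<^sup>r\<^sup>-\<^sup>s)\<close> as an operator from \<open>H\<^sup>s\<close> to \<open>H\<^sup>r\<close>.\<close>

lemma one_minus_truncation_symbol_le:
  assumes N: "0 < N" and r: "0 \<le> r" "r \<le> s"
  shows "japanese_bracket k powr r * (1 - truncation_symbol s N k) \<le> N powr (r - s) * japanese_bracket k powr s"
proof -
  let ?x = "min N (japanese_bracket k) / N"
  have x: "0 < ?x" "?x \<le> 1" "?x \<le> japanese_bracket k / N" using N by (auto simp: divide_right_mono)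
  have "?x powr s \<le> ?x powr (s - r)" using x r by (intro powr_mono') auto
  also have "\<dots> \<le> (japanese_bracket k / N) powr (s - r)" using x r by (intro powr_mono2) auto
  also have "\<dots> = japanese_bracket k powr (s - r) * N powr (r - s)"
    using N powr_minus_divide[of N "s - r"] by (simp add: powr_divide)
  finally have "japanese_bracket k powr r * ?x powr s
    \<le> japanese_bracket k powr r * (japanese_bracket k powr (s - r) * N powr (r - s))"
    by (intro mult_left_mono) auto
  also have "\<dots> = N powr (r - s) * japanese_bracket k powr s" by (simp flip: powr_add mult.assoc)
  finally show ?thesis by (simp add: truncation_symbol_def)
qed

lemma filter_remainder_l2_bound:
  fixes a :: "int ^ 'd \<Rightarrow> complex"
  assumes N: "0 < N" and s: "0 \<le> s" and a: "l2_bound (\<lambda>k. japanese_bracket k powr s) a \<sigma>"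
  shows "l2_bound (\<lambda>_. 1) (\<lambda>k. (1 - complex_of_real (truncation_symbol s N k)) * a k) (\<sigma> * N powr (- s))"
  unfolding l2_bound_def
proof (intro conjI allI impI)
  show "0 \<le> \<sigma> * N powr (- s)" using l2_bound_nonneg[OF a] by simp
  fix F :: "(int ^ 'd) set" assume F: "finite F"
  have "(\<Sum>k\<in>F. (1 * cmod ((1 - complex_of_real (truncation_symbol s N k)) * a k))\<^sup>2)
    \<le> (\<Sum>k\<in>F. (N powr (- s))\<^sup>2 * (japanese_bracket k powr s * cmod (a k))\<^sup>2)"
  proof (intro sum_mono)
    fix k :: "int ^ 'd"
    have "cmod (1 - complex_of_real (truncation_symbol s N k)) = 1 - truncation_symbol s N k"
      using truncation_symbol_bounds[OF N s, of k]
      by (metis abs_of_nonneg diff_ge_0_iff_ge norm_of_real of_real_1 of_real_diff)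
    also have "\<dots> \<le> N powr (- s) * japanese_bracket k powr s"
      using one_minus_truncation_symbol_le[OF N, of 0 s k] s by simp
    finally have "cmod (1 - complex_of_real (truncation_symbol s N k)) * cmod (a k)
      \<le> (N powr (- s) * japanese_bracket k powr s) * cmod (a k)"
      by (intro mult_right_mono) auto
    then have "(cmod (1 - complex_of_real (truncation_symbol s N k)) * cmod (a k))\<^sup>2
      \<le> ((N powr (- s) * japanese_bracket k powr s) * cmod (a k))\<^sup>2"
      by (intro power_mono) auto
    then show "(1 * cmod ((1 - complex_of_real (truncation_symbol s N k)) * a k))\<^sup>2
      \<le> (N powr (- s))\<^sup>2 * (japanese_bracket k powr s * cmod (a k))\<^sup>2"
      by (simp only: norm_mult power_mult_distrib mult_1 mult.assoc)
  qed
  also have "\<dots> \<le> (N powr (- s))\<^sup>2 * \<sigma>\<^sup>2"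
    unfolding sum_distrib_left[symmetric] by (intro mult_left_mono l2_boundD[OF a F]) auto
  finally show "(\<Sum>k\<in>F. (1 * cmod ((1 - complex_of_real (truncation_symbol s N k)) * a k))\<^sup>2) \<le> (\<sigma> * N powr (- s))\<^sup>2"
    by (simp add: power_mult_distrib mult.commute)
qed

lemma truncation_symbol_diff:
  assumes N: "0 < N"
  shows "\<bar>truncation_symbol s N k - truncation_symbol s N l\<bar>
    = N powr (- s) * \<bar>min N (japanese_bracket k) powr s - min N (japanese_bracket l) powr s\<bar>"
proof -
  have "(x / N) powr s = N powr (- s) * x powr s" for x
    using N by (simp add: powr_divide powr_minus divide_simps)
  then have "truncation_symbol s N k - truncation_symbol s N l
    = N powr (- s) * (min N (japanese_bracket l) powr s - min N (japanese_bracket k) powr s)"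
    by (simp add: truncation_symbol_def right_diff_distrib)
  then show ?thesis by (simp add: abs_mult abs_minus_commute)
qed

section \<open>The energy estimate for the filtered difference\<close>

text \<open>The commutator of the multiplier with a first order operator \<open>\<alpha> \<partial>\<^sub>j\<close> is bounded from \<open>H\<^sup>s\<close> to
  \<open>L\<^sup>2\<close> with norm \<open>O(N\<^sup>-\<^sup>s)\<close>, without loss of a derivative. The zero mode of \<open>\<alpha>\<close> commutes, so only a
  sequence \<open>\<alpha>'\<close> that agrees with \<open>\<alpha>\<close> away from \<open>0\<close> enters.\<close>

lemma commutator_pairing:
  fixes \<alpha> \<alpha>' u :: "int ^ 'd \<Rightarrow> complex" and d :: "int ^ 'd \<Rightarrow> real"
  assumes s: "1 \<le> s" and N: "0 < N"
    and \<alpha>: "l2_bound (\<lambda>k. japanese_bracket k powr s) \<alpha>' P" "l1_bound japanese_bracket \<alpha>' P"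
    and u: "l2_bound (\<lambda>k. japanese_bracket k powr s) u Q" "l1_bound japanese_bracket u Q"
    and eq: "\<And>m. m \<noteq> 0 \<Longrightarrow> \<alpha> m = \<alpha>' m"
    and F: "finite F" "finite F'" and d: "\<And>k. 0 \<le> d k"
  shows "(\<Sum>k\<in>F. \<Sum>l\<in>F'. d k * cmod (complex_of_real (truncation_symbol s N k - truncation_symbol s N l)
      * (\<alpha> (k - l) * (\<i> * of_int (l $ j) * u l))))
    \<le> N powr (- s) * (2 * s * 2 powr (s - 1)) * sqrt (\<Sum>k\<in>F. (d k)\<^sup>2) * P * Q"
proof -
  let ?w = "\<lambda>k::int ^ 'd. japanese_bracket k powr s"
  let ?c = "s * 2 powr (s - 1)"
  let ?d = "sqrt (\<Sum>k\<in>F. (d k)\<^sup>2)"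
  have PQ: "0 \<le> P" "0 \<le> Q" using l2_bound_nonneg[OF \<alpha>(1)] l2_bound_nonneg[OF u(1)] by auto
  have d2: "(\<Sum>k\<in>F. (d k)\<^sup>2) \<le> ?d\<^sup>2" by (simp add: sum_nonneg)
  have term_le: "d k * cmod (complex_of_real (truncation_symbol s N k - truncation_symbol s N l)
      * (\<alpha> (k - l) * (\<i> * of_int (l $ j) * u l)))
    \<le> N powr (- s) * ?c * (d k * ((?w (k - l) * cmod (\<alpha>' (k - l))) * (japanese_bracket l * cmod (u l)))
        + d k * ((japanese_bracket (k - l) * cmod (\<alpha>' (k - l))) * (?w l * cmod (u l))))" for k l
  proof (cases "k = l")
    case True
    then show ?thesis using d s by (simp add: add_nonneg_nonneg)
  next
    case False
    then have \<alpha>eq: "\<alpha> (k - l) = \<alpha>' (k - l)" by (intro eq) simp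
    let ?D = "\<bar>truncation_symbol s N k - truncation_symbol s N l\<bar>"
    have "?D \<le> N powr (- s) * (?c * (?w (k - l) + japanese_bracket (k - l) * japanese_bracket l powr (s - 1)))"
      unfolding truncation_symbol_diff[OF N] using s N
      by (intro mult_left_mono truncated_weight_commutator) auto
    then have "?D * japanese_bracket l
      \<le> N powr (- s) * (?c * (?w (k - l) + japanese_bracket (k - l) * japanese_bracket l powr (s - 1))) * japanese_bracket l"
      by (intro mult_right_mono) auto
    also have "\<dots> = N powr (- s) * ?c * (?w (k - l) * japanese_bracket l
        + japanese_bracket (k - l) * (japanese_bracket l powr (s - 1) * japanese_bracket l))"
      by (simp add: algebra_simps)
    also have "japanese_bracket l powr (s - 1) * japanese_bracket l = ?w l" by (simp add: powr_diff)
    finally have D: "?D * japanese_bracket l \<le> N powr (- s) * ?c * (?w (k - l) * japanese_bracket l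
        + japanese_bracket (k - l) * ?w l)" .
    have "cmod (complex_of_real (truncation_symbol s N k - truncation_symbol s N l)
        * (\<alpha> (k - l) * (\<i> * of_int (l $ j) * u l)))
      = ?D * \<bar>real_of_int (l $ j)\<bar> * (cmod (\<alpha>' (k - l)) * cmod (u l))"
      unfolding norm_mult norm_of_real by (simp add: \<alpha>eq)
    also have "\<dots> \<le> ?D * japanese_bracket l * (cmod (\<alpha>' (k - l)) * cmod (u l))"
      by (intro mult_right_mono mult_left_mono abs_component_le_jb) auto
    also have "\<dots> \<le> N powr (- s) * ?c * (?w (k - l) * japanese_bracket l
        + japanese_bracket (k - l) * ?w l) * (cmod (\<alpha>' (k - l)) * cmod (u l))"
      by (intro mult_right_mono D) auto
    finally have "d k * cmod (complex_of_real (truncation_symbol s N k - truncation_symbol s N l)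
        * (\<alpha> (k - l) * (\<i> * of_int (l $ j) * u l)))
      \<le> d k * (N powr (- s) * ?c * (?w (k - l) * japanese_bracket l
        + japanese_bracket (k - l) * ?w l) * (cmod (\<alpha>' (k - l)) * cmod (u l)))"
      by (intro mult_left_mono d)
    then show ?thesis by (simp only: algebra_simps)
  qed
  have "(\<Sum>k\<in>F. \<Sum>l\<in>F'. d k * cmod (complex_of_real (truncation_symbol s N k - truncation_symbol s N l)
      * (\<alpha> (k - l) * (\<i> * of_int (l $ j) * u l))))
    \<le> (\<Sum>k\<in>F. \<Sum>l\<in>F'. N powr (- s) * ?c * (d k * ((?w (k - l) * cmod (\<alpha>' (k - l))) * (japanese_bracket l * cmod (u l)))
        + d k * ((japanese_bracket (k - l) * cmod (\<alpha>' (k - l))) * (?w l * cmod (u l)))))"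
    by (intro sum_mono term_le)
  also have "\<dots> = N powr (- s) * ?c *
      ((\<Sum>k\<in>F. \<Sum>l\<in>F'. d k * ((?w (k - l) * cmod (\<alpha>' (k - l))) * (japanese_bracket l * cmod (u l))))
      + (\<Sum>k\<in>F. \<Sum>l\<in>F'. d k * ((japanese_bracket (k - l) * cmod (\<alpha>' (k - l))) * (?w l * cmod (u l)))))"
    by (simp only: sum_distrib_left sum.distrib distrib_left)
  also have "\<dots> \<le> N powr (- s) * ?c * (?d * P * Q + ?d * P * Q)"
  proof (intro mult_left_mono add_mono)
    show "(\<Sum>k\<in>F. \<Sum>l\<in>F'. d k * ((?w (k - l) * cmod (\<alpha>' (k - l))) * (japanese_bracket l * cmod (u l)))) \<le> ?d * P * Q"
      using F d d2 PQ l2_boundD[OF \<alpha>(1)] l1_boundD[OF u(2)]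
      by (intro young_l2_l1[where f="\<lambda>m. ?w m * cmod (\<alpha>' m)"]) (auto simp: sum_nonneg)
    show "(\<Sum>k\<in>F. \<Sum>l\<in>F'. d k * ((japanese_bracket (k - l) * cmod (\<alpha>' (k - l))) * (?w l * cmod (u l)))) \<le> ?d * P * Q"
      using F d d2 PQ l1_boundD[OF \<alpha>(2)] l2_boundD[OF u(1)]
      by (intro young_l1_l2[where f="\<lambda>m. japanese_bracket m * cmod (\<alpha>' m)"]) (auto simp: sum_nonneg)
  qed (use s in auto)
  finally show ?thesis by (simp add: algebra_simps)
qed

lemma source_pairing:
  fixes \<beta> u :: "int ^ 'd \<Rightarrow> complex" and d \<pi> :: "int ^ 'd \<Rightarrow> real"
  assumes \<beta>: "l2_bound (\<lambda>_. 1) \<beta> B" and u: "l1_bound japanese_bracket u Q"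
    and \<pi>: "\<And>k. 0 \<le> \<pi> k \<and> \<pi> k \<le> 1" and F: "finite F" "finite F'" and d: "\<And>k. 0 \<le> d k"
  shows "(\<Sum>k\<in>F. \<Sum>l\<in>F'. d k * cmod (\<beta> (k - l) * (complex_of_real (\<pi> l) * (\<i> * of_int (l $ j) * u l))))
    \<le> sqrt (\<Sum>k\<in>F. (d k)\<^sup>2) * B * Q"
proof -
  have "(\<Sum>k\<in>F. \<Sum>l\<in>F'. d k * cmod (\<beta> (k - l) * (complex_of_real (\<pi> l) * (\<i> * of_int (l $ j) * u l))))
    \<le> (\<Sum>k\<in>F. \<Sum>l\<in>F'. d k * (cmod (\<beta> (k - l)) * (japanese_bracket l * cmod (u l))))"
  proof (intro sum_mono mult_left_mono d)
    fix k l
    have "\<bar>\<pi> l\<bar> * \<bar>real_of_int (l $ j)\<bar> \<le> 1 * japanese_bracket l"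
      using \<pi>[of l] by (intro mult_mono abs_component_le_jb) auto
    then have "cmod (\<beta> (k - l)) * (\<bar>\<pi> l\<bar> * \<bar>real_of_int (l $ j)\<bar> * cmod (u l))
      \<le> cmod (\<beta> (k - l)) * (1 * japanese_bracket l * cmod (u l))"
      by (intro mult_left_mono mult_right_mono) auto
    then show "cmod (\<beta> (k - l) * (complex_of_real (\<pi> l) * (\<i> * of_int (l $ j) * u l)))
      \<le> cmod (\<beta> (k - l)) * (japanese_bracket l * cmod (u l))"
      by (simp add: norm_mult mult_ac)
  qed
  also have "\<dots> \<le> sqrt (\<Sum>k\<in>F. (d k)\<^sup>2) * B * Q"
    using F d l2_boundD[OF \<beta>] l1_boundD[OF u] l2_bound_nonneg[OF \<beta>]
    by (intro young_l2_l1[where f="\<lambda>m. cmod (\<beta> m)"]) (auto simp: sum_nonneg)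
  finally show ?thesis .
qed

text \<open>For a real symmetric coefficient matrix the adjoint of the transport operator is its opposite up to
  an operator of order zero, whose kernel is \<open>i (l\<^sub>j - k\<^sub>j) \<alpha>(k - l)\<close>.\<close>

lemma symmetric_transport_pairing:
  fixes \<alpha> \<alpha>' :: "'n::finite \<Rightarrow> 'n \<Rightarrow> int ^ 'd \<Rightarrow> complex" and D :: "'n \<Rightarrow> int ^ 'd \<Rightarrow> complex"
  assumes sym: "\<And>a b m. \<alpha> a b m = \<alpha> b a m" and real: "\<And>a b m. \<alpha> a b (- m) = cnj (\<alpha> a b m)"
    and eq: "\<And>a b m. m \<noteq> 0 \<Longrightarrow> \<alpha> a b m = \<alpha>' a b m"
    and W: "\<And>a b. l1_bound japanese_bracket (\<alpha>' a b) W" and F: "finite F"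
  shows "\<bar>Re (\<Sum>a\<in>UNIV. \<Sum>b\<in>UNIV. \<Sum>k\<in>F. \<Sum>l\<in>F. cnj (D a k) * (\<alpha> a b (k - l) * (\<i> * of_int (l $ j) * D b l)))\<bar>
    \<le> (real CARD('n))\<^sup>2 * W * (\<Sum>k\<in>F. \<Sum>a\<in>UNIV. (cmod (D a k))\<^sup>2)"
proof -
  let ?X = "\<Sum>a\<in>UNIV. \<Sum>b\<in>UNIV. \<Sum>k\<in>F. \<Sum>l\<in>F. cnj (D a k) * (\<alpha> a b (k - l) * (\<i> * of_int (l $ j) * D b l))"
  let ?y = "\<Sum>k\<in>F. \<Sum>a\<in>UNIV. (cmod (D a k))\<^sup>2"
  have y0: "0 \<le> ?y" by (intro sum_nonneg) auto
  have W0: "0 \<le> W" using l1_bound_nonneg[OF W] .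
  have "cnj ?X = (\<Sum>a\<in>UNIV. \<Sum>b\<in>UNIV. \<Sum>k\<in>F. \<Sum>l\<in>F. D a k * (\<alpha> a b (l - k) * (- \<i> * of_int (l $ j) * cnj (D b l))))"
  proof -
    have "cnj (\<alpha> a b (k - l)) = \<alpha> a b (l - k)" for a b k l using real[of a b "k - l"] by simp
    then show ?thesis by (simp add: cnj_sum)
  qed
  also have "\<dots> = (\<Sum>b\<in>UNIV. \<Sum>a\<in>UNIV. \<Sum>l\<in>F. \<Sum>k\<in>F. D a k * (\<alpha> a b (l - k) * (- \<i> * of_int (l $ j) * cnj (D b l))))"
    by (subst sum.swap) (intro sum.cong refl sum.swap)
  also have "\<dots> = (\<Sum>a\<in>UNIV. \<Sum>b\<in>UNIV. \<Sum>k\<in>F. \<Sum>l\<in>F. cnj (D a k) * (\<alpha> a b (k - l) * (- \<i> * of_int (k $ j) * D b l)))"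
    by (intro sum.cong refl) (metis (no_types, lifting) sym mult.commute mult.left_commute)
  finally have cnjX: "cnj ?X = \<dots>" .
  have "?X + cnj ?X = (\<Sum>a\<in>UNIV. \<Sum>b\<in>UNIV. \<Sum>k\<in>F. \<Sum>l\<in>F. cnj (D a k) * (\<alpha> a b (k - l) * (\<i> * of_int (l $ j - k $ j) * D b l)))"
    unfolding cnjX by (simp add: algebra_simps flip: sum.distrib)
  then have "cmod (?X + cnj ?X) \<le> (\<Sum>a\<in>UNIV. \<Sum>b\<in>UNIV. \<Sum>k\<in>F. \<Sum>l\<in>F.
      cmod (cnj (D a k) * (\<alpha> a b (k - l) * (\<i> * of_int (l $ j - k $ j) * D b l))))"
    by (auto intro!: order_trans[OF norm_sum] sum_mono)
  also have "\<dots> \<le> (\<Sum>a\<in>(UNIV :: 'n set). \<Sum>b\<in>(UNIV :: 'n set). W * ?y)"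
  proof (rule sum_mono, rule sum_mono)
    fix a b :: 'n
    have "(\<Sum>k\<in>F. \<Sum>l\<in>F. cmod (cnj (D a k) * (\<alpha> a b (k - l) * (\<i> * of_int (l $ j - k $ j) * D b l))))
      \<le> (\<Sum>k\<in>F. \<Sum>l\<in>F. cmod (D a k) * ((japanese_bracket (k - l) * cmod (\<alpha>' a b (k - l))) * (if l \<in> F then cmod (D b l) else 0)))"
    proof (intro sum_mono)
      fix k l assume l: "l \<in> F"
      show "cmod (cnj (D a k) * (\<alpha> a b (k - l) * (\<i> * of_int (l $ j - k $ j) * D b l)))
        \<le> cmod (D a k) * ((japanese_bracket (k - l) * cmod (\<alpha>' a b (k - l))) * (if l \<in> F then cmod (D b l) else 0))"
      proof (cases "k = l")
        case False
        have "\<bar>real_of_int ((l - k) $ j)\<bar> \<le> japanese_bracket (l - k)" by (rule abs_component_le_jb)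
        then have "cmod (D a k) * ((\<bar>real_of_int (l $ j - k $ j)\<bar> * cmod (\<alpha>' a b (k - l))) * cmod (D b l))
          \<le> cmod (D a k) * ((japanese_bracket (k - l) * cmod (\<alpha>' a b (k - l))) * cmod (D b l))"
          by (intro mult_left_mono mult_right_mono) (auto simp: jb_minus_commute)
        moreover have "\<alpha> a b (k - l) = \<alpha>' a b (k - l)" using False by (intro eq) simp
        moreover have "cmod (of_int (l $ j - k $ j)) = \<bar>real_of_int (l $ j - k $ j)\<bar>" by (rule norm_of_int)
        ultimately show ?thesis using l by (simp only: norm_mult complex_mod_cnj norm_ii mult_1 if_True mult_ac)
      qed simp
    qed
    also have "\<dots> \<le> sqrt ?y * W * sqrt ?y"
    proof (rule young_l1_l2[where f="\<lambda>m. japanese_bracket m * cmod (\<alpha>' a b m)" and g="\<lambda>l. if l \<in> F then cmod (D b l) else 0"])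
      have 1: "(\<Sum>k\<in>F. (cmod (D c k))\<^sup>2) \<le> ?y" for c :: 'n
        by (intro sum_mono member_le_sum) auto
      then show "(\<Sum>k\<in>F. (cmod (D a k))\<^sup>2) \<le> (sqrt ?y)\<^sup>2" using y0 by simp
      fix G :: "(int ^ 'd) set" assume G: "finite G"
      have "(\<Sum>k\<in>G. (if k \<in> F then cmod (D b k) else 0)\<^sup>2) = (\<Sum>k\<in>G \<inter> F. (cmod (D b k))\<^sup>2)"
        using G by (subst sum.inter_restrict) (auto intro!: sum.cong)
      also have "\<dots> \<le> (\<Sum>k\<in>F. (cmod (D b k))\<^sup>2)" using F by (intro sum_mono2) auto
      finally show "(\<Sum>k\<in>G. (if k \<in> F then cmod (D b k) else 0)\<^sup>2) \<le> (sqrt ?y)\<^sup>2" using 1[of b] y0 by simp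
      show "(\<Sum>k\<in>G. japanese_bracket k * cmod (\<alpha>' a b k)) \<le> W" using G l1_boundD[OF W] by simp
    qed (use F y0 in auto)
    also have "\<dots> = W * ?y" using y0 by (simp add: mult.commute)
    finally show "(\<Sum>k\<in>F. \<Sum>l\<in>F. cmod (cnj (D a k) * (\<alpha> a b (k - l) * (\<i> * of_int (l $ j - k $ j) * D b l)))) \<le> W * ?y" .
  qed
  also have "\<dots> = (real CARD('n))\<^sup>2 * W * ?y" by (simp add: power2_eq_square)
  finally have "cmod (?X + cnj ?X) \<le> (real CARD('n))\<^sup>2 * W * ?y" .
  moreover have "?X + cnj ?X = complex_of_real (2 * Re ?X)" by (rule complex_add_cnj)
  ultimately show ?thesis by (simp only: norm_of_real)
qed

text \<open>The regularity in space of a classical solution at a fixed time, componentwise.\<close>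

definition C1_periodic :: "(real ^ 'd::finite \<Rightarrow> real ^ 'n::finite) \<Rightarrow> bool" where
  "C1_periodic u \<longleftrightarrow> (\<forall>i. continuous_periodic (\<lambda>x. u x $ i)) \<and>
     (\<forall>j i. continuous_periodic (\<lambda>x. partial_x j u x $ i)) \<and>
     (\<forall>j x. ((\<lambda>h. u (x + axis j h)) has_vector_derivative partial_x j u x) (at 0))"

lemma rcoef_partial:
  assumes "C1_periodic u"
  shows "rcoef (\<lambda>x. partial_x j u x $ i) k = \<i> * of_int (k $ j) * rcoef (\<lambda>x. u x $ i) k"
proof (rule coef_partial)
  show "continuous_periodic (\<lambda>x. complex_of_real (u x $ i))"
    "continuous_periodic (\<lambda>x. complex_of_real (partial_x j u x $ i))"
    using assms by (auto simp: C1_periodic_def intro!: continuous_periodic_of_real)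
  fix x
  have "((\<lambda>h. u (x + axis j h)) has_vector_derivative partial_x j u x) (at 0)"
    using assms by (simp add: C1_periodic_def)
  moreover have "bounded_linear (\<lambda>v :: real ^ 'b. complex_of_real (v $ i))"
    by (intro bounded_linear_compose[OF bounded_linear_of_real bounded_linear_vec_nth])
  ultimately show "((\<lambda>h. complex_of_real (u (x + axis j h) $ i)) has_vector_derivative
      complex_of_real (partial_x j u x $ i)) (at 0)"
    by (rule bounded_linear.has_vector_derivative[rotated])
qed

lemma advection_component:
  "advection A u x $ a = (\<Sum>j\<in>UNIV. \<Sum>b\<in>UNIV. A j (u x) $ a $ b * partial_x j u x $ b)"
  by (simp add: advection_def sum_component matrix_vector_mult_def)

lemma has_sum_finite_sum:
  fixes f :: "'i \<Rightarrow> 'a \<Rightarrow> complex"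
  assumes "finite I" "\<And>i. i \<in> I \<Longrightarrow> (f i has_sum S i) A"
  shows "((\<lambda>x. \<Sum>i\<in>I. f i x) has_sum (\<Sum>i\<in>I. S i)) A"
  using assms
proof (induction I rule: finite_induct)
  case (insert i I)
  have "(f i has_sum S i) A" "((\<lambda>x. \<Sum>i\<in>I. f i x) has_sum sum S I) A"
    using insert.prems insert.IH by blast+
  then have "((\<lambda>x. f i x + (\<Sum>i\<in>I. f i x)) has_sum (S i + (\<Sum>i\<in>I. S i))) A"
    by (rule has_sum_add)
  then show ?case using insert by simp
qed simp

lemma mult_norm_sum_le:
  fixes f :: "'i \<Rightarrow> complex"
  shows "0 \<le> c \<Longrightarrow> c * cmod (\<Sum>i\<in>I. f i) \<le> (\<Sum>i\<in>I. c * cmod (f i))"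
  by (simp add: mult_left_mono norm_sum flip: sum_distrib_left)

lemma mult_norm_double_sum_le:
  fixes f :: "'i \<Rightarrow> 'j \<Rightarrow> complex"
  shows "0 \<le> c \<Longrightarrow> c * cmod (\<Sum>i\<in>I. \<Sum>j\<in>J. f i j) \<le> (\<Sum>i\<in>I. \<Sum>j\<in>J. c * cmod (f i j))"
  by (rule order_trans[OF mult_norm_sum_le]) (auto intro: sum_mono mult_norm_sum_le)

lemma has_sum_diff:
  fixes f g :: "'a \<Rightarrow> complex"
  assumes "(f has_sum a) A" "(g has_sum b) A"
  shows "((\<lambda>x. f x - g x) has_sum (a - b)) A"
  using has_sum_add[OF assms(1) has_sum_cmult_right[OF assms(2), of "- 1"]] by simp

lemma l1_bound_partial:
  assumes "l1_bound japanese_bracket a C"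
  shows "l1_bound (\<lambda>_. 1) (\<lambda>k. \<i> * of_int (k $ j) * a k) C"
  unfolding l1_bound_def
proof (intro allI impI)
  fix F :: "(int ^ 'a) set" assume F: "finite F"
  have "(\<Sum>k\<in>F. 1 * cmod (\<i> * of_int (k $ j) * a k)) \<le> (\<Sum>k\<in>F. japanese_bracket k * cmod (a k))"
    by (intro sum_mono) (simp add: norm_mult mult_right_mono abs_component_le_jb)
  then show "(\<Sum>k\<in>F. 1 * cmod (\<i> * of_int (k $ j) * a k)) \<le> C" using l1_boundD[OF assms F] by linarith
qed

lemma advection_continuous_periodic:
  assumes "C1_periodic u" "\<And>j a b. continuous_periodic (\<lambda>x. A j (u x) $ a $ b)"
  shows "continuous_periodic (\<lambda>x. advection A u x $ a)"
  unfolding advection_component using assms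
  by (intro continuous_periodic_sum continuous_periodic_mult) (auto simp: C1_periodic_def)

text \<open>The convolution is summed over the frequency \<open>l\<close> of the derivative, whose coefficients are
  summable by the Wiener bound.\<close>

lemma rcoef_advection:
  fixes u :: "real ^ 'd::finite \<Rightarrow> real ^ 'n::finite"
  assumes u: "C1_periodic u" and A: "\<And>j a b. continuous_periodic (\<lambda>x. A j (u x) $ a $ b)"
    and l1: "\<And>i. l1_bound japanese_bracket (rcoef (\<lambda>x. u x $ i)) \<mu>"
  shows "((\<lambda>l. \<Sum>j\<in>UNIV. \<Sum>b\<in>UNIV. rcoef (\<lambda>x. A j (u x) $ a $ b) (k - l) * (\<i> * of_int (l $ j) * rcoef (\<lambda>x. u x $ b) l))
    has_sum rcoef (\<lambda>x. advection A u x $ a) k) UNIV"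
proof -
  have p: "continuous_periodic (\<lambda>x. partial_x j u x $ b)" for j b using u by (simp add: C1_periodic_def)
  have "rcoef (\<lambda>x. advection A u x $ a) k = (\<Sum>j\<in>UNIV. \<Sum>b\<in>UNIV. rcoef (\<lambda>x. A j (u x) $ a $ b * partial_x j u x $ b) k)"
    unfolding advection_component
    by (subst rcoef_sum; (intro sum.cong refl rcoef_sum)?) (auto intro!: continuous_periodic_sum continuous_periodic_mult A p)
  moreover have "((\<lambda>l. rcoef (\<lambda>x. A j (u x) $ a $ b) (k - l) * (\<i> * of_int (l $ j) * rcoef (\<lambda>x. u x $ b) l))
      has_sum rcoef (\<lambda>x. A j (u x) $ a $ b * partial_x j u x $ b) k) UNIV" for j b
    unfolding rcoef_partial[OF u, symmetric]
  proof (rule rcoef_mult_has_sum[OF A p])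
    show "l1_bound (\<lambda>_. 1) (rcoef (\<lambda>x. partial_x j u x $ b)) \<mu>"
      using l1_bound_partial[OF l1[of b], of j] by (simp only: rcoef_partial[OF u, abs_def])
  qed
  ultimately show ?thesis by (auto intro!: has_sum_finite_sum)
qed

lemma uniform_constant:
  fixes P :: "'i::finite \<Rightarrow> real \<Rightarrow> bool"
  assumes ex: "\<And>i. \<exists>C\<ge>0. P i C" and mono: "\<And>i C C'. P i C \<Longrightarrow> C \<le> C' \<Longrightarrow> P i C'"
  shows "\<exists>C\<ge>0. \<forall>i. P i C"
proof -
  obtain C where C: "\<And>i. 0 \<le> C i" "\<And>i. P i (C i)" using ex by metis
  have "C i \<le> (\<Sum>i\<in>UNIV. C i)" for i using C(1) by (intro member_le_sum) auto
  then show ?thesis using C mono by (intro exI[of _ "\<Sum>i\<in>UNIV. C i"]) (auto intro: sum_nonneg mono[OF C(2)])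
qed

text \<open>The coefficients of \<open>\<Pi>u - v\<close>, where \<open>\<Pi>\<close> is the filter with the truncation symbol.\<close>

abbreviation defect_coef ::
  "real \<Rightarrow> nat \<Rightarrow> (real ^ 'd::finite \<Rightarrow> real ^ 'n::finite) \<Rightarrow> (real ^ 'd \<Rightarrow> real ^ 'n) \<Rightarrow> 'n \<Rightarrow> int ^ 'd \<Rightarrow> complex" where
  "defect_coef s N u v a k \<equiv>
     complex_of_real (truncation_symbol s (real N) k) * rcoef (\<lambda>x. u x $ a) k - rcoef (\<lambda>x. v x $ a) k"

text \<open>For \<open>v\<close> without frequencies beyond \<open>N\<close>, this is the squared \<open>L\<^sup>2\<close> norm of \<open>\<Pi>u - v\<close>, up to
  normalization.\<close>

definition energy_defect ::
  "real \<Rightarrow> nat \<Rightarrow> (real ^ 'd::finite \<Rightarrow> real ^ 'n::finite) \<Rightarrow> (real ^ 'd \<Rightarrow> real ^ 'n) \<Rightarrow> real" where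
  "energy_defect s N u v = (\<Sum>k\<in>freqs N. \<Sum>a\<in>UNIV. (cmod (defect_coef s N u v a k))\<^sup>2)"

text \<open>Along solutions \<open>u\<close> of the equation and \<open>v\<close> of its truncation, \<open>-2\<close> times this pairing is the time
  derivative of the energy defect. The truncation of the advection of \<open>v\<close> is not visible, because
  only the frequencies of \<open>freqs N\<close> are paired.\<close>

definition defect_pairing ::
  "('d::finite \<Rightarrow> real ^ 'n::finite \<Rightarrow> real ^ 'n ^ 'n) \<Rightarrow> real \<Rightarrow> nat \<Rightarrow> (real ^ 'd \<Rightarrow> real ^ 'n) \<Rightarrow> (real ^ 'd \<Rightarrow> real ^ 'n) \<Rightarrow> real" where
  "defect_pairing A s N u v = (\<Sum>k\<in>freqs N. \<Sum>a\<in>UNIV. Re (cnj (defect_coef s N u v a k) *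
     defect_coef s N (advection A u) (advection A v) a k))"

text \<open>With \<open>D = \<Pi>u - v\<close>, the coefficient of \<open>\<Pi>(A(u) \<partial>u) - A(v) \<partial>v\<close> is decomposed into the commutator
  \<open>\<Pi>(A(u) \<partial>u) - A(u) \<partial>\<Pi>u\<close>, the source \<open>(A(u) - A(v)) \<partial>\<Pi>u\<close> and the transport term \<open>A(v) \<partial>D\<close>. In
  \<open>L\<^sup>2\<close>, the commutator is bounded by a multiple of \<open>\<mu> \<sigma> N\<^sup>-\<^sup>s\<close> and the source by a multiple of \<open>\<mu> |u - v|\<close> with
  \<open>|u - v| \<le> |u - \<Pi>u| + |D|\<close>; the transport operator is antisymmetric up to an operator of order zero
  and norm \<open>O(\<mu>)\<close>.\<close>

theorem energy_rate:
  fixes A :: "'d::finite \<Rightarrow> real ^ 'n::finite \<Rightarrow> real ^ 'n ^ 'n" and s :: real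
  assumes sym: "\<And>j V. transpose (A j V) = A j V"
    and poly: "\<And>j a b. real_polynomial_function (\<lambda>V. A j V $ a $ b)"
    and s: "s > real CARD('d) / 2 + 1" and M: "0 \<le> M"
  shows "\<exists>C\<ge>0. \<forall>N\<ge>1. \<forall>(u :: real ^ 'd \<Rightarrow> real ^ 'n) v \<mu> \<sigma>.
    C1_periodic u \<longrightarrow> C1_periodic v \<longrightarrow> 0 \<le> \<sigma> \<longrightarrow> \<sigma> \<le> \<mu> \<longrightarrow> \<mu> \<le> M \<longrightarrow>
    (\<forall>i. l2_bound (\<lambda>k. japanese_bracket k powr s) (rcoef (\<lambda>x. u x $ i)) \<sigma>) \<longrightarrow>
    (\<forall>i. l1_bound japanese_bracket (rcoef (\<lambda>x. v x $ i)) \<mu>) \<longrightarrow>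
    (\<forall>i k. k \<notin> freqs N \<longrightarrow> rcoef (\<lambda>x. v x $ i) k = 0) \<longrightarrow>
    \<bar>defect_pairing A s N u v\<bar> \<le> C * \<mu> * (energy_defect s N u v + (\<sigma> * real N powr (- s))\<^sup>2)"
proof -
  have s1: "1 \<le> s" using s by linarith
  obtain c where c: "c > 0" "\<And>(a :: int ^ 'd \<Rightarrow> complex) C. l2_bound (\<lambda>k. japanese_bracket k powr s) a C \<Longrightarrow> l1_bound japanese_bracket a (c * C)"
    using l2_imp_l1_bound[OF s] by blast
  \<comment> \<open>As \<open>c \<le> K\<close> and \<open>1 \<le> K\<close>, the bound \<open>K * \<sigma>\<close> holds for \<open>u\<close> both in \<open>H\<^sup>s\<close> and in the Wiener algebra.\<close>
  define K where "K = max 1 c"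
  have K: "1 \<le> K" "c \<le> K" by (auto simp: K_def)
  define p where "p i V = (case i of (j, a, b) \<Rightarrow> A j V $ a $ b)" for i :: "'d \<times> 'n \<times> 'n" and V
  have p: "real_polynomial_function (p i)" for i using poly by (cases i) (simp add: p_def[abs_def])
  have KM: "0 \<le> K * M" using K M by simp
  have "\<exists>C\<ge>0. \<forall>i. \<forall>\<mu> (u :: real ^ 'd \<Rightarrow> real ^ 'n). 0 \<le> \<mu> \<longrightarrow> \<mu> \<le> K * M \<longrightarrow> (\<forall>i. sobolev_bound s (\<lambda>x. u x $ i) \<mu>) \<longrightarrow>
    sobolev_bound s (\<lambda>x. p i (u x) - p i 0) (C * \<mu>)"
    using s1 by (intro uniform_constant polynomial_sobolev_bound p KM)
      (auto intro: sobolev_bound_mono mult_right_mono)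
  then obtain C1 where C1: "0 \<le> C1" "\<And>i \<mu> (u :: real ^ 'd \<Rightarrow> real ^ 'n). 0 \<le> \<mu> \<Longrightarrow> \<mu> \<le> K * M \<Longrightarrow>
    (\<forall>i. sobolev_bound s (\<lambda>x. u x $ i) \<mu>) \<Longrightarrow> sobolev_bound s (\<lambda>x. p i (u x) - p i 0) (C1 * \<mu>)" by blast
  have "\<exists>C\<ge>0. \<forall>i. \<forall>\<mu> (u :: real ^ 'd \<Rightarrow> real ^ 'n). 0 \<le> \<mu> \<longrightarrow> \<mu> \<le> K * M \<longrightarrow> (\<forall>i. wiener_bound (\<lambda>x. u x $ i) \<mu>) \<longrightarrow>
    wiener_bound (\<lambda>x. p i (u x) - p i 0) (C * \<mu>)"
    by (intro uniform_constant polynomial_wiener_bound p KM)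
      (auto intro: wiener_bound_mono mult_right_mono)
  then obtain C2 where C2: "0 \<le> C2" "\<And>i \<mu> (u :: real ^ 'd \<Rightarrow> real ^ 'n). 0 \<le> \<mu> \<Longrightarrow> \<mu> \<le> K * M \<Longrightarrow>
    (\<forall>i. wiener_bound (\<lambda>x. u x $ i) \<mu>) \<Longrightarrow> wiener_bound (\<lambda>x. p i (u x) - p i 0) (C2 * \<mu>)" by blast
  have "\<exists>C\<ge>0. \<forall>i. \<forall>\<epsilon> (u :: real ^ 'd \<Rightarrow> real ^ 'n) v.
    (\<forall>i. wiener_bound (\<lambda>x. u x $ i) (K * M)) \<longrightarrow> (\<forall>i. wiener_bound (\<lambda>x. v x $ i) (K * M)) \<longrightarrow>
    (\<forall>i. l2_bound (\<lambda>_. 1) (rcoef (\<lambda>x. u x $ i - v x $ i)) \<epsilon>) \<longrightarrow>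
    l2_bound (\<lambda>_. 1) (rcoef (\<lambda>x. p i (u x) - p i (v x))) (C * \<epsilon>)"
  proof (rule uniform_constant, rule polynomial_l2_lipschitz[OF p KM], intro allI impI)
    fix i C C' \<epsilon> and u v :: "real ^ 'd \<Rightarrow> real ^ 'n"
    assume C: "\<forall>\<epsilon> (u :: real ^ 'd \<Rightarrow> real ^ 'n) v.
      (\<forall>i. wiener_bound (\<lambda>x. u x $ i) (K * M)) \<longrightarrow> (\<forall>i. wiener_bound (\<lambda>x. v x $ i) (K * M)) \<longrightarrow>
      (\<forall>i. l2_bound (\<lambda>_. 1) (rcoef (\<lambda>x. u x $ i - v x $ i)) \<epsilon>) \<longrightarrow>
      l2_bound (\<lambda>_. 1) (rcoef (\<lambda>x. p i (u x) - p i (v x))) (C * \<epsilon>)" "C \<le> C'"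
    and uv: "\<forall>i. wiener_bound (\<lambda>x. u x $ i) (K * M)" "\<forall>i. wiener_bound (\<lambda>x. v x $ i) (K * M)"
      "\<forall>i. l2_bound (\<lambda>_. 1) (rcoef (\<lambda>x. u x $ i - v x $ i)) \<epsilon>"
    have "0 \<le> \<epsilon>" using uv(3) l2_bound_nonneg by blast
    then have "C * \<epsilon> \<le> C' * \<epsilon>" using C(2) by (rule mult_right_mono[rotated])
    then show "l2_bound (\<lambda>_. 1) (rcoef (\<lambda>x. p i (u x) - p i (v x))) (C' * \<epsilon>)"
      by (rule l2_bound_mono[OF C(1)[THEN spec, THEN spec, THEN spec, THEN mp, THEN mp, THEN mp, OF uv]])
  qed
  then obtain C3 where C3: "0 \<le> C3" "\<And>i \<epsilon> (u :: real ^ 'd \<Rightarrow> real ^ 'n) v.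
    (\<forall>i. wiener_bound (\<lambda>x. u x $ i) (K * M)) \<Longrightarrow> (\<forall>i. wiener_bound (\<lambda>x. v x $ i) (K * M)) \<Longrightarrow>
    (\<forall>i. l2_bound (\<lambda>_. 1) (rcoef (\<lambda>x. u x $ i - v x $ i)) \<epsilon>) \<Longrightarrow>
    l2_bound (\<lambda>_. 1) (rcoef (\<lambda>x. p i (u x) - p i (v x))) (C3 * \<epsilon>)" by blast
  define dn where "dn = real CARD('n) * (real CARD('d) * real CARD('n))"
  have dn: "0 \<le> dn" by (simp add: dn_def)
  define E1 where "E1 = 2 * s * 2 powr (s - 1) * (C1 * K) * K"
  define E2 where "E2 = C3 * K"
  define E3 where "E3 = dn * C2"
  have E: "0 \<le> E1" "0 \<le> E2" "0 \<le> E3" using s1 C1 C2 C3 K dn by (auto simp: E1_def E2_def E3_def)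
  define CC where "CC = dn * E1 + 2 * dn * E2 + E3"
  have main: "\<bar>\<Sum>k\<in>freqs N. \<Sum>a\<in>UNIV. Re (cnj (D a k) *
        (complex_of_real (\<pi> k) * rcoef (\<lambda>x. advection A u x $ a) k - rcoef (\<lambda>x. advection A v x $ a) k))\<bar>
      \<le> CC * \<mu> * ((\<Sum>k\<in>freqs N. \<Sum>a\<in>UNIV. (cmod (D a k))\<^sup>2) + (\<sigma> * real N powr (- s))\<^sup>2)"
    if N: "N \<ge> 1" and uv: "C1_periodic u" "C1_periodic v" and \<sigma>: "0 \<le> \<sigma>" "\<sigma> \<le> \<mu>" "\<mu> \<le> M"
      and u: "\<And>i. l2_bound (\<lambda>k. japanese_bracket k powr s) (rcoef (\<lambda>x. u x $ i)) \<sigma>"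
      and v: "\<And>i. l1_bound japanese_bracket (rcoef (\<lambda>x. v x $ i)) \<mu>"
      and supp: "\<And>i k. k \<notin> freqs N \<Longrightarrow> rcoef (\<lambda>x. v x $ i) k = 0"
      and \<pi>_def: "\<pi> = truncation_symbol s (real N)"
      and D_def: "D = (\<lambda>a k. complex_of_real (\<pi> k) * rcoef (\<lambda>x. u x $ a) k - rcoef (\<lambda>x. v x $ a) k)"
    for N and u v :: "real ^ 'd \<Rightarrow> real ^ 'n" and \<mu> \<sigma> \<pi> D
  proof -
    let ?F = "freqs N :: (int ^ 'd) set"
    define y where "y = (\<Sum>k\<in>?F. \<Sum>a\<in>UNIV. (cmod (D a k))\<^sup>2)"
    define e where "e = \<sigma> * real N powr (- s)"
    have y0: "0 \<le> y" unfolding y_def by (intro sum_nonneg) auto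
    have e0: "0 \<le> e" using \<sigma> by (simp add: e_def)
    have \<mu>0: "0 \<le> \<mu>" using \<sigma> by linarith
    have Npos: "0 < real N" using N by simp
    have \<pi>: "0 \<le> \<pi> k \<and> \<pi> k \<le> 1" for k
      unfolding \<pi>_def using truncation_symbol_bounds[OF Npos, of s k] s1 by simp
    have \<pi>0: "\<pi> k = 0" if "k \<notin> ?F" for k
      unfolding \<pi>_def using not_freqs_jb[OF that] Npos by (intro truncation_symbol_eq_0) auto
    have D0: "D a k = 0" if "k \<notin> ?F" for a k using \<pi>0[OF that] supp[OF that] by (simp add: D_def)
    have cu: "continuous_periodic (\<lambda>x. u x $ i)" and cv: "continuous_periodic (\<lambda>x. v x $ i)" for i
      using uv by (auto simp: C1_periodic_def)
    have u1: "l1_bound japanese_bracket (rcoef (\<lambda>x. u x $ i)) (K * \<sigma>)" for i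
      using c(2)[OF u[of i]] \<sigma> K by (rule_tac l1_bound_mono) (auto intro: mult_right_mono)
    have u2: "l2_bound (\<lambda>k. japanese_bracket k powr s) (rcoef (\<lambda>x. u x $ i)) (K * \<sigma>)" for i
      using u[of i] by (rule l2_bound_mono) (use \<sigma> K in \<open>simp add: mult_le_cancel_right1\<close>)
    have uS: "\<forall>i. sobolev_bound s (\<lambda>x. u x $ i) (K * \<sigma>)"
      using u1 u2 cu by (simp add: sobolev_bound_def wiener_bound_def)
    have le: "K * \<sigma> \<le> K * \<mu>" "K * \<sigma> \<le> K * M" "\<mu> \<le> K * M" "K * \<mu> \<le> K * M" "\<mu> \<le> K * \<mu>"
    proof -
      show "K * \<sigma> \<le> K * \<mu>" "K * \<sigma> \<le> K * M" "K * \<mu> \<le> K * M" using \<sigma> K by auto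
      show "\<mu> \<le> K * \<mu>" using K \<mu>0 by (simp add: mult_le_cancel_right1)
      then show "\<mu> \<le> K * M" using \<open>K * \<mu> \<le> K * M\<close> by linarith
    qed
    have uW: "\<forall>i. wiener_bound (\<lambda>x. u x $ i) (K * M)"
      using uS le by (auto simp: sobolev_bound_def intro: wiener_bound_mono)
    have vW: "\<forall>i. wiener_bound (\<lambda>x. v x $ i) \<mu>" using v cv by (simp add: wiener_bound_def)
    have vW': "\<forall>i. wiener_bound (\<lambda>x. v x $ i) (K * M)" using vW le by (auto intro: wiener_bound_mono)
    define \<alpha> where "\<alpha> j a b = rcoef (\<lambda>x. A j (u x) $ a $ b)" for j a b
    define \<alpha>v where "\<alpha>v j a b = rcoef (\<lambda>x. A j (v x) $ a $ b)" for j a b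
    define \<alpha>' where "\<alpha>' j a b = rcoef (\<lambda>x. A j (u x) $ a $ b - A j 0 $ a $ b)" for j a b
    define \<alpha>v' where "\<alpha>v' j a b = rcoef (\<lambda>x. A j (v x) $ a $ b - A j 0 $ a $ b)" for j a b
    have \<alpha>'S: "sobolev_bound s (\<lambda>x. A j (u x) $ a $ b - A j 0 $ a $ b) (C1 * (K * \<sigma>))" for j a b
      using C1(2)[OF _ le(2) uS, of "(j, a, b)"] \<sigma> K by (simp add: p_def)
    have \<alpha>v'W: "wiener_bound (\<lambda>x. A j (v x) $ a $ b - A j 0 $ a $ b) (C2 * \<mu>)" for j a b
      using C2(2)[OF \<mu>0 le(3) vW, of "(j, a, b)"] by (simp add: p_def)
    have cA: "continuous_periodic (\<lambda>x. A j (u x) $ a $ b)" "continuous_periodic (\<lambda>x. A j (v x) $ a $ b)" for j a b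
    proof -
      have "continuous_periodic (\<lambda>x. A j (u x) $ a $ b - A j 0 $ a $ b)"
        "continuous_periodic (\<lambda>x. A j (v x) $ a $ b - A j 0 $ a $ b)"
        using \<alpha>'S[of j a b] \<alpha>v'W[of j a b] unfolding sobolev_bound_def wiener_bound_def by blast+
      from this[THEN continuous_periodic_add[OF _ continuous_periodic_const[of "A j 0 $ a $ b"]]]
      show "continuous_periodic (\<lambda>x. A j (u x) $ a $ b)" "continuous_periodic (\<lambda>x. A j (v x) $ a $ b)" by simp_all
    qed
    have \<alpha>eq: "\<alpha> j a b m = \<alpha>' j a b m" "\<alpha>v j a b m = \<alpha>v' j a b m" if "m \<noteq> 0" for j a b m
      using that rcoef_diff[OF cA(1) continuous_periodic_const, of j a b "A j 0 $ a $ b" m]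
        rcoef_diff[OF cA(2) continuous_periodic_const, of j a b "A j 0 $ a $ b" m]
      by (simp_all add: \<alpha>_def \<alpha>'_def \<alpha>v_def \<alpha>v'_def rcoef_const)
    have diff: "l2_bound (\<lambda>_. 1) (\<lambda>k. \<alpha> j a b k - \<alpha>v j a b k) (C3 * (sqrt y + e))" for j a b
    proof -
      have "l2_bound (\<lambda>_. 1) (rcoef (\<lambda>x. u x $ i - v x $ i)) (e + sqrt y)" for i
      proof -
        have "rcoef (\<lambda>x. u x $ i - v x $ i) = (\<lambda>k. (1 - complex_of_real (\<pi> k)) * rcoef (\<lambda>x. u x $ i) k + D i k)"
          by (rule ext) (simp add: rcoef_diff[OF cu cv] D_def algebra_simps del: of_real_diff)
        moreover have "l2_bound (\<lambda>_. 1) (\<lambda>k. (1 - complex_of_real (\<pi> k)) * rcoef (\<lambda>x. u x $ i) k) e"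
          unfolding \<pi>_def e_def using s1 by (intro filter_remainder_l2_bound Npos u) simp
        moreover have "l2_bound (\<lambda>_. 1) (D i) (sqrt y)"
          unfolding l2_bound_def
        proof (intro conjI allI impI)
          fix F :: "(int ^ 'd) set" assume F: "finite F"
          have "(\<Sum>k\<in>F. (1 * cmod (D i k))\<^sup>2) = (\<Sum>k\<in>F \<inter> ?F. (cmod (D i k))\<^sup>2)"
            using F D0 by (intro sum.mono_neutral_cong_right) auto
          also have "\<dots> \<le> (\<Sum>k\<in>?F. (cmod (D i k))\<^sup>2)" by (intro sum_mono2) auto
          also have "\<dots> \<le> y" unfolding y_def by (intro sum_mono member_le_sum) auto
          finally show "(\<Sum>k\<in>F. (1 * cmod (D i k))\<^sup>2) \<le> (sqrt y)\<^sup>2" using y0 by simp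
        qed (use y0 in simp)
        ultimately show ?thesis using l2_bound_add[of "\<lambda>_. 1"] by simp
      qed
      then have "l2_bound (\<lambda>_. 1) (rcoef (\<lambda>x. p (j, a, b) (u x) - p (j, a, b) (v x))) (C3 * (e + sqrt y))"
        by (intro C3(2) uW vW') auto
      moreover have "rcoef (\<lambda>x. p (j, a, b) (u x) - p (j, a, b) (v x)) = (\<lambda>k. \<alpha> j a b k - \<alpha>v j a b k)"
        by (rule ext) (simp add: p_def \<alpha>_def \<alpha>v_def rcoef_diff[OF cA] del: of_real_diff)
      ultimately show ?thesis by (simp add: add.commute)
    qed
    define du where "du b j l = \<i> * of_int (l $ j) * rcoef (\<lambda>x. u x $ b) l" for b and j :: 'd and l
    define B where "B a k = complex_of_real (\<pi> k) * rcoef (\<lambda>x. advection A u x $ a) k - rcoef (\<lambda>x. advection A v x $ a) k" for a k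
    \<comment> \<open>The contributions of frequency \<open>l\<close> to commutator, source and transport term at frequency \<open>k\<close>.\<close>
    define t1 where "t1 a k l = (\<Sum>j\<in>UNIV. \<Sum>b\<in>UNIV. complex_of_real (\<pi> k - \<pi> l) * (\<alpha> j a b (k - l) * du b j l))" for a k l
    define t2 where "t2 a k l = (\<Sum>j\<in>UNIV. \<Sum>b\<in>UNIV. (\<alpha> j a b (k - l) - \<alpha>v j a b (k - l)) * (complex_of_real (\<pi> l) * du b j l))" for a k l
    define t3 where "t3 a k l = (\<Sum>j\<in>UNIV. \<Sum>b\<in>UNIV. \<alpha>v j a b (k - l) * (\<i> * of_int (l $ j) * D b l))" for a k l
    define T2 where "T2 a k = (\<Sum>l\<in>?F. t2 a k l)" for a k
    define T3 where "T3 a k = (\<Sum>l\<in>?F. t3 a k l)" for a k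
    \<comment> \<open>Source and transport involve only \<open>l\<close> in \<open>freqs N\<close>; the commutator is a genuine series, identified as the remainder.\<close>
    define T1 where "T1 a k = B a k - T2 a k - T3 a k" for a k
    have T1: "((\<lambda>l. t1 a k l) has_sum T1 a k) UNIV" for a k
    proof -
      let ?gu = "\<lambda>l. \<Sum>j\<in>UNIV. \<Sum>b\<in>UNIV. \<alpha> j a b (k - l) * (\<i> * of_int (l $ j) * rcoef (\<lambda>x. u x $ b) l)"
      let ?gv = "\<lambda>l. \<Sum>j\<in>UNIV. \<Sum>b\<in>UNIV. \<alpha>v j a b (k - l) * (\<i> * of_int (l $ j) * rcoef (\<lambda>x. v x $ b) l)"
      have "(?gu has_sum rcoef (\<lambda>x. advection A u x $ a) k) UNIV"
        unfolding \<alpha>_def by (rule rcoef_advection[OF uv(1) cA(1) u1])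
      moreover have "(?gv has_sum rcoef (\<lambda>x. advection A v x $ a) k) UNIV"
        unfolding \<alpha>v_def by (rule rcoef_advection[OF uv(2) cA(2) v])
      moreover have "((\<lambda>l. if l \<in> ?F then t2 a k l else 0) has_sum T2 a k) UNIV"
        "((\<lambda>l. if l \<in> ?F then t3 a k l else 0) has_sum T3 a k) UNIV"
        unfolding T2_def T3_def by (rule has_sum_finite_neutralI[of ?F]; simp)+
      ultimately have "((\<lambda>l. complex_of_real (\<pi> k) * ?gu l - ?gv l - (if l \<in> ?F then t2 a k l else 0) - (if l \<in> ?F then t3 a k l else 0))
        has_sum T1 a k) UNIV"
        unfolding T1_def B_def by (intro has_sum_diff has_sum_cmult_right)
      moreover have "complex_of_real (\<pi> k) * ?gu l - ?gv l - (if l \<in> ?F then t2 a k l else 0) - (if l \<in> ?F then t3 a k l else 0) = t1 a k l" for l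
      proof (cases "l \<in> ?F")
        case True
        have "complex_of_real (\<pi> k) * ?gu l - ?gv l - t2 a k l - t3 a k l =
          (\<Sum>j\<in>UNIV. \<Sum>b\<in>UNIV. complex_of_real (\<pi> k) * (\<alpha> j a b (k - l) * (\<i> * of_int (l $ j) * rcoef (\<lambda>x. u x $ b) l))
            - \<alpha>v j a b (k - l) * (\<i> * of_int (l $ j) * rcoef (\<lambda>x. v x $ b) l)
            - (\<alpha> j a b (k - l) - \<alpha>v j a b (k - l)) * (complex_of_real (\<pi> l) * du b j l)
            - \<alpha>v j a b (k - l) * (\<i> * of_int (l $ j) * D b l))"
          unfolding t2_def t3_def by (simp only: sum_subtractf sum_distrib_left)
        also have "\<dots> = t1 a k l" unfolding t1_def
          by (intro sum.cong refl) (simp add: du_def D_def algebra_simps)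
        finally show ?thesis using True by simp
      next
        case False
        then show ?thesis using \<pi>0[OF False] supp[OF False]
          by (simp add: t1_def du_def sum_distrib_left)
      qed
      ultimately show ?thesis by simp
    qed
    have dle: "(\<Sum>k\<in>?F. (cmod (D a k))\<^sup>2) \<le> y" for a unfolding y_def by (intro sum_mono member_le_sum) auto
    then have sle: "sqrt (\<Sum>k\<in>?F. (cmod (D a k))\<^sup>2) \<le> sqrt y" for a by simp
    have b1: "(\<Sum>k\<in>?F. cmod (D a k) * cmod (T1 a k)) \<le> (real CARD('d) * real CARD('n)) * (sqrt y * E1 * \<mu> * e)" for a
    proof (rule row_sums_bound[OF finite_freqs T1])
      fix F' :: "(int ^ 'd) set" assume F': "finite F'"
      have "(\<Sum>k\<in>?F. \<Sum>l\<in>F'. cmod (D a k) * cmod (t1 a k l))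
        \<le> (\<Sum>k\<in>?F. \<Sum>l\<in>F'. \<Sum>j\<in>UNIV. \<Sum>b\<in>UNIV. cmod (D a k) * cmod (complex_of_real (\<pi> k - \<pi> l) * (\<alpha> j a b (k - l) * du b j l)))"
        unfolding t1_def by (intro sum_mono mult_norm_double_sum_le) auto
      also have "\<dots> = (\<Sum>j\<in>UNIV. \<Sum>b\<in>UNIV. \<Sum>k\<in>?F. \<Sum>l\<in>F'. cmod (D a k) * cmod (complex_of_real (\<pi> k - \<pi> l) * (\<alpha> j a b (k - l) * du b j l)))"
        unfolding sum.swap[of _ F' UNIV] sum.swap[of _ ?F UNIV] ..
      also have "\<dots> \<le> (\<Sum>j\<in>(UNIV::'d set). \<Sum>b\<in>(UNIV::'n set). sqrt y * E1 * \<mu> * e)"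
      proof (rule sum_mono, rule sum_mono)
        fix j :: 'd and b :: 'n
        have "(\<Sum>k\<in>?F. \<Sum>l\<in>F'. cmod (D a k) * cmod (complex_of_real (\<pi> k - \<pi> l) * (\<alpha> j a b (k - l) * du b j l)))
          \<le> real N powr (- s) * (2 * s * 2 powr (s - 1)) * sqrt (\<Sum>k\<in>?F. (cmod (D a k))\<^sup>2) * (C1 * (K * \<sigma>)) * (K * \<sigma>)"
          unfolding \<pi>_def du_def
          using \<alpha>'S[of j a b] \<alpha>eq(1) u1 u2 F'
          by (intro commutator_pairing[where \<alpha>' = "\<alpha>' j a b"] s1 Npos)
            (auto simp: sobolev_bound_def wiener_bound_def \<alpha>'_def)
        also have "\<dots> \<le> real N powr (- s) * (2 * s * 2 powr (s - 1)) * sqrt y * (C1 * (K * \<mu>)) * (K * \<sigma>)"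
          using sle[of a] le(1) s1 C1(1) K \<sigma> \<mu>0 y0
          by (intro mult_mono) (auto intro!: sum_nonneg mult_nonneg_nonneg)
        also have "\<dots> = sqrt y * E1 * \<mu> * e" by (simp add: E1_def e_def mult_ac)
        finally show "(\<Sum>k\<in>?F. \<Sum>l\<in>F'. cmod (D a k) * cmod (complex_of_real (\<pi> k - \<pi> l) * (\<alpha> j a b (k - l) * du b j l)))
          \<le> sqrt y * E1 * \<mu> * e" .
      qed
      finally show "(\<Sum>k\<in>?F. \<Sum>l\<in>F'. cmod (D a k) * cmod (t1 a k l)) \<le> (real CARD('d) * real CARD('n)) * (sqrt y * E1 * \<mu> * e)"
        by simp
    qed auto
    have b2: "(\<Sum>k\<in>?F. cmod (D a k) * cmod (T2 a k)) \<le> (real CARD('d) * real CARD('n)) * (sqrt y * E2 * \<mu> * (sqrt y + e))" for a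
    proof -
      have "(\<Sum>k\<in>?F. cmod (D a k) * cmod (T2 a k))
        \<le> (\<Sum>k\<in>?F. \<Sum>l\<in>?F. \<Sum>j\<in>UNIV. \<Sum>b\<in>UNIV. cmod (D a k) * cmod ((\<alpha> j a b (k - l) - \<alpha>v j a b (k - l)) * (complex_of_real (\<pi> l) * du b j l)))"
        unfolding T2_def t2_def
        by (rule sum_mono, rule order_trans[OF mult_norm_sum_le]) (auto intro!: sum_mono mult_norm_double_sum_le)
      also have "\<dots> = (\<Sum>j\<in>UNIV. \<Sum>b\<in>UNIV. \<Sum>k\<in>?F. \<Sum>l\<in>?F. cmod (D a k) * cmod ((\<alpha> j a b (k - l) - \<alpha>v j a b (k - l)) * (complex_of_real (\<pi> l) * du b j l)))"
        unfolding sum.swap[of _ ?F UNIV] ..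
      also have "\<dots> \<le> (\<Sum>j\<in>(UNIV::'d set). \<Sum>b\<in>(UNIV::'n set). sqrt y * E2 * \<mu> * (sqrt y + e))"
      proof (rule sum_mono, rule sum_mono)
        fix j :: 'd and b :: 'n
        have "(\<Sum>k\<in>?F. \<Sum>l\<in>?F. cmod (D a k) * cmod ((\<alpha> j a b (k - l) - \<alpha>v j a b (k - l)) * (complex_of_real (\<pi> l) * du b j l)))
          \<le> sqrt (\<Sum>k\<in>?F. (cmod (D a k))\<^sup>2) * (C3 * (sqrt y + e)) * (K * \<sigma>)"
          unfolding du_def by (rule source_pairing[OF diff u1 \<pi>]) auto
        also have "\<dots> \<le> sqrt y * (C3 * (sqrt y + e)) * (K * \<mu>)"
          using sle[of a] le(1) C3(1) K \<sigma> \<mu>0 y0 e0 by (intro mult_mono) (auto intro: sum_nonneg)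
        also have "\<dots> = sqrt y * E2 * \<mu> * (sqrt y + e)" by (simp add: E2_def mult_ac)
        finally show "(\<Sum>k\<in>?F. \<Sum>l\<in>?F. cmod (D a k) * cmod ((\<alpha> j a b (k - l) - \<alpha>v j a b (k - l)) * (complex_of_real (\<pi> l) * du b j l)))
          \<le> sqrt y * E2 * \<mu> * (sqrt y + e)" .
      qed
      finally show ?thesis by simp
    qed
    have b3: "\<bar>\<Sum>k\<in>?F. \<Sum>a\<in>UNIV. Re (cnj (D a k) * T3 a k)\<bar> \<le> E3 * \<mu> * y"
    proof -
      have "(\<Sum>k\<in>?F. \<Sum>a\<in>UNIV. Re (cnj (D a k) * T3 a k)) =
        (\<Sum>j\<in>UNIV. Re (\<Sum>a\<in>UNIV. \<Sum>b\<in>UNIV. \<Sum>k\<in>?F. \<Sum>l\<in>?F. cnj (D a k) * (\<alpha>v j a b (k - l) * (\<i> * of_int (l $ j) * D b l))))"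
      proof -
        have "(\<Sum>k\<in>?F. \<Sum>a\<in>UNIV. Re (cnj (D a k) * T3 a k)) =
          Re (\<Sum>k\<in>?F. \<Sum>a\<in>UNIV. \<Sum>l\<in>?F. \<Sum>j\<in>UNIV. \<Sum>b\<in>UNIV. cnj (D a k) * (\<alpha>v j a b (k - l) * (\<i> * of_int (l $ j) * D b l)))"
          by (simp add: T3_def t3_def sum_distrib_left)
        also have "(\<Sum>k\<in>?F. \<Sum>a\<in>UNIV. \<Sum>l\<in>?F. \<Sum>j\<in>UNIV. \<Sum>b\<in>UNIV. cnj (D a k) * (\<alpha>v j a b (k - l) * (\<i> * of_int (l $ j) * D b l)))
          = (\<Sum>j\<in>UNIV. \<Sum>a\<in>UNIV. \<Sum>b\<in>UNIV. \<Sum>k\<in>?F. \<Sum>l\<in>?F. cnj (D a k) * (\<alpha>v j a b (k - l) * (\<i> * of_int (l $ j) * D b l)))"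
        proof -
          have "(\<Sum>k\<in>?F. \<Sum>a\<in>UNIV. \<Sum>l\<in>?F. \<Sum>j\<in>UNIV. \<Sum>b\<in>UNIV. G j a b k l)
            = (\<Sum>j\<in>UNIV. \<Sum>a\<in>UNIV. \<Sum>b\<in>UNIV. \<Sum>k\<in>?F. \<Sum>l\<in>?F. G j a b k l)"
            for G :: "'d \<Rightarrow> 'n \<Rightarrow> 'n \<Rightarrow> int ^ 'd \<Rightarrow> int ^ 'd \<Rightarrow> complex"
            unfolding sum.swap[of _ ?F UNIV] by (subst sum.swap) (rule refl)
          then show ?thesis .
        qed
        finally show ?thesis by simp
      qed
      also have "\<bar>\<dots>\<bar> \<le> (\<Sum>j\<in>(UNIV::'d set). (real CARD('n))\<^sup>2 * (C2 * \<mu>) * y)"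
        unfolding y_def
      proof (intro order_trans[OF sum_abs] sum_mono symmetric_transport_pairing)
        fix j :: 'd and a b :: 'n and m :: "int ^ 'd"
        have "A j V $ a $ b = A j V $ b $ a" for V using arg_cong[OF sym[of j V], of "\<lambda>m. m $ b $ a"] by (simp add: transpose_def)
        then show "\<alpha>v j a b m = \<alpha>v j b a m" by (simp add: \<alpha>v_def)
        show "\<alpha>v j a b (- m) = cnj (\<alpha>v j a b m)" unfolding \<alpha>v_def by (rule coef_real_cnj)
        show "m \<noteq> 0 \<Longrightarrow> \<alpha>v j a b m = \<alpha>v' j a b m" by (rule \<alpha>eq)
        show "l1_bound japanese_bracket (\<alpha>v' j a b) (C2 * \<mu>)" using \<alpha>v'W by (simp add: \<alpha>v'_def wiener_bound_def)
      qed simp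
      finally show ?thesis by (simp add: E3_def dn_def power2_eq_square mult_ac)
    qed
    have "(\<Sum>k\<in>?F. \<Sum>a\<in>UNIV. Re (cnj (D a k) * B a k)) = (\<Sum>k\<in>?F. \<Sum>a\<in>UNIV. Re (cnj (D a k) * T1 a k))
        + (\<Sum>k\<in>?F. \<Sum>a\<in>UNIV. Re (cnj (D a k) * T2 a k)) + (\<Sum>k\<in>?F. \<Sum>a\<in>UNIV. Re (cnj (D a k) * T3 a k))"
    proof -
      have "Re (cnj (D a k) * B a k) = Re (cnj (D a k) * T1 a k) + Re (cnj (D a k) * T2 a k) + Re (cnj (D a k) * T3 a k)" for a k
        by (simp add: T1_def algebra_simps)
      then show ?thesis by (simp only: sum.distrib)
    qed
    moreover have "\<bar>\<Sum>k\<in>?F. \<Sum>a\<in>UNIV. Re (cnj (D a k) * T a k)\<bar> \<le> real CARD('n) * X"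
      if X: "\<And>a. (\<Sum>k\<in>?F. cmod (D a k) * cmod (T a k)) \<le> X" for T X
    proof -
      have "\<bar>\<Sum>k\<in>?F. \<Sum>a\<in>UNIV. Re (cnj (D a k) * T a k)\<bar> \<le> (\<Sum>k\<in>?F. \<Sum>a\<in>UNIV. cmod (D a k) * cmod (T a k))"
      proof (intro order_trans[OF sum_abs] sum_mono)
        fix k and a :: 'n
        show "\<bar>Re (cnj (D a k) * T a k)\<bar> \<le> cmod (D a k) * cmod (T a k)"
          by (metis abs_Re_le_cmod complex_mod_cnj norm_mult)
      qed
      also have "\<dots> = (\<Sum>a\<in>UNIV. \<Sum>k\<in>?F. cmod (D a k) * cmod (T a k))" by (rule sum.swap)
      also have "\<dots> \<le> (\<Sum>a\<in>(UNIV::'n set). X)" by (intro sum_mono X)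
      finally show ?thesis by simp
    qed
    from this[of T1, OF b1] this[of T2, OF b2]
    have "\<bar>\<Sum>k\<in>?F. \<Sum>a\<in>UNIV. Re (cnj (D a k) * T1 a k)\<bar> \<le> dn * (sqrt y * E1 * \<mu> * e)"
      "\<bar>\<Sum>k\<in>?F. \<Sum>a\<in>UNIV. Re (cnj (D a k) * T2 a k)\<bar> \<le> dn * (sqrt y * E2 * \<mu> * (sqrt y + e))"
      by (simp_all only: dn_def mult.assoc)
    ultimately have "\<bar>\<Sum>k\<in>?F. \<Sum>a\<in>UNIV. Re (cnj (D a k) * B a k)\<bar>
      \<le> dn * (sqrt y * E1 * \<mu> * e) + dn * (sqrt y * E2 * \<mu> * (sqrt y + e)) + E3 * \<mu> * y"
      using b3 by linarith
    also have "\<dots> = \<mu> * (dn * E1 * (sqrt y * e) + dn * E2 * (sqrt y * sqrt y + sqrt y * e) + E3 * y)"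
      by (simp add: algebra_simps)
    also have "\<dots> \<le> \<mu> * (dn * E1 * (y + e\<^sup>2) + dn * E2 * ((y + e\<^sup>2) + (y + e\<^sup>2)) + E3 * (y + e\<^sup>2))"
    proof -
      have "2 * (sqrt y * e) \<le> (sqrt y)\<^sup>2 + e\<^sup>2" using sum_squares_bound[of "sqrt y" e] by simp
      then have 1: "sqrt y * e \<le> y + e\<^sup>2" using y0 e0 by (simp add: real_sqrt_pow2) (smt (verit) mult_nonneg_nonneg real_sqrt_ge_0_iff)
      have 2: "sqrt y * sqrt y \<le> y + e\<^sup>2" "y \<le> y + e\<^sup>2" using y0 by auto
      show ?thesis using 1 2 E dn \<mu>0 by (intro mult_left_mono add_mono) auto
    qed
    also have "\<dots> = CC * \<mu> * (y + e\<^sup>2)" by (simp add: CC_def algebra_simps)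
    finally show ?thesis by (simp add: B_def y_def e_def)
  qed
  have "0 \<le> CC" using E dn by (simp add: CC_def)
  then show ?thesis unfolding energy_defect_def defect_pairing_def
    by (intro exI[of _ CC] conjI allI impI main) auto
qed

section \<open>Sobolev norms and filters in terms of coefficients\<close>

lemma sobolev_weight_eq:
  "japanese_bracket k powr (2 * s) * (norm (fourier_coeff U k))\<^sup>2 = (japanese_bracket k powr s * norm (fourier_coeff U k))\<^sup>2"
  by (simp add: power_mult_distrib powr_powr mult.commute flip: powr_numeral)

lemma norm_fourier_coeff_sq:
  "(norm (fourier_coeff U k))\<^sup>2 = (\<Sum>i\<in>UNIV. (cmod (rcoef (\<lambda>x. U x $ i) k))\<^sup>2)"
  by (simp add: norm_vec_def L2_set_def sum_nonneg fourier_coeff_component)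

lemma sobolev_norm_partial_sums:
  assumes "U \<in> sobolev s" "finite F"
  shows "(\<Sum>k\<in>F. (japanese_bracket k powr s * norm (fourier_coeff U k))\<^sup>2) \<le> (sobolev_norm s U)\<^sup>2"
proof -
  have sm: "(\<lambda>k. (japanese_bracket k powr s * norm (fourier_coeff U k))\<^sup>2) summable_on UNIV"
    using assms(1) by (simp add: sobolev_def sobolev_weight_eq)
  have "(\<Sum>k\<in>F. (japanese_bracket k powr s * norm (fourier_coeff U k))\<^sup>2)
    \<le> (\<Sum>\<^sub>\<infinity>k. (japanese_bracket k powr s * norm (fourier_coeff U k))\<^sup>2)"
    using sm assms(2) by (intro finite_sum_le_infsum) auto
  also have "\<dots> = (sobolev_norm s U)\<^sup>2"
    by (simp add: sobolev_norm_def sobolev_weight_eq infsum_nonneg)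
  finally show ?thesis .
qed

lemma sobolev_norm_nonneg: "0 \<le> sobolev_norm s U"
  by (simp add: sobolev_norm_def infsum_nonneg)

lemma sobolev_norm_le:
  assumes "0 \<le> B" "\<And>F. finite F \<Longrightarrow> (\<Sum>k\<in>F. (japanese_bracket k powr s * norm (fourier_coeff U k))\<^sup>2) \<le> B\<^sup>2"
  shows "sobolev_norm s U \<le> B"
proof -
  have sm: "(\<lambda>k. (japanese_bracket k powr s * norm (fourier_coeff U k))\<^sup>2) summable_on UNIV"
    by (rule nonneg_bounded_partial_sums_imp_summable_on[where C = "B\<^sup>2"]) (use assms in \<open>auto\<close>)
  have "(\<Sum>\<^sub>\<infinity>k. (japanese_bracket k powr s * norm (fourier_coeff U k))\<^sup>2) \<le> B\<^sup>2"
    by (rule infsum_le_finite_sums[OF sm]) (use assms in auto)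
  then show ?thesis unfolding sobolev_norm_def sobolev_weight_eq
    using assms(1) by (intro real_le_lsqrt) (auto intro: infsum_nonneg)
qed

lemma low_pass_component:
  "complex_of_real (low_pass N W x $ i) = (\<Sum>k\<in>freqs N. rcoef (\<lambda>x. W x $ i) k * cis (freq_dot k x))"
proof -
  let ?S = "\<Sum>k\<in>freqs N. rcoef (\<lambda>x. W x $ i) k * cis (freq_dot k x)"
  have "cnj ?S = (\<Sum>k\<in>freqs N. rcoef (\<lambda>x. W x $ i) (- k) * cis (freq_dot (- k) x))"
    by (simp add: coef_real_cnj freq_dot_simps cis_cnj)
  also have "\<dots> = ?S"
    by (rule sum.reindex_bij_witness[of _ uminus uminus]) (auto simp: freqs_uminus)
  finally have "?S \<in> \<real>" by (simp only: Reals_cnj_iff)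
  then have "?S = complex_of_real (Re ?S)" by (simp only: of_real_Re)
  moreover have "low_pass N W x $ i = Re ?S"
    by (simp add: low_pass_def freqs_def fourier_coeff_component)
  ultimately show ?thesis by (simp only:)
qed

lemma rcoef_low_pass:
  "rcoef (\<lambda>x. low_pass N W x $ i) k = (if k \<in> freqs N then rcoef (\<lambda>x. W x $ i) k else 0)"
  unfolding low_pass_component by (rule coef_trig_sum) simp

lemma low_pass_continuous_periodic: "continuous_periodic (\<lambda>x. low_pass N W x $ i)"
proof -
  have "continuous_periodic (\<lambda>x. Re (\<Sum>k\<in>freqs N. rcoef (\<lambda>x. W x $ i) k * cis (freq_dot k x)))"
    by (rule continuous_periodic_compose[OF continuous_periodic_trig_sum]) (intro continuous_intros)
  then show ?thesis by (simp add: low_pass_def freqs_def fourier_coeff_component)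
qed

lemma continuous_on_vec_components:
  fixes f :: "'a::topological_space \<Rightarrow> real ^ 'n"
  shows "(\<And>i. continuous_on S (\<lambda>x. f x $ i)) \<Longrightarrow> continuous_on S f"
  using continuous_on_vec_lambda[of S "\<lambda>i x. f x $ i"] by simp

lemma rcoef_AE_cong:
  fixes U V :: "real ^ 'd \<Rightarrow> real ^ 'n"
  assumes "AE x in lebesgue. U x = V x" "U \<in> borel_measurable lebesgue" "V \<in> borel_measurable lebesgue"
  shows "rcoef (\<lambda>x. U x $ i) k = rcoef (\<lambda>x. V x $ i) k"
proof -
  have c: "(\<lambda>x. cis (- freq_dot k x)) \<in> borel_measurable lebesgue"
    using continuous_periodicD(1)[OF continuous_periodic_cis_minus, of UNIV k]
    by (intro measurable_completion) (auto intro: borel_measurable_continuous_onI)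
  have m: "(\<lambda>x. indicator torus_cell x *\<^sub>R (complex_of_real (W x $ i) * cis (- freq_dot k x))) \<in> borel_measurable lebesgue"
    if "W \<in> borel_measurable lebesgue" for W :: "real ^ 'd \<Rightarrow> real ^ 'n"
  proof -
    have "(\<lambda>x. complex_of_real (W x $ i)) \<in> borel_measurable lebesgue"
      by (rule borel_measurable_continuous_on[OF _ that]) (intro continuous_intros)
    moreover have "(torus_cell :: (real ^ 'd) set) \<in> sets lebesgue" by (simp add: torus_cell_def)
    ultimately show ?thesis using c by (intro borel_measurable_scaleR borel_measurable_times borel_measurable_indicator)
  qed
  show ?thesis unfolding coef_def set_lebesgue_integral_def
    using assms by (intro arg_cong2[where f = "(/)"] integral_cong_AE m refl) auto
qed

section \<open>Solutions as flows of Fourier coefficients\<close>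

lemma C1_on_slices:
  fixes u :: "real \<Rightarrow> real ^ 'd::finite \<Rightarrow> real ^ 'n::finite"
  assumes "C1_on (I \<times> UNIV) (\<lambda>(t, x). u t x)"
  shows "t \<in> I \<Longrightarrow> ((\<lambda>\<tau>. u \<tau> x) has_vector_derivative vector_derivative (\<lambda>\<tau>. u \<tau> x) (at t)) (at t)"
    and "t \<in> I \<Longrightarrow> ((\<lambda>h. u t (x + axis j h)) has_vector_derivative partial_x j (u t) x) (at 0)"
    and "continuous_on (I \<times> UNIV) (\<lambda>(t, x). vector_derivative (\<lambda>\<tau>. u \<tau> x) (at t))"
    and "continuous_on (I \<times> UNIV) (\<lambda>(t, x). partial_x j (u t) x)"
    and "continuous_on (I \<times> UNIV) (\<lambda>(t, x). u t x)"
proof -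
  obtain D where D: "continuous_on (I \<times> UNIV) D"
    "\<And>p. p \<in> I \<times> UNIV \<Longrightarrow> ((\<lambda>(t, x). u t x) has_derivative blinfun_apply (D p)) (at p)"
    using assms by (auto simp: C1_on_def)
  have dt: "((\<lambda>\<tau>. u \<tau> x) has_vector_derivative D (t, x) (1, 0)) (at t)" if "t \<in> I" for t x
  proof -
    have "((\<lambda>\<tau>. (\<tau>, x)) has_derivative (\<lambda>\<tau>. (\<tau>, 0))) (at t)" by (auto intro!: derivative_eq_intros)
    from has_derivative_compose[OF this, of "\<lambda>(t, x). u t x" "blinfun_apply (D (t, x))"] D(2)[of "(t, x)"] that
    have "((\<lambda>\<tau>. u \<tau> x) has_derivative (\<lambda>\<tau>. D (t, x) (\<tau>, 0))) (at t)" by simp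
    moreover have "(\<lambda>\<tau>. D (t, x) (\<tau>, 0)) = (\<lambda>\<tau>. \<tau> *\<^sub>R D (t, x) (1, 0))"
    proof
      show "D (t, x) (\<tau>, 0) = \<tau> *\<^sub>R D (t, x) (1, 0)" for \<tau>
        using blinfun.scaleR_right[of "D (t, x)" \<tau> "(1, 0)"] by simp
    qed
    ultimately show ?thesis by (simp only: has_vector_derivative_def)
  qed
  have dx: "((\<lambda>h. u t (x + axis j h)) has_vector_derivative D (t, x) (0, axis j 1)) (at 0)" if "t \<in> I" for t x j
  proof -
    have ax: "axis j h = h *\<^sub>R (axis j 1 :: real ^ 'd)" for h by (simp add: vec_eq_iff axis_def)
    have "((\<lambda>h. (t, x + h *\<^sub>R axis j 1)) has_derivative (\<lambda>h. (0, h *\<^sub>R axis j 1))) (at 0)"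
      by (auto intro!: derivative_eq_intros)
    from has_derivative_compose[OF this, of "\<lambda>(t, x). u t x" "blinfun_apply (D (t, x))"] D(2)[of "(t, x)"] that
    have "((\<lambda>h. u t (x + h *\<^sub>R axis j 1)) has_derivative (\<lambda>h. D (t, x) (0, h *\<^sub>R axis j 1))) (at 0)" by simp
    moreover have "(\<lambda>h. D (t, x) (0, h *\<^sub>R axis j 1)) = (\<lambda>h. h *\<^sub>R D (t, x) (0, axis j 1))"
    proof
      show "D (t, x) (0, h *\<^sub>R axis j 1) = h *\<^sub>R D (t, x) (0, axis j 1)" for h
        using blinfun.scaleR_right[of "D (t, x)" h "(0, axis j 1)"] by simp
    qed
    moreover have "(\<lambda>h. u t (x + axis j h)) = (\<lambda>h. u t (x + h *\<^sub>R axis j 1))"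
      by (rule ext) (subst ax, rule refl)
    ultimately show ?thesis by (simp only: has_vector_derivative_def)
  qed
  show "t \<in> I \<Longrightarrow> ((\<lambda>\<tau>. u \<tau> x) has_vector_derivative vector_derivative (\<lambda>\<tau>. u \<tau> x) (at t)) (at t)"
    by (subst vector_derivative_at[OF dt]) (auto intro: dt)
  have px: "t \<in> I \<Longrightarrow> partial_x j (u t) x = D (t, x) (0, axis j 1)" for t x j
    unfolding partial_x_def using dx by (rule vector_derivative_at)
  then show "t \<in> I \<Longrightarrow> ((\<lambda>h. u t (x + axis j h)) has_vector_derivative partial_x j (u t) x) (at 0)"
    using dx by simp
  have "continuous_on (I \<times> UNIV) (\<lambda>p. D p (1, 0))" using D(1) by (intro continuous_intros)
  then show "continuous_on (I \<times> UNIV) (\<lambda>(t, x). vector_derivative (\<lambda>\<tau>. u \<tau> x) (at t))"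
    by (rule continuous_on_eq) (auto simp: vector_derivative_at[OF dt])
  have "continuous_on (I \<times> UNIV) (\<lambda>p. D p (0, axis j 1))" using D(1) by (intro continuous_intros)
  then show "continuous_on (I \<times> UNIV) (\<lambda>(t, x). partial_x j (u t) x)"
    by (rule continuous_on_eq) (auto simp: px)
  show "continuous_on (I \<times> UNIV) (\<lambda>(t, x). u t x)"
    using D(2) by (intro has_derivative_continuous_on[where f' = "\<lambda>p. blinfun_apply (D p)"])
      (auto intro: has_derivative_at_withinI)
qed

lemma continuous_slice:
  assumes "continuous_on (I \<times> UNIV) (\<lambda>(t, x). f t x)" "t \<in> I"
  shows "continuous_on UNIV (f t)"
proof -
  have "continuous_on UNIV (\<lambda>x. (t, x))" by (intro continuous_intros)
  from continuous_on_compose2[OF assms(1) this] assms(2) show ?thesis by auto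
qed

lemma C1_on_imp_C1_periodic:
  fixes u :: "real \<Rightarrow> real ^ 'd::finite \<Rightarrow> real ^ 'n::finite"
  assumes "C1_on (I \<times> UNIV) (\<lambda>(t, x). u t x)" "t \<in> I" and per: "torus_periodic (u t)"
  shows "C1_periodic (u t)"
  unfolding C1_periodic_def
proof (intro conjI allI)
  note sl = C1_on_slices[OF assms(1)]
  show "continuous_periodic (\<lambda>x. u t x $ i)" for i
    using continuous_slice[OF sl(5) assms(2)] per
    by (auto simp: continuous_periodic_def torus_periodic_def intro!: continuous_intros)
  show "((\<lambda>h. u t (x + axis j h)) has_vector_derivative partial_x j (u t) x) (at 0)" for j x
    using sl(2) assms(2) by blast
  have "partial_x j (u t) (x + axis i (2 * pi)) = partial_x j (u t) x" for j i x
  proof -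
    have "u t (x + axis i (2 * pi) + axis j h) = u t (x + axis j h)" for h
      using per unfolding torus_periodic_def by (metis add.assoc add.commute)
    then show ?thesis by (simp add: partial_x_def)
  qed
  then show "continuous_periodic (\<lambda>x. partial_x j (u t) x $ i)" for j i
    using continuous_slice[OF sl(4) assms(2)]
    by (auto simp: continuous_periodic_def torus_periodic_def intro!: continuous_intros)
qed

lemma rcoef_time_derivative:
  fixes u :: "real \<Rightarrow> real ^ 'd::finite \<Rightarrow> real ^ 'n::finite"
  assumes I: "open I" "is_interval I" "t \<in> I" and C1: "C1_on (I \<times> UNIV) (\<lambda>(t, x). u t x)"
    and per: "\<And>t. t \<in> I \<Longrightarrow> torus_periodic (u t)"
  shows "((\<lambda>\<tau>. rcoef (\<lambda>x. u \<tau> x $ i) k) has_vector_derivative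
    rcoef (\<lambda>x. vector_derivative (\<lambda>\<tau>. u \<tau> x) (at t) $ i) k) (at t)"
proof -
  note sl = C1_on_slices[OF C1]
  define c where "c = complex_of_real ((2 * pi) ^ CARD('d))"
  have cp: "continuous_periodic (\<lambda>x. complex_of_real (u \<tau> x $ i))" if "\<tau> \<in> I" for \<tau>
    using C1_on_imp_C1_periodic[OF C1 that per[OF that]]
    by (intro continuous_periodic_of_real) (auto simp: C1_periodic_def)
  let ?d = "\<lambda>t x. vector_derivative (\<lambda>\<tau>. u \<tau> x) (at t)"
  have cpd: "continuous_periodic (\<lambda>x. complex_of_real (?d t x $ i))"
  proof (rule continuous_periodic_of_real)
    have "(?d t (x + axis j (2 * pi))) = ?d t x" for x j
    proof -
      have "((\<lambda>\<tau>. u \<tau> x) has_vector_derivative ?d t x) (at t)" using sl(1) I(3) by blast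
      then have "((\<lambda>\<tau>. u \<tau> (x + axis j (2 * pi))) has_vector_derivative ?d t x) (at t)"
        by (rule has_vector_derivative_transform_within_open[OF _ I(1,3)])
          (use per in \<open>auto simp: torus_periodic_def\<close>)
      then show ?thesis by (rule vector_derivative_at)
    qed
    then show "continuous_periodic (\<lambda>x. ?d t x $ i)"
      using continuous_slice[OF sl(3) I(3)]
      by (auto simp: continuous_periodic_def torus_periodic_def intro!: continuous_intros)
  qed
  have "((\<lambda>\<tau>. integral torus_cell (\<lambda>x. complex_of_real (u \<tau> x $ i) * cis (- freq_dot k x))) has_vector_derivative
      integral torus_cell (\<lambda>x. complex_of_real (?d t x $ i) * cis (- freq_dot k x))) (at t within I)"
    unfolding torus_cell_def
  proof (rule leibniz_rule_vector_derivative)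
    show "convex I" using I(2) by (rule is_interval_convex)
    show "t \<in> I" by fact
    fix \<tau> x assume \<tau>: "\<tau> \<in> I"
    have "((\<lambda>\<tau>. u \<tau> x) has_vector_derivative ?d \<tau> x) (at \<tau> within I)"
      using sl(1)[OF \<tau>] by (rule has_vector_derivative_at_within)
    moreover have "bounded_linear (\<lambda>v :: real ^ 'n. complex_of_real (v $ i) * cis (- freq_dot k x))"
      by (intro bounded_linear_mult_const bounded_linear_compose[OF bounded_linear_of_real bounded_linear_vec_nth])
    ultimately show "((\<lambda>\<tau>. complex_of_real (u \<tau> x $ i) * cis (- freq_dot k x)) has_vector_derivative
        complex_of_real (?d \<tau> x $ i) * cis (- freq_dot k x)) (at \<tau> within I)"
      by (rule bounded_linear.has_vector_derivative[rotated])
  next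
    fix \<tau> assume \<tau>: "\<tau> \<in> I"
    show "(\<lambda>x. complex_of_real (u \<tau> x $ i) * cis (- freq_dot k x)) integrable_on cbox 0 (\<chi> j. 2 * pi)"
      using coef_integrable[OF cp[OF \<tau>]] by (simp add: torus_cell_def)
  next
    have "continuous_on (I \<times> cbox 0 (\<chi> j. 2 * pi)) (\<lambda>p. ?d (fst p) (snd p))"
      using continuous_on_subset[OF sl(3), of "I \<times> cbox 0 (\<chi> j. 2 * pi)"] by (auto simp: case_prod_beta')
    moreover have "continuous_on (I \<times> cbox 0 (\<chi> j. 2 * pi)) (\<lambda>p. freq_dot k (snd p))"
      by (rule continuous_on_compose2[OF continuous_on_freq_dot[of UNIV]]) (auto intro!: continuous_intros)
    ultimately show "continuous_on (I \<times> cbox 0 (\<chi> j. 2 * pi)) (\<lambda>(\<tau>, x). complex_of_real (?d \<tau> x $ i) * cis (- freq_dot k x))"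
      unfolding case_prod_beta'
      by (intro continuous_on_mult continuous_on_cis continuous_on_minus continuous_on_of_real continuous_on_component)
  qed
  then have "((\<lambda>\<tau>. integral torus_cell (\<lambda>x. complex_of_real (u \<tau> x $ i) * cis (- freq_dot k x)) / c) has_vector_derivative
      integral torus_cell (\<lambda>x. complex_of_real (?d t x $ i) * cis (- freq_dot k x)) / c) (at t within I)"
    by (rule has_vector_derivative_divide)
  then have "((\<lambda>\<tau>. integral torus_cell (\<lambda>x. complex_of_real (u \<tau> x $ i) * cis (- freq_dot k x)) / c) has_vector_derivative
      rcoef (\<lambda>x. ?d t x $ i) k) (at t)"
    unfolding at_within_open[OF I(3,1)] coef_eq_integral[OF cpd] c_def .
  then show ?thesis
    by (rule has_vector_derivative_transform_within_open[OF _ I(1,3)]) (simp only: coef_eq_integral[OF cp] c_def)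
qed

text \<open>On the coefficients in \<open>freqs N\<close> the filtered equation coincides with the unfiltered one, so that
  a single notion, restricted to a set \<open>S\<close> of frequencies, covers both.\<close>

definition coefficient_flow ::
  "('d::finite \<Rightarrow> real ^ 'n::finite \<Rightarrow> real ^ 'n ^ 'n) \<Rightarrow> (int ^ 'd) set \<Rightarrow> real set \<Rightarrow> (real \<Rightarrow> real ^ 'd \<Rightarrow> real ^ 'n) \<Rightarrow> bool" where
  "coefficient_flow A S I u \<longleftrightarrow> (\<forall>t\<in>I. C1_periodic (u t) \<and>
     (\<forall>i. \<forall>k\<in>S. ((\<lambda>\<tau>. rcoef (\<lambda>x. u \<tau> x $ i) k) has_vector_derivative
        - rcoef (\<lambda>x. advection A (u t) x $ i) k) (at t)))"

lemma rcoef_uminus: "rcoef (\<lambda>x. - f x) k = - rcoef f k"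
  by (simp add: coef_def set_lebesgue_integral_def)

lemma sobolev_periodic: "U \<in> sobolev s \<Longrightarrow> torus_periodic U"
  by (simp add: sobolev_def torus_L2_def)

lemma classical_solution_coef_derivative:
  assumes "classical_solution s F U0 I u" "t \<in> I"
  shows "((\<lambda>\<tau>. rcoef (\<lambda>x. u \<tau> x $ i) k) has_vector_derivative - rcoef (\<lambda>x. F (u t) x $ i) k) (at t)"
proof -
  have *: "vector_derivative (\<lambda>\<tau>. u \<tau> x) (at t) $ i = - (F (u t) x $ i)" for x
  proof -
    have "vector_derivative (\<lambda>\<tau>. u \<tau> x) (at t) + F (u t) x = 0"
      using assms by (simp add: classical_solution_def)
    then show ?thesis by (metis add_eq_0_iff2 vector_uminus_component)
  qed
  have "((\<lambda>\<tau>. rcoef (\<lambda>x. u \<tau> x $ i) k) has_vector_derivative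
    rcoef (\<lambda>x. vector_derivative (\<lambda>\<tau>. u \<tau> x) (at t) $ i) k) (at t)"
    using assms by (intro rcoef_time_derivative) (auto simp: classical_solution_def intro: sobolev_periodic)
  then show ?thesis unfolding * rcoef_uminus .
qed

lemma classical_solution_C1_periodic:
  assumes "classical_solution s F U0 I u" "t \<in> I"
  shows "C1_periodic (u t)"
  using assms by (intro C1_on_imp_C1_periodic[of I]) (auto simp: classical_solution_def intro: sobolev_periodic)

lemma classical_solution_initial_coef:
  assumes "classical_solution s F U0 I u" "U0 \<in> borel_measurable lebesgue"
  shows "rcoef (\<lambda>x. u 0 x $ i) k = rcoef (\<lambda>x. U0 x $ i) k"
proof (rule rcoef_AE_cong)
  have "u 0 \<in> sobolev s" using assms by (auto simp: classical_solution_def)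
  then show "u 0 \<in> borel_measurable lebesgue" by (simp add: sobolev_def torus_L2_def)
qed (use assms in \<open>auto simp: classical_solution_def\<close>)

lemma sobolev_measurable: "U \<in> sobolev s \<Longrightarrow> U \<in> borel_measurable lebesgue"
  by (simp add: sobolev_def torus_L2_def)

lemma low_pass_measurable: "low_pass N U \<in> borel_measurable lebesgue"
proof (rule measurable_completion, simp, rule borel_measurable_continuous_onI)
  show "continuous_on UNIV (low_pass N U)"
    by (rule continuous_on_vec_components) (rule continuous_periodicD(1)[OF low_pass_continuous_periodic])
qed

lemma solution_H_coefficient_flow:
  assumes "classical_solution s (advection A) U0 I u"
  shows "coefficient_flow A UNIV I u"
  using classical_solution_coef_derivative[OF assms] classical_solution_C1_periodic[OF assms]
  by (simp add: coefficient_flow_def)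

lemma solution_HN_coefficient_flow:
  fixes u :: "real \<Rightarrow> real ^ 'd::finite \<Rightarrow> real ^ 'n::finite"
  assumes "classical_solution s (\<lambda>V. low_pass N (advection A V)) W I u"
  shows "coefficient_flow A (freqs N) I u"
  unfolding coefficient_flow_def
proof (intro ballI allI conjI)
  fix t i and k :: "int ^ 'd" assume t: "t \<in> I" and k: "k \<in> freqs N"
  show "((\<lambda>\<tau>. rcoef (\<lambda>x. u \<tau> x $ i) k) has_vector_derivative - rcoef (\<lambda>x. advection A (u t) x $ i) k) (at t)"
    using classical_solution_coef_derivative[OF assms t, of i k] k by (simp only: rcoef_low_pass if_True)
qed (rule classical_solution_C1_periodic[OF assms])

text \<open>The filtered equation keeps the frequencies beyond \<open>N\<close> at rest.\<close>

lemma solution_HN_band_limited: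
  assumes sol: "classical_solution s (\<lambda>V. low_pass N (advection A V)) (low_pass N U0) I u"
    and t: "t \<in> I" and k: "k \<notin> freqs N"
  shows "rcoef (\<lambda>x. u t x $ i) k = 0"
proof -
  have I: "open I" "convex I" "0 \<in> I" using sol by (auto simp: classical_solution_def is_interval_convex)
  have "((\<lambda>\<tau>. rcoef (\<lambda>x. u \<tau> x $ i) k) has_vector_derivative 0) (at \<tau> within I)" if "\<tau> \<in> I" for \<tau>
    using classical_solution_coef_derivative[OF sol that, of i k] k
    by (auto simp: rcoef_low_pass intro: has_vector_derivative_at_within)
  then obtain c where c: "\<And>\<tau>. \<tau> \<in> I \<Longrightarrow> rcoef (\<lambda>x. u \<tau> x $ i) k = c"
    using has_vector_derivative_zero_constant[OF I(2), of "\<lambda>\<tau>. rcoef (\<lambda>x. u \<tau> x $ i) k"] by blast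
  have "rcoef (\<lambda>x. u t x $ i) k = rcoef (\<lambda>x. u 0 x $ i) k" using c t I by simp
  also have "\<dots> = rcoef (\<lambda>x. low_pass N U0 x $ i) k"
    by (rule classical_solution_initial_coef[OF sol low_pass_measurable])
  finally show ?thesis using k by (simp add: rcoef_low_pass)
qed

section \<open>Gronwall inequalities\<close>

lemma gronwall_forward:
  fixes z z' :: "real \<Rightarrow> real"
  assumes "a \<le> b" and d: "\<And>t. a \<le> t \<Longrightarrow> t \<le> b \<Longrightarrow> (z has_real_derivative z' t) (at t)"
    and le: "\<And>t. a \<le> t \<Longrightarrow> t \<le> b \<Longrightarrow> z' t \<le> C * z t"
  shows "z b \<le> z a * exp (C * (b - a))"
proof -
  have "z b * exp (- C * b) \<le> z a * exp (- C * a)"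
  proof (rule DERIV_nonpos_imp_nonincreasing[OF assms(1)])
    fix t assume t: "a \<le> t" "t \<le> b"
    have "((\<lambda>t. z t * exp (- C * t)) has_real_derivative (z' t * exp (- C * t) + z t * (exp (- C * t) * (- C)))) (at t)"
      using d[OF t] by (auto intro!: derivative_eq_intros)
    moreover have "z' t * exp (- C * t) + z t * (exp (- C * t) * (- C)) = (z' t - C * z t) * exp (- C * t)"
      by (simp add: algebra_simps)
    moreover have "(z' t - C * z t) * exp (- C * t) \<le> 0"
      using le[OF t] by (simp add: mult_le_0_iff)
    ultimately show "\<exists>y. ((\<lambda>t. z t * exp (- C * t)) has_real_derivative y) (at t) \<and> y \<le> 0" by auto
  qed
  then have "z b * exp (- C * b) * exp (C * b) \<le> z a * exp (- C * a) * exp (C * b)"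
    by (intro mult_right_mono) auto
  then show ?thesis by (simp add: mult.assoc right_diff_distrib add.commute flip: exp_add)
qed

text \<open>The continuity argument: the differential inequality is only available below the threshold \<open>\<Theta>\<close>,
  which the resulting bound does not reach.\<close>

lemma gronwall_bootstrap_forward:
  fixes z z' :: "real \<Rightarrow> real"
  assumes ab: "a \<le> b" and d: "\<And>t. a \<le> t \<Longrightarrow> t \<le> b \<Longrightarrow> (z has_real_derivative z' t) (at t)"
    and le: "\<And>t. a \<le> t \<Longrightarrow> t \<le> b \<Longrightarrow> z t < \<Theta> \<Longrightarrow> z' t \<le> C * z t"
    and C: "0 \<le> C" and z0: "0 \<le> z a" and small: "z a * exp (C * (b - a)) < \<Theta>"
  shows "z b \<le> z a * exp (C * (b - a))"
proof -
  have mono: "z a * exp (C * (t - a)) \<le> z a * exp (C * (b - a))" if "t \<le> b" for t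
    using that C z0 by (intro mult_left_mono) (auto intro: mult_left_mono)
  have "z t < \<Theta>" if "a \<le> t" "t \<le> b" for t
  proof (rule ccontr)
    assume "\<not> z t < \<Theta>"
    \<comment> \<open>The first time \<open>\<tau>\<close> at which the threshold is reached; before it the Gronwall bound holds, and it persists in the limit.\<close>
    define S where "S = {\<tau> \<in> {a..t}. z \<tau> \<ge> \<Theta>}"
    have cont: "continuous_on {a..t} z"
      using that by (intro continuous_at_imp_continuous_on ballI DERIV_isCont[OF d]) auto
    have "S = {a..t} \<inter> z -` {\<Theta>..}" by (auto simp: S_def)
    then have "closed S" using continuous_on_closed_vimage[of "{a..t}" z] cont by (metis Int_commute closed_atLeast closed_atLeastAtMost)
    moreover have "S \<noteq> {}" "bdd_below S" using that \<open>\<not> z t < \<Theta>\<close> by (auto simp: S_def bdd_below_def)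
    ultimately have inf: "Inf S \<in> S" by (intro closed_contains_Inf)
    define \<tau> where "\<tau> = Inf S"
    have \<tau>: "a \<le> \<tau>" "\<tau> \<le> t" "\<Theta> \<le> z \<tau>" using inf by (auto simp: \<tau>_def S_def)
    have below: "z r < \<Theta>" if "a \<le> r" "r < \<tau>" for r
    proof (rule ccontr)
      assume "\<not> z r < \<Theta>"
      then have "r \<in> S" using that \<tau> by (auto simp: S_def)
      then have "\<tau> \<le> r" unfolding \<tau>_def using \<open>bdd_below S\<close> by (rule cInf_lower)
      with that show False by simp
    qed
    have "z a < \<Theta>" using small mono[of a] ab by simp
    then have "a < \<tau>" using \<tau> by (cases "a = \<tau>") auto
    have "z r \<le> z a * exp (C * (b - a))" if "a \<le> r" "r < \<tau>" for r
    proof -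
      have "z r \<le> z a * exp (C * (r - a))"
        using that \<tau> \<open>t \<le> b\<close> by (intro gronwall_forward[of a r z z']) (auto intro!: d le below)
      then show ?thesis using mono[of r] that \<tau> \<open>t \<le> b\<close> by linarith
    qed
    then have "\<forall>\<^sub>F r in at_left \<tau>. z r \<le> z a * exp (C * (b - a))"
      unfolding eventually_at_left_field using \<open>a < \<tau>\<close> by (auto intro!: exI[of _ a])
    moreover have "(z \<longlongrightarrow> z \<tau>) (at_left \<tau>)"
      using d[of \<tau>] \<tau> \<open>t \<le> b\<close> DERIV_isCont[of z] by (auto simp: isCont_def intro: filterlim_at_split[THEN iffD1, THEN conjunct1])
    ultimately have "z \<tau> \<le> z a * exp (C * (b - a))"
      by (intro tendsto_upperbound[of z "z \<tau>" "at_left \<tau>"]) auto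
    with \<tau>(3) small show False by linarith
  qed
  then show ?thesis using ab by (intro gronwall_forward[of a b z z']) (auto intro!: d le)
qed

text \<open>Solutions are considered for negative times as well; the backward case is the forward one for
  \<open>t \<mapsto> z (- t)\<close>.\<close>

lemma gronwall_bootstrap:
  fixes z z' :: "real \<Rightarrow> real"
  assumes J: "is_interval J" "a \<in> J" "b \<in> J" and d: "\<And>t. t \<in> J \<Longrightarrow> (z has_real_derivative z' t) (at t)"
    and le: "\<And>t. t \<in> J \<Longrightarrow> z t < \<Theta> \<Longrightarrow> \<bar>z' t\<bar> \<le> C * z t"
    and C: "0 \<le> C" and z0: "0 \<le> z a" and small: "z a * exp (C * \<bar>b - a\<bar>) < \<Theta>"
  shows "z b \<le> z a * exp (C * \<bar>b - a\<bar>)"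
proof (cases "a \<le> b")
  case True
  have "t \<in> J" if "a \<le> t" "t \<le> b" for t using J that by (meson mem_is_interval_1_I)
  then have "z b \<le> z a * exp (C * (b - a))"
    using True C z0 small d le by (intro gronwall_bootstrap_forward[of a b z z' \<Theta>]) (auto simp: abs_le_iff)
  then show ?thesis using True by simp
next
  case False
  have mem: "- t \<in> J" if "- a \<le> t" "t \<le> - b" for t using J that
    by (metis mem_is_interval_1_I minus_le_iff le_minus_iff)
  have "z (- (- b)) \<le> z (- (- a)) * exp (C * (- b - (- a)))"
  proof (rule gronwall_bootstrap_forward[of "- a" "- b" "\<lambda>t. z (- t)" "\<lambda>t. - z' (- t)" \<Theta> C])
    fix t assume t: "- a \<le> t" "t \<le> - b"
    show "((\<lambda>t. z (- t)) has_real_derivative - z' (- t)) (at t)"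
      using DERIV_chain2[where f = z and g = uminus and x = t and Da = "z' (- t)" and Db = "- 1" and s = UNIV]
        d[OF mem[OF t]] DERIV_minus[OF DERIV_ident, of t] by (simp add: id_def)
    assume "z (- t) < \<Theta>"
    then show "- z' (- t) \<le> C * z (- t)" using le[OF mem[OF t]] by (auto simp: abs_le_iff)
  qed (use False C z0 small in auto)
  then show ?thesis using False by simp
qed

section \<open>Comparison of the equation with its Galerkin truncation\<close>

text \<open>A bound for the Sobolev norm that includes membership in the space, as far as coefficients are
  concerned: the norm itself is \<open>0\<close> when the sum diverges.\<close>

definition sobolev_sums_le :: "real \<Rightarrow> (real ^ 'd::finite \<Rightarrow> real ^ 'n::finite) \<Rightarrow> real \<Rightarrow> bool" where
  "sobolev_sums_le s U \<sigma> \<longleftrightarrow> 0 \<le> \<sigma> \<and>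
     (\<forall>F. finite F \<longrightarrow> (\<Sum>k\<in>F. (japanese_bracket k powr s * norm (fourier_coeff U k))\<^sup>2) \<le> \<sigma>\<^sup>2)"

lemma sobolev_sums_leI:
  assumes "U \<in> sobolev s" "sobolev_norm s U \<le> \<sigma>"
  shows "sobolev_sums_le s U \<sigma>"
  unfolding sobolev_sums_le_def
proof (intro conjI allI impI)
  show "0 \<le> \<sigma>" using assms(2) sobolev_norm_nonneg[of s U] by linarith
  fix F :: "(int ^ 'a) set" assume "finite F"
  from sobolev_norm_partial_sums[OF assms(1) this]
  show "(\<Sum>k\<in>F. (japanese_bracket k powr s * norm (fourier_coeff U k))\<^sup>2) \<le> \<sigma>\<^sup>2"
    using power_mono[OF assms(2) sobolev_norm_nonneg, of 2] by linarith
qed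

lemma sobolev_sums_le_l2_bound:
  assumes "sobolev_sums_le s U \<sigma>"
  shows "l2_bound (\<lambda>k. japanese_bracket k powr s) (rcoef (\<lambda>x. U x $ i)) \<sigma>"
  unfolding l2_bound_def
proof (intro conjI allI impI)
  show "0 \<le> \<sigma>" using assms by (simp add: sobolev_sums_le_def)
  fix F :: "(int ^ 'a) set" assume F: "finite F"
  have "cmod (rcoef (\<lambda>x. U x $ i) k) \<le> norm (fourier_coeff U k)" for k
    using Finite_Cartesian_Product.norm_nth_le[of "fourier_coeff U k" i] by (simp add: fourier_coeff_component)
  then have "(\<Sum>k\<in>F. (japanese_bracket k powr s * cmod (rcoef (\<lambda>x. U x $ i) k))\<^sup>2)
    \<le> (\<Sum>k\<in>F. (japanese_bracket k powr s * norm (fourier_coeff U k))\<^sup>2)"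
    by (intro sum_mono power_mono mult_left_mono) auto
  also have "\<dots> \<le> \<sigma>\<^sup>2" using assms F by (simp add: sobolev_sums_le_def)
  finally show "(\<Sum>k\<in>F. (japanese_bracket k powr s * cmod (rcoef (\<lambda>x. U x $ i) k))\<^sup>2) \<le> \<sigma>\<^sup>2" .
qed

lemma energy_defect_nonneg: "0 \<le> energy_defect s N u v"
  unfolding energy_defect_def by (intro sum_nonneg) auto

lemma has_real_derivative_cmod_sq:
  assumes "(f has_vector_derivative f') (at t)"
  shows "((\<lambda>t. (cmod (f t))\<^sup>2) has_real_derivative 2 * Re (cnj (f t) * f')) (at t)"
proof -
  have "((\<lambda>t. Re (f t)) has_real_derivative Re f') (at t)" "((\<lambda>t. Im (f t)) has_real_derivative Im f') (at t)"
    using bounded_linear.has_vector_derivative[OF bounded_linear_Re assms]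
      bounded_linear.has_vector_derivative[OF bounded_linear_Im assms]
    by (auto simp: has_real_derivative_iff_has_vector_derivative)
  from DERIV_add[OF DERIV_power[OF this(1), of 2] DERIV_power[OF this(2), of 2]]
  show ?thesis unfolding cmod_power2 by (simp add: algebra_simps)
qed

lemma energy_defect_derivative:
  fixes A :: "'d::finite \<Rightarrow> real ^ 'n::finite \<Rightarrow> real ^ 'n ^ 'n"
  assumes u: "coefficient_flow A UNIV I u" and v: "coefficient_flow A (freqs N) I' v" and t: "t \<in> I" "t \<in> I'"
  shows "((\<lambda>\<tau>. energy_defect s N (u \<tau>) (v \<tau>)) has_real_derivative
    - 2 * defect_pairing A s N (u t) (v t)) (at t)"
proof -
  let ?\<pi> = "\<lambda>k. complex_of_real (truncation_symbol s (real N) k)"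
  let ?D = "\<lambda>a k \<tau>. ?\<pi> k * rcoef (\<lambda>x. u \<tau> x $ a) k - rcoef (\<lambda>x. v \<tau> x $ a) k"
  let ?B = "\<lambda>a k. ?\<pi> k * rcoef (\<lambda>x. advection A (u t) x $ a) k - rcoef (\<lambda>x. advection A (v t) x $ a) k"
  have d: "((\<lambda>\<tau>. (cmod (?D a k \<tau>))\<^sup>2) has_real_derivative 2 * Re (cnj (?D a k t) * (- ?B a k))) (at t)"
    if k: "k \<in> freqs N" for a k
  proof (rule has_real_derivative_cmod_sq)
    have "((\<lambda>\<tau>. rcoef (\<lambda>x. u \<tau> x $ a) k) has_vector_derivative - rcoef (\<lambda>x. advection A (u t) x $ a) k) (at t)"
      using u t(1) unfolding coefficient_flow_def by blast
    moreover have "((\<lambda>\<tau>. rcoef (\<lambda>x. v \<tau> x $ a) k) has_vector_derivative - rcoef (\<lambda>x. advection A (v t) x $ a) k) (at t)"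
      using v t(2) k unfolding coefficient_flow_def by blast
    ultimately have "((\<lambda>\<tau>. ?D a k \<tau>) has_vector_derivative
        ?\<pi> k * (- rcoef (\<lambda>x. advection A (u t) x $ a) k) - (- rcoef (\<lambda>x. advection A (v t) x $ a) k)) (at t)"
      by (intro has_vector_derivative_diff has_vector_derivative_mult_right)
    then show "((\<lambda>\<tau>. ?D a k \<tau>) has_vector_derivative - ?B a k) (at t)" by simp
  qed
  have "((\<lambda>\<tau>. \<Sum>k\<in>freqs N. \<Sum>a\<in>UNIV. (cmod (?D a k \<tau>))\<^sup>2) has_real_derivative
    (\<Sum>k\<in>freqs N. \<Sum>a\<in>UNIV. 2 * Re (cnj (?D a k t) * (- ?B a k)))) (at t)"
    by (intro DERIV_sum d)
  moreover have "(\<Sum>k\<in>freqs N. \<Sum>a\<in>UNIV. 2 * Re (cnj (?D a k t) * (- ?B a k)))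
    = - 2 * (\<Sum>k\<in>freqs N. \<Sum>a\<in>UNIV. Re (cnj (?D a k t) * ?B a k))"
    unfolding sum_distrib_left by (intro sum.cong refl) (simp only: mult_minus_right uminus_complex.sel mult_minus_left)
  ultimately show ?thesis unfolding energy_defect_def defect_pairing_def by (simp only:)
qed

text \<open>The energy inequality in integrated form, with a constant independent of \<open>N\<close>. The Wiener bound for
  \<open>v\<close> is requested only as long as the defect is below the threshold \<open>\<Theta>\<close>, which the conclusion
  does not reach. This covers solutions \<open>v\<close> for which no bound is known in advance.\<close>

definition growth_constant ::
  "('d::finite \<Rightarrow> real ^ 'n::finite \<Rightarrow> real ^ 'n ^ 'n) \<Rightarrow> real \<Rightarrow> real \<Rightarrow> real \<Rightarrow> bool" where
  "growth_constant A s M C \<longleftrightarrow> 0 \<le> C \<and>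
    (\<forall>N\<ge>1. \<forall>(u :: real \<Rightarrow> real ^ 'd \<Rightarrow> real ^ 'n) v I I' J a b \<mu> \<sigma> \<Theta>.
    coefficient_flow A UNIV I u \<longrightarrow> coefficient_flow A (freqs N) I' v \<longrightarrow>
    is_interval J \<longrightarrow> J \<subseteq> I \<longrightarrow> J \<subseteq> I' \<longrightarrow> a \<in> J \<longrightarrow> b \<in> J \<longrightarrow>
    0 \<le> \<sigma> \<longrightarrow> \<sigma> \<le> \<mu> \<longrightarrow> \<mu> \<le> M \<longrightarrow> (\<forall>t\<in>J. sobolev_sums_le s (u t) \<sigma>) \<longrightarrow>
    (\<forall>t\<in>J. \<forall>i k. k \<notin> freqs N \<longrightarrow> rcoef (\<lambda>x. v t x $ i) k = 0) \<longrightarrow>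
    (\<forall>t\<in>J. energy_defect s N (u t) (v t) < \<Theta> \<longrightarrow> (\<forall>i. l1_bound japanese_bracket (rcoef (\<lambda>x. v t x $ i)) \<mu>)) \<longrightarrow>
    (energy_defect s N (u a) (v a) + (\<sigma> * real N powr (- s))\<^sup>2) * exp (C * \<mu> * \<bar>b - a\<bar>) < \<Theta> \<longrightarrow>
    energy_defect s N (u b) (v b) + (\<sigma> * real N powr (- s))\<^sup>2
      \<le> (energy_defect s N (u a) (v a) + (\<sigma> * real N powr (- s))\<^sup>2) * exp (C * \<mu> * \<bar>b - a\<bar>))"

text \<open>Adding the constant \<open>(\<sigma> N\<^sup>-\<^sup>s)\<^sup>2\<close> to the energy defect makes the differential inequality
  homogeneous.\<close>

theorem energy_growth:
  fixes A :: "'d::finite \<Rightarrow> real ^ 'n::finite \<Rightarrow> real ^ 'n ^ 'n" and s :: real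
  assumes sym: "\<And>j V. transpose (A j V) = A j V"
    and poly: "\<And>j a b. real_polynomial_function (\<lambda>V. A j V $ a $ b)"
    and s: "s > real CARD('d) / 2 + 1" and M: "0 \<le> M"
  obtains C where "growth_constant A s M C"
proof -
  obtain C where C: "0 \<le> C" and rate: "\<And>N (u :: real ^ 'd \<Rightarrow> real ^ 'n) v \<mu> \<sigma>. N \<ge> 1 \<Longrightarrow>
    C1_periodic u \<Longrightarrow> C1_periodic v \<Longrightarrow> 0 \<le> \<sigma> \<Longrightarrow> \<sigma> \<le> \<mu> \<Longrightarrow> \<mu> \<le> M \<Longrightarrow>
    (\<forall>i. l2_bound (\<lambda>k. japanese_bracket k powr s) (rcoef (\<lambda>x. u x $ i)) \<sigma>) \<Longrightarrow>
    (\<forall>i. l1_bound japanese_bracket (rcoef (\<lambda>x. v x $ i)) \<mu>) \<Longrightarrow>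
    (\<forall>i k. k \<notin> freqs N \<longrightarrow> rcoef (\<lambda>x. v x $ i) k = 0) \<Longrightarrow>
    \<bar>defect_pairing A s N u v\<bar> \<le> C * \<mu> * (energy_defect s N u v + (\<sigma> * real N powr (- s))\<^sup>2)"
    using energy_rate[where A = A, OF sym poly s M] by blast
  have "growth_constant A s M (2 * C)"
    unfolding growth_constant_def
  proof (intro conjI allI impI)
    fix N :: nat and u v :: "real \<Rightarrow> real ^ 'd \<Rightarrow> real ^ 'n" and I I' J a b \<mu> \<sigma> \<Theta>
    assume N: "N \<ge> 1" and fl: "coefficient_flow A UNIV I u" "coefficient_flow A (freqs N) I' v"
      and J: "is_interval J" "J \<subseteq> I" "J \<subseteq> I'" "a \<in> J" "b \<in> J"
      and \<sigma>: "0 \<le> \<sigma>" "\<sigma> \<le> \<mu>" "\<mu> \<le> M" and u: "\<forall>t\<in>J. sobolev_sums_le s (u t) \<sigma>"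
      and supp: "\<forall>t\<in>J. \<forall>i k. k \<notin> freqs N \<longrightarrow> rcoef (\<lambda>x. v t x $ i) k = 0"
      and v: "\<forall>t\<in>J. energy_defect s N (u t) (v t) < \<Theta> \<longrightarrow> (\<forall>i. l1_bound japanese_bracket (rcoef (\<lambda>x. v t x $ i)) \<mu>)"
      and small: "(energy_defect s N (u a) (v a) + (\<sigma> * real N powr (- s))\<^sup>2) * exp (2 * C * \<mu> * \<bar>b - a\<bar>) < \<Theta>"
    define z where "z t = energy_defect s N (u t) (v t) + (\<sigma> * real N powr (- s))\<^sup>2" for t
    define S where "S t = defect_pairing A s N (u t) (v t)" for t
    have "z b \<le> z a * exp (2 * C * \<mu> * \<bar>b - a\<bar>)"
    proof (rule gronwall_bootstrap[OF J(1,4,5)])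
      fix t assume t: "t \<in> J"
      have "((\<lambda>\<tau>. energy_defect s N (u \<tau>) (v \<tau>)) has_real_derivative - 2 * S t) (at t)"
        unfolding S_def using t J by (intro energy_defect_derivative[OF fl]) auto
      then show "(z has_real_derivative - 2 * S t) (at t)"
        unfolding z_def[abs_def] by (rule DERIV_cong[OF DERIV_add[OF _ DERIV_const]]) simp
      assume "z t < \<Theta>"
      then have "energy_defect s N (u t) (v t) < \<Theta>" by (simp add: z_def) (smt (verit) zero_le_power2)
      then have "\<bar>S t\<bar> \<le> C * \<mu> * z t"
        unfolding S_def z_def using t J fl u v supp \<sigma> N
        by (intro rate) (auto simp: coefficient_flow_def intro: sobolev_sums_le_l2_bound)
      then show "\<bar>- 2 * S t\<bar> \<le> 2 * C * \<mu> * z t" by (simp add: abs_mult)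
    qed (use C \<sigma> small energy_defect_nonneg[of s N "u a" "v a"] in \<open>auto simp: z_def\<close>)
    then show "energy_defect s N (u b) (v b) + (\<sigma> * real N powr (- s))\<^sup>2
      \<le> (energy_defect s N (u a) (v a) + (\<sigma> * real N powr (- s))\<^sup>2) * exp (2 * C * \<mu> * \<bar>b - a\<bar>)"
      by (simp add: z_def)
  qed (use C in simp)
  then show thesis by (rule that)
qed

lemma freqs_jb_le_mult:
  assumes "N \<ge> 1" "k \<in> freqs N"
  shows "japanese_bracket (k :: int ^ 'd) \<le> sqrt (1 + real CARD('d)) * real N"
proof -
  have "1 * 1 \<le> real N * real N" using assms(1) by (intro mult_mono) auto
  then have "1 + real CARD('d) * (real N)\<^sup>2 \<le> (1 + real CARD('d)) * (real N)\<^sup>2"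
    by (simp add: power2_eq_square algebra_simps)
  then have "sqrt (1 + real CARD('d) * (real N)\<^sup>2) \<le> sqrt ((1 + real CARD('d)) * (real N)\<^sup>2)"
    by (rule real_sqrt_le_mono)
  also have "\<dots> = sqrt (1 + real CARD('d)) * real N" by (simp add: real_sqrt_mult)
  finally show ?thesis using freqs_jb_le[OF assms(2)] by linarith
qed

text \<open>The filtered difference is band-limited, so an inverse inequality turns its \<open>L\<^sup>2\<close> size \<open>N\<^sup>-\<^sup>s\<close> into an \<open>H\<^sup>r\<close> size
  \<open>N\<^sup>r\<^sup>-\<^sup>s\<close>; no energy estimate in \<open>H\<^sup>r\<close> is involved.\<close>

lemma sobolev_norm_difference_le:
  fixes u v :: "real ^ 'd::finite \<Rightarrow> real ^ 'n::finite"
  assumes N: "N \<ge> 1" and r: "0 \<le> r" "r \<le> s"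
    and cu: "\<And>i. continuous_periodic (\<lambda>x. u x $ i)" and cv: "\<And>i. continuous_periodic (\<lambda>x. v x $ i)"
    and u: "sobolev_sums_le s u \<sigma>" and supp: "\<And>i k. k \<notin> freqs N \<Longrightarrow> rcoef (\<lambda>x. v x $ i) k = 0"
    and E: "energy_defect s N u v \<le> X\<^sup>2" "0 \<le> X"
  shows "sobolev_norm r (\<lambda>x. u x - v x)
    \<le> \<sigma> * real N powr (r - s) + sqrt (1 + real CARD('d)) powr s * real N powr r * X"
proof (rule sobolev_norm_le)
  have \<sigma>: "0 \<le> \<sigma>" using u by (simp add: sobolev_sums_le_def)
  let ?\<kappa> = "sqrt (1 + real CARD('d))"
  have \<kappa>: "1 \<le> ?\<kappa>" by simp
  have Npos: "0 < real N" using N by simp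
  show "0 \<le> \<sigma> * real N powr (r - s) + ?\<kappa> powr s * real N powr r * X" using \<sigma> E(2) by simp
  define \<pi> :: "int ^ 'd \<Rightarrow> real" where "\<pi> = truncation_symbol s (real N)"
  define D where "D k = (\<chi> a. complex_of_real (\<pi> k) * rcoef (\<lambda>x. u x $ a) k - rcoef (\<lambda>x. v x $ a) k)" for k
  have \<pi>: "0 \<le> \<pi> k" "\<pi> k \<le> 1" for k
    unfolding \<pi>_def using truncation_symbol_bounds[OF Npos, of s k] r by auto
  have D0: "D k = 0" if "k \<notin> freqs N" for k
    using supp[OF that] truncation_symbol_eq_0[OF Npos not_freqs_jb[OF that]]
    by (simp add: D_def \<pi>_def vec_eq_iff)
  fix F :: "(int ^ 'd) set" assume F: "finite F"
  have split: "fourier_coeff (\<lambda>x. u x - v x) k = (1 - \<pi> k) *\<^sub>R fourier_coeff u k + D k" for k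
    by (simp add: vec_eq_iff fourier_coeff_component D_def rcoef_diff[OF cu cv] 
        scaleR_conv_of_real[of _ "_ :: complex"] del: of_real_diff) (simp add: algebra_simps)
  have "L2_set (\<lambda>k. japanese_bracket k powr r * norm (fourier_coeff (\<lambda>x. u x - v x) k)) F
    \<le> L2_set (\<lambda>k. japanese_bracket k powr r * norm ((1 - \<pi> k) *\<^sub>R fourier_coeff u k) + japanese_bracket k powr r * norm (D k)) F"
    unfolding split distrib_left[symmetric]
    by (intro L2_set_mono mult_left_mono norm_triangle_ineq) auto
  also have "\<dots> \<le> L2_set (\<lambda>k. japanese_bracket k powr r * norm ((1 - \<pi> k) *\<^sub>R fourier_coeff u k)) F
      + L2_set (\<lambda>k. japanese_bracket k powr r * norm (D k)) F"
    by (rule L2_set_triangle_ineq)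
  also have "\<dots> \<le> real N powr (r - s) * \<sigma> + ?\<kappa> powr s * real N powr r * X"
  proof (rule add_mono)
    have "L2_set (\<lambda>k. japanese_bracket k powr r * norm ((1 - \<pi> k) *\<^sub>R fourier_coeff u k)) F
      \<le> L2_set (\<lambda>k. real N powr (r - s) * (japanese_bracket k powr s * norm (fourier_coeff u k))) F"
    proof (rule L2_set_mono)
      fix k
      have "japanese_bracket k powr r * (1 - \<pi> k) * norm (fourier_coeff u k)
        \<le> real N powr (r - s) * japanese_bracket k powr s * norm (fourier_coeff u k)"
        unfolding \<pi>_def by (intro mult_right_mono one_minus_truncation_symbol_le[OF Npos r]) auto
      then show "japanese_bracket k powr r * norm ((1 - \<pi> k) *\<^sub>R fourier_coeff u k)
        \<le> real N powr (r - s) * (japanese_bracket k powr s * norm (fourier_coeff u k))"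
        using \<pi>[of k] by (simp add: mult.assoc)
    qed (use \<pi> in auto)
    also have "\<dots> = real N powr (r - s) * L2_set (\<lambda>k. japanese_bracket k powr s * norm (fourier_coeff u k)) F"
      by (simp add: L2_set_right_distrib)
    also have "\<dots> \<le> real N powr (r - s) * \<sigma>"
    proof (intro mult_left_mono)
      show "L2_set (\<lambda>k. japanese_bracket k powr s * norm (fourier_coeff u k)) F \<le> \<sigma>"
        unfolding L2_set_def using u F by (intro real_le_lsqrt) (auto simp: sobolev_sums_le_def sum_nonneg)
    qed simp
    finally show "L2_set (\<lambda>k. japanese_bracket k powr r * norm ((1 - \<pi> k) *\<^sub>R fourier_coeff u k)) F \<le> real N powr (r - s) * \<sigma>" .
    have "L2_set (\<lambda>k. japanese_bracket k powr r * norm (D k)) F \<le> L2_set (\<lambda>k. (?\<kappa> powr s * real N powr r) * norm (D k)) F"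
    proof (rule L2_set_mono)
      fix k
      show "japanese_bracket k powr r * norm (D k) \<le> (?\<kappa> powr s * real N powr r) * norm (D k)"
      proof (cases "k \<in> freqs N")
        case True
        have "japanese_bracket k powr r \<le> (?\<kappa> * real N) powr r"
          using r by (intro powr_mono2 freqs_jb_le_mult[OF N True]) auto
        also have "\<dots> = ?\<kappa> powr r * real N powr r" by (simp add: powr_mult)
        also have "\<dots> \<le> ?\<kappa> powr s * real N powr r"
          using r \<kappa> by (intro mult_right_mono powr_mono) auto
        finally show ?thesis by (rule mult_right_mono) simp
      qed (simp add: D0)
    qed auto
    also have "\<dots> = (?\<kappa> powr s * real N powr r) * L2_set (\<lambda>k. norm (D k)) F"
      by (simp add: L2_set_right_distrib)
    also have "\<dots> \<le> (?\<kappa> powr s * real N powr r) * X"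
    proof (intro mult_left_mono)
      have "(\<Sum>k\<in>F. (norm (D k))\<^sup>2) = (\<Sum>k\<in>F \<inter> freqs N. (norm (D k))\<^sup>2)"
        using F D0 by (intro sum.mono_neutral_cong_right) auto
      also have "\<dots> \<le> (\<Sum>k\<in>freqs N. (norm (D k))\<^sup>2)" by (intro sum_mono2) auto
      also have "\<dots> = energy_defect s N u v"
        by (simp add: energy_defect_def norm_vec_def L2_set_def sum_nonneg D_def \<pi>_def)
      finally show "L2_set (\<lambda>k. norm (D k)) F \<le> X"
        unfolding L2_set_def using E by (intro real_le_lsqrt) (auto simp: sum_nonneg)
    qed auto
    finally show "L2_set (\<lambda>k. japanese_bracket k powr r * norm (D k)) F \<le> ?\<kappa> powr s * real N powr r * X" .
  qed
  finally have "sqrt (\<Sum>k\<in>F. (japanese_bracket k powr r * norm (fourier_coeff (\<lambda>x. u x - v x) k))\<^sup>2)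
    \<le> \<sigma> * real N powr (r - s) + ?\<kappa> powr s * real N powr r * X"
    by (simp add: L2_set_def mult.commute)
  then show "(\<Sum>k\<in>F. (japanese_bracket k powr r * norm (fourier_coeff (\<lambda>x. u x - v x) k))\<^sup>2)
    \<le> (\<sigma> * real N powr (r - s) + ?\<kappa> powr s * real N powr r * X)\<^sup>2"
    by (rule sqrt_le_D)
qed

text \<open>The initial values have the same frequencies up to \<open>N\<close>, so that the defect consists of what the
  filter removes from these frequencies.\<close>

lemma energy_defect_initial:
  fixes u v :: "real ^ 'd::finite \<Rightarrow> real ^ 'n::finite"
  assumes N: "N \<ge> 1" and s: "0 \<le> s" and u: "sobolev_sums_le s u \<sigma>"
    and v: "\<And>i k. k \<in> freqs N \<Longrightarrow> rcoef (\<lambda>x. v x $ i) k = rcoef (\<lambda>x. u x $ i) k"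
  shows "energy_defect s N u v \<le> (\<sigma> * real N powr (- s))\<^sup>2"
proof -
  have Npos: "0 < real N" using N by simp
  let ?\<pi> = "truncation_symbol s (real N)"
  have "energy_defect s N u v = (\<Sum>k\<in>freqs N. (1 - ?\<pi> k)\<^sup>2 * (norm (fourier_coeff u k))\<^sup>2)"
    unfolding energy_defect_def norm_fourier_coeff_sq sum_distrib_left
  proof (intro sum.cong refl)
    fix k :: "int ^ 'd" and a assume k: "k \<in> freqs N"
    have "complex_of_real (?\<pi> k) * rcoef (\<lambda>x. u x $ a) k - rcoef (\<lambda>x. v x $ a) k
      = complex_of_real (?\<pi> k - 1) * rcoef (\<lambda>x. u x $ a) k"
      using v[OF k] by (simp add: algebra_simps)
    then show "(cmod (complex_of_real (?\<pi> k) * rcoef (\<lambda>x. u x $ a) k - rcoef (\<lambda>x. v x $ a) k))\<^sup>2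
      = (1 - ?\<pi> k)\<^sup>2 * (cmod (rcoef (\<lambda>x. u x $ a) k))\<^sup>2"
      by (simp only: norm_mult norm_of_real power_mult_distrib power2_abs power2_commute)
  qed
  also have "\<dots> \<le> (\<Sum>k\<in>freqs N. (real N powr (- s))\<^sup>2 * (japanese_bracket k powr s * norm (fourier_coeff u k))\<^sup>2)"
  proof (intro sum_mono)
    fix k :: "int ^ 'd"
    have "0 \<le> 1 - ?\<pi> k" using truncation_symbol_bounds[OF Npos s, of k] by simp
    moreover have "1 - ?\<pi> k \<le> real N powr (- s) * japanese_bracket k powr s"
      using one_minus_truncation_symbol_le[OF Npos, of 0 s k] s by simp
    ultimately have "(1 - ?\<pi> k)\<^sup>2 \<le> (real N powr (- s) * japanese_bracket k powr s)\<^sup>2" by (intro power_mono)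
    then have "(1 - ?\<pi> k)\<^sup>2 * (norm (fourier_coeff u k))\<^sup>2 \<le> (real N powr (- s) * japanese_bracket k powr s)\<^sup>2 * (norm (fourier_coeff u k))\<^sup>2"
      by (intro mult_right_mono) auto
    then show "(1 - ?\<pi> k)\<^sup>2 * (norm (fourier_coeff u k))\<^sup>2
      \<le> (real N powr (- s))\<^sup>2 * (japanese_bracket k powr s * norm (fourier_coeff u k))\<^sup>2"
      by (simp add: power_mult_distrib mult.assoc)
  qed
  also have "\<dots> \<le> (real N powr (- s))\<^sup>2 * \<sigma>\<^sup>2"
    unfolding sum_distrib_left[symmetric] using u by (intro mult_left_mono) (auto simp: sobolev_sums_le_def)
  finally show ?thesis by (simp add: power_mult_distrib mult.commute)
qed

text \<open>The coefficients of \<open>v = \<Pi>u - D\<close> are estimated separately: \<open>\<Pi>u\<close> by the Sobolev embedding in \<open>H\<^sup>s\<close>,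
  and \<open>D\<close> by the embedding in \<open>H\<^sup>s\<^sup>'\<close> and the inverse inequality, which costs the factor \<open>N\<^sup>s\<^sup>'\<close>. Choosing
  \<open>s' < s\<close> leaves room between this factor and the size \<open>N\<^sup>-\<^sup>s\<close> of \<open>D\<close>.\<close>
lemma wiener_bound_of_small_defect:
  fixes s s' :: real
  assumes s': "s' > real CARD('d) / 2 + 1" and s: "s' \<le> s"
  shows "\<exists>c>0. \<forall>N\<ge>1. \<forall>(u :: real ^ 'd::finite \<Rightarrow> real ^ 'n::finite) v \<sigma> i.
    sobolev_sums_le s u \<sigma> \<longrightarrow> (\<forall>i k. k \<notin> freqs N \<longrightarrow> rcoef (\<lambda>x. v x $ i) k = 0) \<longrightarrow>
    l1_bound japanese_bracket (rcoef (\<lambda>x. v x $ i)) (c * \<sigma> + c * real N powr s' * sqrt (energy_defect s N u v))"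
proof -
  obtain c1 where c1: "c1 > 0" "\<And>(a :: int ^ 'd \<Rightarrow> complex) C. l2_bound (\<lambda>k. japanese_bracket k powr s) a C \<Longrightarrow> l1_bound japanese_bracket a (c1 * C)"
    using l2_imp_l1_bound[of s, where 'd='d] s s' by auto
  obtain c2 where c2: "c2 > 0" "\<And>(a :: int ^ 'd \<Rightarrow> complex) C. l2_bound (\<lambda>k. japanese_bracket k powr s') a C \<Longrightarrow> l1_bound japanese_bracket a (c2 * C)"
    using l2_imp_l1_bound[OF s'] by blast
  let ?\<kappa> = "sqrt (1 + real CARD('d))"
  define c where "c = max c1 (c2 * ?\<kappa> powr s')"
  have "l1_bound japanese_bracket (rcoef (\<lambda>x. v x $ i)) (c * \<sigma> + c * real N powr s' * sqrt (energy_defect s N u v))"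
    if N: "N \<ge> 1" and u: "sobolev_sums_le s u \<sigma>" and supp: "\<forall>i k. k \<notin> freqs N \<longrightarrow> rcoef (\<lambda>x. v x $ i) k = 0"
    for N and u v :: "real ^ 'd \<Rightarrow> real ^ 'n" and \<sigma> i
  proof -
    have Npos: "0 < real N" using N by simp
    have \<sigma>: "0 \<le> \<sigma>" using u by (simp add: sobolev_sums_le_def)
    define \<pi> :: "int ^ 'd \<Rightarrow> real" where "\<pi> = truncation_symbol s (real N)"
    have \<pi>: "0 \<le> \<pi> k" "\<pi> k \<le> 1" for k
      unfolding \<pi>_def using truncation_symbol_bounds[OF Npos, of s k] s s' by auto
    define D where "D a k = complex_of_real (\<pi> k) * rcoef (\<lambda>x. u x $ a) k - rcoef (\<lambda>x. v x $ a) k" for a k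
    have D0: "D a k = 0" if "k \<notin> freqs N" for a k
      using supp that truncation_symbol_eq_0[OF Npos not_freqs_jb[OF that]] by (simp add: D_def \<pi>_def)
    have "l1_bound japanese_bracket (rcoef (\<lambda>x. u x $ i)) (c1 * \<sigma>)"
      by (rule c1(2)[OF sobolev_sums_le_l2_bound[OF u]])
    then have "l1_bound japanese_bracket (\<lambda>k. complex_of_real (\<pi> k) * rcoef (\<lambda>x. u x $ i) k) (c1 * \<sigma>)"
      unfolding l1_bound_def
    proof (elim all_forward imp_forward; assumption?)
      fix F :: "(int ^ 'd) set"
      assume le: "(\<Sum>k\<in>F. japanese_bracket k * cmod (rcoef (\<lambda>x. u x $ i) k)) \<le> c1 * \<sigma>"
      have "(\<Sum>k\<in>F. japanese_bracket k * cmod (complex_of_real (\<pi> k) * rcoef (\<lambda>x. u x $ i) k))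
        \<le> (\<Sum>k\<in>F. japanese_bracket k * cmod (rcoef (\<lambda>x. u x $ i) k))"
        using \<pi> by (intro sum_mono mult_left_mono) (auto simp: norm_mult mult_left_le_one_le)
      with le show "(\<Sum>k\<in>F. japanese_bracket k * cmod (complex_of_real (\<pi> k) * rcoef (\<lambda>x. u x $ i) k)) \<le> c1 * \<sigma>"
        by linarith
    qed
    moreover have "l1_bound japanese_bracket (\<lambda>k. (- 1) * D i k) (cmod (- 1) * (c2 * (?\<kappa> powr s' * real N powr s' * sqrt (energy_defect s N u v))))"
    proof (intro l1_bound_cmult c2(2))
      let ?E = "energy_defect s N u v"
      show "l2_bound (\<lambda>k. japanese_bracket k powr s') (D i) (?\<kappa> powr s' * real N powr s' * sqrt ?E)"
        unfolding l2_bound_def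
      proof (intro conjI allI impI)
        fix F :: "(int ^ 'd) set" assume F: "finite F"
        have "(\<Sum>k\<in>F. (japanese_bracket k powr s' * cmod (D i k))\<^sup>2)
          = (\<Sum>k\<in>F \<inter> freqs N. (japanese_bracket k powr s' * cmod (D i k))\<^sup>2)"
          using F D0 by (intro sum.mono_neutral_cong_right) auto
        also have "\<dots> \<le> (\<Sum>k\<in>F \<inter> freqs N. (?\<kappa> powr s' * real N powr s')\<^sup>2 * (cmod (D i k))\<^sup>2)"
        proof (intro sum_mono)
          fix k assume k: "k \<in> F \<inter> freqs N"
          have "japanese_bracket k powr s' \<le> (?\<kappa> * real N) powr s'"
            using s' k by (intro powr_mono2 freqs_jb_le_mult[OF N]) auto
          then have "japanese_bracket k powr s' \<le> ?\<kappa> powr s' * real N powr s'" by (simp add: powr_mult)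
          then have "(japanese_bracket k powr s' * cmod (D i k))\<^sup>2 \<le> (?\<kappa> powr s' * real N powr s' * cmod (D i k))\<^sup>2"
            by (intro power_mono mult_right_mono) auto
          then show "(japanese_bracket k powr s' * cmod (D i k))\<^sup>2 \<le> (?\<kappa> powr s' * real N powr s')\<^sup>2 * (cmod (D i k))\<^sup>2"
            by (simp only: power_mult_distrib)
        qed
        also have "\<dots> = (?\<kappa> powr s' * real N powr s')\<^sup>2 * (\<Sum>k\<in>F \<inter> freqs N. (cmod (D i k))\<^sup>2)"
          by (simp only: sum_distrib_left)
        also have "\<dots> \<le> (?\<kappa> powr s' * real N powr s')\<^sup>2 * ?E"
        proof (rule mult_left_mono)
          have "(\<Sum>k\<in>F \<inter> freqs N. (cmod (D i k))\<^sup>2) \<le> (\<Sum>k\<in>freqs N. (cmod (D i k))\<^sup>2)"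
            by (intro sum_mono2) auto
          also have "\<dots> \<le> ?E" unfolding energy_defect_def D_def \<pi>_def
            by (intro sum_mono member_le_sum) auto
          finally show "(\<Sum>k\<in>F \<inter> freqs N. (cmod (D i k))\<^sup>2) \<le> ?E" .
        qed simp
        finally show "(\<Sum>k\<in>F. (japanese_bracket k powr s' * cmod (D i k))\<^sup>2) \<le> (?\<kappa> powr s' * real N powr s' * sqrt ?E)\<^sup>2"
          by (simp add: power_mult_distrib energy_defect_nonneg)
      qed (simp add: energy_defect_nonneg)
    qed
    ultimately have "l1_bound japanese_bracket (\<lambda>k. complex_of_real (\<pi> k) * rcoef (\<lambda>x. u x $ i) k + (- 1) * D i k)
      (c1 * \<sigma> + cmod (- 1) * (c2 * (?\<kappa> powr s' * real N powr s' * sqrt (energy_defect s N u v))))"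
      by (rule l1_bound_add) simp
    then have "l1_bound japanese_bracket (rcoef (\<lambda>x. v x $ i))
      (c1 * \<sigma> + c2 * (?\<kappa> powr s' * real N powr s' * sqrt (energy_defect s N u v)))"
      by (simp add: D_def)
    then show ?thesis
    proof (rule l1_bound_mono)
      have "c1 * \<sigma> \<le> c * \<sigma>" unfolding c_def using \<sigma> by (intro mult_right_mono) auto
      moreover have "(c2 * ?\<kappa> powr s') * (real N powr s' * sqrt (energy_defect s N u v)) \<le> c * (real N powr s' * sqrt (energy_defect s N u v))"
        unfolding c_def by (intro mult_right_mono) (auto simp: energy_defect_nonneg)
      ultimately show "c1 * \<sigma> + c2 * (?\<kappa> powr s' * real N powr s' * sqrt (energy_defect s N u v))
        \<le> c * \<sigma> + c * real N powr s' * sqrt (energy_defect s N u v)" by (simp add: mult.assoc)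
    qed auto
  qed
  moreover have "0 < c" using c1(1) by (simp add: c_def)
  ultimately show ?thesis by blast
qed

section \<open>Local solvability of the Galerkin system\<close>

lemma integral_lipschitz:
  fixes g :: "real \<Rightarrow> 'a::banach"
  assumes g: "continuous_on {a..b} g" "\<And>t. t \<in> {a..b} \<Longrightarrow> norm (g t) \<le> K" and st: "s \<in> {a..b}" "t \<in> {a..b}"
  shows "norm (integral {a..t} g - integral {a..s} g) \<le> K * \<bar>t - s\<bar>"
proof -
  have *: "norm (integral {a..t} g - integral {a..s} g) \<le> K * (t - s)" if "a \<le> s" "s \<le> t" "t \<le> b" for s t
  proof -
    have "integral {a..s} g + integral {s..t} g = integral {a..t} g"
      using that by (intro Henstock_Kurzweil_Integration.integral_combine integrable_continuous_real
          continuous_on_subset[OF g(1)]) auto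
    then have "integral {a..t} g - integral {a..s} g = integral {s..t} g" by (simp add: algebra_simps)
    moreover have "norm (integral {s..t} g) \<le> K * (t - s)"
      using that g by (intro integral_bound continuous_on_subset[OF g(1)]) auto
    ultimately show ?thesis by simp
  qed
  show ?thesis
  proof (cases "s \<le> t")
    case True then show ?thesis using *[of s t] st by simp
  next
    case False then show ?thesis using *[of t s] st by (simp add: norm_minus_commute)
  qed
qed

text \<open>Picard--Lindeloef, with a step that depends only on the size and the Lipschitz constant of the
  vector field near the initial value.\<close>

theorem picard_local:
  fixes G :: "'a::banach \<Rightarrow> 'a"
  assumes lip: "\<And>x y. x \<in> cball c0 1 \<Longrightarrow> y \<in> cball c0 1 \<Longrightarrow> norm (G x - G y) \<le> L * norm (x - y)"
    and bnd: "\<And>x. x \<in> cball c0 1 \<Longrightarrow> norm (G x) \<le> B"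
    and \<delta>: "0 < \<delta>" "\<delta> * B \<le> 1" "\<delta> * L \<le> 1 / 2" and L: "0 \<le> L" and B: "0 \<le> B"
  shows "\<exists>v. v t0 = c0 \<and> (\<forall>t\<in>{t0 - \<delta><..<t0 + \<delta>}. v t \<in> cball c0 1 \<and> (v has_vector_derivative G (v t)) (at t))"
proof -
  define a where "a = t0 - \<delta>"
  define b where "b = t0 + \<delta>"
  \<comment> \<open>Clamping the time turns curves on \<open>{a..b}\<close> into bounded continuous functions on the whole line.\<close>
  define cl where "cl t = max a (min b t)" for t
  have ab: "a \<le> b" "t0 \<in> {a..b}" using \<delta>(1) by (auto simp: a_def b_def)
  have cl: "cl t \<in> {a..b}" "t \<in> {a..b} \<Longrightarrow> cl t = t" "\<bar>cl t - t0\<bar> \<le> \<delta>" for t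
    using ab \<delta>(1) by (auto simp: cl_def a_def b_def)
  have contG: "continuous_on (cball c0 1) G"
    by (rule lipschitz_on_continuous_on[of L]) (use lip L in \<open>auto simp: lipschitz_on_def dist_norm\<close>)
  define S where "S = (PiC UNIV (\<lambda>_::real. cball c0 1) :: (real \<Rightarrow>\<^sub>C 'a) set)"
  have S: "\<Phi> \<in> S \<longleftrightarrow> (\<forall>t. apply_bcontfun \<Phi> t \<in> cball c0 1)" for \<Phi> by (auto simp: S_def mem_PiC_iff)
  define g where "g \<Phi> t = G (apply_bcontfun \<Phi> t)" for \<Phi> :: "real \<Rightarrow>\<^sub>C 'a" and t
  have g: "continuous_on {a..b} (g \<Phi>)" "norm (g \<Phi> t) \<le> B" if "\<Phi> \<in> S" for \<Phi> t
  proof -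
    show "continuous_on {a..b} (g \<Phi>)" unfolding g_def
      using that by (intro continuous_on_compose2[OF contG]) (auto simp: S)
    show "norm (g \<Phi> t) \<le> B" unfolding g_def using that by (intro bnd) (auto simp: S)
  qed
  define P where "P \<Phi> t = c0 + (integral {a..cl t} (g \<Phi>) - integral {a..t0} (g \<Phi>))" for \<Phi> t
  have P0: "norm (P \<Phi> t - c0) \<le> 1" if "\<Phi> \<in> S" for \<Phi> t
  proof -
    have "norm (P \<Phi> t - c0) \<le> B * \<bar>cl t - t0\<bar>"
      unfolding P_def using g[OF that] cl(1)[of t] ab by (simp add: integral_lipschitz[of a b])
    also have "\<dots> \<le> B * \<delta>" using B cl(3)[of t] by (intro mult_left_mono) auto
    finally show ?thesis using \<delta>(2) by (simp add: mult.commute)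
  qed
  have Pc: "P \<Phi> \<in> bcontfun" if "\<Phi> \<in> S" for \<Phi>
  proof (rule bcontfun_normI)
    have "continuous_on {a..b} (\<lambda>t. integral {a..t} (g \<Phi>))"
      using g(1)[OF that] by (intro indefinite_integral_continuous_1 integrable_continuous_real)
    moreover have "continuous_on UNIV cl" unfolding cl_def by (intro continuous_intros)
    ultimately have "continuous_on UNIV (\<lambda>t. integral {a..cl t} (g \<Phi>))"
      by (rule continuous_on_compose2) (use cl(1) in auto)
    then show "continuous_on UNIV (P \<Phi>)" unfolding P_def by (intro continuous_intros)
    show "norm (P \<Phi> t) \<le> 1 + norm c0" for t
      using P0[OF that, of t] norm_triangle_sub[of "P \<Phi> t" c0] by linarith
  qed
  define T where "T \<Phi> = Bcontfun (P \<Phi>)" for \<Phi>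
  have T: "apply_bcontfun (T \<Phi>) = P \<Phi>" if "\<Phi> \<in> S" for \<Phi>
    unfolding T_def using Pc[OF that] by (simp add: Bcontfun_inverse)
  have "\<exists>!\<Phi>. \<Phi> \<in> S \<and> T \<Phi> = \<Phi>"
  proof (rule Banach_fix[of S "1/2" T])
    show "complete S" unfolding S_def complete_eq_closed by (rule closed_PiC) simp
    show "S \<noteq> {}"
    proof -
      have "const_bcontfun c0 \<in> S" by (simp add: S)
      then show ?thesis by blast
    qed
    show "T ` S \<subseteq> S"
    proof
      fix \<Psi> assume "\<Psi> \<in> T ` S"
      then obtain \<Phi> where "\<Phi> \<in> S" "\<Psi> = T \<Phi>" by blast
      then show "\<Psi> \<in> S" using T P0 by (simp add: S dist_norm norm_minus_commute)
    qed
    fix \<Phi> \<Psi> assume in_S: "\<Phi> \<in> S" "\<Psi> \<in> S"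
    show "dist (T \<Phi>) (T \<Psi>) \<le> 1 / 2 * dist \<Phi> \<Psi>"
    proof (rule dist_bound)
      fix t
      have gl: "norm (g \<Phi> \<tau> - g \<Psi> \<tau>) \<le> L * dist \<Phi> \<Psi>" for \<tau>
      proof -
        have "norm (g \<Phi> \<tau> - g \<Psi> \<tau>) \<le> L * norm (apply_bcontfun \<Phi> \<tau> - apply_bcontfun \<Psi> \<tau>)"
          unfolding g_def using in_S by (intro lip) (auto simp: S)
        also have "\<dots> \<le> L * dist \<Phi> \<Psi>"
          using L dist_bounded[of \<Phi> \<tau> \<Psi>] by (intro mult_left_mono) (auto simp: dist_norm)
        finally show ?thesis .
      qed
      have int: "integral {a..\<tau>} (\<lambda>\<tau>. g \<Phi> \<tau> - g \<Psi> \<tau>) = integral {a..\<tau>} (g \<Phi>) - integral {a..\<tau>} (g \<Psi>)" if "\<tau> \<in> {a..b}" for \<tau>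
        using that in_S by (intro integral_diff integrable_continuous_real continuous_on_subset[OF g(1)]) auto
      have "P \<Phi> t - P \<Psi> t = integral {a..cl t} (\<lambda>\<tau>. g \<Phi> \<tau> - g \<Psi> \<tau>) - integral {a..t0} (\<lambda>\<tau>. g \<Phi> \<tau> - g \<Psi> \<tau>)"
        unfolding P_def int[OF cl(1)] int[OF ab(2)] by (simp add: algebra_simps)
      also have "norm \<dots> \<le> (L * dist \<Phi> \<Psi>) * \<bar>cl t - t0\<bar>"
        using in_S g gl cl(1) ab by (intro integral_lipschitz[of a b] continuous_intros) auto
      also have "\<dots> \<le> (L * dist \<Phi> \<Psi>) * \<delta>" using L cl(3)[of t] by (intro mult_left_mono) auto
      also have "\<dots> = (\<delta> * L) * dist \<Phi> \<Psi>" by simp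
      also have "\<dots> \<le> 1 / 2 * dist \<Phi> \<Psi>" using \<delta>(3) by (intro mult_right_mono) auto
      finally show "dist (apply_bcontfun (T \<Phi>) t) (apply_bcontfun (T \<Psi>) t) \<le> 1 / 2 * dist \<Phi> \<Psi>"
        by (simp add: T in_S dist_norm)
    qed
  qed auto
  then obtain \<Phi> where \<Phi>: "\<Phi> \<in> S" "T \<Phi> = \<Phi>" by blast
  have v: "apply_bcontfun \<Phi> t = P \<Phi> t" for t using T[OF \<Phi>(1)] \<Phi>(2) by simp
  show ?thesis
  proof (intro exI[of _ "apply_bcontfun \<Phi>"] conjI ballI)
    show "apply_bcontfun \<Phi> t0 = c0" using v[of t0] cl(2)[OF ab(2)] by (simp add: P_def)
    fix t assume t: "t \<in> {t0 - \<delta><..<t0 + \<delta>}"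
    show "apply_bcontfun \<Phi> t \<in> cball c0 1" using \<Phi>(1) by (simp add: S)
    have t': "t \<in> {a<..<b}" using t by (simp add: a_def b_def)
    have "((\<lambda>t. integral {a..t} (g \<Phi>)) has_vector_derivative g \<Phi> t) (at t within {a..b})"
      using t' g(1)[OF \<Phi>(1)] by (intro integral_has_vector_derivative) auto
    then have "((\<lambda>t. integral {a..t} (g \<Phi>)) has_vector_derivative g \<Phi> t) (at t)"
      using t' by (simp add: at_within_Icc_at)
    then have "((\<lambda>t. c0 + (integral {a..t} (g \<Phi>) - integral {a..t0} (g \<Phi>))) has_vector_derivative g \<Phi> t) (at t)"
      by (auto intro!: derivative_eq_intros)
    then have "(apply_bcontfun \<Phi> has_vector_derivative g \<Phi> t) (at t)"
      by (rule has_vector_derivative_transform_within_open[of _ _ _ "{a<..<b}"])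
        (use t' in \<open>auto simp: v P_def cl(2)\<close>)
    then show "(apply_bcontfun \<Phi> has_vector_derivative G (apply_bcontfun \<Phi> t)) (at t)" by (simp add: g_def)
  qed
qed

lemma coef_dist_le:
  fixes f g :: "real ^ 'd \<Rightarrow> complex"
  assumes fg: "continuous_on UNIV f" "continuous_on UNIV g" and B: "\<And>x. cmod (f x - g x) \<le> B"
  shows "cmod (coef f k - coef g k) \<le> B"
proof -
  have c: "continuous_on UNIV (\<lambda>x. h x * cis (- freq_dot k x))" if "continuous_on UNIV h" for h :: "real ^ 'd \<Rightarrow> complex"
    using that continuous_periodicD(1)[OF continuous_periodic_cis_minus] by (intro continuous_intros)
  note i = continuous_integrable_torus[OF c[OF fg(1)]] continuous_integrable_torus[OF c[OF fg(2)]]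
  have "coef f k - coef g k = integral torus_cell (\<lambda>x. f x * cis (- freq_dot k x) - g x * cis (- freq_dot k x)) / complex_of_real ((2 * pi) ^ CARD('d))"
    using i by (simp add: coef_def integral_diff diff_divide_distrib)
  moreover have "cmod (integral torus_cell (\<lambda>x. f x * cis (- freq_dot k x) - g x * cis (- freq_dot k x))) \<le> integral (torus_cell :: (real ^ 'd) set) (\<lambda>_. B)"
  proof (intro integral_norm_bound_integral)
    show "cmod (f x * cis (- freq_dot k x) - g x * cis (- freq_dot k x)) \<le> B" for x
      using B[of x] by (simp add: norm_mult flip: left_diff_distrib)
  qed (use i in \<open>auto intro: integrable_diff simp: torus_cell_def\<close>)
  moreover have "integral (torus_cell :: (real ^ 'd) set) (\<lambda>_. B) = B * (2 * pi) ^ CARD('d)"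
    using torus_cell_props(3)[where 'd='d] by (simp add: torus_cell_def)
  ultimately show ?thesis by (simp add: norm_divide divide_le_eq norm_power norm_mult)
qed

lemma has_vector_derivative_vecI:
  fixes f :: "real \<Rightarrow> real ^ 'n"
  assumes "\<And>i. ((\<lambda>h. f h $ i) has_vector_derivative f' $ i) F"
  shows "(f has_vector_derivative f') F"
proof -
  have "((\<lambda>h. \<Sum>i\<in>UNIV. (f h $ i) *\<^sub>R (axis i 1 :: real ^ 'n)) has_vector_derivative (\<Sum>i\<in>UNIV. (f' $ i) *\<^sub>R axis i 1)) F"
    by (intro has_vector_derivative_sum bounded_linear.has_vector_derivative[OF bounded_linear_scaleR_left] assms)
  moreover have "(\<Sum>i\<in>UNIV. (v $ i) *\<^sub>R (axis i 1 :: real ^ 'n)) = v" for v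
    using basis_expansion[of v] by (simp add: scalar_mult_eq_scaleR)
  ultimately show ?thesis by simp
qed

definition trig_constant :: "nat \<Rightarrow> 'd::finite itself \<Rightarrow> 'n::finite itself \<Rightarrow> real" where
  "trig_constant N d n = real CARD('n) * real (card (freqs N :: (int ^ 'd) set))"

lemma norm_vec_le_sum:
  fixes v :: "real ^ 'n"
  assumes "\<And>i. \<bar>v $ i\<bar> \<le> B"
  shows "norm v \<le> real CARD('n) * B"
proof -
  have "norm v \<le> (\<Sum>i\<in>UNIV. \<bar>v $ i\<bar>)" by (rule norm_le_l1_cart)
  also have "\<dots> \<le> (\<Sum>i\<in>(UNIV :: 'n set). B)" by (intro sum_mono assms)
  finally show ?thesis by simp
qed

lemma low_pass_dist_le:
  fixes V W :: "real ^ 'd \<Rightarrow> real ^ 'n"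
  assumes e: "\<And>i k. k \<in> freqs N \<Longrightarrow> cmod (rcoef (\<lambda>x. V x $ i) k - rcoef (\<lambda>x. W x $ i) k) \<le> e"
  shows "norm (low_pass N V x - low_pass N W x) \<le> trig_constant N TYPE('d) TYPE('n) * e"
proof -
  have "\<bar>(low_pass N V x - low_pass N W x) $ i\<bar> \<le> real (card (freqs N :: (int ^ 'd) set)) * e" for i
  proof -
    have "\<bar>(low_pass N V x - low_pass N W x) $ i\<bar> = cmod (complex_of_real (low_pass N V x $ i) - complex_of_real (low_pass N W x $ i))"
      by (simp flip: of_real_diff)
    also have "\<dots> = cmod (\<Sum>k\<in>freqs N. (rcoef (\<lambda>x. V x $ i) k - rcoef (\<lambda>x. W x $ i) k) * cis (freq_dot k x))"
      by (simp add: low_pass_component left_diff_distrib sum_subtractf)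
    also have "\<dots> \<le> (\<Sum>k\<in>(freqs N :: (int ^ 'd) set). e)"
      using e by (intro order_trans[OF norm_sum] sum_mono) (auto simp: norm_mult)
    finally show ?thesis by simp
  qed
  from norm_vec_le_sum[OF this] show ?thesis by (simp add: trig_constant_def mult.assoc)
qed

lemma partial_low_pass:
  "partial_x j (low_pass N V) x = (\<chi> i. Re (\<Sum>k\<in>freqs N. \<i> * of_int (k $ j) * rcoef (\<lambda>x. V x $ i) k * cis (freq_dot k x)))"
  "((\<lambda>h. low_pass N V (x + axis j h)) has_vector_derivative partial_x j (low_pass N V) x) (at 0)"
proof -
  have lp: "low_pass N V y $ i = Re (\<Sum>k\<in>freqs N. rcoef (\<lambda>x. V x $ i) k * cis (freq_dot k y))" for y i
    using arg_cong[OF low_pass_component[of N V y i], of Re] by simp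
  have d1: "((\<lambda>h. cis (freq_dot k (x + axis j h))) has_vector_derivative \<i> * of_int (k $ j) * cis (freq_dot k x)) (at 0)" for k
  proof -
    have "((\<lambda>h. cis (freq_dot k x + real_of_int (k $ j) * h)) has_vector_derivative
      real_of_int (k $ j) *\<^sub>R (\<i> * cis (freq_dot k x + real_of_int (k $ j) * 0))) (at 0)"
      by (auto intro!: derivative_eq_intros simp: has_vector_derivative_def)
    then show ?thesis by (simp add: freq_dot_simps freq_dot_axis scaleR_conv_of_real mult_ac)
  qed
  have "((\<lambda>h. low_pass N V (x + axis j h)) has_vector_derivative
    (\<chi> i. Re (\<Sum>k\<in>freqs N. rcoef (\<lambda>x. V x $ i) k * (\<i> * of_int (k $ j) * cis (freq_dot k x))))) (at 0)"
  proof (rule has_vector_derivative_vecI)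
    fix i
    have "((\<lambda>h. \<Sum>k\<in>freqs N. rcoef (\<lambda>x. V x $ i) k * cis (freq_dot k (x + axis j h))) has_vector_derivative
      (\<Sum>k\<in>freqs N. rcoef (\<lambda>x. V x $ i) k * (\<i> * of_int (k $ j) * cis (freq_dot k x)))) (at 0)"
      by (intro has_vector_derivative_sum has_vector_derivative_mult_right d1)
    from bounded_linear.has_vector_derivative[OF bounded_linear_Re this]
    show "((\<lambda>h. low_pass N V (x + axis j h) $ i) has_vector_derivative
      (\<chi> i. Re (\<Sum>k\<in>freqs N. rcoef (\<lambda>x. V x $ i) k * (\<i> * of_int (k $ j) * cis (freq_dot k x)))) $ i) (at 0)"
      by (simp only: lp vec_lambda_beta)
  qed
  moreover have "(\<chi> i. Re (\<Sum>k\<in>freqs N. rcoef (\<lambda>x. V x $ i) k * (\<i> * of_int (k $ j) * cis (freq_dot k x))))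
    = (\<chi> i. Re (\<Sum>k\<in>freqs N. \<i> * of_int (k $ j) * rcoef (\<lambda>x. V x $ i) k * cis (freq_dot k x)))"
    by (simp only: mult_ac)
  ultimately have d: "((\<lambda>h. low_pass N V (x + axis j h)) has_vector_derivative
    (\<chi> i. Re (\<Sum>k\<in>freqs N. \<i> * of_int (k $ j) * rcoef (\<lambda>x. V x $ i) k * cis (freq_dot k x)))) (at 0)"
    by (simp only:)
  show 1: "partial_x j (low_pass N V) x = (\<chi> i. Re (\<Sum>k\<in>freqs N. \<i> * of_int (k $ j) * rcoef (\<lambda>x. V x $ i) k * cis (freq_dot k x)))"
    unfolding partial_x_def by (rule vector_derivative_at[OF d])
  show "((\<lambda>h. low_pass N V (x + axis j h)) has_vector_derivative partial_x j (low_pass N V) x) (at 0)"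
    unfolding 1 by (rule d)
qed

lemma partial_low_pass_dist_le:
  fixes V W :: "real ^ 'd \<Rightarrow> real ^ 'n"
  assumes e: "\<And>i k. k \<in> freqs N \<Longrightarrow> cmod (rcoef (\<lambda>x. V x $ i) k - rcoef (\<lambda>x. W x $ i) k) \<le> e"
  shows "norm (partial_x j (low_pass N V) x - partial_x j (low_pass N W) x) \<le> trig_constant N TYPE('d) TYPE('n) * (real N * e)"
proof -
  have "\<bar>(partial_x j (low_pass N V) x - partial_x j (low_pass N W) x) $ i\<bar> \<le> real (card (freqs N :: (int ^ 'd) set)) * (real N * e)" for i
  proof -
    have "(partial_x j (low_pass N V) x - partial_x j (low_pass N W) x) $ i
      = Re (\<Sum>k\<in>freqs N. \<i> * of_int (k $ j) * (rcoef (\<lambda>x. V x $ i) k - rcoef (\<lambda>x. W x $ i) k) * cis (freq_dot k x))"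
      by (simp add: partial_low_pass(1) right_diff_distrib left_diff_distrib sum_subtractf del: Re_sum)
    also have "\<bar>\<dots>\<bar> \<le> cmod (\<Sum>k\<in>freqs N. \<i> * of_int (k $ j) * (rcoef (\<lambda>x. V x $ i) k - rcoef (\<lambda>x. W x $ i) k) * cis (freq_dot k x))"
      by (rule abs_Re_le_cmod)
    also have "\<dots> \<le> (\<Sum>k\<in>(freqs N :: (int ^ 'd) set). real N * e)"
    proof (intro order_trans[OF norm_sum] sum_mono)
      fix k :: "int ^ 'd" assume k: "k \<in> freqs N"
      then have "\<bar>k $ j\<bar> \<le> int N" by (simp add: freqs_def)
      then have "\<bar>real_of_int (k $ j)\<bar> \<le> real N" by linarith
      then have "\<bar>real_of_int (k $ j)\<bar> * cmod (rcoef (\<lambda>x. V x $ i) k - rcoef (\<lambda>x. W x $ i) k) \<le> real N * e"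
        using e[OF k] by (intro mult_mono) auto
      then show "cmod (\<i> * of_int (k $ j) * (rcoef (\<lambda>x. V x $ i) k - rcoef (\<lambda>x. W x $ i) k) * cis (freq_dot k x)) \<le> real N * e"
        by (simp add: norm_mult)
    qed
    finally show ?thesis by simp
  qed
  from norm_vec_le_sum[OF this] show ?thesis by (simp add: trig_constant_def mult.assoc)
qed

lemma low_pass_zero: "low_pass N (\<lambda>x. 0) = (\<lambda>x. 0)"
  by (auto simp: vec_eq_iff coef_const low_pass_def fourier_coeff_component)

lemma partial_zero: "partial_x j (\<lambda>x. 0) x = 0"
  by (simp add: partial_x_def vector_derivative_at[OF has_vector_derivative_const])

lemma advection_zero: "advection A (\<lambda>x. 0) x = 0"
  by (simp add: advection_def partial_zero)

lemma polynomial_lipschitz_on_ball: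
  fixes p :: "'a::euclidean_space \<Rightarrow> real"
  assumes "real_polynomial_function p"
  shows "\<exists>L\<ge>0. \<forall>y z. norm y \<le> R \<longrightarrow> norm z \<le> R \<longrightarrow> \<bar>p y - p z\<bar> \<le> L * norm (y - z) \<and> \<bar>p y\<bar> \<le> L"
proof -
  have bnd: "\<exists>B\<ge>0. \<forall>y. norm y \<le> R \<longrightarrow> \<bar>q y\<bar> \<le> B" if "real_polynomial_function q" for q :: "'a \<Rightarrow> real"
  proof -
    have "continuous_on (cball 0 R) q"
      using that by (intro continuous_on_polymonial_function) (simp add: real_polynomial_function_eq)
    then have "bounded (q ` cball 0 R)" by (intro compact_imp_bounded compact_continuous_image) auto
    then obtain B where "\<And>y. y \<in> cball 0 R \<Longrightarrow> norm (q y) \<le> B" by (metis bounded_iff image_eqI)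
    then have "\<bar>q y\<bar> \<le> max B 0" if "norm y \<le> R" for y using that by (simp add: le_max_iff_disj)
    then show ?thesis by (intro exI[of _ "max B 0"]) auto
  qed
  have "\<exists>L\<ge>0. \<forall>y z. norm y \<le> R \<longrightarrow> norm z \<le> R \<longrightarrow> \<bar>p y - p z\<bar> \<le> L * norm (y - z)"
    using assms
  proof (induction p)
    case (linear f)
    then interpret bounded_linear f .
    have "\<bar>f y - f z\<bar> \<le> onorm f * norm (y - z)" for y z
      using onorm[OF bounded_linear_axioms, of "y - z"] by (simp add: diff)
    then show ?case using onorm_pos_le[OF bounded_linear_axioms] by blast
  next
    case (const c) show ?case by (intro exI[of _ 0]) auto
  next
    case (add f g)
    then obtain L1 L2 where L: "0 \<le> L1" "0 \<le> L2" "\<And>y z. norm y \<le> R \<Longrightarrow> norm z \<le> R \<Longrightarrow> \<bar>f y - f z\<bar> \<le> L1 * norm (y - z)"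
      "\<And>y z. norm y \<le> R \<Longrightarrow> norm z \<le> R \<Longrightarrow> \<bar>g y - g z\<bar> \<le> L2 * norm (y - z)" by blast
    have "\<bar>f y + g y - (f z + g z)\<bar> \<le> (L1 + L2) * norm (y - z)" if "norm y \<le> R" "norm z \<le> R" for y z
      using L(3)[OF that] L(4)[OF that] by (simp add: distrib_right abs_le_iff)
    then show ?case using L by (intro exI[of _ "L1 + L2"]) auto
  next
    case (mult f g)
    then obtain L1 L2 where L: "0 \<le> L1" "0 \<le> L2" "\<And>y z. norm y \<le> R \<Longrightarrow> norm z \<le> R \<Longrightarrow> \<bar>f y - f z\<bar> \<le> L1 * norm (y - z)"
      "\<And>y z. norm y \<le> R \<Longrightarrow> norm z \<le> R \<Longrightarrow> \<bar>g y - g z\<bar> \<le> L2 * norm (y - z)" by blast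
    obtain B1 where B1: "0 \<le> B1" "\<And>y. norm y \<le> R \<Longrightarrow> \<bar>f y\<bar> \<le> B1" using bnd[OF mult.hyps(1)] by blast
    obtain B2 where B2: "0 \<le> B2" "\<And>y. norm y \<le> R \<Longrightarrow> \<bar>g y\<bar> \<le> B2" using bnd[OF mult.hyps(2)] by blast
    have "\<bar>f y * g y - f z * g z\<bar> \<le> (B1 * L2 + L1 * B2) * norm (y - z)" if yz: "norm y \<le> R" "norm z \<le> R" for y z
    proof -
      have "f y * g y - f z * g z = f y * (g y - g z) + (f y - f z) * g z" by (simp add: algebra_simps)
      also have "\<bar>\<dots>\<bar> \<le> \<bar>f y\<bar> * \<bar>g y - g z\<bar> + \<bar>f y - f z\<bar> * \<bar>g z\<bar>"
        by (metis abs_mult abs_triangle_ineq)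
      also have "\<dots> \<le> B1 * (L2 * norm (y - z)) + (L1 * norm (y - z)) * B2"
        using B1 B2 L yz by (intro add_mono mult_mono) auto
      finally show ?thesis by (simp add: algebra_simps)
    qed
    then show ?case using B1(1) B2(1) L by (intro exI[of _ "B1 * L2 + L1 * B2"]) auto
  qed
  then obtain L where L: "0 \<le> L" "\<And>y z. norm y \<le> R \<Longrightarrow> norm z \<le> R \<Longrightarrow> \<bar>p y - p z\<bar> \<le> L * norm (y - z)" by blast
  obtain B where B: "0 \<le> B" "\<And>y. norm y \<le> R \<Longrightarrow> \<bar>p y\<bar> \<le> B" using bnd[OF assms] by blast
  show ?thesis
  proof (intro exI[of _ "max L B"] conjI allI impI)
    fix y z :: 'a assume yz: "norm y \<le> R" "norm z \<le> R"
    show "\<bar>p y - p z\<bar> \<le> max L B * norm (y - z)"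
      using L(2)[OF yz] mult_right_mono[of L "max L B" "norm (y - z)"] by simp
    show "\<bar>p y\<bar> \<le> max L B" using B(2)[OF yz(1)] by simp
  qed (use L in auto)
qed

text \<open>Crude estimates suffice here, with constants that depend on \<open>N\<close>: they only serve the solvability
  of the truncated system for each \<open>N\<close>, whereas the error estimates are uniform in \<open>N\<close>.\<close>

lemma advection_low_pass_lipschitz:
  fixes A :: "'d::finite \<Rightarrow> real ^ 'n::finite \<Rightarrow> real ^ 'n ^ 'n"
  assumes poly: "\<And>j a b. real_polynomial_function (\<lambda>V. A j V $ a $ b)" and R: "0 \<le> R"
  obtains L where "0 \<le> L" "\<forall>(V :: real ^ 'd \<Rightarrow> real ^ 'n) W e x.
    (\<forall>i k. k \<in> freqs N \<longrightarrow> cmod (rcoef (\<lambda>x. V x $ i) k) \<le> R \<and> cmod (rcoef (\<lambda>x. W x $ i) k) \<le> R \<and>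
      cmod (rcoef (\<lambda>x. V x $ i) k - rcoef (\<lambda>x. W x $ i) k) \<le> e) \<longrightarrow>
    norm (advection A (low_pass N V) x - advection A (low_pass N W) x) \<le> L * e"
proof -
  define \<kappa> where "\<kappa> = trig_constant N TYPE('d) TYPE('n)"
  have \<kappa>: "0 \<le> \<kappa>" by (simp add: \<kappa>_def trig_constant_def)
  define K where "K = \<kappa> * (R + real N * R)"
  have K: "\<kappa> * R \<le> K" "\<kappa> * (real N * R) \<le> K" unfolding K_def using \<kappa> R by (auto intro: mult_left_mono)
  have "\<exists>L\<ge>0. \<forall>i. \<forall>y z. norm y \<le> K \<longrightarrow> norm z \<le> K \<longrightarrow>
    \<bar>(case i of (j, a, b) \<Rightarrow> A j y $ a $ b) - (case i of (j, a, b) \<Rightarrow> A j z $ a $ b)\<bar> \<le> L * norm (y - z) \<and> \<bar>case i of (j, a, b) \<Rightarrow> A j y $ a $ b\<bar> \<le> L"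
  proof (rule uniform_constant)
    fix i :: "'d \<times> 'n \<times> 'n"
    show "\<exists>L\<ge>0. \<forall>y z. norm y \<le> K \<longrightarrow> norm z \<le> K \<longrightarrow>
      \<bar>(case i of (j, a, b) \<Rightarrow> A j y $ a $ b) - (case i of (j, a, b) \<Rightarrow> A j z $ a $ b)\<bar> \<le> L * norm (y - z) \<and> \<bar>case i of (j, a, b) \<Rightarrow> A j y $ a $ b\<bar> \<le> L"
      using polynomial_lipschitz_on_ball[OF poly] by (cases i) simp
  next
    fix i :: "'d \<times> 'n \<times> 'n" and C C' :: real
    assume C: "\<forall>y z. norm y \<le> K \<longrightarrow> norm z \<le> K \<longrightarrow>
      \<bar>(case i of (j, a, b) \<Rightarrow> A j y $ a $ b) - (case i of (j, a, b) \<Rightarrow> A j z $ a $ b)\<bar> \<le> C * norm (y - z) \<and> \<bar>case i of (j, a, b) \<Rightarrow> A j y $ a $ b\<bar> \<le> C" "C \<le> C'"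
    have "C * norm (y - z) \<le> C' * norm (y - z)" for y z :: "real ^ 'n" using C(2) by (intro mult_right_mono) auto
    with C show "\<forall>y z. norm y \<le> K \<longrightarrow> norm z \<le> K \<longrightarrow>
      \<bar>(case i of (j, a, b) \<Rightarrow> A j y $ a $ b) - (case i of (j, a, b) \<Rightarrow> A j z $ a $ b)\<bar> \<le> C' * norm (y - z) \<and> \<bar>case i of (j, a, b) \<Rightarrow> A j y $ a $ b\<bar> \<le> C'"
      by (meson order_trans)
  qed
  then obtain L where L: "0 \<le> L" "\<And>j a b y z. norm y \<le> K \<Longrightarrow> norm z \<le> K \<Longrightarrow>
    \<bar>A j y $ a $ b - A j z $ a $ b\<bar> \<le> L * norm (y - z)" "\<And>j a b y. norm y \<le> K \<Longrightarrow> \<bar>A j y $ a $ b\<bar> \<le> L"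
    by (metis (no_types, lifting) case_prod_conv)
  define C where "C = real CARD('n) * (real CARD('d) * (real CARD('n) * (L * \<kappa> * K + L * (\<kappa> * real N))))"
  have main: "norm (advection A (low_pass N V) x - advection A (low_pass N W) x) \<le> C * e"
    if VW: "\<And>i k. k \<in> freqs N \<Longrightarrow> cmod (rcoef (\<lambda>x. V x $ i) k) \<le> R \<and> cmod (rcoef (\<lambda>x. W x $ i) k) \<le> R \<and>
      cmod (rcoef (\<lambda>x. V x $ i) k - rcoef (\<lambda>x. W x $ i) k) \<le> e" for V W :: "real ^ 'd \<Rightarrow> real ^ 'n" and e x
  proof -
    let ?P = "low_pass N V x" and ?Q = "low_pass N W x"
    let ?p = "\<lambda>j. partial_x j (low_pass N V) x" and ?q = "\<lambda>j. partial_x j (low_pass N W) x"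
    have PQ: "norm ?P \<le> K" "norm ?Q \<le> K"
      using low_pass_dist_le[of N V "\<lambda>x. 0" R x] low_pass_dist_le[of N W "\<lambda>x. 0" R x] VW K
      by (auto simp: coef_const low_pass_zero \<kappa>_def)
    have pq: "norm (?q j) \<le> K" "norm (?p j) \<le> K" for j
      using partial_low_pass_dist_le[of N V "\<lambda>x. 0" R j x] partial_low_pass_dist_le[of N W "\<lambda>x. 0" R j x] VW K
      by (auto simp: coef_const low_pass_zero partial_zero \<kappa>_def)
    have d1: "norm (?P - ?Q) \<le> \<kappa> * e" using VW by (auto simp: \<kappa>_def intro: low_pass_dist_le)
    have d2: "norm (?p j - ?q j) \<le> \<kappa> * (real N * e)" for j using VW by (auto simp: \<kappa>_def intro: partial_low_pass_dist_le)
    have "\<bar>(advection A (low_pass N V) x - advection A (low_pass N W) x) $ a\<bar> \<le> real CARD('d) * (real CARD('n) * ((L * \<kappa> * K + L * (\<kappa> * real N)) * e))" for a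
    proof -
      have "(advection A (low_pass N V) x - advection A (low_pass N W) x) $ a
        = (\<Sum>j\<in>UNIV. \<Sum>b\<in>UNIV. (A j ?P $ a $ b - A j ?Q $ a $ b) * ?p j $ b + A j ?Q $ a $ b * (?p j - ?q j) $ b)"
        by (simp add: advection_component algebra_simps flip: sum_subtractf)
      also have "\<bar>\<dots>\<bar> \<le> (\<Sum>j\<in>(UNIV :: 'd set). \<Sum>b\<in>(UNIV :: 'n set). (L * \<kappa> * K + L * (\<kappa> * real N)) * e)"
      proof (intro order_trans[OF sum_abs] sum_mono)
        fix j :: 'd and b :: 'n
        have "\<bar>A j ?P $ a $ b - A j ?Q $ a $ b\<bar> \<le> L * (\<kappa> * e)"
          using L(2)[OF PQ, of j a b] mult_left_mono[OF d1 L(1)] by linarith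
        moreover have "\<bar>?p j $ b\<bar> \<le> K" using pq(2)[of j] component_le_norm_cart[of "?p j" b] by linarith
        moreover have "\<bar>A j ?Q $ a $ b\<bar> \<le> L" by (rule L(3)[OF PQ(2)])
        moreover have "\<bar>(?p j - ?q j) $ b\<bar> \<le> \<kappa> * (real N * e)"
          using d2[of j] component_le_norm_cart[of "?p j - ?q j" b] by linarith
        ultimately have "\<bar>A j ?P $ a $ b - A j ?Q $ a $ b\<bar> * \<bar>?p j $ b\<bar> + \<bar>A j ?Q $ a $ b\<bar> * \<bar>(?p j - ?q j) $ b\<bar>
          \<le> L * (\<kappa> * e) * K + L * (\<kappa> * (real N * e))"
          by (intro add_mono mult_mono) (auto intro: order_trans[OF abs_ge_zero])
        then show "\<bar>(A j ?P $ a $ b - A j ?Q $ a $ b) * ?p j $ b + A j ?Q $ a $ b * (?p j - ?q j) $ b\<bar>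
          \<le> (L * \<kappa> * K + L * (\<kappa> * real N)) * e"
          using abs_triangle_ineq[of "(A j ?P $ a $ b - A j ?Q $ a $ b) * ?p j $ b" "A j ?Q $ a $ b * (?p j - ?q j) $ b"]
          unfolding abs_mult by (simp add: algebra_simps)
      qed
      finally show ?thesis by simp
    qed
    from norm_vec_le_sum[OF this] show ?thesis by (simp add: C_def mult.assoc)
  qed
  have "0 \<le> C" unfolding C_def using L(1) \<kappa> K R by (auto simp: K_def)
  with that main show ?thesis by meson
qed

section \<open>Continuation of solutions of the Galerkin system\<close>

lemma low_pass_continuous_periodic_vec: "continuous_periodic (low_pass N W)"
proof -
  have "continuous_on UNIV (low_pass N W)"
    by (rule continuous_on_vec_components) (rule continuous_periodicD(1)[OF low_pass_continuous_periodic])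
  moreover have "torus_periodic (low_pass N W)"
    using continuous_periodicD(2)[OF low_pass_continuous_periodic] by (auto simp: torus_periodic_def vec_eq_iff)
  ultimately show ?thesis by (simp add: continuous_periodic_def)
qed

lemma low_pass_idem: "low_pass N (low_pass N W) = low_pass N W"
proof -
  have "complex_of_real (low_pass N (low_pass N W) x $ i) = complex_of_real (low_pass N W x $ i)" for x i
    unfolding low_pass_component[of N "low_pass N W"] low_pass_component[of N W x i]
    by (intro sum.cong refl) (simp only: rcoef_low_pass if_True)
  then show ?thesis by (simp add: fun_eq_iff vec_eq_iff)
qed

lemma low_pass_cong:
  "(\<And>i k. k \<in> freqs N \<Longrightarrow> rcoef (\<lambda>x. V x $ i) k = rcoef (\<lambda>x. W x $ i) k) \<Longrightarrow> low_pass N V = low_pass N W"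
proof -
  assume "\<And>i k. k \<in> freqs N \<Longrightarrow> rcoef (\<lambda>x. V x $ i) k = rcoef (\<lambda>x. W x $ i) k"
  then have "complex_of_real (low_pass N V x $ i) = complex_of_real (low_pass N W x $ i)" for x i
    unfolding low_pass_component by (intro sum.cong) auto
  then show ?thesis by (simp add: fun_eq_iff vec_eq_iff)
qed

lemma low_pass_fixed:
  assumes "\<And>i. continuous_periodic (\<lambda>x. V x $ i)" "\<And>i k. k \<notin> freqs N \<Longrightarrow> rcoef (\<lambda>x. V x $ i) k = 0"
  shows "low_pass N V = V"
proof -
  have "complex_of_real (V x $ i - low_pass N V x $ i) = 0" for x i
  proof (rule fourier_uniqueness[of "\<lambda>x. complex_of_real (V x $ i - low_pass N V x $ i)"])
    show "continuous_periodic (\<lambda>x. complex_of_real (V x $ i - low_pass N V x $ i))"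
      by (intro continuous_periodic_of_real continuous_periodic_diff assms low_pass_continuous_periodic)
    show "rcoef (\<lambda>x. V x $ i - low_pass N V x $ i) k = 0" for k
      unfolding rcoef_diff[OF assms(1) low_pass_continuous_periodic] using assms(2) by (simp add: rcoef_low_pass)
  qed
  then show ?thesis by (simp add: fun_eq_iff vec_eq_iff)
qed

lemma C1_periodic_low_pass: "C1_periodic (low_pass N V)"
  unfolding C1_periodic_def
proof (intro conjI allI low_pass_continuous_periodic partial_low_pass(2))
  fix j i
  have "continuous_periodic (\<lambda>x. Re (\<Sum>k\<in>freqs N. (\<i> * of_int (k $ j) * rcoef (\<lambda>x. V x $ i) k) * cis (freq_dot k x)))"
    by (rule continuous_periodic_compose[OF continuous_periodic_trig_sum]) (intro continuous_intros)
  then show "continuous_periodic (\<lambda>x. partial_x j (low_pass N V) x $ i)"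
    by (simp only: partial_low_pass(1) vec_lambda_beta)
qed

lemma advection_low_pass_continuous:
  assumes poly: "\<And>j a b. real_polynomial_function (\<lambda>V. A j V $ a $ b)"
  shows "continuous_periodic (\<lambda>x. advection A (low_pass N V) x $ a)"
proof (rule advection_continuous_periodic[OF C1_periodic_low_pass])
  fix j a b
  have "continuous_on UNIV (\<lambda>V. A j V $ a $ b)"
    using poly by (intro continuous_on_polymonial_function) (simp add: real_polynomial_function_eq)
  then show "continuous_periodic (\<lambda>x. A j (low_pass N V x) $ a $ b)"
    by (rule continuous_periodic_compose[OF low_pass_continuous_periodic_vec])
qed

lemma continuous_rcoef_bcontfun: "continuous_on UNIV (\<lambda>x. complex_of_real (apply_bcontfun V x $ i))"
  by (intro continuous_intros) simp

lemma rcoef_bcontfun_le: "cmod (rcoef (\<lambda>x. apply_bcontfun V x $ i) k) \<le> norm V"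
proof -
  have "cmod (rcoef (\<lambda>x. apply_bcontfun V x $ i) k - coef (\<lambda>x. 0) k) \<le> norm V"
  proof (rule coef_dist_le[OF continuous_rcoef_bcontfun])
    show "cmod (complex_of_real (apply_bcontfun V x $ i) - 0) \<le> norm V" for x
      using component_le_norm_cart[of "apply_bcontfun V x" i] norm_bounded[of V x] by simp
  qed simp
  then show ?thesis by (simp add: coef_const)
qed

lemma rcoef_continuous_add:
  assumes "continuous_on UNIV f" "continuous_on UNIV g"
  shows "coef (\<lambda>x. f x + g x) k = coef f k + coef g k"
proof -
  have "continuous_on UNIV (\<lambda>x. h x * cis (- freq_dot k x))" if "continuous_on UNIV h" for h :: "real ^ 'a \<Rightarrow> complex"
    using that continuous_periodicD(1)[OF continuous_periodic_cis_minus] by (intro continuous_intros)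
  note i = continuous_integrable_torus[OF this[OF assms(1)]] continuous_integrable_torus[OF this[OF assms(2)]]
    continuous_integrable_torus[OF this[OF continuous_on_add[OF assms]]]
  show ?thesis unfolding coef_def i(2) i(4) i(6) using i by (simp add: distrib_right integral_add add_divide_distrib)
qed

lemma bounded_linear_rcoef:
  "bounded_linear (\<lambda>V :: (real ^ 'd) \<Rightarrow>\<^sub>C (real ^ 'n). rcoef (\<lambda>x. apply_bcontfun V x $ i) k)"
proof (rule bounded_linear_intro[of _ 1])
  fix V W :: "(real ^ 'd) \<Rightarrow>\<^sub>C (real ^ 'n)" and r :: real
  show "rcoef (\<lambda>x. apply_bcontfun (V + W) x $ i) k = rcoef (\<lambda>x. apply_bcontfun V x $ i) k + rcoef (\<lambda>x. apply_bcontfun W x $ i) k"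
    using rcoef_continuous_add[OF continuous_rcoef_bcontfun continuous_rcoef_bcontfun, of V i W i k] by simp
  show "rcoef (\<lambda>x. apply_bcontfun (r *\<^sub>R V) x $ i) k = r *\<^sub>R rcoef (\<lambda>x. apply_bcontfun V x $ i) k"
  proof -
    have "complex_of_real (apply_bcontfun (r *\<^sub>R V) x $ i) * cis (- freq_dot k x)
      = complex_of_real r * (complex_of_real (apply_bcontfun V x $ i) * cis (- freq_dot k x))" for x by simp
    then show ?thesis unfolding coef_def by (simp only: set_integral_mult_right) (simp add: scaleR_conv_of_real)
  qed
  show "norm (rcoef (\<lambda>x. apply_bcontfun V x $ i) k) \<le> norm V * 1" using rcoef_bcontfun_le[of V i k] by simp
qed

text \<open>Filtering the argument extends the right-hand side of the truncated equation from band-limited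
  functions to all bounded continuous ones, a Banach space on which it is locally Lipschitz. The
  filter depends on finitely many coefficients only, which are continuous linear functionals.\<close>

definition galerkin_field ::
  "('d::finite \<Rightarrow> real ^ 'n::finite \<Rightarrow> real ^ 'n ^ 'n) \<Rightarrow> nat \<Rightarrow> ((real ^ 'd) \<Rightarrow>\<^sub>C (real ^ 'n)) \<Rightarrow> ((real ^ 'd) \<Rightarrow>\<^sub>C (real ^ 'n))" where
  "galerkin_field A N V = Bcontfun (\<lambda>x. - low_pass N (advection A (low_pass N (apply_bcontfun V))) x)"

lemma low_pass_bcontfun: "low_pass N W \<in> bcontfun"
proof -
  obtain B where "\<And>x. norm (low_pass N W x) \<le> B"
    using continuous_periodic_bounded[OF low_pass_continuous_periodic_vec] by blast
  then show ?thesis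
    by (rule bcontfun_normI[OF continuous_periodicD(1)[OF low_pass_continuous_periodic_vec]])
qed

lemma apply_galerkin_field:
  "apply_bcontfun (galerkin_field A N V) = (\<lambda>x. - low_pass N (advection A (low_pass N (apply_bcontfun V))) x)"
  unfolding galerkin_field_def by (simp add: Bcontfun_inverse uminus_cont low_pass_bcontfun)

lemma galerkin_field_lipschitz:
  fixes A :: "'d::finite \<Rightarrow> real ^ 'n::finite \<Rightarrow> real ^ 'n ^ 'n"
  assumes poly: "\<And>j a b. real_polynomial_function (\<lambda>V. A j V $ a $ b)" and R: "0 \<le> R"
  shows "\<exists>L\<ge>0. \<forall>V W. norm V \<le> R \<longrightarrow> norm W \<le> R \<longrightarrow> norm (galerkin_field A N V - galerkin_field A N W) \<le> L * norm (V - W)"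
proof -
  obtain L where L0: "0 \<le> L" and L1: "\<forall>(V :: real ^ 'd \<Rightarrow> real ^ 'n) W e x.
    (\<forall>i k. k \<in> freqs N \<longrightarrow> cmod (rcoef (\<lambda>x. V x $ i) k) \<le> R \<and> cmod (rcoef (\<lambda>x. W x $ i) k) \<le> R \<and>
      cmod (rcoef (\<lambda>x. V x $ i) k - rcoef (\<lambda>x. W x $ i) k) \<le> e) \<longrightarrow>
    norm (advection A (low_pass N V) x - advection A (low_pass N W) x) \<le> L * e"
    by (rule advection_low_pass_lipschitz[where A = A and N = N, OF poly R])
  note L = L0 L1[rule_format]
  let ?\<kappa> = "trig_constant N TYPE('d) TYPE('n)"
  have \<kappa>: "0 \<le> ?\<kappa>" by (simp add: trig_constant_def)
  have "norm (galerkin_field A N V - galerkin_field A N W) \<le> (?\<kappa> * L) * norm (V - W)"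
    if VW: "norm V \<le> R" "norm W \<le> R" for V W :: "(real ^ 'd) \<Rightarrow>\<^sub>C (real ^ 'n)"
  proof (rule norm_bound)
    fix x
    let ?V = "advection A (low_pass N (apply_bcontfun V))" and ?W = "advection A (low_pass N (apply_bcontfun W))"
    have diff: "cmod (rcoef (\<lambda>x. apply_bcontfun V x $ i) k - rcoef (\<lambda>x. apply_bcontfun W x $ i) k) \<le> norm (V - W)" for i k
      using rcoef_bcontfun_le[of "V - W" i k] linear_diff[OF bounded_linear.linear[OF bounded_linear_rcoef[of i k]], of V W]
      by (simp only:)
    have "norm (?V x - ?W x) \<le> L * norm (V - W)" for x
      using VW diff rcoef_bcontfun_le[of V] rcoef_bcontfun_le[of W] by (intro L(2)) (blast intro: order_trans)
    then have "cmod (complex_of_real (?V x $ i) - complex_of_real (?W x $ i)) \<le> L * norm (V - W)" for x i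
      using component_le_norm_cart[of "?V x - ?W x" i] by (simp add: order_trans flip: of_real_diff)
    then have "cmod (rcoef (\<lambda>x. ?V x $ i) k - rcoef (\<lambda>x. ?W x $ i) k) \<le> L * norm (V - W)" for i k
      by (intro coef_dist_le continuous_periodicD(1)[OF continuous_periodic_of_real] advection_low_pass_continuous[OF poly])
    then have "norm (low_pass N ?V x - low_pass N ?W x) \<le> ?\<kappa> * (L * norm (V - W))"
      by (intro low_pass_dist_le)
    then show "norm (apply_bcontfun (galerkin_field A N V - galerkin_field A N W) x) \<le> ?\<kappa> * L * norm (V - W)"
      by (simp add: apply_galerkin_field norm_minus_commute mult.assoc)
  qed
  then show ?thesis using \<kappa> L(1) by (intro exI[of _ "?\<kappa> * L"]) auto
qed

lemma galerkin_field_zero: "galerkin_field A N 0 = 0"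
proof -
  have "apply_bcontfun 0 = (\<lambda>x. 0)" by (simp add: fun_eq_iff)
  then show ?thesis
    by (intro bcontfun_eqI) (simp add: apply_galerkin_field low_pass_zero advection_zero[abs_def])
qed

text \<open>The finite system of ordinary differential equations for the coefficients, as satisfied both by
  solutions of the truncated equation and by integral curves of the vector field above.\<close>

definition galerkin_curve ::
  "('d::finite \<Rightarrow> real ^ 'n::finite \<Rightarrow> real ^ 'n ^ 'n) \<Rightarrow> nat \<Rightarrow> real set \<Rightarrow> (real \<Rightarrow> real ^ 'd \<Rightarrow> real ^ 'n) \<Rightarrow> bool" where
  "galerkin_curve A N J v \<longleftrightarrow> (\<forall>t\<in>J. \<forall>i. \<forall>k\<in>freqs N.
     ((\<lambda>\<tau>. rcoef (\<lambda>x. v \<tau> x $ i) k) has_vector_derivative - rcoef (\<lambda>x. advection A (low_pass N (v t)) x $ i) k) (at t))"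

text \<open>Gronwall's inequality for the squared difference of the coefficients. As it vanishes at
  \<open>t0\<close>, the bound stays below every positive threshold.\<close>

lemma galerkin_curve_unique:
  fixes A :: "'d::finite \<Rightarrow> real ^ 'n::finite \<Rightarrow> real ^ 'n ^ 'n"
  assumes poly: "\<And>j a b. real_polynomial_function (\<lambda>V. A j V $ a $ b)"
    and v: "galerkin_curve A N J v" and w: "galerkin_curve A N J w"
    and J: "is_interval J" "t0 \<in> J" "t \<in> J"
    and init: "\<And>i k. k \<in> freqs N \<Longrightarrow> rcoef (\<lambda>x. v t0 x $ i) k = rcoef (\<lambda>x. w t0 x $ i) k"
  shows "k \<in> freqs N \<Longrightarrow> rcoef (\<lambda>x. v t x $ i) k = rcoef (\<lambda>x. w t x $ i) k"
proof -
  let ?F = "freqs N :: (int ^ 'd) set"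
  let ?S = "closed_segment t0 t"
  have S: "?S \<subseteq> J" using J by (intro closed_segment_subset is_interval_convex)
  have S': "is_interval ?S" "compact ?S" by (auto simp: is_interval_convex_1)
  define V where "V i k \<tau> = rcoef (\<lambda>x. v \<tau> x $ i) k" for i k \<tau>
  define W where "W i k \<tau> = rcoef (\<lambda>x. w \<tau> x $ i) k" for i k \<tau>
  define V' where "V' i k \<tau> = - rcoef (\<lambda>x. advection A (low_pass N (v \<tau>)) x $ i) k" for i k \<tau>
  define W' where "W' i k \<tau> = - rcoef (\<lambda>x. advection A (low_pass N (w \<tau>)) x $ i) k" for i k \<tau>
  have dV: "(V i k has_vector_derivative V' i k \<tau>) (at \<tau>)" and dW: "(W i k has_vector_derivative W' i k \<tau>) (at \<tau>)"
    if "\<tau> \<in> ?S" "k \<in> ?F" for i k \<tau>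
    using v w S that unfolding galerkin_curve_def V_def[abs_def] W_def[abs_def] V'_def W'_def by blast+
  define n where "n \<tau> = (\<Sum>k\<in>?F. \<Sum>i\<in>UNIV. cmod (V i k \<tau>) + cmod (W i k \<tau>))" for \<tau>
  have "continuous_on ?S (V i k)" "continuous_on ?S (W i k)" if "k \<in> ?F" for i k
    using dV dW that by (meson has_vector_derivative_continuous continuous_at_imp_continuous_on)+
  then have "continuous_on ?S n" unfolding n_def by (intro continuous_intros)
  then have "bounded (n ` ?S)" by (intro compact_imp_bounded compact_continuous_image) auto
  then obtain R0 where R0: "\<And>\<tau>. \<tau> \<in> ?S \<Longrightarrow> norm (n \<tau>) \<le> R0" by (metis bounded_iff image_eqI)
  define R where "R = max R0 0"
  have Rb: "cmod (V i k \<tau>) \<le> R" "cmod (W i k \<tau>) \<le> R" if "\<tau> \<in> ?S" "k \<in> ?F" for i k \<tau>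
  proof -
    have "cmod (V i k \<tau>) + cmod (W i k \<tau>) \<le> (\<Sum>i\<in>UNIV. cmod (V i k \<tau>) + cmod (W i k \<tau>))"
      by (rule member_le_sum) auto
    also have "\<dots> \<le> n \<tau>" unfolding n_def using that
      by (intro member_le_sum[of k ?F "\<lambda>k. \<Sum>i\<in>UNIV. cmod (V i k \<tau>) + cmod (W i k \<tau>)"]) (auto intro: sum_nonneg)
    also have "\<dots> \<le> R" using R0[OF that(1)] by (simp add: R_def)
    finally have "cmod (V i k \<tau>) + cmod (W i k \<tau>) \<le> R" .
    then show "cmod (V i k \<tau>) \<le> R" "cmod (W i k \<tau>) \<le> R" using norm_ge_zero[of "V i k \<tau>"] norm_ge_zero[of "W i k \<tau>"] by linarith+
  qed
  have R: "0 \<le> R" by (simp add: R_def)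
  obtain L where L0: "0 \<le> L" and L1: "\<forall>(V :: real ^ 'd \<Rightarrow> real ^ 'n) W e x.
    (\<forall>i k. k \<in> freqs N \<longrightarrow> cmod (rcoef (\<lambda>x. V x $ i) k) \<le> R \<and> cmod (rcoef (\<lambda>x. W x $ i) k) \<le> R \<and>
      cmod (rcoef (\<lambda>x. V x $ i) k - rcoef (\<lambda>x. W x $ i) k) \<le> e) \<longrightarrow>
    norm (advection A (low_pass N V) x - advection A (low_pass N W) x) \<le> L * e"
    by (rule advection_low_pass_lipschitz[where A = A and N = N, OF poly R])
  note L = L0 L1[rule_format]
  define y where "y \<tau> = (\<Sum>k\<in>?F. \<Sum>i\<in>UNIV. (cmod (V i k \<tau> - W i k \<tau>))\<^sup>2)" for \<tau>
  define y' where "y' \<tau> = (\<Sum>k\<in>?F. \<Sum>i\<in>UNIV. 2 * Re (cnj (V i k \<tau> - W i k \<tau>) * (V' i k \<tau> - W' i k \<tau>)))" for \<tau>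
  have y0: "0 \<le> y \<tau>" for \<tau> unfolding y_def by (intro sum_nonneg) auto
  have mem: "cmod (V i k \<tau> - W i k \<tau>) \<le> sqrt (y \<tau>)" if "k \<in> ?F" for i k \<tau>
  proof -
    have "(cmod (V i k \<tau> - W i k \<tau>))\<^sup>2 \<le> (\<Sum>i\<in>UNIV. (cmod (V i k \<tau> - W i k \<tau>))\<^sup>2)" by (rule member_le_sum) auto
    also have "\<dots> \<le> y \<tau>" unfolding y_def using that
      by (intro member_le_sum[of k ?F "\<lambda>k. \<Sum>i\<in>UNIV. (cmod (V i k \<tau> - W i k \<tau>))\<^sup>2"]) (auto intro: sum_nonneg)
    finally show ?thesis by (rule real_le_rsqrt)
  qed
  define C where "C = 2 * (real (card ?F) * (real CARD('n) * L))"
  have "y t \<le> y t0 * exp (C * \<bar>t - t0\<bar>)"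
  proof (rule gronwall_bootstrap[OF S'(1), where \<Theta> = 1])
    fix \<tau> assume \<tau>: "\<tau> \<in> ?S"
    have d: "((\<lambda>\<tau>. (cmod (V i k \<tau> - W i k \<tau>))\<^sup>2) has_real_derivative 2 * Re (cnj (V i k \<tau> - W i k \<tau>) * (V' i k \<tau> - W' i k \<tau>))) (at \<tau>)"
      if "k \<in> ?F" for i k
      using dV[OF \<tau> that] dW[OF \<tau> that] by (intro has_real_derivative_cmod_sq has_vector_derivative_diff) auto
    show "(y has_real_derivative y' \<tau>) (at \<tau>)"
      unfolding y_def[abs_def] y'_def by (intro DERIV_sum d)
    have "norm (advection A (low_pass N (v \<tau>)) x - advection A (low_pass N (w \<tau>)) x) \<le> L * sqrt (y \<tau>)" for x
      using Rb[OF \<tau>] mem[of _ _ \<tau>] by (intro L(2)) (auto simp: V_def W_def)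
    then have "cmod (complex_of_real (advection A (low_pass N (v \<tau>)) x $ i) - complex_of_real (advection A (low_pass N (w \<tau>)) x $ i)) \<le> L * sqrt (y \<tau>)" for x i
      using component_le_norm_cart[of "advection A (low_pass N (v \<tau>)) x - advection A (low_pass N (w \<tau>)) x" i]
      by (simp add: order_trans flip: of_real_diff)
    then have "cmod (rcoef (\<lambda>x. advection A (low_pass N (v \<tau>)) x $ i) k - rcoef (\<lambda>x. advection A (low_pass N (w \<tau>)) x $ i) k) \<le> L * sqrt (y \<tau>)" for i k
      by (intro coef_dist_le continuous_periodicD(1)[OF continuous_periodic_of_real] advection_low_pass_continuous[OF poly])
    then have d': "cmod (V' i k \<tau> - W' i k \<tau>) \<le> L * sqrt (y \<tau>)" for i k
      by (simp add: V'_def W'_def norm_minus_commute)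
    have "\<bar>y' \<tau>\<bar> \<le> (\<Sum>k\<in>?F. \<Sum>i\<in>(UNIV :: 'n set). 2 * (L * y \<tau>))"
      unfolding y'_def
    proof (rule order_trans[OF sum_abs], rule sum_mono, rule order_trans[OF sum_abs], rule sum_mono)
      fix k i assume k: "k \<in> ?F"
      have "\<bar>Re (cnj (V i k \<tau> - W i k \<tau>) * (V' i k \<tau> - W' i k \<tau>))\<bar> \<le> cmod (V i k \<tau> - W i k \<tau>) * cmod (V' i k \<tau> - W' i k \<tau>)"
        by (metis abs_Re_le_cmod complex_mod_cnj norm_mult)
      also have "\<dots> \<le> sqrt (y \<tau>) * (L * sqrt (y \<tau>))" using mem[OF k] d' by (intro mult_mono) (auto simp: y0)
      also have "\<dots> = L * y \<tau>" using y0[of \<tau>] by (simp add: mult.left_commute)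
      finally show "\<bar>2 * Re (cnj (V i k \<tau> - W i k \<tau>) * (V' i k \<tau> - W' i k \<tau>))\<bar> \<le> 2 * (L * y \<tau>)" by simp
    qed
    also have "\<dots> = C * y \<tau>" by (simp add: C_def)
    finally show "\<bar>y' \<tau>\<bar> \<le> C * y \<tau>" .
  qed (use L(1) init in \<open>auto simp: C_def y_def V_def W_def\<close>)
  moreover have "y t0 = 0" using init by (simp add: y_def V_def W_def)
  ultimately have "y t = 0" using y0[of t] by simp
  then show "k \<in> freqs N \<Longrightarrow> rcoef (\<lambda>x. v t x $ i) k = rcoef (\<lambda>x. w t x $ i) k"
    using mem[of k i t] by (simp add: V_def W_def)
qed

lemma C1_on_trigonometric:
  fixes c c' :: "'n::finite \<Rightarrow> int ^ 'd::finite \<Rightarrow> real \<Rightarrow> complex"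
  assumes F: "finite F" and d: "\<And>i k t. t \<in> P \<Longrightarrow> k \<in> F \<Longrightarrow> (c i k has_vector_derivative c' i k t) (at t)"
    and cont: "\<And>i k. k \<in> F \<Longrightarrow> continuous_on P (c' i k)"
  shows "C1_on (P \<times> UNIV) (\<lambda>(t, x). (\<chi> i. Re (\<Sum>k\<in>F. c i k t * cis (freq_dot k x))) :: real ^ 'n)"
proof -
  define Bt :: "'n \<Rightarrow> (real \<times> (real ^ 'd)) \<Rightarrow>\<^sub>L (real ^ 'n)" where "Bt i = Blinfun (\<lambda>p. fst p *\<^sub>R axis i 1)" for i
  define Bx :: "'n \<Rightarrow> int ^ 'd \<Rightarrow> (real \<times> (real ^ 'd)) \<Rightarrow>\<^sub>L (real ^ 'n)" where
    "Bx i k = Blinfun (\<lambda>p. freq_dot k (snd p) *\<^sub>R axis i 1)" for i k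
  have blf: "bounded_linear (freq_dot k :: real ^ 'd \<Rightarrow> real)" for k
    unfolding freq_dot_def by (intro bounded_linear_sum bounded_linear_const_mult bounded_linear_vec_nth)
  have Bt: "blinfun_apply (Bt i) h = fst h *\<^sub>R axis i 1" for i h
    unfolding Bt_def by (subst bounded_linear_Blinfun_apply) (auto intro!: bounded_linear_compose[OF bounded_linear_scaleR_left] bounded_linear_fst)
  have Bx: "blinfun_apply (Bx i k) h = freq_dot k (snd h) *\<^sub>R axis i 1" for i k h
    unfolding Bx_def by (subst bounded_linear_Blinfun_apply)
      (auto intro!: bounded_linear_compose[OF bounded_linear_scaleR_left] bounded_linear_compose[OF blf] bounded_linear_snd)
  define D where "D p = (\<Sum>i\<in>UNIV. \<Sum>k\<in>F. Re (c' i k (fst p) * cis (freq_dot k (snd p))) *\<^sub>R Bt i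
      + Re (c i k (fst p) * (\<i> * cis (freq_dot k (snd p)))) *\<^sub>R Bx i k)" for p
  have cc: "continuous_on P (c i k)" if "k \<in> F" for i k
    using d that by (meson has_vector_derivative_continuous continuous_at_imp_continuous_on)
  have fs: "continuous_on (P \<times> UNIV) (\<lambda>p. f (fst p))" if "continuous_on P f" for f :: "real \<Rightarrow> complex"
    using that by (rule continuous_on_compose2) (auto intro!: continuous_intros)
  have fq: "continuous_on A (\<lambda>p :: real \<times> (real ^ 'd). cis (freq_dot k (snd p)))" for A k
    by (intro continuous_on_cis continuous_on_compose2[OF continuous_on_freq_dot[of UNIV]]) (auto intro!: continuous_intros)
  have "continuous_on (P \<times> UNIV) D"
    unfolding D_def
    by (intro continuous_on_sum continuous_on_add continuous_on_scaleR continuous_on_Re continuous_on_mult fs fq cont cc continuous_on_const)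
  moreover have "((\<lambda>(t, x). (\<chi> i. Re (\<Sum>k\<in>F. c i k t * cis (freq_dot k x))) :: real ^ 'n) has_derivative blinfun_apply (D p)) (at p)"
    if p: "p \<in> P \<times> UNIV" for p
  proof -
    have h: "((\<lambda>q. Re (c i k (fst q) * cis (freq_dot k (snd q))) *\<^sub>R (axis i 1 :: real ^ 'n)) has_derivative
      (\<lambda>h. Re (c' i k (fst p) * cis (freq_dot k (snd p))) *\<^sub>R blinfun_apply (Bt i) h
        + Re (c i k (fst p) * (\<i> * cis (freq_dot k (snd p)))) *\<^sub>R blinfun_apply (Bx i k) h)) (at p)" if k: "k \<in> F" for i k
    proof -
      have "(c i k has_derivative (\<lambda>h. h *\<^sub>R c' i k (fst p))) (at (fst p))"
        using d[of "fst p" k i] p k by (auto simp: has_vector_derivative_def)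
      from has_derivative_compose[OF has_derivative_fst[OF has_derivative_ident] this]
      have 1: "((\<lambda>q. c i k (fst q)) has_derivative (\<lambda>h. fst h *\<^sub>R c' i k (fst p))) (at p)" by simp
      have 2: "((\<lambda>q :: real \<times> (real ^ 'd). freq_dot k (snd q)) has_derivative (\<lambda>h. freq_dot k (snd h))) (at p)"
        by (rule bounded_linear.has_derivative[OF blf has_derivative_snd[OF has_derivative_ident]])
      have 3: "((\<lambda>q :: real \<times> (real ^ 'd). cis (freq_dot k (snd q))) has_derivative (\<lambda>h. freq_dot k (snd h) *\<^sub>R (\<i> * cis (freq_dot k (snd p))))) (at p)"
        using 2 by (auto intro!: derivative_eq_intros)
      have "((\<lambda>q. c i k (fst q) * cis (freq_dot k (snd q))) has_derivative
        (\<lambda>h. c i k (fst p) * (freq_dot k (snd h) *\<^sub>R (\<i> * cis (freq_dot k (snd p)))) + (fst h *\<^sub>R c' i k (fst p)) * cis (freq_dot k (snd p)))) (at p)"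
        by (rule has_derivative_mult[OF 1 3])
      from bounded_linear.has_derivative[OF bounded_linear_compose[OF bounded_linear_scaleR_left bounded_linear_Re] this, of "axis i 1"]
      show ?thesis by (rule has_derivative_eq_rhs) (auto simp: Bt Bx fun_eq_iff algebra_simps simp flip: scaleR_add_left)
    qed
    have "(\<lambda>(t, x). (\<chi> i. Re (\<Sum>k\<in>F. c i k t * cis (freq_dot k x))) :: real ^ 'n)
      = (\<lambda>q. \<Sum>i\<in>UNIV. \<Sum>k\<in>F. Re (c i k (fst q) * cis (freq_dot k (snd q))) *\<^sub>R axis i 1)"
    proof
      fix q :: "real \<times> (real ^ 'd)"
      have "(\<chi> i. Re (\<Sum>k\<in>F. c i k (fst q) * cis (freq_dot k (snd q)))) = (\<Sum>i\<in>UNIV. Re (\<Sum>k\<in>F. c i k (fst q) * cis (freq_dot k (snd q))) *\<^sub>R (axis i 1 :: real ^ 'n))"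
        using basis_expansion[of "\<chi> i. Re (\<Sum>k\<in>F. c i k (fst q) * cis (freq_dot k (snd q)))"] by (simp add: scalar_mult_eq_scaleR)
      then show "(case q of (t, x) \<Rightarrow> (\<chi> i. Re (\<Sum>k\<in>F. c i k t * cis (freq_dot k x))))
        = (\<Sum>i\<in>UNIV. \<Sum>k\<in>F. Re (c i k (fst q) * cis (freq_dot k (snd q))) *\<^sub>R axis i 1)"
        by (simp only: case_prod_beta' Re_sum scaleR_left.sum)
    qed
    moreover have "blinfun_apply (D p) = (\<lambda>h. \<Sum>i\<in>UNIV. \<Sum>k\<in>F. Re (c' i k (fst p) * cis (freq_dot k (snd p))) *\<^sub>R blinfun_apply (Bt i) h
        + Re (c i k (fst p) * (\<i> * cis (freq_dot k (snd p)))) *\<^sub>R blinfun_apply (Bx i k) h)"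
      unfolding D_def by (simp add: fun_eq_iff blinfun.sum_left blinfun.add_left blinfun.scaleR_left)
    ultimately show ?thesis using h by (auto intro!: has_derivative_sum)
  qed
  ultimately show ?thesis unfolding C1_on_def by blast
qed

lemma C1_on_cong_open:
  assumes "C1_on S f" "open S" "\<And>p. p \<in> S \<Longrightarrow> f p = g p"
  shows "C1_on S g"
proof -
  obtain D where D: "continuous_on S D" "\<And>p. p \<in> S \<Longrightarrow> (f has_derivative blinfun_apply (D p)) (at p)"
    using assms(1) unfolding C1_on_def by blast
  have "(g has_derivative blinfun_apply (D p)) (at p)" if "p \<in> S" for p
    by (rule has_derivative_transform_within_open[OF D(2)[OF that] assms(2) that assms(3)])
  with D(1) show ?thesis unfolding C1_on_def by blast
qed

text \<open>On the overlap the two derivatives agree by uniqueness.\<close>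

lemma C1_on_Un:
  assumes "C1_on S f" "C1_on T f" "open S" "open T"
  shows "C1_on (S \<union> T) f"
proof -
  obtain D where D: "continuous_on S D" "\<And>p. p \<in> S \<Longrightarrow> (f has_derivative blinfun_apply (D p)) (at p)"
    using assms(1) unfolding C1_on_def by blast
  obtain E where E: "continuous_on T E" "\<And>p. p \<in> T \<Longrightarrow> (f has_derivative blinfun_apply (E p)) (at p)"
    using assms(2) unfolding C1_on_def by blast
  define G where "G p = (if p \<in> S then D p else E p)" for p
  have GT: "G p = E p" if "p \<in> T" for p
  proof (cases "p \<in> S")
    case True
    have "blinfun_apply (D p) = blinfun_apply (E p)" using D(2)[OF True] E(2)[OF that] by (rule has_derivative_unique)
    then show ?thesis using True by (simp add: G_def blinfun_apply_inject)
  qed (simp add: G_def)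
  have "continuous_on S G" using D(1) by (rule continuous_on_eq) (simp add: G_def)
  moreover have "continuous_on T G" using E(1) by (rule continuous_on_eq) (simp add: GT)
  ultimately have "continuous_on (S \<union> T) G" using assms(3,4) by (intro continuous_on_open_Un)
  moreover have "(f has_derivative blinfun_apply (G p)) (at p)" if "p \<in> S \<union> T" for p
    using that D(2)[of p] E(2)[of p] GT[of p] by (cases "p \<in> S") (auto simp: G_def)
  ultimately show ?thesis unfolding C1_on_def by blast
qed

lemma fourier_coeff_low_pass: "k \<notin> freqs N \<Longrightarrow> fourier_coeff (low_pass N V) k = 0"
  by (simp only: vec_eq_iff fourier_coeff_component rcoef_low_pass if_False zero_index) simp

lemma low_pass_sobolev: "low_pass N V \<in> sobolev s"
proof -
  have "low_pass N V \<in> torus_L2"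
  proof -
    have c: "continuous_on A (low_pass N V)" for A by (rule continuous_periodicD(1)[OF low_pass_continuous_periodic_vec])
    have "set_integrable lebesgue torus_cell (\<lambda>x. (norm (low_pass N V x))\<^sup>2)"
      unfolding torus_cell_def by (intro absolutely_integrable_continuous continuous_intros c)
    then show ?thesis using low_pass_measurable low_pass_continuous_periodic_vec
      by (auto simp: torus_L2_def continuous_periodic_def)
  qed
  moreover have "(\<lambda>k. japanese_bracket k powr (2 * s) * (norm (fourier_coeff (low_pass N V) k))\<^sup>2) summable_on UNIV"
    by (rule has_sum_imp_summable, rule has_sum_finite_neutralI[OF finite_freqs[of N] _ _ refl]) (auto simp: fourier_coeff_low_pass)
  ultimately show ?thesis by (simp add: sobolev_def)
qed

text \<open>Picard's theorem is applied in the space of bounded continuous functions of \<open>x\<close>.\<close>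

instance bcontfun :: (metric_space, banach) banach ..

lemma low_pass_uminus: "low_pass N (\<lambda>x. - W x) x = - low_pass N W x"
proof -
  have "complex_of_real (low_pass N (\<lambda>x. - W x) x $ i) = complex_of_real ((- low_pass N W x) $ i)" for i
  proof -
    have "complex_of_real (low_pass N (\<lambda>x. - W x) x $ i) = - (\<Sum>k\<in>freqs N. rcoef (\<lambda>x. W x $ i) k * cis (freq_dot k x))"
      by (simp only: low_pass_component vector_uminus_component rcoef_uminus mult_minus_left sum_negf)
    then show ?thesis by (simp only: vector_uminus_component of_real_minus low_pass_component)
  qed
  then show ?thesis by (simp add: vec_eq_iff)
qed

lemma low_pass_eq_trig:
  "low_pass N W x = (\<chi> i. Re (\<Sum>k\<in>freqs N. rcoef (\<lambda>x. W x $ i) k * cis (freq_dot k x)))"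
  by (simp add: low_pass_def freqs_def fourier_coeff_component)

text \<open>On a finite set of frequencies all Sobolev norms are controlled by the coefficients.\<close>

lemma sobolev_norm_band_limited_tendsto:
  fixes u :: "real \<Rightarrow> real ^ 'd::finite \<Rightarrow> real ^ 'n::finite"
  assumes lp: "\<And>\<tau>. \<tau> \<in> J \<Longrightarrow> low_pass N (u \<tau>) = u \<tau>" and t: "t \<in> J"
    and cont: "\<And>i k. k \<in> freqs N \<Longrightarrow> ((\<lambda>\<tau>. rcoef (\<lambda>x. u \<tau> x $ i) k) \<longlongrightarrow> rcoef (\<lambda>x. u t x $ i) k) (at t within J)"
  shows "((\<lambda>\<tau>. sobolev_norm s (\<lambda>x. u \<tau> x - u t x)) \<longlongrightarrow> 0) (at t within J)"
proof -
  define b where "b \<tau> = sqrt (\<Sum>k\<in>freqs N. (japanese_bracket k powr s)\<^sup>2 *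
    (\<Sum>i\<in>UNIV. (cmod (rcoef (\<lambda>x. u \<tau> x $ i) k - rcoef (\<lambda>x. u t x $ i) k))\<^sup>2))" for \<tau>
  have "(b \<longlongrightarrow> sqrt (\<Sum>k\<in>freqs N. (japanese_bracket k powr s)\<^sup>2 *
    (\<Sum>i\<in>(UNIV :: 'n set). (cmod (rcoef (\<lambda>x. u t x $ i) k - rcoef (\<lambda>x. u t x $ i) k))\<^sup>2))) (at t within J)"
    unfolding b_def by (intro tendsto_real_sqrt tendsto_sum tendsto_mult tendsto_power tendsto_norm tendsto_diff cont tendsto_const)
  then have b: "(b \<longlongrightarrow> 0) (at t within J)" by simp
  have "sobolev_norm s (\<lambda>x. u \<tau> x - u t x) \<le> b \<tau>" if \<tau>: "\<tau> \<in> J" for \<tau>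
  proof (rule sobolev_norm_le)
    show "0 \<le> b \<tau>" unfolding b_def by (intro real_sqrt_ge_zero sum_nonneg mult_nonneg_nonneg) auto
    have cp: "continuous_periodic (\<lambda>x. u r x $ i)" if "r \<in> J" for r i
      using low_pass_continuous_periodic[of N "u r" i] by (simp only: lp[OF that])
    have rc: "rcoef (\<lambda>x. (u \<tau> x - u t x) $ i) k = rcoef (\<lambda>x. u \<tau> x $ i) k - rcoef (\<lambda>x. u t x $ i) k" for i k
      unfolding vector_minus_component by (rule rcoef_diff[OF cp[OF \<tau>] cp[OF t]])
    have r0: "rcoef (\<lambda>x. u r x $ i) k = 0" if "r \<in> J" "k \<notin> freqs N" for r i k
      using rcoef_low_pass[of N "u r" i k] that(2) by (simp only: lp[OF that(1)] if_False)
    have sq: "(norm (fourier_coeff (\<lambda>x. u \<tau> x - u t x) k))\<^sup>2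
      = (\<Sum>i\<in>UNIV. (cmod (rcoef (\<lambda>x. u \<tau> x $ i) k - rcoef (\<lambda>x. u t x $ i) k))\<^sup>2)" for k
      unfolding norm_fourier_coeff_sq rc ..
    fix F :: "(int ^ 'd) set" assume F: "finite F"
    let ?g = "\<lambda>k. (japanese_bracket k powr s * norm (fourier_coeff (\<lambda>x. u \<tau> x - u t x) k))\<^sup>2"
    have "sum ?g F = sum ?g (F \<inter> freqs N)"
      using F by (intro sum.mono_neutral_right) (auto simp: power_mult_distrib sq r0 \<tau> t)
    also have "\<dots> \<le> sum ?g (freqs N)" by (intro sum_mono2) auto
    also have "\<dots> = (b \<tau>)\<^sup>2" unfolding b_def power_mult_distrib sq
      by (subst real_sqrt_pow2) (auto intro!: sum_nonneg mult_nonneg_nonneg)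
    finally show "sum ?g F \<le> (b \<tau>)\<^sup>2" .
  qed
  then have "\<forall>\<^sub>F \<tau> in at t within J. sobolev_norm s (\<lambda>x. u \<tau> x - u t x) \<le> b \<tau>"
    by (auto simp: eventually_at_filter)
  then show ?thesis
    by (intro tendsto_sandwich[OF _ _ tendsto_const b]) (auto simp: sobolev_norm_nonneg)
qed

text \<open>The step \<open>\<delta>\<close> of Picard's theorem depends only on the system and on the size \<open>R\<close> of the solution at \<open>t0\<close>. If the step led
  beyond the interval of existence, the given solution and the filtered integral curve through its
  value at \<open>t0\<close>, which agree where both exist, would combine to an extension, contradicting
  maximality.\<close>

theorem galerkin_continuation:
  fixes A :: "'d::finite \<Rightarrow> real ^ 'n::finite \<Rightarrow> real ^ 'n ^ 'n"
  assumes poly: "\<And>j a b. real_polynomial_function (\<lambda>V. A j V $ a $ b)" and R: "0 \<le> R"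
  shows "\<exists>\<delta>>0. \<forall>s U0 I (v :: real \<Rightarrow> real ^ 'd \<Rightarrow> real ^ 'n) t0. maximal_solution_HN A s N U0 I v \<longrightarrow> t0 \<in> I \<longrightarrow>
    (\<forall>x. norm (v t0 x) \<le> R) \<longrightarrow> {t0 - \<delta><..<t0 + \<delta>} \<subseteq> I"
proof -
  define G where "G = (galerkin_field A N :: ((real ^ 'd) \<Rightarrow>\<^sub>C (real ^ 'n)) \<Rightarrow> _)"
  obtain L where L: "0 \<le> L" "\<And>V W. norm V \<le> R + 1 \<Longrightarrow> norm W \<le> R + 1 \<Longrightarrow> norm (G V - G W) \<le> L * norm (V - W)"
    using galerkin_field_lipschitz[where A = A and N = N and R = "R + 1", OF poly] R unfolding G_def by (auto simp del: norm_minus_commute)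
  define B where "B = L * (R + 1)"
  have B: "0 \<le> B" using L R by (simp add: B_def)
  have GB: "norm (G V) \<le> B" if "norm V \<le> R + 1" for V
  proof -
    have "norm (G V - G 0) \<le> L * norm (V - 0)" using that R by (intro L(2)) auto
    also have "\<dots> \<le> B" unfolding B_def using that L(1) by (auto intro: mult_left_mono)
    finally show ?thesis by (simp add: G_def galerkin_field_zero)
  qed
  define \<delta> where "\<delta> = min (1 / (B + 1)) (1 / (2 * L + 1))"
  have \<delta>: "0 < \<delta>" "\<delta> * B \<le> 1" "\<delta> * L \<le> 1 / 2"
  proof -
    show "0 < \<delta>" using B L by (simp add: \<delta>_def)
    have "\<delta> * B \<le> 1 / (B + 1) * B" using B by (intro mult_right_mono) (auto simp: \<delta>_def)
    also have "\<dots> \<le> 1" using B by simp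
    finally show "\<delta> * B \<le> 1" .
    have "\<delta> * L \<le> 1 / (2 * L + 1) * L" using L by (intro mult_right_mono) (auto simp: \<delta>_def)
    also have "\<dots> \<le> 1 / 2" using L by (simp add: field_simps)
    finally show "\<delta> * L \<le> 1 / 2" .
  qed
  have "{t0 - \<delta><..<t0 + \<delta>} \<subseteq> I"
    if max: "maximal_solution_HN A s N U0 I v" and t0: "t0 \<in> I" and vR: "\<forall>x. norm (v t0 x) \<le> R"
    for s U0 I t0 and v :: "real \<Rightarrow> real ^ 'd \<Rightarrow> real ^ 'n"
  proof (rule ccontr)
    assume notsub: "\<not> {t0 - \<delta><..<t0 + \<delta>} \<subseteq> I"
    define P where "P = {t0 - \<delta><..<t0 + \<delta>}"
    have P: "open P" "is_interval P" "t0 \<in> P" using \<delta>(1) by (auto simp: P_def is_interval_oo)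
    have sol: "classical_solution s (\<lambda>V. low_pass N (advection A V)) (low_pass N U0) I v"
      using max by (simp add: maximal_solution_HN_def maximal_solution_def)
    have I: "open I" "is_interval I" "0 \<in> I" using sol by (auto simp: classical_solution_def)
    have vlp: "low_pass N (v t) = v t" if "t \<in> I" for t
      using classical_solution_C1_periodic[OF sol that] solution_HN_band_limited[OF sol that]
      by (intro low_pass_fixed) (auto simp: C1_periodic_def)
    have vb: "v t0 \<in> bcontfun" using low_pass_bcontfun[of N "v t0"] by (simp only: vlp[OF t0])
    define c0 where "c0 = Bcontfun (v t0)"
    have c0: "apply_bcontfun c0 = v t0" using vb by (simp add: c0_def Bcontfun_inverse)
    have "norm c0 \<le> R" using vR by (intro norm_bound) (simp add: c0)
    then have ball: "norm V \<le> R + 1" if "V \<in> cball c0 1" for V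
      using that norm_triangle_sub[of V c0] by (auto simp: dist_norm norm_minus_commute)
    have "\<exists>\<Phi>. \<Phi> t0 = c0 \<and> (\<forall>t\<in>{t0 - \<delta><..<t0 + \<delta>}. \<Phi> t \<in> cball c0 1 \<and> (\<Phi> has_vector_derivative G (\<Phi> t)) (at t))"
    proof (rule picard_local[of c0 G L B \<delta> t0, OF _ _ \<delta> L(1) B])
      show "norm (G x - G y) \<le> L * norm (x - y)" if "x \<in> cball c0 1" "y \<in> cball c0 1" for x y
        using that by (intro L(2) ball)
      show "norm (G x) \<le> B" if "x \<in> cball c0 1" for x using that by (intro GB ball)
    qed
    then obtain \<Phi> where \<Phi>: "\<Phi> t0 = c0" "\<And>t. t \<in> P \<Longrightarrow> \<Phi> t \<in> cball c0 1"
      "\<And>t. t \<in> P \<Longrightarrow> (\<Phi> has_vector_derivative G (\<Phi> t)) (at t)" unfolding P_def by blast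
    define c where "c i k t = rcoef (\<lambda>x. apply_bcontfun (\<Phi> t) x $ i) k" for i k t
    define c' where "c' i k t = rcoef (\<lambda>x. apply_bcontfun (G (\<Phi> t)) x $ i) k" for i k t
    have dc: "(c i k has_vector_derivative c' i k t) (at t)" if "t \<in> P" for i k t
      unfolding c_def[abs_def] c'_def
      by (rule bounded_linear.has_vector_derivative[OF bounded_linear_rcoef \<Phi>(3)[OF that]])
    have cont\<Phi>: "continuous_on P \<Phi>"
      using \<Phi>(3) by (meson has_vector_derivative_continuous continuous_at_imp_continuous_on)
    have contc': "continuous_on P (c' i k)" for i k
    proof -
      have "continuous_on (cball c0 1) G"
        by (rule lipschitz_on_continuous_on[of L]) (use L ball in \<open>auto simp: lipschitz_on_def dist_norm\<close>)
      then have "continuous_on P (\<lambda>t. G (\<Phi> t))"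
        by (rule continuous_on_compose2[OF _ cont\<Phi>]) (use \<Phi>(2) in auto)
      then show ?thesis unfolding c'_def[abs_def]
        by (rule bounded_linear.continuous_on[OF bounded_linear_rcoef])
    qed
    have c'F: "c' i k t = - rcoef (\<lambda>x. advection A (low_pass N (apply_bcontfun (\<Phi> t))) x $ i) k" if "k \<in> freqs N" for i k t
      unfolding c'_def G_def apply_galerkin_field vector_uminus_component rcoef_uminus
      using that by (simp only: rcoef_low_pass if_True)
    have curve\<Phi>: "galerkin_curve A N P (\<lambda>t. apply_bcontfun (\<Phi> t))"
      unfolding galerkin_curve_def
    proof (intro ballI allI)
      fix t i and k :: "int ^ 'd" assume t: "t \<in> P" "k \<in> freqs N"
      show "((\<lambda>\<tau>. rcoef (\<lambda>x. apply_bcontfun (\<Phi> \<tau>) x $ i) k) has_vector_derivative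
        - rcoef (\<lambda>x. advection A (low_pass N (apply_bcontfun (\<Phi> t))) x $ i) k) (at t)"
        using dc[OF t(1), of i k] unfolding c_def[abs_def] c'F[OF t(2)] .
    qed
    have curvev: "galerkin_curve A N I v"
      unfolding galerkin_curve_def
    proof (intro ballI allI)
      fix t i and k :: "int ^ 'd" assume t: "t \<in> I" "k \<in> freqs N"
      show "((\<lambda>\<tau>. rcoef (\<lambda>x. v \<tau> x $ i) k) has_vector_derivative
        - rcoef (\<lambda>x. advection A (low_pass N (v t)) x $ i) k) (at t)"
        using classical_solution_coef_derivative[OF sol t(1), of i k] t(2)
        by (simp only: rcoef_low_pass if_True vlp[OF t(1)])
    qed
    define w where "w t = low_pass N (apply_bcontfun (\<Phi> t))" for t
    have IP: "is_interval (I \<inter> P)" using I P by (intro is_interval_Int)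
    have agree: "v t = w t" if t: "t \<in> I" "t \<in> P" for t
    proof -
      have "rcoef (\<lambda>x. v t x $ i) k = rcoef (\<lambda>x. apply_bcontfun (\<Phi> t) x $ i) k" if "k \<in> freqs N" for i k
      proof (rule galerkin_curve_unique[where A = A and N = N and v = v and w = "\<lambda>t. apply_bcontfun (\<Phi> t)"
            and ?t0.0 = t0, OF poly _ _ IP])
        show "galerkin_curve A N (I \<inter> P) v" "galerkin_curve A N (I \<inter> P) (\<lambda>t. apply_bcontfun (\<Phi> t))"
          using curvev curve\<Phi> unfolding galerkin_curve_def by blast+
      qed (use t t0 P that in \<open>auto simp: \<Phi>(1) c0\<close>)
      then have "low_pass N (v t) = low_pass N (apply_bcontfun (\<Phi> t))" by (rule low_pass_cong)
      then show ?thesis by (simp add: w_def vlp t)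
    qed
    define u where "u t = (if t \<in> I then v t else w t)" for t
    have uv: "u t = v t" if "t \<in> I" for t using that by (simp add: u_def)
    have uw: "u t = w t" if "t \<in> P" for t using that agree by (simp add: u_def)
    let ?J = "I \<union> P"
    have ulp: "low_pass N (u t) = u t" if "t \<in> ?J" for t
      using that uv uw vlp by (auto simp: w_def low_pass_idem)
    have wtrig: "w t x = (\<chi> i. Re (\<Sum>k\<in>freqs N. c i k t * cis (freq_dot k x)))" for t x
      by (simp only: w_def c_def low_pass_eq_trig)
    have contu: "((\<lambda>\<tau>. rcoef (\<lambda>x. u \<tau> x $ i) k) \<longlongrightarrow> rcoef (\<lambda>x. u t x $ i) k) (at t within ?J)"
      if t: "t \<in> ?J" and k: "k \<in> freqs N" for t i k
    proof -
      have "isCont (\<lambda>\<tau>. rcoef (\<lambda>x. u \<tau> x $ i) k) t"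
      proof (cases "t \<in> I")
        case True
        have "((\<lambda>\<tau>. rcoef (\<lambda>x. u \<tau> x $ i) k) has_vector_derivative - rcoef (\<lambda>x. low_pass N (advection A (v t)) x $ i) k) (at t)"
          using classical_solution_coef_derivative[OF sol True, of i k]
          by (rule has_vector_derivative_transform_within_open[OF _ I(1) True]) (simp add: uv)
        then show ?thesis by (rule has_vector_derivative_continuous)
      next
        case False
        with t have tP: "t \<in> P" by blast
        have "((\<lambda>\<tau>. rcoef (\<lambda>x. u \<tau> x $ i) k) has_vector_derivative c' i k t) (at t)"
          using dc[OF tP, of i k]
          by (rule has_vector_derivative_transform_within_open[OF _ P(1) tP])
            (simp only: uw w_def c_def rcoef_low_pass k if_True)
        then show ?thesis by (rule has_vector_derivative_continuous)
      qed
      then show ?thesis by (auto simp: isCont_def intro: tendsto_within_subset)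
    qed
    have "classical_solution s (\<lambda>V. low_pass N (advection A V)) (low_pass N U0) ?J u"
      unfolding classical_solution_def
    proof (intro conjI ballI allI)
      show "open ?J" using I P by auto
      show "is_interval ?J"
        unfolding is_interval_connected_1 using I P t0
        by (intro connected_Un) (auto simp: is_interval_connected_1)
      show "0 \<in> ?J" using I by simp
      show "u t \<in> sobolev s" if "t \<in> ?J" for t
        using low_pass_sobolev[of N "u t" s] by (simp only: ulp[OF that])
      show "((\<lambda>\<tau>. sobolev_norm s (\<lambda>x. u \<tau> x - u t x)) \<longlongrightarrow> 0) (at t within ?J)" if "t \<in> ?J" for t
        by (rule sobolev_norm_band_limited_tendsto[OF ulp that contu[OF that]])
      have C1v: "C1_on (I \<times> UNIV) (\<lambda>(t, x). v t x)" using sol unfolding classical_solution_def by (elim conjE)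
      have "C1_on (I \<times> UNIV) (\<lambda>(t, x). u t x)"
      proof (rule C1_on_cong_open[OF C1v])
        show "open (I \<times> UNIV :: (real \<times> (real ^ 'd)) set)" using I by (intro open_Times) auto
      qed (auto simp: uv)
      moreover have "C1_on (P \<times> UNIV) (\<lambda>(t, x). u t x)"
      proof (rule C1_on_cong_open)
        show "C1_on (P \<times> UNIV) (\<lambda>(t, x). (\<chi> i. Re (\<Sum>k\<in>freqs N. c i k t * cis (freq_dot k x))) :: real ^ 'n)"
          by (rule C1_on_trigonometric[OF finite_freqs dc contc'])
        show "open (P \<times> UNIV :: (real \<times> (real ^ 'd)) set)" using P by (intro open_Times) auto
      qed (auto simp: uw wtrig)
      ultimately have "C1_on (I \<times> UNIV \<union> P \<times> UNIV) (\<lambda>(t, x). u t x)"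
        using I P by (intro C1_on_Un open_Times) auto
      then show "C1_on (?J \<times> UNIV) (\<lambda>(t, x). u t x)" by (simp add: Times_Un_distrib1)
      show "vector_derivative (\<lambda>\<tau>. u \<tau> x) (at t) + low_pass N (advection A (u t)) x = 0" if t: "t \<in> ?J" for t x
      proof (cases "t \<in> I")
        case True
        have "((\<lambda>\<tau>. v \<tau> x) has_vector_derivative vector_derivative (\<lambda>\<tau>. v \<tau> x) (at t)) (at t)"
          by (rule C1_on_slices(1)[OF C1v True])
        then have "((\<lambda>\<tau>. u \<tau> x) has_vector_derivative vector_derivative (\<lambda>\<tau>. v \<tau> x) (at t)) (at t)"
          by (rule has_vector_derivative_transform_within_open[OF _ I(1) True]) (simp add: uv)
        then have "vector_derivative (\<lambda>\<tau>. u \<tau> x) (at t) = vector_derivative (\<lambda>\<tau>. v \<tau> x) (at t)"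
          by (rule vector_derivative_at)
        then show ?thesis using sol True by (simp add: classical_solution_def uv)
      next
        case False
        with t have tP: "t \<in> P" by blast
        have "((\<lambda>\<tau>. w \<tau> x) has_vector_derivative low_pass N (apply_bcontfun (G (\<Phi> t))) x) (at t)"
        proof (rule has_vector_derivative_vecI)
          fix i
          have "((\<lambda>\<tau>. \<Sum>k\<in>freqs N. c i k \<tau> * cis (freq_dot k x)) has_vector_derivative (\<Sum>k\<in>freqs N. c' i k t * cis (freq_dot k x))) (at t)"
            by (intro has_vector_derivative_sum has_vector_derivative_mult_left dc tP)
          from bounded_linear.has_vector_derivative[OF bounded_linear_Re this]
          show "((\<lambda>\<tau>. w \<tau> x $ i) has_vector_derivative low_pass N (apply_bcontfun (G (\<Phi> t))) x $ i) (at t)"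
            by (simp only: wtrig c'_def low_pass_eq_trig vec_lambda_beta)
        qed
        then have "((\<lambda>\<tau>. u \<tau> x) has_vector_derivative low_pass N (apply_bcontfun (G (\<Phi> t))) x) (at t)"
          by (rule has_vector_derivative_transform_within_open[OF _ P(1) tP]) (simp add: uw)
        then have "vector_derivative (\<lambda>\<tau>. u \<tau> x) (at t) = low_pass N (apply_bcontfun (G (\<Phi> t))) x"
          by (rule vector_derivative_at)
        also have "\<dots> = - low_pass N (advection A (u t)) x"
          unfolding G_def apply_galerkin_field low_pass_uminus low_pass_idem uw[OF tP] w_def ..
        finally show ?thesis by simp
      qed
      show "AE x in lebesgue. u 0 x = low_pass N U0 x"
        using sol I by (simp add: classical_solution_def uv)
    qed
    moreover have "I \<subset> ?J" using notsub by (auto simp: P_def)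
    moreover have "\<forall>t\<in>I. u t = v t" using uv by blast
    ultimately show False
      using max unfolding maximal_solution_HN_def maximal_solution_def by blast
  qed
  with \<delta>(1) show ?thesis by blast
qed

section \<open>Boundedness of solutions in the Sobolev norm\<close>

text \<open>The difference has to be shown to lie in the Sobolev space first, as its norm would be \<open>0\<close>
  otherwise.\<close>

lemma sobolev_norm_triangle:
  fixes u v :: "real ^ 'd::finite \<Rightarrow> real ^ 'n::finite"
  assumes u: "u \<in> sobolev s" "\<And>i. continuous_periodic (\<lambda>x. u x $ i)"
    and v: "v \<in> sobolev s" "\<And>i. continuous_periodic (\<lambda>x. v x $ i)"
  shows "sobolev_norm s u \<le> sobolev_norm s v + sobolev_norm s (\<lambda>x. u x - v x)"
    "sobolev_norm s (\<lambda>x. v x - u x) = sobolev_norm s (\<lambda>x. u x - v x)"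
proof -
  let ?w = "\<lambda>k::int ^ 'd. japanese_bracket k powr s"
  let ?d = "\<lambda>x. u x - v x"
  have fc: "fourier_coeff ?d k = fourier_coeff u k - fourier_coeff v k" for k
    by (simp add: vec_eq_iff fourier_coeff_component rcoef_diff[OF u(2) v(2)] del: of_real_diff)
  have fc': "fourier_coeff (\<lambda>x. v x - u x) k = fourier_coeff v k - fourier_coeff u k" for k
    by (simp add: vec_eq_iff fourier_coeff_component rcoef_diff[OF v(2) u(2)] del: of_real_diff)
  show "sobolev_norm s (\<lambda>x. v x - u x) = sobolev_norm s ?d"
    by (simp add: sobolev_norm_def fc fc' norm_minus_commute)
  have part: "L2_set (\<lambda>k. ?w k * norm (fourier_coeff z k)) F \<le> sobolev_norm s z" if "z \<in> sobolev s" "finite F" for z :: "real ^ 'd \<Rightarrow> real ^ 'n" and F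
    unfolding L2_set_def using sobolev_norm_partial_sums[OF that] sobolev_norm_nonneg
    by (intro real_le_lsqrt) (auto intro: sum_nonneg)
  define B where "B = sobolev_norm s u + sobolev_norm s v"
  have dB: "L2_set (\<lambda>k. ?w k * norm (fourier_coeff ?d k)) F \<le> B" if F: "finite F" for F
  proof -
    have "L2_set (\<lambda>k. ?w k * norm (fourier_coeff ?d k)) F \<le> L2_set (\<lambda>k. ?w k * norm (fourier_coeff u k) + ?w k * norm (fourier_coeff v k)) F"
      unfolding fc distrib_left[symmetric] by (intro L2_set_mono mult_left_mono norm_triangle_ineq4) auto
    also have "\<dots> \<le> L2_set (\<lambda>k. ?w k * norm (fourier_coeff u k)) F + L2_set (\<lambda>k. ?w k * norm (fourier_coeff v k)) F"
      by (rule L2_set_triangle_ineq)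
    finally show ?thesis using part[OF u(1) F] part[OF v(1) F] by (simp add: B_def)
  qed
  have "(\<lambda>k. (?w k * norm (fourier_coeff ?d k))\<^sup>2) summable_on UNIV"
  proof (rule nonneg_bounded_partial_sums_imp_summable_on[where C = "B\<^sup>2"])
    show "\<forall>\<^sub>F F in finite_subsets_at_top UNIV. (\<Sum>k\<in>F. (?w k * norm (fourier_coeff ?d k))\<^sup>2) \<le> B\<^sup>2"
    proof (rule eventually_finite_subsets_at_top_weakI)
      fix F :: "(int ^ 'd) set" assume "finite F"
      from dB[OF this] show "(\<Sum>k\<in>F. (?w k * norm (fourier_coeff ?d k))\<^sup>2) \<le> B\<^sup>2"
        unfolding L2_set_def by (rule sqrt_le_D)
    qed
  qed auto
  moreover have "?d \<in> torus_L2"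
  proof -
    have cp: "continuous_periodic (\<lambda>x. ?d x $ i)" for i
      unfolding vector_minus_component by (intro continuous_periodic_diff u v)
    then have c: "continuous_on A ?d" for A
      by (intro continuous_on_vec_components continuous_periodicD(1))
    have "torus_periodic ?d" using continuous_periodicD(2)[OF cp] by (auto simp: torus_periodic_def vec_eq_iff)
    moreover have "?d \<in> borel_measurable lebesgue"
      by (rule measurable_completion, simp, rule borel_measurable_continuous_onI[OF c])
    moreover have "set_integrable lebesgue torus_cell (\<lambda>x. (norm (?d x))\<^sup>2)"
      unfolding torus_cell_def by (intro absolutely_integrable_continuous continuous_intros c)
    ultimately show ?thesis by (simp add: torus_L2_def)
  qed
  ultimately have d: "?d \<in> sobolev s" by (simp add: sobolev_def sobolev_weight_eq)
  show "sobolev_norm s u \<le> sobolev_norm s v + sobolev_norm s ?d"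
  proof (rule sobolev_norm_le)
    show "0 \<le> sobolev_norm s v + sobolev_norm s ?d" by (simp add: sobolev_norm_nonneg)
    fix F :: "(int ^ 'd) set" assume F: "finite F"
    have "L2_set (\<lambda>k. ?w k * norm (fourier_coeff u k)) F \<le> L2_set (\<lambda>k. ?w k * norm (fourier_coeff v k) + ?w k * norm (fourier_coeff ?d k)) F"
    proof (intro L2_set_mono)
      show "?w k * norm (fourier_coeff u k) \<le> ?w k * norm (fourier_coeff v k) + ?w k * norm (fourier_coeff ?d k)" for k
        unfolding fc distrib_left[symmetric] by (intro mult_left_mono norm_triangle_sub) auto
    qed auto
    also have "\<dots> \<le> L2_set (\<lambda>k. ?w k * norm (fourier_coeff v k)) F + L2_set (\<lambda>k. ?w k * norm (fourier_coeff ?d k)) F"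
      by (rule L2_set_triangle_ineq)
    also have "\<dots> \<le> sobolev_norm s v + sobolev_norm s ?d" by (intro add_mono part v d F)
    finally show "(\<Sum>k\<in>F. (?w k * norm (fourier_coeff u k))\<^sup>2) \<le> (sobolev_norm s v + sobolev_norm s ?d)\<^sup>2"
      unfolding L2_set_def by (rule sqrt_le_D)
  qed
qed

lemma solution_sobolev_norm_bounded:
  assumes sol: "classical_solution s F U0 I u" and K: "compact K" "K \<subseteq> I"
  shows "bdd_above ((\<lambda>t. sobolev_norm s (u t)) ` K)"
proof -
  have "continuous_on I (\<lambda>t. sobolev_norm s (u t))"
    unfolding continuous_on_def
  proof
    fix t assume t: "t \<in> I"
    let ?g = "\<lambda>\<tau>. sobolev_norm s (\<lambda>x. u \<tau> x - u t x)"
    have g: "(?g \<longlongrightarrow> 0) (at t within I)" using sol t by (simp add: classical_solution_def)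
    have us: "u \<tau> \<in> sobolev s" "continuous_periodic (\<lambda>x. u \<tau> x $ i)" if "\<tau> \<in> I" for \<tau> i
      using sol that classical_solution_C1_periodic[OF sol that] by (auto simp: classical_solution_def C1_periodic_def)
    have "\<bar>sobolev_norm s (u \<tau>) - sobolev_norm s (u t)\<bar> \<le> ?g \<tau>" if \<tau>: "\<tau> \<in> I" for \<tau>
      using sobolev_norm_triangle[OF us[OF \<tau>] us[OF t]] sobolev_norm_triangle(1)[OF us[OF t] us[OF \<tau>]] by linarith
    then have "\<forall>\<^sub>F \<tau> in at t within I. norm (sobolev_norm s (u \<tau>) - sobolev_norm s (u t)) \<le> ?g \<tau>"
      by (auto simp: eventually_at_filter)
    from Lim_null_comparison[OF this g]
    show "((\<lambda>t. sobolev_norm s (u t)) \<longlongrightarrow> sobolev_norm s (u t)) (at t within I)"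
      by (subst LIM_zero_iff[symmetric])
  qed
  then have "compact ((\<lambda>t. sobolev_norm s (u t)) ` K)"
    using K by (intro compact_continuous_image) (auto intro: continuous_on_subset)
  then show ?thesis by (intro bounded_imp_bdd_above compact_imp_bounded)
qed

section \<open>Spectral convergence\<close>

lemma low_pass_norm_le:
  fixes v :: "real ^ 'd::finite \<Rightarrow> real ^ 'n::finite"
  assumes lp: "low_pass N v = v" and l1: "\<And>i. l1_bound japanese_bracket (rcoef (\<lambda>x. v x $ i)) \<mu>"
  shows "norm (v x) \<le> real CARD('n) * \<mu>"
proof (rule norm_vec_le_sum)
  fix i
  have "\<bar>v x $ i\<bar> = cmod (complex_of_real (low_pass N v x $ i))" by (simp add: lp)
  also have "\<dots> \<le> (\<Sum>k\<in>freqs N. cmod (rcoef (\<lambda>x. v x $ i) k * cis (freq_dot k x)))"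
    unfolding low_pass_component by (rule norm_sum)
  also have "\<dots> \<le> (\<Sum>k\<in>freqs N. japanese_bracket k * cmod (rcoef (\<lambda>x. v x $ i) k))"
    using jb_ge_1 by (intro sum_mono) (auto simp: norm_mult mult_le_cancel_right1)
  also have "\<dots> \<le> \<mu>" by (rule l1_boundD[OF l1 finite_freqs])
  finally show "\<bar>v x $ i\<bar> \<le> \<mu>" .
qed

lemma abs_le_interval_measure:
  fixes K :: "real set"
  assumes K: "compact K" "is_interval K" "0 \<in> K" and t: "t \<in> K"
  shows "\<bar>t\<bar> \<le> measure lebesgue K"
proof -
  have "min 0 t \<in> K" "max 0 t \<in> K" using K t by (simp_all add: min_def max_def)
  then have "{min 0 t..max 0 t} \<subseteq> K"
    by (intro subsetI) (rule mem_is_interval_1_I[OF K(2), of "min 0 t" "max 0 t"]; simp)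
  then have "measure lebesgue {min 0 t..max 0 t} \<le> measure lebesgue K"
    using K(1) by (intro measure_mono_fmeasurable lmeasurable_compact) auto
  then show ?thesis by (simp add: min_def max_def split: if_splits)
qed

lemma classical_solution_sobolev: "classical_solution s F U0 I u \<Longrightarrow> t \<in> I \<Longrightarrow> u t \<in> sobolev s"
  by (simp add: classical_solution_def)

lemma initial_energy_defect:
  fixes U0 :: "real ^ 'd::finite \<Rightarrow> real ^ 'n::finite"
  assumes N: "N \<ge> 1" and s: "0 \<le> s" and U0: "U0 \<in> sobolev s"
    and U: "classical_solution s (advection A) U0 I U"
    and V: "classical_solution s (\<lambda>V. low_pass N (advection A V)) (low_pass N U0) I' V"
    and \<sigma>: "sobolev_norm s (U 0) \<le> \<sigma>"
  shows "energy_defect s N (U 0) (V 0) \<le> (\<sigma> * real N powr (- s))\<^sup>2"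
proof (rule energy_defect_initial[OF N s])
  show "sobolev_sums_le s (U 0) \<sigma>" using U \<sigma> by (intro sobolev_sums_leI) (auto simp: classical_solution_def)
  fix i and k :: "int ^ 'd" assume "k \<in> freqs N"
  then show "rcoef (\<lambda>x. V 0 x $ i) k = rcoef (\<lambda>x. U 0 x $ i) k"
    using classical_solution_initial_coef[OF V low_pass_measurable, of i k]
      classical_solution_initial_coef[OF U sobolev_measurable[OF U0], of i k] by (simp only: rcoef_low_pass if_True)
qed

text \<open>Both parts of the error, what the filter removes from \<open>U\<close> and the filtered difference, are of order
  \<open>N\<^sup>r\<^sup>-\<^sup>s\<close> in \<open>H\<^sup>r\<close> as soon as the energy defect is of order \<open>N\<^sup>-\<^sup>2\<^sup>s\<close>.\<close>

lemma error_of_energy_defect: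
  fixes U V :: "real \<Rightarrow> real ^ 'd::finite \<Rightarrow> real ^ 'n::finite"
  assumes N: "N \<ge> 1" and r: "0 \<le> r" "r \<le> s"
    and U: "classical_solution s (advection A) U0 I U"
    and V: "classical_solution s (\<lambda>V. low_pass N (advection A V)) (low_pass N U0') I' V"
    and t: "t \<in> I" "t \<in> I'" and \<sigma>: "sobolev_sums_le s (U t) \<sigma>"
    and E: "energy_defect s N (U t) (V t) \<le> 2 * (\<sigma> * real N powr (- s))\<^sup>2 * exp Q"
  shows "sobolev_norm r (\<lambda>x. U t x - V t x)
    \<le> (1 + sqrt (1 + real CARD('d)) powr s * sqrt (2 * exp Q)) * \<sigma> * real N powr (r - s)"
proof -
  let ?\<kappa> = "sqrt (1 + real CARD('d))"
  define X where "X = sqrt (2 * exp Q) * (\<sigma> * real N powr (- s))"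
  have \<sigma>0: "0 \<le> \<sigma>" using \<sigma> by (simp add: sobolev_sums_le_def)
  have X: "0 \<le> X" using \<sigma>0 by (simp add: X_def)
  have "energy_defect s N (U t) (V t) \<le> X\<^sup>2" using E by (simp add: X_def power_mult_distrib mult_ac)
  then have "sobolev_norm r (\<lambda>x. U t x - V t x) \<le> \<sigma> * real N powr (r - s) + ?\<kappa> powr s * real N powr r * X"
    using classical_solution_C1_periodic[OF U t(1)] classical_solution_C1_periodic[OF V t(2)] X
      solution_HN_band_limited[OF V t(2)]
    by (intro sobolev_norm_difference_le[OF N r _ _ \<sigma>]) (auto simp: C1_periodic_def)
  also have "?\<kappa> powr s * real N powr r * X = ?\<kappa> powr s * sqrt (2 * exp Q) * \<sigma> * (real N powr r * real N powr (- s))"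
    by (simp add: X_def)
  also have "real N powr r * real N powr (- s) = real N powr (r - s)" by (simp flip: powr_add)
  finally show ?thesis by (simp add: algebra_simps)
qed

text \<open>All norms are at most \<open>2 m\<close> with \<open>m = |U0|\<close>, so the growth rate is proportional to \<open>m\<close> and the
  exponent is at most a multiple of \<open>m t \<le> T\<close>.\<close>

lemma convergence_on_existence_time:
  fixes A :: "'d::finite \<Rightarrow> real ^ 'n::finite \<Rightarrow> real ^ 'n ^ 'n" and s :: real
  assumes sym: "\<And>j V. transpose (A j V) = A j V"
    and poly: "\<And>j a b. real_polynomial_function (\<lambda>V. A j V $ a $ b)"
    and s: "s > real CARD('d) / 2 + 1"
    and M: "M > 0" and T: "uniform_existence_time A s M T"
  shows "\<exists>C>0. \<forall>U0\<in>sobolev s. sobolev_norm s U0 \<le> M \<longrightarrow>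
          (\<forall>I U. maximal_solution_H A s U0 I U \<longrightarrow>
             (\<forall>N\<ge>1. \<forall>I_N U_N. maximal_solution_HN A s N U0 I_N U_N \<longrightarrow>
                (\<forall>t\<in>time_span T (sobolev_norm s U0). \<forall>r\<in>{0..s}.
                   sobolev_norm r (\<lambda>x. U t x - U_N t x)
                     \<le> C * sobolev_norm s U0 * real N powr (r - s))))"
proof -
  have s0: "0 \<le> s" using s by linarith
  obtain C1 where T0: "T > 0" and C1: "C1 > 0" and existence: "\<forall>V0\<in>sobolev s. sobolev_norm s V0 \<le> M \<longrightarrow>
        (\<forall>t\<in>time_span T (sobolev_norm s V0).
           sobolev_norm s V0 * exp (C1 * sobolev_norm s V0 * t) \<le> 2 * sobolev_norm s V0) \<and>
        (\<forall>I V. maximal_solution_H A s V0 I V \<longrightarrow>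
           time_span T (sobolev_norm s V0) \<subseteq> I \<and>
           (\<forall>t\<in>time_span T (sobolev_norm s V0).
              sobolev_norm s (V t) \<le> sobolev_norm s V0 * exp (C1 * sobolev_norm s V0 * t))) \<and>
        (\<forall>N\<ge>1. \<forall>I V. maximal_solution_HN A s N V0 I V \<longrightarrow>
           time_span T (sobolev_norm s V0) \<subseteq> I \<and>
           (\<forall>t\<in>time_span T (sobolev_norm s V0).
              sobolev_norm s (V t) \<le> sobolev_norm s V0 * exp (C1 * sobolev_norm s V0 * t)))"
    using T unfolding uniform_existence_time_def by blast
  obtain c where c: "c > 0" "\<And>(a :: int ^ 'd \<Rightarrow> complex) C. l2_bound (\<lambda>k. japanese_bracket k powr s) a C \<Longrightarrow> l1_bound japanese_bracket a (c * C)"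
    using l2_imp_l1_bound[OF s] by blast
  \<comment> \<open>A bound \<open>\<sigma>\<close> in \<open>H\<^sup>s\<close> gives the bound \<open>K * \<sigma>\<close> in the Wiener algebra, and \<open>\<sigma> \<le> K * \<sigma>\<close>.\<close>
  define K where "K = max 1 c"
  have K: "1 \<le> K" "c \<le> K" by (auto simp: K_def)
  have KM: "0 \<le> K * (2 * M)" using K M by simp
  obtain C where growth: "growth_constant A s (K * (2 * M)) C"
    by (rule energy_growth[where A = A, OF sym poly s KM])
  then have C: "0 \<le> C" by (simp add: growth_constant_def)
  define Q where "Q = C * K * 2 * T"
  define CC where "CC = 2 * (1 + sqrt (1 + real CARD('d)) powr s * sqrt (2 * exp Q))"
  have "sobolev_norm r (\<lambda>x. U t x - V t x) \<le> CC * sobolev_norm s U0 * real N powr (r - s)"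
    if U0: "U0 \<in> sobolev s" "sobolev_norm s U0 \<le> M" and U: "maximal_solution_H A s U0 I U" and N: "N \<ge> 1"
      and V: "maximal_solution_HN A s N U0 I' V" and t: "t \<in> time_span T (sobolev_norm s U0)" and r: "r \<in> {0..s}"
    for U0 I U N I' V t r
  proof -
    define m where "m = sobolev_norm s U0"
    have m: "0 \<le> m" "m \<le> M" using U0 sobolev_norm_nonneg by (auto simp: m_def)
    have t0: "0 \<le> t" using t by (auto simp: time_span_def split: if_splits)
    have mt: "m * t \<le> T"
      using t m T0 by (auto simp: time_span_def m_def field_simps split: if_splits)
    let ?J = "{0..t}"
    have J: "?J \<subseteq> time_span T m" using t by (auto simp: time_span_def m_def split: if_splits)
    have twice: "m * exp (C1 * m * \<tau>) \<le> 2 * m" if "\<tau> \<in> time_span T m" for \<tau>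
      using existence U0 that unfolding m_def by blast
    have solU: "classical_solution s (advection A) U0 I U"
      using U by (simp add: maximal_solution_H_def maximal_solution_def)
    have solV: "classical_solution s (\<lambda>V. low_pass N (advection A V)) (low_pass N U0) I' V"
      using V by (simp add: maximal_solution_HN_def maximal_solution_def)
    have span: "time_span T m \<subseteq> I" "time_span T m \<subseteq> I'" using existence U0 U V N unfolding m_def by blast+
    have normU: "sobolev_norm s (U \<tau>) \<le> 2 * m" if \<tau>: "\<tau> \<in> time_span T m" for \<tau>
    proof -
      have "sobolev_norm s (U \<tau>) \<le> m * exp (C1 * m * \<tau>)" using existence U0 U \<tau> unfolding m_def by blast
      with twice[OF \<tau>] show ?thesis by linarith
    qed
    have normV: "sobolev_norm s (V \<tau>) \<le> 2 * m" if \<tau>: "\<tau> \<in> time_span T m" for \<tau>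
    proof -
      have "sobolev_norm s (V \<tau>) \<le> m * exp (C1 * m * \<tau>)" using existence U0 V N \<tau> unfolding m_def by blast
      with twice[OF \<tau>] show ?thesis by linarith
    qed
    have sumsU: "sobolev_sums_le s (U \<tau>) (2 * m)" if "\<tau> \<in> ?J" for \<tau>
      using that J span normU by (intro sobolev_sums_leI classical_solution_sobolev[OF solU]) auto
    define \<mu> where "\<mu> = K * (2 * m)"
    have l1V: "l1_bound japanese_bracket (rcoef (\<lambda>x. V \<tau> x $ i)) \<mu>" if "\<tau> \<in> ?J" for \<tau> i
    proof -
      have "sobolev_sums_le s (V \<tau>) (2 * m)"
        using that J span normV by (intro sobolev_sums_leI classical_solution_sobolev[OF solV]) auto
      from c(2)[OF sobolev_sums_le_l2_bound[OF this, of i]]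
      show ?thesis by (rule l1_bound_mono) (use K m in \<open>auto simp: \<mu>_def intro: mult_right_mono\<close>)
    qed
    let ?e = "(2 * m * real N powr (- s))\<^sup>2"
    let ?E = "\<lambda>\<tau>. energy_defect s N (U \<tau>) (V \<tau>)"
    have zero: "0 \<in> time_span T m" using J t0 by auto
    have bandV: "rcoef (\<lambda>x. V \<tau> x $ i) k = 0" if "\<tau> \<in> ?J" "k \<notin> freqs N" for \<tau> i k
      using solution_HN_band_limited[OF solV _ that(2)] that(1) J span by blast
    have E0: "?E 0 \<le> ?e"
      using normU[OF zero] by (intro initial_energy_defect[OF N s0 U0(1) solU solV])
    \<comment> \<open>The Wiener bound for \<open>V\<close> holds unconditionally, so any threshold above the final bound will do.\<close>
    have "?E t + ?e \<le> (?E 0 + ?e) * exp (C * \<mu> * \<bar>t - 0\<bar>)"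
    proof (rule growth[unfolded growth_constant_def, THEN conjunct2, rule_format, OF N solution_H_coefficient_flow[OF solU] solution_HN_coefficient_flow[OF solV], of ?J 0 t "2 * m" \<mu> "(?E 0 + ?e) * exp (C * \<mu> * \<bar>t - 0\<bar>) + 1"])
      show "?J \<subseteq> I" "?J \<subseteq> I'" using J span by auto
      show "\<mu> \<le> K * (2 * M)" "2 * m \<le> \<mu>" using m K by (auto simp: \<mu>_def mult_le_cancel_right1)
    qed (use t0 m sumsU l1V bandV in \<open>auto simp: is_interval_cc\<close>)
    also have "\<dots> \<le> (?e + ?e) * exp Q"
    proof (rule mult_mono)
      have "C * \<mu> * \<bar>t - 0\<bar> = (C * K * 2) * (m * t)" using t0 by (simp add: \<mu>_def)
      also have "\<dots> \<le> (C * K * 2) * T" using mt C K by (intro mult_left_mono) auto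
      finally show "exp (C * \<mu> * \<bar>t - 0\<bar>) \<le> exp Q" by (simp add: Q_def)
    qed (use E0 energy_defect_nonneg[of s N "U 0" "V 0"] in auto)
    also have "(?e + ?e) * exp Q = 2 * ?e * exp Q" by (simp only: mult_2)
    finally have "?E t \<le> 2 * ?e * exp Q" using zero_le_power2[of "2 * m * real N powr (- s)"] by linarith
    moreover have "t \<in> ?J" using t0 by simp
    ultimately have "sobolev_norm r (\<lambda>x. U t x - V t x)
      \<le> (1 + sqrt (1 + real CARD('d)) powr s * sqrt (2 * exp Q)) * (2 * m) * real N powr (r - s)"
      using r J span by (intro error_of_energy_defect[OF N _ _ solU solV _ _ sumsU]) auto
    then show ?thesis by (simp add: CC_def m_def algebra_simps)
  qed
  moreover have "CC > 0" unfolding CC_def by (intro mult_pos_pos add_pos_nonneg) auto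
  ultimately show ?thesis by blast
qed

text \<open>The Wiener bound for the truncated solution is bootstrapped from the smallness of the energy defect.
  The estimate holds on \<open>K \<inter> I'\<close>, and the bound that it implies allows steps of fixed length from \<open>0\<close> to
  all points of \<open>K\<close>. The constants are chosen before the solution and depend only on the
  length of \<open>K\<close> and on the supremum of the norm.\<close>

lemma convergence_on_compact_interval:
  fixes A :: "'d::finite \<Rightarrow> real ^ 'n::finite \<Rightarrow> real ^ 'n ^ 'n" and s :: real
  assumes sym: "\<And>j V. transpose (A j V) = A j V"
    and poly: "\<And>j a b. real_polynomial_function (\<lambda>V. A j V $ a $ b)"
    and s: "s > real CARD('d) / 2 + 1"
  shows "\<exists>N0\<ge>1. \<exists>C>0. \<forall>U0\<in>sobolev s. \<forall>I U. maximal_solution_H A s U0 I U \<longrightarrow>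
       (\<forall>K. compact K \<and> is_interval K \<and> 0 \<in> K \<and> K \<subseteq> I \<and> measure lebesgue K = L \<and>
            (SUP t\<in>K. sobolev_norm s (U t)) = Mstar \<longrightarrow>
          (\<forall>N\<ge>N0. \<forall>I_N U_N. maximal_solution_HN A s N U0 I_N U_N \<longrightarrow>
             K \<subseteq> I_N \<and>
             (\<forall>r\<in>{0..s}. \<forall>t\<in>K.
                sobolev_norm r (\<lambda>x. U t x - U_N t x) \<le> C * Mstar * real N powr (r - s))))"
proof -
  have s0: "0 \<le> s" using s by linarith
  \<comment> \<open>\<open>Mstar\<close> is arbitrary at this point; as soon as there is a solution it is a supremum of norms, and then \<open>\<sigma> = Mstar\<close>.\<close>
  define \<sigma> where "\<sigma> = max 0 Mstar"
  define s' where "s' = (s + (real CARD('d) / 2 + 1)) / 2"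
  have s': "s' > real CARD('d) / 2 + 1" "s' < s" using s by (auto simp: s'_def)
  obtain c where c: "c > 0" and wiener: "\<forall>N\<ge>1. \<forall>(u :: real ^ 'd \<Rightarrow> real ^ 'n) v \<sigma> i.
    sobolev_sums_le s u \<sigma> \<longrightarrow> (\<forall>i k. k \<notin> freqs N \<longrightarrow> rcoef (\<lambda>x. v x $ i) k = 0) \<longrightarrow>
    l1_bound japanese_bracket (rcoef (\<lambda>x. v x $ i)) (c * \<sigma> + c * real N powr s' * sqrt (energy_defect s N u v))"
    using wiener_bound_of_small_defect[OF s'(1) less_imp_le[OF s'(2)], where 'n = 'n] by (elim exE conjE)
  define \<mu> where "\<mu> = \<sigma> + c * \<sigma> + 1"
  have \<sigma>: "0 \<le> \<sigma>" by (simp add: \<sigma>_def)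
  have \<mu>: "0 \<le> \<mu>" "\<sigma> \<le> \<mu>" "c * \<sigma> + 1 \<le> \<mu>" using \<sigma> c by (auto simp: \<mu>_def)
  obtain C where growth: "growth_constant A s \<mu> C"
    by (rule energy_growth[where A = A, OF sym poly s \<mu>(1)])
  then have C: "0 \<le> C" by (simp add: growth_constant_def)
  define Q where "Q = C * \<mu> * \<bar>L\<bar>"
  \<comment> \<open>Below this threshold the contribution of the defect to the Wiener bound is at most \<open>1\<close>.\<close>
  define \<Theta> where "\<Theta> N = (1 / (c * real N powr s'))\<^sup>2" for N :: nat
  \<comment> \<open>The bound for the defect is of size \<open>N\<^sup>-\<^sup>2\<^sup>s\<close>, the threshold of size \<open>N\<^sup>-\<^sup>2\<^sup>s\<^sup>'\<close>; as \<open>s' < s\<close> it is not reached for large \<open>N\<close>.\<close>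
  have "\<exists>N0\<ge>1. \<forall>N\<ge>N0. 2 * (\<sigma> * real N powr (- s))\<^sup>2 * exp Q < \<Theta> N"
  proof -
    have "((\<lambda>N. 2 * \<sigma>\<^sup>2 * exp Q * c\<^sup>2 * real N powr (2 * s' - 2 * s)) \<longlongrightarrow> 2 * \<sigma>\<^sup>2 * exp Q * c\<^sup>2 * 0) sequentially"
      using s'(2) by (intro tendsto_mult tendsto_const tendsto_neg_powr filterlim_real_sequentially) auto
    then have "\<forall>\<^sub>F N in sequentially. 2 * \<sigma>\<^sup>2 * exp Q * c\<^sup>2 * real N powr (2 * s' - 2 * s) < 1"
      by (rule order_tendstoD(2)) simp
    then obtain N1 where N1: "\<And>N. N \<ge> N1 \<Longrightarrow> 2 * \<sigma>\<^sup>2 * exp Q * c\<^sup>2 * real N powr (2 * s' - 2 * s) < 1"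
      by (auto simp: eventually_sequentially)
    have "2 * (\<sigma> * real N powr (- s))\<^sup>2 * exp Q < \<Theta> N" if N: "N \<ge> max 1 N1" for N
    proof -
      have pos: "0 < (c * real N powr s')\<^sup>2" using c N by auto
      have "real N powr (2 * s' - 2 * s) = (real N powr s')\<^sup>2 * (real N powr (- s))\<^sup>2"
        by (simp add: power2_eq_square flip: powr_add)
      then have "2 * (\<sigma> * real N powr (- s))\<^sup>2 * exp Q * (c * real N powr s')\<^sup>2 < 1"
        using N1[of N] N by (simp add: power_mult_distrib mult_ac)
      then show ?thesis using pos by (simp add: \<Theta>_def power_divide pos_less_divide_eq)
    qed
    then show ?thesis by (intro exI[of _ "max 1 N1"]) auto
  qed
  then obtain N0 where N0: "N0 \<ge> 1" "\<And>N. N \<ge> N0 \<Longrightarrow> 2 * (\<sigma> * real N powr (- s))\<^sup>2 * exp Q < \<Theta> N" by blast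
  define CC where "CC = 1 + sqrt (1 + real CARD('d)) powr s * sqrt (2 * exp Q)"
  have "K \<subseteq> I' \<and> (\<forall>r\<in>{0..s}. \<forall>t\<in>K. sobolev_norm r (\<lambda>x. U t x - V t x) \<le> CC * Mstar * real N powr (r - s))"
    if U0: "U0 \<in> sobolev s" and U: "maximal_solution_H A s U0 I U"
      and K: "compact K" "is_interval K" "0 \<in> K" "K \<subseteq> I" "measure lebesgue K = L" "(SUP t\<in>K. sobolev_norm s (U t)) = Mstar"
      and NN0: "N \<ge> N0" and V: "maximal_solution_HN A s N U0 I' V"
    for U0 I U K N I' V
  proof -
    have N: "N \<ge> 1" using NN0 N0 by simp
    have Npos: "0 < real N" using N by simp
    have solU: "classical_solution s (advection A) U0 I U"
      using U by (simp add: maximal_solution_H_def maximal_solution_def)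
    have solV: "classical_solution s (\<lambda>V. low_pass N (advection A V)) (low_pass N U0) I' V"
      using V by (simp add: maximal_solution_HN_def maximal_solution_def)
    have I': "is_interval I'" "0 \<in> I'" using solV by (auto simp: classical_solution_def)
    have normU: "sobolev_norm s (U t) \<le> Mstar" if "t \<in> K" for t
      using that solution_sobolev_norm_bounded[OF solU K(1,4)] unfolding K(6)[symmetric] by (intro cSUP_upper)
    have "0 \<le> Mstar" using normU[OF K(3)] sobolev_norm_nonneg[of s "U 0"] by linarith
    then have \<sigma>M: "\<sigma> = Mstar" by (simp add: \<sigma>_def)
    have sumsU: "sobolev_sums_le s (U t) \<sigma>" if "t \<in> K" for t
      using that K(4) normU unfolding \<sigma>M by (intro sobolev_sums_leI classical_solution_sobolev[OF solU]) auto
    let ?e = "(\<sigma> * real N powr (- s))\<^sup>2"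
    let ?E = "\<lambda>\<tau>. energy_defect s N (U \<tau>) (V \<tau>)"
    have E0: "?E 0 \<le> ?e"
      using normU[OF K(3)] unfolding \<sigma>M by (intro initial_energy_defect[OF N s0 U0 solU solV])
    let ?J = "K \<inter> I'"
    have band: "\<forall>i k. k \<notin> freqs N \<longrightarrow> rcoef (\<lambda>x. V t x $ i) k = 0" if "t \<in> I'" for t
      using solution_HN_band_limited[OF solV that] by blast
    have wien: "l1_bound japanese_bracket (rcoef (\<lambda>x. V t x $ i)) \<mu>" if t: "t \<in> ?J" and E: "?E t < \<Theta> N" for t i
    proof -
      have "l1_bound japanese_bracket (rcoef (\<lambda>x. V t x $ i)) (c * \<sigma> + c * real N powr s' * sqrt (?E t))"
        using wiener[rule_format, OF N sumsU, of t "V t" i] band t by blast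
      moreover have "c * real N powr s' * sqrt (?E t) \<le> 1"
      proof -
        have "sqrt (?E t) \<le> sqrt (\<Theta> N)" using E by simp
        also have "\<dots> = 1 / (c * real N powr s')" using c unfolding \<Theta>_def by (subst real_sqrt_abs) simp
        finally show ?thesis using c Npos by (simp add: field_simps)
      qed
      ultimately show ?thesis using \<mu>(3) by (elim l1_bound_mono) auto
    qed
    have bound: "?E t + ?e \<le> 2 * ?e * exp Q" if t: "t \<in> ?J" for t
    proof -
      have absL: "\<bar>t - 0\<bar> \<le> \<bar>L\<bar>" using abs_le_interval_measure[OF K(1-3), of t] t K(5) by auto
      have le: "(?E 0 + ?e) * exp (C * \<mu> * \<bar>t - 0\<bar>) \<le> (?e + ?e) * exp Q"
      proof (rule mult_mono)
        show "exp (C * \<mu> * \<bar>t - 0\<bar>) \<le> exp Q"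
          unfolding Q_def exp_le_cancel_iff using absL C \<mu>(1) by (intro mult_left_mono) auto
      qed (use E0 energy_defect_nonneg[of s N "U 0" "V 0"] in auto)
      then have small: "(?E 0 + ?e) * exp (C * \<mu> * \<bar>t - 0\<bar>) < \<Theta> N" using N0(2)[OF NN0] by simp
      have "?E t + ?e \<le> (?E 0 + ?e) * exp (C * \<mu> * \<bar>t - 0\<bar>)"
        by (rule growth[unfolded growth_constant_def, THEN conjunct2, rule_format, OF N solution_H_coefficient_flow[OF solU] solution_HN_coefficient_flow[OF solV], of ?J 0 t \<sigma> \<mu> "\<Theta> N"])
          (use t K I' \<sigma> \<mu> sumsU wien band small in \<open>auto intro: is_interval_Int\<close>)
      with le show ?thesis by simp
    qed
    have l1V: "l1_bound japanese_bracket (rcoef (\<lambda>x. V t x $ i)) \<mu>" if t: "t \<in> ?J" for t i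
    proof (rule wien[OF t])
      show "?E t < \<Theta> N" using bound[OF t] N0(2)[OF NN0] zero_le_power2[of "\<sigma> * real N powr (- s)"] by linarith
    qed
    have R: "0 \<le> real CARD('n) * \<mu>" using \<mu> by simp
    obtain \<delta> where \<delta>: "0 < \<delta>" and continuation: "\<forall>s U0 I (v :: real \<Rightarrow> real ^ 'd \<Rightarrow> real ^ 'n) t0. maximal_solution_HN A s N U0 I v \<longrightarrow> t0 \<in> I \<longrightarrow>
      (\<forall>x. norm (v t0 x) \<le> real CARD('n) * \<mu>) \<longrightarrow> {t0 - \<delta><..<t0 + \<delta>} \<subseteq> I"
      using galerkin_continuation[where A = A and N = N, OF poly R] by (elim exE conjE)
    have step: "{t0 - \<delta><..<t0 + \<delta>} \<subseteq> I'" if t0: "t0 \<in> ?J" for t0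
    proof (rule continuation[rule_format, OF V])
      have "low_pass N (V t0) = V t0"
        using classical_solution_C1_periodic[OF solV, of t0] band[of t0] t0 by (intro low_pass_fixed) (auto simp: C1_periodic_def)
      then show "norm (V t0 x) \<le> real CARD('n) * \<mu>" for x by (rule low_pass_norm_le[OF _ l1V[OF t0]])
    qed (use t0 in auto)
    have reach: "t \<in> K \<Longrightarrow> \<bar>t\<bar> \<le> real n * (\<delta> / 2) \<Longrightarrow> t \<in> I'" for n t
    proof (induction n arbitrary: t)
      case 0 then show ?case using I' by simp
    next
      case (Suc n)
      \<comment> \<open>a point of \<open>K\<close> between \<open>0\<close> and \<open>t\<close> at distance less than \<open>\<delta>\<close> from \<open>t\<close>\<close>
      define q where "q = (if t \<ge> 0 then max 0 (t - \<delta> / 2) else min 0 (t + \<delta> / 2))"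
      have q: "\<bar>q\<bar> \<le> real n * (\<delta> / 2)" "\<bar>t - q\<bar> < \<delta>" "min 0 t \<le> q" "q \<le> max 0 t"
        using Suc.prems(2) \<delta> by (auto simp: q_def algebra_simps max_def min_def abs_if split: if_splits)
      have "min 0 t \<in> K" "max 0 t \<in> K" using K(3) Suc.prems(1) by (simp_all add: min_def max_def)
      then have "q \<in> K" using q(3,4) by (rule mem_is_interval_1_I[OF K(2)])
      then have "q \<in> ?J" using Suc.IH q(1) by blast
      from step[OF this] show ?case using q(2) by (auto simp: abs_less_iff)
    qed
    have KI': "K \<subseteq> I'"
    proof
      fix t assume t: "t \<in> K"
      obtain n :: nat where "\<bar>t\<bar> / (\<delta> / 2) \<le> real n" using real_arch_simple by blast
      then have "\<bar>t\<bar> \<le> real n * (\<delta> / 2)" using \<delta> by (simp add: field_simps)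
      then show "t \<in> I'" by (rule reach[OF t])
    qed
    moreover have "sobolev_norm r (\<lambda>x. U t x - V t x) \<le> CC * Mstar * real N powr (r - s)" if "r \<in> {0..s}" "t \<in> K" for r t
    proof -
      have "t \<in> ?J" using that(2) KI' by blast
      then have "?E t \<le> 2 * ?e * exp Q"
        using bound[of t] zero_le_power2[of "\<sigma> * real N powr (- s)"] by linarith
      then show ?thesis unfolding CC_def \<sigma>M[symmetric] using that K(4) KI'
        by (intro error_of_energy_defect[OF N _ _ solU solV _ _ sumsU]) auto
    qed
    ultimately show ?thesis by blast
  qed
  moreover have "CC > 0" unfolding CC_def by (intro add_pos_nonneg) auto
  ultimately show ?thesis using N0(1) by (intro exI[of _ N0] conjI exI[of _ CC]) blast+
qed

text \<open>Zero is a solution of every truncated system. Comparing \<open>U\<close> with it gives a bound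
  \<open>O(N\<^sup>-\<^sup>s)\<close>, uniform in \<open>N\<close>, for the \<open>L\<^sup>2\<close> norm of \<open>U(t)\<close>, which therefore vanishes. The estimate runs
  forward and backward in time.\<close>

lemma solution_vanishes:
  fixes A :: "'d::finite \<Rightarrow> real ^ 'n::finite \<Rightarrow> real ^ 'n ^ 'n" and s :: real
  assumes sym: "\<And>j V. transpose (A j V) = A j V"
    and poly: "\<And>j a b. real_polynomial_function (\<lambda>V. A j V $ a $ b)"
    and s: "s > real CARD('d) / 2 + 1"
    and sol: "classical_solution s (advection A) U0 I U" and K: "is_interval K" "compact K" "K \<subseteq> I" "t0 \<in> K" "t \<in> K"
    and zero: "sobolev_norm s (U t0) = 0"
  shows "sobolev_norm s (U t) = 0"
proof -
  have s0: "0 \<le> s" using s by linarith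
  obtain M where M: "\<And>\<tau>. \<tau> \<in> K \<Longrightarrow> sobolev_norm s (U \<tau>) \<le> M"
    using solution_sobolev_norm_bounded[OF sol K(2,3)] by (auto simp: bdd_above_def)
  have M0: "0 \<le> M" using M[OF K(4)] sobolev_norm_nonneg[of s "U t0"] by linarith
  have Us: "U \<tau> \<in> sobolev s" if "\<tau> \<in> K" for \<tau> using sol that K(3) by (auto simp: classical_solution_def)
  obtain C where growth: "growth_constant A s M C"
    by (rule energy_growth[where A = A, OF sym poly s M0])
  then have C: "0 \<le> C" by (simp add: growth_constant_def)
  define Q where "Q = C * M * \<bar>t - t0\<bar>"
  define Z where "Z = (\<lambda>(\<tau>::real) (x::real ^ 'd). 0 :: real ^ 'n)"
  have Z: "coefficient_flow A (freqs N) UNIV Z" for N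
    by (auto simp: coefficient_flow_def C1_periodic_def Z_def advection_zero partial_zero coef_const
        has_vector_derivative_const)
  have rZ: "rcoef (\<lambda>x. Z \<tau> x $ i) k = 0" for \<tau> i k by (simp add: Z_def coef_const)
  have sums0: "sobolev_sums_le s (U t0) 0" using zero Us[OF K(4)] by (intro sobolev_sums_leI) auto
  have sums: "sobolev_sums_le s (U \<tau>) M" if "\<tau> \<in> K" for \<tau> using Us M that by (intro sobolev_sums_leI)
  define CC where "CC = M + sqrt (1 + real CARD('d)) powr s * (M * sqrt (exp Q))"
  have est: "sobolev_norm 0 (U t) \<le> CC * real N powr (- s)" if N: "N \<ge> 1" for N
  proof -
    let ?e = "(M * real N powr (- s))\<^sup>2"
    have "energy_defect s N (U t0) (Z t0) \<le> (0 * real N powr (- s))\<^sup>2"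
      using sobolev_sums_le_l2_bound[OF sums0]
    proof (intro energy_defect_initial[OF N s0 sums0])
      fix i and k :: "int ^ 'd"
      have "(\<Sum>k\<in>{k}. (japanese_bracket k powr s * cmod (rcoef (\<lambda>x. U t0 x $ i) k))\<^sup>2) \<le> 0\<^sup>2"
        by (rule l2_boundD[OF sobolev_sums_le_l2_bound[OF sums0]]) simp
      then show "rcoef (\<lambda>x. Z t0 x $ i) k = rcoef (\<lambda>x. U t0 x $ i) k" by (simp add: rZ)
    qed
    then have E0: "energy_defect s N (U t0) (Z t0) = 0" using energy_defect_nonneg[of s N "U t0" "Z t0"] by simp
    have "energy_defect s N (U t) (Z t) + ?e \<le> (energy_defect s N (U t0) (Z t0) + ?e) * exp (C * M * \<bar>t - t0\<bar>)"
      by (rule growth[unfolded growth_constant_def, THEN conjunct2, rule_format, OF N solution_H_coefficient_flow[OF sol] Z, of K t0 t M M "?e * exp (C * M * \<bar>t - t0\<bar>) + 1"])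
        (use K M0 sums E0 in \<open>auto simp: rZ l1_bound_def\<close>)
    then have "energy_defect s N (U t) (Z t) \<le> ?e * exp Q"
      unfolding E0 Q_def add_0 using zero_le_power2[of "M * real N powr (- s)"] by linarith
    also have "\<dots> = (M * real N powr (- s) * sqrt (exp Q))\<^sup>2" by (simp add: power_mult_distrib)
    finally have "energy_defect s N (U t) (Z t) \<le> (M * real N powr (- s) * sqrt (exp Q))\<^sup>2" .
    then have "sobolev_norm 0 (\<lambda>x. U t x - Z t x) \<le> M * real N powr (0 - s)
        + sqrt (1 + real CARD('d)) powr s * real N powr 0 * (M * real N powr (- s) * sqrt (exp Q))"
      using K M0 classical_solution_C1_periodic[OF sol, of t]
      by (intro sobolev_norm_difference_le[OF N _ s0 _ _ sums]) (auto simp: C1_periodic_def Z_def coef_const)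
    then show ?thesis using N by (simp add: Z_def CC_def algebra_simps)
  qed
  have "((\<lambda>N. CC * real N powr (- s)) \<longlongrightarrow> CC * 0) sequentially"
    using s0 s by (intro tendsto_mult tendsto_const tendsto_neg_powr filterlim_real_sequentially) linarith
  then have "sobolev_norm 0 (U t) \<le> CC * 0"
    by (rule tendsto_lowerbound) (auto simp: eventually_sequentially intro!: exI[of _ 1] est)
  then have n0: "sobolev_norm 0 (U t) = 0" using sobolev_norm_nonneg[of 0 "U t"] by simp
  have "U t \<in> sobolev 0"
  proof -
    have "(\<lambda>k. (japanese_bracket k powr 0 * norm (fourier_coeff (U t) k))\<^sup>2) summable_on UNIV"
    proof (rule nonneg_bounded_partial_sums_imp_summable_on[where C = "(sobolev_norm s (U t))\<^sup>2"])
      show "\<forall>\<^sub>F F in finite_subsets_at_top UNIV.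
        (\<Sum>k\<in>F. (japanese_bracket k powr 0 * norm (fourier_coeff (U t) k))\<^sup>2) \<le> (sobolev_norm s (U t))\<^sup>2"
      proof (rule eventually_finite_subsets_at_top_weakI)
        fix F :: "(int ^ 'd) set" assume F: "finite F"
        have "(\<Sum>k\<in>F. (japanese_bracket k powr 0 * norm (fourier_coeff (U t) k))\<^sup>2)
          \<le> (\<Sum>k\<in>F. (japanese_bracket k powr s * norm (fourier_coeff (U t) k))\<^sup>2)"
          using s0 jb_ge_1 by (intro sum_mono power_mono mult_right_mono powr_mono) auto
        then show "(\<Sum>k\<in>F. (japanese_bracket k powr 0 * norm (fourier_coeff (U t) k))\<^sup>2) \<le> (sobolev_norm s (U t))\<^sup>2"
          using sobolev_norm_partial_sums[OF Us[OF K(5)] F] by linarith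
      qed
    qed auto
    then show ?thesis using Us[OF K(5)] unfolding sobolev_def sobolev_weight_eq by simp
  qed
  have "fourier_coeff (U t) k = 0" for k
    using sobolev_norm_partial_sums[OF \<open>U t \<in> sobolev 0\<close>, of "{k}"] n0 by simp
  then show ?thesis by (simp add: sobolev_norm_def)
qed

theorem proposition2p4:
  fixes A :: "'d::finite \<Rightarrow> real ^ 'n::finite \<Rightarrow> real ^ 'n ^ 'n" and s :: real
  assumes "\<And>j V. transpose (A j V) = A j V"
    and "\<And>j a b. real_polynomial_function (\<lambda>V. A j V $ a $ b)"
    and "s > real CARD('d) / 2 + 1"
  shows
    "(\<forall>M>0. \<forall>T. uniform_existence_time A s M T \<longrightarrow>
       (\<exists>C>0. \<forall>U0\<in>sobolev s. sobolev_norm s U0 \<le> M \<longrightarrow>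
          (\<forall>I U. maximal_solution_H A s U0 I U \<longrightarrow>
             (\<forall>N\<ge>1. \<forall>I_N U_N. maximal_solution_HN A s N U0 I_N U_N \<longrightarrow>
                (\<forall>t\<in>time_span T (sobolev_norm s U0). \<forall>r\<in>{0..s}.
                   sobolev_norm r (\<lambda>x. U t x - U_N t x)
                     \<le> C * sobolev_norm s U0 * real N powr (r - s)))))) \<and>
     (\<forall>L Mstar. \<exists>N0\<ge>1. \<exists>C>0. \<forall>U0\<in>sobolev s. \<forall>I U. maximal_solution_H A s U0 I U \<longrightarrow>
       (\<forall>K. compact K \<and> is_interval K \<and> 0 \<in> K \<and> K \<subseteq> I \<and> measure lebesgue K = L \<and>
            (SUP t\<in>K. sobolev_norm s (U t)) = Mstar \<longrightarrow>
          (\<forall>N\<ge>N0. \<forall>I_N U_N. maximal_solution_HN A s N U0 I_N U_N \<longrightarrow>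
             K \<subseteq> I_N \<and>
             (\<forall>r\<in>{0..s}. \<forall>t\<in>K.
                sobolev_norm r (\<lambda>x. U t x - U_N t x) \<le> C * Mstar * real N powr (r - s))))) \<and>
     (\<forall>U0\<in>sobolev s. \<forall>I U. maximal_solution_H A s U0 I U \<longrightarrow>
       (\<forall>K. compact K \<and> K \<subseteq> I \<longrightarrow>
          (\<exists>N0\<ge>1. \<exists>C>0. \<forall>N\<ge>N0. \<forall>I_N U_N. maximal_solution_HN A s N U0 I_N U_N \<longrightarrow>
             K \<subseteq> I_N \<and>
             (\<forall>r\<in>{0..s}. \<forall>t\<in>K.
                sobolev_norm r (\<lambda>x. U t x - U_N t x)
                  \<le> C * (SUP \<tau>\<in>K. sobolev_norm s (U \<tau>)) * real N powr (r - s)))))"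
proof (intro conjI)
  note compact_interval = convergence_on_compact_interval[where A = A, OF assms]
  show "\<forall>M>0. \<forall>T. uniform_existence_time A s M T \<longrightarrow>
       (\<exists>C>0. \<forall>U0\<in>sobolev s. sobolev_norm s U0 \<le> M \<longrightarrow>
          (\<forall>I U. maximal_solution_H A s U0 I U \<longrightarrow>
             (\<forall>N\<ge>1. \<forall>I_N U_N. maximal_solution_HN A s N U0 I_N U_N \<longrightarrow>
                (\<forall>t\<in>time_span T (sobolev_norm s U0). \<forall>r\<in>{0..s}.
                   sobolev_norm r (\<lambda>x. U t x - U_N t x)
                     \<le> C * sobolev_norm s U0 * real N powr (r - s)))))"
    by (intro allI impI) (rule convergence_on_existence_time[OF assms])
  show "\<forall>L Mstar. \<exists>N0\<ge>1. \<exists>C>0. \<forall>U0\<in>sobolev s. \<forall>I U. maximal_solution_H A s U0 I U \<longrightarrow>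
       (\<forall>K. compact K \<and> is_interval K \<and> 0 \<in> K \<and> K \<subseteq> I \<and> measure lebesgue K = L \<and>
            (SUP t\<in>K. sobolev_norm s (U t)) = Mstar \<longrightarrow>
          (\<forall>N\<ge>N0. \<forall>I_N U_N. maximal_solution_HN A s N U0 I_N U_N \<longrightarrow>
             K \<subseteq> I_N \<and>
             (\<forall>r\<in>{0..s}. \<forall>t\<in>K.
                sobolev_norm r (\<lambda>x. U t x - U_N t x) \<le> C * Mstar * real N powr (r - s))))"
    by (intro allI compact_interval)
  show "\<forall>U0\<in>sobolev s. \<forall>I U. maximal_solution_H A s U0 I U \<longrightarrow>
       (\<forall>K. compact K \<and> K \<subseteq> I \<longrightarrow>
          (\<exists>N0\<ge>1. \<exists>C>0. \<forall>N\<ge>N0. \<forall>I_N U_N. maximal_solution_HN A s N U0 I_N U_N \<longrightarrow>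
             K \<subseteq> I_N \<and>
             (\<forall>r\<in>{0..s}. \<forall>t\<in>K.
                sobolev_norm r (\<lambda>x. U t x - U_N t x)
                  \<le> C * (SUP \<tau>\<in>K. sobolev_norm s (U \<tau>)) * real N powr (r - s))))"
  proof (intro ballI allI impI, elim conjE)
    fix U0 :: "real ^ 'd \<Rightarrow> real ^ 'n" and I U and K :: "real set"
    assume U0: "U0 \<in> sobolev s" and U: "maximal_solution_H A s U0 I U" and K: "compact K" "K \<subseteq> I"
    let ?S = "SUP \<tau>\<in>K. sobolev_norm s (U \<tau>)"
    have sol: "classical_solution s (advection A) U0 I U"
      using U by (simp add: maximal_solution_H_def maximal_solution_def)
    have I: "is_interval I" "0 \<in> I" using sol by (auto simp: classical_solution_def)
    show "\<exists>N0\<ge>1. \<exists>C>0. \<forall>N\<ge>N0. \<forall>I_N U_N. maximal_solution_HN A s N U0 I_N U_N \<longrightarrow>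
             K \<subseteq> I_N \<and>
             (\<forall>r\<in>{0..s}. \<forall>t\<in>K. sobolev_norm r (\<lambda>x. U t x - U_N t x) \<le> C * ?S * real N powr (r - s))"
    proof (cases "K = {}")
      case True
      then show ?thesis by (intro exI[of _ "1::nat"] conjI exI[of _ "1::real"]) auto
    next
      case False
      \<comment> \<open>the interval spanned by \<open>K\<close> and \<open>0\<close>\<close>
      obtain a where a: "a \<in> K" "\<And>t. t \<in> K \<Longrightarrow> a \<le> t" using compact_attains_inf[OF K(1) False] by blast
      obtain b where b: "b \<in> K" "\<And>t. t \<in> K \<Longrightarrow> t \<le> b" using compact_attains_sup[OF K(1) False] by blast
      define H where "H = {min a 0..max b 0}"
      have KH: "K \<subseteq> H" using a b by (auto simp: H_def min_le_iff_disj le_max_iff_disj)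
      have H: "compact H" "is_interval H" "0 \<in> H" by (auto simp: H_def is_interval_cc)
      have HI: "H \<subseteq> I"
      proof
        fix t assume t: "t \<in> H"
        have "min a 0 \<in> I" "max b 0 \<in> I" using a(1) b(1) K(2) I(2) by (auto simp: min_def max_def)
        then show "t \<in> I" by (rule mem_is_interval_1_I[OF I(1)]) (use t in \<open>auto simp: H_def\<close>)
      qed
      define M where "M = (SUP t\<in>H. sobolev_norm s (U t))"
      have bddK: "bdd_above ((\<lambda>t. sobolev_norm s (U t)) ` K)" and bddH: "bdd_above ((\<lambda>t. sobolev_norm s (U t)) ` H)"
        using solution_sobolev_norm_bounded[OF sol] K H HI by auto
      obtain N0 C where N0: "N0 \<ge> 1" and C: "C > 0" and main: "\<forall>U0\<in>sobolev s. \<forall>I U. maximal_solution_H A s U0 I U \<longrightarrow>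
       (\<forall>K. compact K \<and> is_interval K \<and> 0 \<in> K \<and> K \<subseteq> I \<and> measure lebesgue K = measure lebesgue H \<and>
            (SUP t\<in>K. sobolev_norm s (U t)) = M \<longrightarrow>
          (\<forall>N\<ge>N0. \<forall>I_N U_N. maximal_solution_HN A s N U0 I_N U_N \<longrightarrow>
             K \<subseteq> I_N \<and>
             (\<forall>r\<in>{0..s}. \<forall>t\<in>K.
                sobolev_norm r (\<lambda>x. U t x - U_N t x) \<le> C * M * real N powr (r - s))))"
        using compact_interval[of "measure lebesgue H" M] by (elim exE conjE)
      have est: "H \<subseteq> I_N \<and> (\<forall>r\<in>{0..s}. \<forall>t\<in>H. sobolev_norm r (\<lambda>x. U t x - U_N t x) \<le> C * M * real N powr (r - s))"
        if "N \<ge> N0" "maximal_solution_HN A s N U0 I_N U_N" for N I_N U_N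
        using main[rule_format, OF U0 U _ that] H HI by (simp add: M_def)
      have S: "sobolev_norm s (U t) \<le> ?S" if "t \<in> K" for t using that bddK by (rule cSUP_upper)
      have S0: "0 \<le> ?S" using S[OF a(1)] sobolev_norm_nonneg[of s "U a"] by linarith
      \<comment> \<open>The supremum over \<open>H\<close> may exceed that over \<open>K\<close>; the ratio is absorbed in the constant.\<close>
      have "\<exists>C'>0. C * M \<le> C' * ?S"
      proof (cases "?S = 0")
        case True
        \<comment> \<open>the solution vanishes at a point of \<open>K\<close>, hence throughout\<close>
        then have "sobolev_norm s (U a) = 0" using S[OF a(1)] sobolev_norm_nonneg[of s "U a"] by linarith
        then have "sobolev_norm s (U t) = 0" if "t \<in> H" for t
          using solution_vanishes[where A = A, OF assms sol H(2,1) HI _ that, of a] KH a(1) by blast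
        then have "M = (SUP t\<in>H. 0)" unfolding M_def by (intro SUP_cong) auto
        moreover have "H \<noteq> {}" using H(3) by blast
        ultimately have "M = 0" by simp
        then show ?thesis using True C by (intro exI[of _ C]) auto
      next
        case False
        with S0 have pos: "0 < ?S" by linarith
        have "C * M \<le> (max 1 (C * M / ?S)) * ?S" using pos by (simp add: max_def field_simps)
        then show ?thesis by (intro exI[of _ "max 1 (C * M / ?S)"]) auto
      qed
      then obtain C' where C': "C' > 0" "C * M \<le> C' * ?S" by blast
      show ?thesis
      proof (intro exI[of _ N0] conjI exI[of _ C'] allI impI N0 C'(1) ballI)
        fix N I_N U_N assume N: "N \<ge> N0" "maximal_solution_HN A s N U0 I_N U_N"
        show "K \<subseteq> I_N" using est[OF N] KH by blast
        fix r t assume rt: "r \<in> {0..s}" "t \<in> K"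
        then have "sobolev_norm r (\<lambda>x. U t x - U_N t x) \<le> C * M * real N powr (r - s)" using est[OF N] KH by blast
        also have "\<dots> \<le> C' * ?S * real N powr (r - s)" using C'(2) by (rule mult_right_mono) simp
        finally show "sobolev_norm r (\<lambda>x. U t x - U_N t x) \<le> C' * ?S * real N powr (r - s)" .
      qed
    qed
  qed
qed

end
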